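(* Let $k>1$, let $X$ be a CW-complex, let $B = SX$ be its suspension, and suppose that $n_{SX} := |[SX,SO_{2k}]|$ is finite. Then for any oriented rank-$2k$ vector bundle $E \to SX$, $$|\pi_0(\mathcal{G}_E)| = \begin{cases} n_{SX} & \text{if } E \text{ is } \eta\text{-turnable},\\ \dfrac{n_{SX}}{2} & \text{if } E \text{ is not } \eta\text{-turnable}.\end{cases}$$
   Context: All vector bundles are real and Euclidean. $[SX,SO_{2k}]$ is the set of homotopy classes of maps. $\mathcal{G}_E$ is the topological group of (fibrewise orientation-preserving isometric, covering the identity) automorphisms of $E$, equivalently the gauge group of the oriented orthonormal frame bundle $\mathrm{Fr}(E)$, a principal $SO_{2k}$-bundle. $\eta$ denotes a loop in $SO_{2k}$ based at the identity representing the generator of $\pi_1(SO_{2k})\cong\mathbb{Z}/2$. The bundle $E$ is $\eta$-turnable if there is a loop $(\psi_t)_{t\in[0,1]}$ in $\mathcal{G}_E$ based at $\mathbb{1}_E$ whose restriction to a fibre $E_b$ is an essential loop in $SO(E_b) \cong SO_{2k}$; equivalently, restriction to a fibre induces a surjection $\pi_1(\mathcal{G}_E) \to \pi_1(SO_{2k})$. *)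

theory Defs
  imports "HOL-Analysis.Analysis"
begin

section \<open>CW-complexes\<close>

definition disc :: "nat \<Rightarrow> (nat \<Rightarrow> real) topology" where
  "disc n = subtopology (Euclidean_space n) {x. (\<Sum>i<n. (x i)\<^sup>2) \<le> 1}"

text \<open>For \<open>n = 0\<close> the disc is a point, its interior is that point and its boundary is empty.\<close>

definition disc_interior :: "nat \<Rightarrow> (nat \<Rightarrow> real) set" where
  "disc_interior n = {x \<in> topspace (disc n). (\<Sum>i<n. (x i)\<^sup>2) < 1}"

definition disc_boundary :: "nat \<Rightarrow> (nat \<Rightarrow> real) set" where
  "disc_boundary n = {x \<in> topspace (disc n). (\<Sum>i<n. (x i)\<^sup>2) = 1}"

text \<open>A CW-structure is given by a set of characteristic maps, each one paired with the dimension
  of its cell. As the open cells are nonempty and pairwise disjoint, distinct pairs belong to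
  distinct cells.\<close>

definition CW_structure :: "'a topology \<Rightarrow> (nat \<times> ((nat \<Rightarrow> real) \<Rightarrow> 'a)) set \<Rightarrow> bool" where
  "CW_structure X C \<longleftrightarrow>
     (\<forall>(n, \<Phi>) \<in> C.
        continuous_map (disc n) X \<Phi> \<and>
        homeomorphic_map (subtopology (disc n) (disc_interior n))
          (subtopology X (\<Phi> ` disc_interior n)) \<Phi>) \<and>
     (\<forall>(n, \<Phi>) \<in> C. \<forall>(m, \<Psi>) \<in> C. (n, \<Phi>) \<noteq> (m, \<Psi>) \<longrightarrow>
        \<Phi> ` disc_interior n \<inter> \<Psi> ` disc_interior m = {}) \<and>
     (\<Union>(n, \<Phi>) \<in> C. \<Phi> ` disc_interior n) = topspace X \<and>
     (\<forall>(n, \<Phi>) \<in> C. \<exists>F. finite F \<and> F \<subseteq> {(m, \<Psi>) \<in> C. m < n} \<and>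
        \<Phi> ` disc_boundary n \<subseteq> (\<Union>(m, \<Psi>) \<in> F. \<Psi> ` disc_interior m)) \<and>
     (\<forall>A \<subseteq> topspace X.
        closedin X A \<longleftrightarrow>
        (\<forall>(n, \<Phi>) \<in> C. closedin X (A \<inter> (X closure_of (\<Phi> ` disc_interior n)))))"

definition CW_complex :: "'a topology \<Rightarrow> bool" where
  "CW_complex X \<longleftrightarrow> Hausdorff_space X \<and> (\<exists>C. CW_structure X C)"


section \<open>Unreduced suspension\<close>

text \<open>The two cone points are separate constructors, so that the suspension of the empty space is
  the two-point discrete space \<open>S\<^sup>0\<close>.\<close>

datatype 'a susp = South | North | Level 'a real

definition susp_map :: "'a \<times> real \<Rightarrow> 'a susp" where
  "susp_map = (\<lambda>(x, t). if t = 0 then South else if t = 1 then North else Level x t)"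

definition susp_points :: "'a topology \<Rightarrow> 'a susp set" where
  "susp_points X = {South, North} \<union> susp_map ` (topspace X \<times> {0..1})"

definition suspension :: "'a topology \<Rightarrow> 'a susp topology" where
  "suspension X = topology (\<lambda>W. W \<subseteq> susp_points X \<and>
     openin (prod_topology X (top_of_set {0..1})) {z \<in> topspace X \<times> {0..1}. susp_map z \<in> W})"

lemma openin_suspension:
  "openin (suspension X) W \<longleftrightarrow> W \<subseteq> susp_points X \<and>
     openin (prod_topology X (top_of_set {0..1})) {z \<in> topspace X \<times> {0..1}. susp_map z \<in> W}"
proof -
  let ?P = "prod_topology X (top_of_set {0..1::real})"
  let ?pre = "\<lambda>W. {z \<in> topspace X \<times> {0..1}. susp_map z \<in> W}"
  let ?op = "\<lambda>W. W \<subseteq> susp_points X \<and> openin ?P (?pre W)"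
  have "?op (S \<inter> T)" if "?op S" "?op T" for S T
  proof -
    have "?pre (S \<inter> T) = ?pre S \<inter> ?pre T" by blast
    moreover have "openin ?P (?pre S \<inter> ?pre T)"
      using that by (intro openin_Int) simp_all
    ultimately show ?thesis using that(1) by (metis le_infI1)
  qed
  moreover have "?op (\<Union>\<K>)" if K: "\<And>K. K \<in> \<K> \<Longrightarrow> ?op K" for \<K>
  proof -
    have "?pre (\<Union>\<K>) = \<Union> (?pre ` \<K>)" by blast
    moreover have "openin ?P (\<Union> (?pre ` \<K>))"
    proof (rule openin_Union)
      fix T assume "T \<in> ?pre ` \<K>"
      then obtain K where "K \<in> \<K>" "T = ?pre K" by (rule imageE)
      then show "openin ?P T" using K[of K] by simp
    qed
    moreover have "\<Union>\<K> \<subseteq> susp_points X" using K by (intro Sup_least) simp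
    ultimately show ?thesis by simp
  qed
  ultimately have "istopology ?op"
    unfolding istopology_def by simp
  then show ?thesis
    unfolding suspension_def by (simp only: topology_inverse')
qed

lemma topspace_suspension: "topspace (suspension X) = susp_points X"
proof (rule subset_antisym)
  show "topspace (suspension X) \<subseteq> susp_points X"
    using openin_suspension[of X "topspace (suspension X)"] openin_topspace[of "suspension X"]
    by (rule iffD1 [THEN conjunct1])
  let ?P = "prod_topology X (top_of_set {0..1::real})"
  have "{z \<in> topspace X \<times> {0..1}. susp_map z \<in> susp_points X} = topspace ?P"
    unfolding susp_points_def by auto
  then have "openin ?P {z \<in> topspace X \<times> {0..1}. susp_map z \<in> susp_points X}"
    using openin_topspace[of ?P] by (simp only:)
  then have "openin (suspension X) (susp_points X)"
    unfolding openin_suspension by (rule conjI[OF subset_refl])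
  then show "susp_points X \<subseteq> topspace (suspension X)"
    by (rule openin_subset)
qed

lemma quotient_map_susp_map:
  assumes "topspace X \<noteq> {}"
  shows "quotient_map (prod_topology X (top_of_set {0..1})) (suspension X) susp_map"
proof -
  let ?P = "prod_topology X (top_of_set {0..1::real})"
  from assms obtain x where x: "x \<in> topspace X" by blast
  have "South = susp_map (x, 0)" "North = susp_map (x, 1)"
    by (simp_all add: susp_map_def)
  with x have "South \<in> susp_map ` (topspace X \<times> {0..1})" "North \<in> susp_map ` (topspace X \<times> {0..1})"
    by (metis SigmaI atLeastAtMost_iff imageI order_refl zero_le_one)+
  then have im: "susp_map ` topspace ?P = topspace (suspension X)"
    unfolding topspace_suspension susp_points_def by simp blast
  show ?thesis
    unfolding quotient_map_def
  proof (intro conjI allI impI)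
    show "susp_map ` topspace ?P = topspace (suspension X)" by (rule im)
  next
    fix W assume W: "W \<subseteq> topspace (suspension X)"
    have "topspace ?P = topspace X \<times> {0..1}" by simp
    with W show "openin ?P {z \<in> topspace ?P. susp_map z \<in> W} = openin (suspension X) W"
      by (simp only: openin_suspension topspace_suspension simp_thms)
  qed
qed


section \<open>Mapping spaces and homotopy\<close>

text \<open>Points of the mapping space are continuous maps made extensional, so that each one is
  represented by exactly one function.\<close>

definition compact_open :: "'a topology \<Rightarrow> 'b topology \<Rightarrow> ('a \<Rightarrow> 'b) topology" where
  "compact_open Y Z = topology_generated_by
     {{f \<in> extensional (topspace Y). continuous_map Y Z f \<and> f ` K \<subseteq> U} | K U.
        compactin Y K \<and> openin Z U}"

definition homotopy_classes :: "'a topology \<Rightarrow> 'b topology \<Rightarrow> ('a \<Rightarrow> 'b) set set" where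
  "homotopy_classes Y Z =
     {f. continuous_map Y Z f} // {(f, g). homotopic_with (\<lambda>_. True) Y Z f g}"

definition essential_loop :: "'a topology \<Rightarrow> (real \<Rightarrow> 'a) \<Rightarrow> bool" where
  "essential_loop Y \<gamma> \<longleftrightarrow> pathin Y \<gamma> \<and> \<gamma> 0 = \<gamma> 1 \<and>
     \<not> homotopic_with (\<lambda>\<sigma>. \<sigma> 0 = \<gamma> 0 \<and> \<sigma> 1 = \<gamma> 0) (top_of_set {0..1}) Y \<gamma> (\<lambda>_. \<gamma> 0)"

definition special_orthogonal :: "(real^'n^'n) topology" where
  "special_orthogonal = top_of_set {A. rotation_matrix A}"


section \<open>Oriented Euclidean vector bundles\<close>

text \<open>The rank is \<open>CARD('n)\<close>. A frame of a fibre is a linear isomorphism from \<open>\<real>\<^sup>n\<close> to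
  it, and \<open>orient E b\<close> is the set of positively oriented frames of the fibre over \<open>b\<close>.
  The fibre operations matter only on pairs of vectors in a common fibre.\<close>

record ('b, 'e, 'n) bundle_data =
  base :: "'b topology"
  total :: "'e topology"
  proj :: "'e \<Rightarrow> 'b"
  vadd :: "'e \<Rightarrow> 'e \<Rightarrow> 'e"
  vscale :: "real \<Rightarrow> 'e \<Rightarrow> 'e"
  vinner :: "'e \<Rightarrow> 'e \<Rightarrow> real"
  orient :: "'b \<Rightarrow> ((real, 'n) vec \<Rightarrow> 'e) set"

definition fibre :: "('b, 'e, 'n::finite) bundle_data \<Rightarrow> 'b \<Rightarrow> 'e set" where
  "fibre E b = {v \<in> topspace (total E). proj E v = b}"

definition frame :: "('b, 'e, 'n::finite) bundle_data \<Rightarrow> 'b \<Rightarrow> (real^'n \<Rightarrow> 'e) \<Rightarrow> bool" where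
  "frame E b L \<longleftrightarrow> bij_betw L UNIV (fibre E b) \<and>
     (\<forall>x y. L (x + y) = vadd E (L x) (L y)) \<and> (\<forall>c x. L (c *\<^sub>R x) = vscale E c (L x))"

definition bundle_chart ::
    "('b, 'e, 'n::finite) bundle_data \<Rightarrow> 'b set \<Rightarrow> ('b \<times> (real^'n) \<Rightarrow> 'e) \<Rightarrow> bool" where
  "bundle_chart E U \<phi> \<longleftrightarrow> openin (base E) U \<and>
     homeomorphic_map (prod_topology (subtopology (base E) U) euclidean)
       (subtopology (total E) {v. proj E v \<in> U}) \<phi> \<and>
     (\<forall>b\<in>U. frame E b (\<lambda>x. \<phi> (b, x)))"

text \<open>The vector space axioms in each fibre are not listed: they are transported from
  \<open>\<real>\<^sup>n\<close> by the frames that the charts provide.\<close>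

definition vector_bundle :: "('b, 'e, 'n::finite) bundle_data \<Rightarrow> bool" where
  "vector_bundle E \<longleftrightarrow> continuous_map (total E) (base E) (proj E) \<and>
     (\<forall>b \<in> topspace (base E). \<exists>U \<phi>. b \<in> U \<and> bundle_chart E U \<phi>)"

definition euclidean_metric :: "('b, 'e, 'n::finite) bundle_data \<Rightarrow> bool" where
  "euclidean_metric E \<longleftrightarrow>
     continuous_map
       (subtopology (prod_topology (total E) (total E)) {(u, v). proj E u = proj E v})
       euclideanreal (\<lambda>(u, v). vinner E u v) \<and>
     (\<forall>b \<in> topspace (base E). \<forall>u \<in> fibre E b. \<forall>v \<in> fibre E b.
        vinner E u v = vinner E v u \<and>
        (\<forall>w \<in> fibre E b. vinner E (vadd E u v) w = vinner E u w + vinner E v w) \<and>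
        (\<forall>c. vinner E (vscale E c u) v = c * vinner E u v) \<and>
        (u \<noteq> vscale E 0 u \<longrightarrow> vinner E u u > 0))"

text \<open>An orientation of a fibre is an orbit of frames under precomposition with linear maps of
  positive determinant; locally some chart is orientation-preserving on every fibre.\<close>

definition bundle_orientation :: "('b, 'e, 'n::finite) bundle_data \<Rightarrow> bool" where
  "bundle_orientation E \<longleftrightarrow>
     (\<forall>b \<in> topspace (base E). orient E b \<noteq> {} \<and>
        (\<forall>L \<in> orient E b. frame E b L \<and>
           orient E b = {L \<circ> (\<lambda>x. A *v x) | A. det A > 0})) \<and>
     (\<forall>b \<in> topspace (base E). \<exists>U \<phi>. b \<in> U \<and> bundle_chart E U \<phi> \<and>
        (\<forall>b'\<in>U. (\<lambda>x. \<phi> (b', x)) \<in> orient E b'))"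

definition oriented_euclidean_vector_bundle :: "('b, 'e, 'n::finite) bundle_data \<Rightarrow> bool" where
  "oriented_euclidean_vector_bundle E \<longleftrightarrow>
     vector_bundle E \<and> euclidean_metric E \<and> bundle_orientation E"


section \<open>The gauge group\<close>

definition fibre_rotations :: "('b, 'e, 'n::finite) bundle_data \<Rightarrow> 'b \<Rightarrow> ('e \<Rightarrow> 'e) set" where
  "fibre_rotations E b = {f \<in> fibre E b \<rightarrow>\<^sub>E fibre E b.
     (\<forall>u \<in> fibre E b. \<forall>v \<in> fibre E b.
        f (vadd E u v) = vadd E (f u) (f v) \<and> vinner E (f u) (f v) = vinner E u v) \<and>
     (\<forall>c. \<forall>u \<in> fibre E b. f (vscale E c u) = vscale E c (f u)) \<and>
     (\<forall>L \<in> orient E b. f \<circ> L \<in> orient E b)}"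

definition fibre_SO :: "('b, 'e, 'n::finite) bundle_data \<Rightarrow> 'b \<Rightarrow> ('e \<Rightarrow> 'e) topology" where
  "fibre_SO E b = subtopology
     (compact_open (subtopology (total E) (fibre E b)) (subtopology (total E) (fibre E b)))
     (fibre_rotations E b)"

definition gauge_group :: "('b, 'e, 'n::finite) bundle_data \<Rightarrow> ('e \<Rightarrow> 'e) topology" where
  "gauge_group E = subtopology (compact_open (total E) (total E))
     {f. homeomorphic_map (total E) (total E) f \<and>
         (\<forall>b \<in> topspace (base E). restrict f (fibre E b) \<in> fibre_rotations E b)}"

definition gauge_one :: "('b, 'e, 'n::finite) bundle_data \<Rightarrow> 'e \<Rightarrow> 'e" where
  "gauge_one E = restrict id (topspace (total E))"

definition turnable :: "('b, 'e, 'n::finite) bundle_data \<Rightarrow> bool" where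
  "turnable E \<longleftrightarrow> (\<exists>\<psi>. pathin (gauge_group E) \<psi> \<and> \<psi> 0 = gauge_one E \<and> \<psi> 1 = gauge_one E \<and>
     (\<exists>b \<in> topspace (base E).
        essential_loop (fibre_SO E b) (\<lambda>t. restrict (\<psi> t) (fibre E b))))"

end

theory Submission
  imports Defs
begin

text \<open>
  Pulling \<open>E\<close> back to the cylinder \<open>X \<times> [0, 1]\<close> gives an orthonormal frame, constant over the south
  pole and twisted over the north pole by a clutching map \<open>g\<close>. In this frame a gauge transformation
  is a rotation-valued map on the cylinder whose value at \<open>(x, 1)\<close> is a fixed rotation conjugated by
  \<open>g x\<close>. Since rotations are connected, every path component of the gauge group and every homotopy
  class of maps from the suspension is represented by a map \<open>u\<close> that is trivial over the north
  pole, and for such maps the two descriptions agree.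

  A path of gauge transformations between two such maps traces a loop of rotations over the north
  pole. Undoing that loop along the suspension coordinate shows that a path component consists of the
  homotopy classes of \<open>u\<close> and of \<open>u\<close> multiplied by a pinch along the essential loop, because
  the fundamental group of the rotation group has order two. The two classes coincide exactly when
  the essential loop extends to a loop of gauge transformations, i.e. when \<open>E\<close> is turnable.

  The fundamental group is obtained by homotopy lifting along rotors, which reduces loops to a
  coordinate plane and discs to dimension three. There a null-homotopy of a full turn would yield,
  through the unit quaternions, a continuous square root on the circle.
\<close>

section \<open>Rotation matrices\<close>

text \<open>The count is uniform because rotations form a group: multiplying by a fixed
  \<open>v\<close> carries any homotopy from the trivial map to its pinch to one from
  \<open>v\<close> to the pinch of \<open>v\<close>. So the classes coincide with their partners all
  at once or never, and passing from homotopy classes to gauge components is one-to-one or exactly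
  two-to-one. The obstacle is point-set topology, since the complex need be neither locally compact
  nor finite. Bundles are therefore trivialized cell by cell, where lifting only meets compact
  discs, and paths in the compact-open topology become jointly continuous families on compact
  pieces, which suffices in a compactly generated space. Lifting treats arbitrary oriented frames,
  because a chart moves these between fibres by a formula; the metric enters afterwards, through a
  continuous Gram-Schmidt process. The reductions stop where homotopy groups of spheres appear:
  loops are null in spheres of dimension at least two, 2-spheres in those of dimension at least
  three. Hence two coordinates remain for loops and three for discs, and the last step needs a
  special argument in dimension three.\<close>

lemma continuous_on_matrix_iff:
  fixes f :: "'a::topological_space \<Rightarrow> real^'n^'m"
  shows "continuous_on S f \<longleftrightarrow> (\<forall>i j. continuous_on S (\<lambda>x. f x $ i $ j))"
proof
  assume "\<forall>i j. continuous_on S (\<lambda>x. f x $ i $ j)"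
  then have "continuous_on S (\<lambda>x. \<chi> i j. f x $ i $ j)"
    by (intro continuous_on_vec_lambda) auto
  then show "continuous_on S f" by simp
qed (intro allI continuous_intros)

lemma continuous_on_matrix_mult [continuous_intros]:
  fixes f :: "'a::topological_space \<Rightarrow> real^'n^'m" and g :: "'a \<Rightarrow> real^'k^'n"
  assumes "continuous_on S f" "continuous_on S g"
  shows "continuous_on S (\<lambda>x. f x ** g x)"
  unfolding matrix_matrix_mult_def using assms by (intro continuous_intros)

lemma continuous_on_matrix_vector_mult [continuous_intros]:
  fixes f :: "'a::topological_space \<Rightarrow> real^'n^'m" and g :: "'a \<Rightarrow> real^'n"
  assumes "continuous_on S f" "continuous_on S g"
  shows "continuous_on S (\<lambda>x. f x *v g x)"
  unfolding matrix_vector_mult_def using assms by (intro continuous_intros)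

lemma continuous_on_transpose [continuous_intros]:
  fixes f :: "'a::topological_space \<Rightarrow> real^'n^'m"
  assumes "continuous_on S f"
  shows "continuous_on S (\<lambda>x. transpose (f x))"
  unfolding transpose_def using assms by (intro continuous_intros)

lemma continuous_on_det [continuous_intros]:
  fixes f :: "'a::topological_space \<Rightarrow> real^'n^'n"
  assumes "continuous_on S f"
  shows "continuous_on S (\<lambda>x. det (f x))"
  unfolding det_def using assms by (intro continuous_intros)

lemma rotation_matrix_mult: "rotation_matrix A \<Longrightarrow> rotation_matrix B \<Longrightarrow> rotation_matrix (A ** B)"
  for A B :: "real^'n^'n"
  by (simp add: rotation_matrix_def orthogonal_matrix_mul det_mul)

lemma rotation_matrix_transpose [simp]: "rotation_matrix (transpose A) \<longleftrightarrow> rotation_matrix A"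
  for A :: "real^'n^'n"
  by (simp add: rotation_matrix_def det_transpose)

lemma rotation_matrix_one [simp]: "rotation_matrix (mat 1 :: real^'n^'n)"
  by (simp add: rotation_matrix_def orthogonal_matrix_id)

lemma rotation_transpose_mult:
  fixes A :: "real^'n^'n"
  assumes "rotation_matrix A"
  shows "transpose A ** A = mat 1" "A ** transpose A = mat 1"
  using assms by (simp_all add: rotation_matrix_def orthogonal_matrix_def)

lemma orthogonal_matrix_dot:
  fixes A :: "real^'n^'n"
  assumes "orthogonal_matrix A"
  shows "(A *v x) \<bullet> (A *v y) = x \<bullet> y"
proof -
  have "(A *v x) \<bullet> (A *v y) = (transpose A *v (A *v x)) \<bullet> y"
    by (simp add: dot_matrix_vector_mul dot_lmul_matrix transpose_matrix_vector)
  then show ?thesis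
    using assms by (simp add: orthogonal_matrix_def matrix_vector_mul_assoc)
qed

text \<open>The determinant of an orthogonal matrix is 1 or -1, hence constant along a connected
  family. This replaces determinant computations: one known rotation settles the whole
  family.\<close>

lemma rotation_matrix_connected:
  fixes f :: "'a::topological_space \<Rightarrow> real^'n^'n"
  assumes "connected S" "continuous_on S f" "\<And>x. x \<in> S \<Longrightarrow> orthogonal_matrix (f x)"
    and "a \<in> S" "rotation_matrix (f a)" "x \<in> S"
  shows "rotation_matrix (f x)"
proof -
  have "connected ((\<lambda>x. det (f x)) ` S)"
    using assms by (intro connected_continuous_image continuous_intros)
  moreover have "(\<lambda>x. det (f x)) ` S \<subseteq> {1, -1}"
    using assms(3) det_orthogonal_matrix by blast
  ultimately have "\<exists>c. \<forall>x\<in>S. det (f x) = c"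
    using connected_finite_iff_sing[of "(\<lambda>x. det (f x)) ` S"] finite_subset[of _ "{1, -1 :: real}"]
    by (metis empty_iff finite.emptyI finite.insertI imageI singletonD)
  then show ?thesis
    using assms by (metis rotation_matrix_def)
qed

section \<open>Lifting homotopies in spheres to rotations\<close>

text \<open>For unit vectors this is the reflection in the hyperplane orthogonal to \<open>x\<close>
  followed by the one in the hyperplane orthogonal to \<open>x + y\<close>: the rotation in the
  plane of \<open>x\<close> and \<open>y\<close> that carries \<open>x\<close> to \<open>y\<close>.
  The denominator vanishes only for antipodal vectors.\<close>

definition rotor :: "real^'n \<Rightarrow> real^'n \<Rightarrow> real^'n^'n" where
  "rotor x y = (\<chi> i j. (if i = j then 1 else 0)
     - (x $ j + y $ j) / (1 + x \<bullet> y) * (x $ i + y $ i) + 2 * x $ j * y $ i)"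

lemma rotor_mult_vec:
  "rotor x y *v z = z - (((x + y) \<bullet> z) / (1 + x \<bullet> y)) *\<^sub>R (x + y) + (2 * (x \<bullet> z)) *\<^sub>R y"
proof (rule vec_eq_iff[THEN iffD2], rule allI)
  fix i
  have "(rotor x y *v z) $ i = (\<Sum>j\<in>UNIV. (if i = j then z $ j else 0)
     - (x $ j + y $ j) * z $ j * ((x $ i + y $ i) / (1 + x \<bullet> y)) + x $ j * z $ j * (2 * y $ i))"
    unfolding matrix_vector_mult_def rotor_def
    by (auto intro!: sum.cong simp: algebra_simps add_divide_distrib diff_divide_distrib)
  also have "\<dots> = z $ i - ((x + y) \<bullet> z) * ((x $ i + y $ i) / (1 + x \<bullet> y)) + (x \<bullet> z) * (2 * y $ i)"
    unfolding inner_vec_def inner_real_def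
    by (simp add: sum.distrib sum_subtractf sum_distrib_right sum_divide_distrib)
  finally show "(rotor x y *v z) $ i =
      (z - (((x + y) \<bullet> z) / (1 + x \<bullet> y)) *\<^sub>R (x + y) + (2 * (x \<bullet> z)) *\<^sub>R y) $ i"
    by (simp add: algebra_simps add_divide_distrib)
qed

lemma rotor_self:
  assumes "norm x = 1"
  shows "rotor x x = mat 1"
proof -
  have "x \<bullet> x = 1" using assms by (simp add: norm_eq_1)
  then show ?thesis
    by (auto simp: rotor_def mat_def vec_eq_iff)
qed

lemma rotor_apply:
  assumes "norm x = 1" "norm y = 1" "x \<bullet> y \<noteq> -1"
  shows "rotor x y *v x = y"
proof -
  have "x \<bullet> x = 1" using assms by (simp add: norm_eq_1)
  then have "(x + y) \<bullet> x / (1 + x \<bullet> y) = 1"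
    using assms(3) by (simp add: inner_add_left inner_commute[of y x] add_eq_0_iff2)
  then show ?thesis
    using \<open>x \<bullet> x = 1\<close> by (simp add: rotor_mult_vec scaleR_2)
qed

lemma rotor_fixes:
  assumes "x \<bullet> w = 0" "y \<bullet> w = 0"
  shows "rotor x y *v w = w"
  using assms by (simp add: rotor_mult_vec inner_add_left)

lemma orthogonal_rotor:
  fixes x y :: "real^'n"
  assumes "norm x = 1" "norm y = 1" "x \<bullet> y \<noteq> -1"
  shows "orthogonal_matrix (rotor x y)"
proof -
  have xx: "x \<bullet> x = 1" "y \<bullet> y = 1" using assms by (simp_all add: norm_eq_1)
  have c0: "1 + x \<bullet> y \<noteq> 0" using assms(3) by linarith
  have "norm (rotor x y *v z) = norm z" for z
  proof -
    define c where "c = 1 + x \<bullet> y"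
    define a b where "a = x \<bullet> z" and "b = y \<bullet> z"
    define r where "r = (a + b) / c"
    \<comment> \<open>\<open>c\<close> is half the squared length of \<open>x + y\<close>. With this
      relation the terms of the expanded norm that contain \<open>r\<close> reduce to multiples of
      \<open>a + b\<close> and everything beyond \<open>z \<bullet> z\<close> cancels.\<close>
    have rc: "r * c = a + b" using c0 by (simp add: r_def c_def)
    have rz: "rotor x y *v z = z - r *\<^sub>R (x + y) + (2 * a) *\<^sub>R y"
      by (simp add: rotor_mult_vec r_def a_def b_def c_def inner_add_left)
    have ex: "(z - r *\<^sub>R s + k *\<^sub>R y) \<bullet> (z - r *\<^sub>R s + k *\<^sub>R y) =
        z \<bullet> z + r * r * (s \<bullet> s) + k * k * (y \<bullet> y) - 2 * r * (s \<bullet> z) - 2 * k * r * (s \<bullet> y)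
        + 2 * k * (y \<bullet> z)" for s k
      by (simp add: inner_diff_left inner_diff_right inner_add_left inner_add_right
          inner_commute[of z s] inner_commute[of z y] inner_commute[of y s]) (simp add: algebra_simps)
    have sc: "(x + y) \<bullet> (x + y) = 2 * c" "(x + y) \<bullet> y = c" "(x + y) \<bullet> z = a + b"
      by (simp_all add: inner_add_left inner_add_right xx inner_commute[of y x] c_def a_def b_def)
    have "(rotor x y *v z) \<bullet> (rotor x y *v z) =
        z \<bullet> z + r * (r * (2 * c)) + 4 * a * a - 2 * r * (a + b) - 4 * a * (r * c) + 4 * a * b"
      unfolding rz ex sc xx b_def[symmetric] by (simp add: algebra_simps)
    also have "\<dots> = z \<bullet> z + 2 * r * (r * c) + 4 * a * a - 2 * r * (a + b) - 4 * a * (r * c) + 4 * a * b"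
      by (simp add: algebra_simps)
    also have "\<dots> = z \<bullet> z"
      unfolding rc by (simp add: algebra_simps)
    finally show ?thesis by (simp add: norm_eq)
  qed
  then have "orthogonal_transformation ((*v) (rotor x y))"
    by (simp add: orthogonal_transformation)
  then show ?thesis by (simp add: orthogonal_transformation_matrix)
qed

lemma continuous_on_rotor [continuous_intros]:
  assumes "continuous_on S f" "continuous_on S g" "\<And>p. p \<in> S \<Longrightarrow> f p \<bullet> g p \<noteq> -1"
  shows "continuous_on S (\<lambda>p. rotor (f p) (g p))"
proof -
  have "1 + f p \<bullet> g p \<noteq> 0" if "p \<in> S" for p using assms(3)[OF that] by linarith
  then show ?thesis
    unfolding rotor_def using assms(1,2)
    by (intro continuous_intros) auto
qed

text \<open>The composite of the rotors between consecutive samples of a path on the sphere. It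
  carries \<open>p 0\<close> to \<open>p k\<close> as long as no two neighbours are
  antipodal.\<close>

fun rotor_chain :: "(nat \<Rightarrow> real^'n) \<Rightarrow> nat \<Rightarrow> real^'n^'n" where
  "rotor_chain p 0 = mat 1"
| "rotor_chain p (Suc k) = rotor (p k) (p (Suc k)) ** rotor_chain p k"

text \<open>Uniform continuity on the compact cylinder makes neighbouring samples of every path
  closer than 1, while antipodal points have distance 2, so the chain of rotors depends continuously
  on \<open>(t, z)\<close>. The last two conclusions hold because the chain sees only the values of
  the path: equal paths give equal rotations, and a vector orthogonal to the whole path is fixed by
  each rotor.\<close>

lemma sphere_homotopy_lift:
  fixes h :: "real \<times> 'z::metric_space \<Rightarrow> real^'n"
  assumes Z: "compact Z" and h: "continuous_on ({0..1} \<times> Z) h"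
    and nh: "\<And>p. p \<in> {0..1} \<times> Z \<Longrightarrow> norm (h p) = 1"
  obtains Q :: "real \<times> 'z \<Rightarrow> real^'n^'n" where
    "continuous_on ({0..1} \<times> Z) Q"
    "\<And>p. p \<in> {0..1} \<times> Z \<Longrightarrow> rotation_matrix (Q p)"
    "\<And>z. z \<in> Z \<Longrightarrow> Q (0, z) = mat 1"
    "\<And>t z. t \<in> {0..1} \<Longrightarrow> z \<in> Z \<Longrightarrow> Q (t, z) *v h (0, z) = h (t, z)"
    "\<And>t z z'. t \<in> {0..1} \<Longrightarrow> (\<And>s. s \<in> {0..1} \<Longrightarrow> h (s, z) = h (s, z')) \<Longrightarrow> Q (t, z) = Q (t, z')"
    "\<And>t z w. t \<in> {0..1} \<Longrightarrow> (\<And>s. s \<in> {0..1} \<Longrightarrow> h (s, z) \<bullet> w = 0) \<Longrightarrow> Q (t, z) *v w = w"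
proof -
  have "uniformly_continuous_on ({0..1} \<times> Z) h"
    using Z h by (intro compact_uniformly_continuous compact_Times) auto
  then obtain d where d: "d > 0"
    and dh: "\<And>p p'. p \<in> {0..1} \<times> Z \<Longrightarrow> p' \<in> {0..1} \<times> Z \<Longrightarrow> dist p' p < d \<Longrightarrow> dist (h p') (h p) < 1"
    unfolding uniformly_continuous_on_def by (meson zero_less_one)
  obtain N :: nat where N: "N > 0" "1 / real N < d"
    using d real_arch_inverse[of d] by (auto simp: inverse_eq_divide)
  \<comment> \<open>The path up to time \<open>t\<close> is cut into \<open>N\<close> pieces. The
    samples thus move continuously with \<open>t\<close>, and at \<open>t = 0\<close> they all
    coincide, which makes the chain the identity.\<close>
  define p where "p = (\<lambda>t z k. h (t * real k / real N, z))"
  define Q where "Q = (\<lambda>(t, z). rotor_chain (p t z) N)"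
  have mem: "t * real k / real N \<in> {0..1}" if "t \<in> {0..1}" "k \<le> N" for t k
    using that N(1) mult_mono[of t 1 "real k" "real N"] by (simp add: divide_le_eq)
  have np: "norm (p t z k) = 1" if "t \<in> {0..1}" "z \<in> Z" "k \<le> N" for t z k
    unfolding p_def using nh[of "(t * real k / real N, z)"] mem[of t k] that by auto
  have step: "p t z k \<bullet> p t z (Suc k) \<noteq> -1" if "t \<in> {0..1}" "z \<in> Z" "k < N" for t z k
  proof
    assume a: "p t z k \<bullet> p t z (Suc k) = -1"
    have "dist (t * real k / real N, z) (t * real (Suc k) / real N, z) = \<bar>t * real k / real N - t * real (Suc k) / real N\<bar>"
      by (simp add: dist_Pair_Pair dist_real_def)
    also have "\<dots> = t / real N" using that N by (simp add: field_simps abs_if)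
    also have "\<dots> \<le> 1 / real N" using that by (simp add: divide_right_mono)
    finally have "dist (p t z k) (p t z (Suc k)) < 1"
      unfolding p_def using N dh[of "(t * real (Suc k) / real N, z)" "(t * real k / real N, z)"]
        mem[of t k] mem[of t "Suc k"] that by auto
    then have "(norm (p t z k - p t z (Suc k)))\<^sup>2 < 1"
      by (simp add: dist_norm power_less_one_iff)
    moreover have "(norm (p t z k - p t z (Suc k)))\<^sup>2 = 4"
      using a np[OF that(1,2), of k] np[OF that(1,2), of "Suc k"] that(3)
      by (simp add: power2_norm_eq_inner norm_eq_1 inner_diff_left inner_diff_right inner_commute)
    ultimately show False by simp
  qed
  have cp: "continuous_on ({0..1} \<times> Z) (\<lambda>q. p (fst q) (snd q) k)" if "k \<le> N" for k
    unfolding p_def using mem that N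
    by (intro continuous_on_compose2[OF h] continuous_intros) fastforce+
  have cQ: "continuous_on ({0..1} \<times> Z) (\<lambda>q. rotor_chain (p (fst q) (snd q)) k)" if "k \<le> N" for k
    using that
  proof (induction k)
    case (Suc k)
    then show ?case
      unfolding rotor_chain.simps
      by (intro continuous_intros cp Suc.IH) (use step in auto)
  qed simp
  have oQ: "orthogonal_matrix (rotor_chain (p t z) k)"
    if tz: "t \<in> {0..1}" "z \<in> Z" and "k \<le> N" for t z k
    using that(3)
  proof (induction k)
    case (Suc k)
    then show ?case
      using orthogonal_rotor[OF np[OF tz, of k] np[OF tz, of "Suc k"] step[OF tz, of k]]
      by (simp add: orthogonal_matrix_mul)
  qed (simp add: orthogonal_matrix_id)
  have aQ: "rotor_chain (p t z) k *v p t z 0 = p t z k"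
    if tz: "t \<in> {0..1}" "z \<in> Z" and "k \<le> N" for t z k
    using that(3)
  proof (induction k)
    case (Suc k)
    then show ?case
      using rotor_apply[OF np[OF tz, of k] np[OF tz, of "Suc k"] step[OF tz, of k]]
      by (simp add: matrix_vector_mul_assoc[symmetric])
  qed simp
  have Q0: "Q (0, z) = mat 1" if "z \<in> Z" for z
  proof -
    have "rotor_chain (p 0 z) k = mat 1" for k
      using nh[of "(0, z)"] that by (induction k) (auto simp: p_def rotor_self)
    then show ?thesis by (simp add: Q_def)
  qed
  show ?thesis
  proof
    show c: "continuous_on ({0..1} \<times> Z) Q"
      using cQ[of N] by (simp add: Q_def case_prod_beta')
    show "rotation_matrix (Q q)" if "q \<in> {0..1} \<times> Z" for q
    proof -
      obtain t z where q: "q = (t, z)" "t \<in> {0..1}" "z \<in> Z" using \<open>q \<in> _\<close> by auto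
      \<comment> \<open>So far the chain is only known to be orthogonal; its determinant is followed
        from the identity at time 0.\<close>
      have "rotation_matrix ((\<lambda>s. Q (s, z)) t)"
      proof (rule rotation_matrix_connected[of "{0..1::real}" "\<lambda>s. Q (s, z)" 0])
        show "continuous_on {0..1} (\<lambda>s. Q (s, z))"
          using q by (intro continuous_on_compose2[OF c] continuous_intros) auto
        show "orthogonal_matrix (Q (s, z))" if "s \<in> {0..1}" for s
          using oQ[of s z N] q that by (simp add: Q_def)
      qed (use q Q0 in auto)
      then show ?thesis using q by simp
    qed
    show "Q (t, z) *v h (0, z) = h (t, z)" if "t \<in> {0..1}" "z \<in> Z" for t z
      using aQ[of t z N] that N by (simp add: Q_def p_def)
    show "Q (t, z) = Q (t, z')" if t: "t \<in> {0..1}" and h: "\<And>s. s \<in> {0..1} \<Longrightarrow> h (s, z) = h (s, z')" for t z z'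
    proof -
      have eq: "p t z k = p t z' k" if "k \<le> N" for k
        unfolding p_def by (intro h mem) (use \<open>t \<in> {0..1}\<close> \<open>k \<le> N\<close> in auto)
      have "rotor_chain (p t z) k = rotor_chain (p t z') k" if "k \<le> N" for k
        using that by (induction k) (simp_all add: eq)
      then show ?thesis by (simp add: Q_def)
    qed
    show "Q (t, z) *v w = w" if t: "t \<in> {0..1}" and h: "\<And>s. s \<in> {0..1} \<Longrightarrow> h (s, z) \<bullet> w = 0" for t z w
    proof -
      have eq: "p t z k \<bullet> w = 0" if "k \<le> N" for k
        unfolding p_def by (intro h mem) (use \<open>t \<in> {0..1}\<close> \<open>k \<le> N\<close> in auto)
      have "rotor_chain (p t z) k *v w = w" if "k \<le> N" for k
        using that by (induction k) (simp_all add: eq rotor_fixes matrix_vector_mul_assoc[symmetric])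
      then show ?thesis by (simp add: Q_def)
    qed
  qed (use Q0 in auto)
qed

lemma homotopic_with_canon_True_iff:
  fixes S :: "'a::topological_space set" and T :: "'b::topological_space set"
  shows "homotopic_with_canon (\<lambda>_. True) S T f g \<longleftrightarrow>
    (\<exists>h. continuous_on ({0..1::real} \<times> S) h \<and> h ` ({0..1} \<times> S) \<subseteq> T \<and>
       (\<forall>x\<in>S. h (0, x) = f x) \<and> (\<forall>x\<in>S. h (1, x) = g x))"
  by (subst homotopic_with) (auto simp: image_subset_iff Pi_iff)

lemma homotopic_with_canon_TrueE:
  fixes S :: "'a::topological_space set" and T :: "'b::topological_space set"
  assumes "homotopic_with_canon (\<lambda>_. True) S T f g"
  obtains h where "continuous_on ({0..1::real} \<times> S) h" "h ` ({0..1} \<times> S) \<subseteq> T"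
    "\<And>x. x \<in> S \<Longrightarrow> h (0, x) = f x" "\<And>x. x \<in> S \<Longrightarrow> h (1, x) = g x"
  using assms unfolding homotopic_with_canon_True_iff by auto

section \<open>Reduction of rotations to dimension three\<close>

definition unit_vectors_off :: "'n set \<Rightarrow> (real^'n) set" where
  "unit_vectors_off S = {v. norm v = 1 \<and> (\<forall>i\<in>S. v $ i = 0)}"

definition coord_subspace :: "'n set \<Rightarrow> (real^'n) set" where
  "coord_subspace S = {v. \<forall>i\<in>S. v $ i = 0}"

lemma subspace_coord_subspace: "subspace (coord_subspace S)"
  by (auto simp: coord_subspace_def subspace_def)

lemma dim_coord_subspace: "dim (coord_subspace S :: (real^'n) set) \<ge> card (- S)"
proof -
  let ?B = "(\<lambda>i. axis i 1 :: real^'n) ` (- S)"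
  have "independent ?B"
    by (rule independent_mono[OF independent_Basis]) (auto simp: Basis_vec_def)
  moreover have "?B \<subseteq> coord_subspace S"
    by (auto simp: coord_subspace_def axis_def)
  ultimately have "card ?B \<le> dim (coord_subspace S :: (real^'n) set)"
    by (intro independent_card_le_dim)
  moreover have "inj_on (\<lambda>i. axis i 1 :: real^'n) (- S)"
    by (auto simp: inj_on_def axis_eq_axis)
  ultimately show ?thesis by (simp add: card_image)
qed

text \<open>Presents the coordinate sphere as the relative frontier of a bounded convex set, the
  setting in which maps between spheres of different dimension are known to be inessential.\<close>

lemma unit_vectors_off_eq_rel_frontier:
  "(unit_vectors_off S :: (real^'n) set) = rel_frontier (cball 0 1 \<inter> coord_subspace S)"
proof -
  have "(0 :: real^'n) \<in> interior (cball 0 1) \<inter> coord_subspace S"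
    by (simp add: coord_subspace_def)
  then have "rel_frontier (cball 0 1 \<inter> (coord_subspace S :: (real^'n) set)) = frontier (cball 0 1) \<inter> (coord_subspace S)"
    by (intro convex_affine_rel_frontier_Int subspace_imp_affine subspace_coord_subspace convex_cball) blast
  then show ?thesis
    by (auto simp: unit_vectors_off_def coord_subspace_def)
qed

lemma aff_dim_ball_coord_subspace:
  "aff_dim (cball 0 1 \<inter> (coord_subspace S :: (real^'n) set)) \<ge> int (card (- S))"
proof -
  have "(0 :: real^'n) \<in> coord_subspace S \<inter> interior (cball 0 1)"
    by (simp add: coord_subspace_def)
  then have "aff_dim (coord_subspace S \<inter> cball 0 (1::real)) = aff_dim (coord_subspace S :: (real^'n) set)"
    by (intro aff_dim_convex_Int_nonempty_interior subspace_imp_convex subspace_coord_subspace) blast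
  then show ?thesis
    by (simp add: aff_dim_subspace subspace_coord_subspace dim_coord_subspace Int_commute)
qed

lemma convex_bounded_ball_coord_subspace:
  "convex (cball 0 1 \<inter> (coord_subspace S :: (real^'n) set))" "bounded (cball 0 1 \<inter> (coord_subspace S :: (real^'n) set))"
  by (auto intro: convex_Int convex_cball subspace_imp_convex subspace_coord_subspace bounded_Int)

text \<open>The source has dimension \<open>DIM('m) - 1\<close> and the target
  \<open>card (- S) - 1\<close>, and maps from a sphere to one of larger dimension are inessential.
  Path connectedness of the target lets the constant be chosen. The source type stays general
  because it is \<open>complex\<close> for loops and \<open>complex \<times> real\<close> for the
  2-sphere.\<close>

lemma sphere_map_unit_vectors_off_null:
  fixes f :: "'m::euclidean_space \<Rightarrow> real^'n"
  assumes "DIM('m) < card (- S)" "continuous_on (sphere 0 1) f" "f ` sphere 0 1 \<subseteq> unit_vectors_off S"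
    and "c \<in> unit_vectors_off S" "card (- S) \<ge> 2"
  shows "homotopic_with_canon (\<lambda>_. True) (sphere 0 1) (unit_vectors_off S) f (\<lambda>_. c)"
proof -
  let ?T = "cball 0 1 \<inter> (coord_subspace S :: (real^'n) set)"
  have sp: "sphere (0::'m) 1 = rel_frontier (cball 0 1)" by simp
  have "aff_dim (cball (0::'m) 1) < aff_dim ?T"
    using aff_dim_ball_coord_subspace[of S] assms(1) by (simp add: aff_dim_cball)
  then obtain b where b: "homotopic_with_canon (\<lambda>_. True) (sphere 0 1) (unit_vectors_off S) f (\<lambda>_. b)"
    using inessential_spheremap_lowdim_gen[of "cball (0::'m) 1" ?T f] assms(2,3)
      convex_bounded_ball_coord_subspace[of S]
    unfolding unit_vectors_off_eq_rel_frontier sp image_subset_iff_funcset by auto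
  have "path_connected (unit_vectors_off S)"
    unfolding unit_vectors_off_eq_rel_frontier
    by (rule path_connected_sphere_gen)
       (use convex_bounded_ball_coord_subspace[of S] aff_dim_ball_coord_subspace[of S] assms(5) in auto)
  moreover have "sphere (0::'m) 1 \<noteq> {}" by simp
  then have "b \<in> unit_vectors_off S"
    using b homotopic_with_imp_subset2[OF b] by fastforce
  ultimately have "path_component (unit_vectors_off S) b c"
    using assms(4) by (simp add: path_connected_component)
  then have "homotopic_with_canon (\<lambda>_. True) (sphere (0::'m) 1) (unit_vectors_off S) (\<lambda>_. b) (\<lambda>_. c)"
    by (simp add: homotopic_constant_maps path_component_of_def path_component_def pathin_def
        path_def path_image_def pathstart_def pathfinish_def continuous_map_in_subtopology) blast
  with b show ?thesis by (rule homotopic_with_trans)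
qed

section \<open>Stabilizers of coordinate vectors as a tower over spheres\<close>

definition rot_fix :: "'n set \<Rightarrow> (real^'n^'n) set" where
  "rot_fix S = {A. rotation_matrix A \<and> (\<forall>i\<in>S. A *v axis i 1 = axis i 1)}"

lemma rot_fix_empty: "rot_fix {} = {A. rotation_matrix A}"
  by (simp add: rot_fix_def)

lemma rot_fix_mult: "A \<in> rot_fix S \<Longrightarrow> B \<in> rot_fix S \<Longrightarrow> A ** B \<in> rot_fix S"
  by (auto simp: rot_fix_def rotation_matrix_mult matrix_vector_mul_assoc[symmetric])

lemma rot_fix_transpose:
  assumes "A \<in> rot_fix S"
  shows "transpose A \<in> rot_fix S"
proof -
  have "transpose A *v axis i 1 = axis i 1" if "i \<in> S" for i
  proof -
    have "transpose A *v (A *v axis i 1) = axis i 1"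
      using assms by (simp add: rot_fix_def rotation_transpose_mult matrix_vector_mul_assoc)
    then show ?thesis using assms that by (simp add: rot_fix_def)
  qed
  then show ?thesis using assms by (simp add: rot_fix_def)
qed

lemma rot_fix_column:
  assumes "A \<in> rot_fix S" "j \<notin> S"
  shows "A *v axis j 1 \<in> unit_vectors_off S"
proof -
  have o: "orthogonal_matrix A" using assms by (simp add: rot_fix_def rotation_matrix_def)
  have "(A *v axis j 1) $ i = 0" if "i \<in> S" for i
  proof -
    have "(A *v axis j 1) $ i = (A *v axis j 1) \<bullet> (A *v axis i 1)"
      using assms that by (simp add: rot_fix_def inner_axis)
    also have "\<dots> = axis j 1 \<bullet> (axis i 1 :: real^'a)" by (rule orthogonal_matrix_dot[OF o])
    also have "\<dots> = 0" using that assms by (auto simp: inner_axis_axis)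
    finally show ?thesis .
  qed
  moreover have "norm (A *v axis j 1) = 1"
    using orthogonal_matrix_dot[OF o, of "axis j 1" "axis j 1"] by (simp add: norm_eq_1 inner_axis_axis)
  ultimately show ?thesis by (simp add: unit_vectors_off_def)
qed

text \<open>Homotopy lifting for the map from \<open>rot_fix S\<close> to the unit sphere off
  \<open>S\<close> that sends a rotation to its column \<open>j\<close>; the fibre over the axis of
  \<open>j\<close> is \<open>rot_fix (insert j S)\<close>. The rotations \<open>Q\<close> act from
  the left and fix the axes in \<open>S\<close> because \<open>h\<close> stays orthogonal to
  them.\<close>

lemma rot_fix_homotopy_lift:
  fixes F :: "'z::metric_space \<Rightarrow> real^'n^'n" and h :: "real \<times> 'z \<Rightarrow> real^'n"
  assumes Z: "compact Z" and F: "continuous_on Z F" "F ` Z \<subseteq> rot_fix S" and j: "j \<notin> S"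
    and h: "continuous_on ({0..1} \<times> Z) h" "h ` ({0..1} \<times> Z) \<subseteq> unit_vectors_off S"
    and h0: "\<And>z. z \<in> Z \<Longrightarrow> h (0, z) = F z *v axis j 1"
  obtains Q :: "real \<times> 'z \<Rightarrow> real^'n^'n" where
    "continuous_on ({0..1} \<times> Z) Q"
    "\<And>p. p \<in> {0..1::real} \<times> Z \<Longrightarrow> Q p \<in> rot_fix S"
    "\<And>z. z \<in> Z \<Longrightarrow> Q (0, z) = mat 1"
    "\<And>t z. t \<in> {0..1} \<Longrightarrow> z \<in> Z \<Longrightarrow> (Q (t, z) ** F z) *v axis j 1 = h (t, z)"
    "\<And>t z z'. t \<in> {0..1} \<Longrightarrow> (\<And>s. s \<in> {0..1} \<Longrightarrow> h (s, z) = h (s, z')) \<Longrightarrow> Q (t, z) = Q (t, z')"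
proof -
  have nh: "norm (h p) = 1" if "p \<in> {0..1} \<times> Z" for p
    using h(2) that by (auto simp: unit_vectors_off_def image_subset_iff)
  obtain Q where Q: "continuous_on ({0..1} \<times> Z) Q"
    "\<And>p. p \<in> {0..1::real} \<times> Z \<Longrightarrow> rotation_matrix (Q p)"
    "\<And>z. z \<in> Z \<Longrightarrow> Q (0, z) = mat 1"
    "\<And>t z. t \<in> {0..1} \<Longrightarrow> z \<in> Z \<Longrightarrow> Q (t, z) *v h (0, z) = h (t, z)"
    "\<And>t z z'. t \<in> {0..1} \<Longrightarrow> (\<And>s. s \<in> {0..1} \<Longrightarrow> h (s, z) = h (s, z')) \<Longrightarrow> Q (t, z) = Q (t, z')"
    "\<And>t z w. t \<in> {0..1} \<Longrightarrow> (\<And>s. s \<in> {0..1} \<Longrightarrow> h (s, z) \<bullet> w = 0) \<Longrightarrow> Q (t, z) *v w = w"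
    using sphere_homotopy_lift[OF Z h(1) nh] by blast
  show ?thesis
  proof (rule that[of Q])
    fix p :: "real \<times> 'z" assume p: "p \<in> {0..1} \<times> Z"
    then obtain t z where tz: "p = (t, z)" "t \<in> {0..1}" "z \<in> Z" by auto
    have "Q p *v axis i 1 = axis i 1" if "i \<in> S" for i
    proof -
      have "h (s, z) \<bullet> axis i 1 = 0" if "s \<in> {0..1}" for s
        using h(2) tz that \<open>i \<in> S\<close> by (auto simp: unit_vectors_off_def image_subset_iff inner_axis)
      then show ?thesis using Q(6)[of t z "axis i 1"] tz by auto
    qed
    then show "Q p \<in> rot_fix S" using Q(2)[OF p] by (simp add: rot_fix_def)
  next
    show "(Q (t, z) ** F z) *v axis j 1 = h (t, z)" if "t \<in> {0..1}" "z \<in> Z" for t z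
      using Q(4)[OF that] h0[OF that(2)] by (simp add: matrix_vector_mul_assoc)
  qed (rule Q; assumption)+
qed

text \<open>Column \<open>j\<close> of \<open>F\<close> is a loop in a sphere of dimension at least
  two, so it contracts to the axis of \<open>j\<close>. Lifting the contraction moves
  \<open>F\<close> into the stabilizer of that axis.\<close>

lemma circle_map_rot_fix_reduce:
  fixes F :: "complex \<Rightarrow> real^'n^'n"
  assumes F: "continuous_on (sphere 0 1) F" "F ` sphere 0 1 \<subseteq> rot_fix S"
    and j: "j \<notin> S" and S: "card (- S) \<ge> 3"
  obtains F' where "homotopic_with_canon (\<lambda>_. True) (sphere 0 1) {A. rotation_matrix A} F F'"
    "F' ` sphere 0 1 \<subseteq> rot_fix (insert j S)"
proof -
  have "homotopic_with_canon (\<lambda>_. True) (sphere 0 1) (unit_vectors_off S) (\<lambda>z. F z *v axis j 1) (\<lambda>_. axis j 1)"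
  proof (rule sphere_map_unit_vectors_off_null)
    show "(\<lambda>z. F z *v axis j 1) ` sphere 0 1 \<subseteq> unit_vectors_off S"
      using F(2) j by (auto simp: image_subset_iff intro!: rot_fix_column)
    show "axis j 1 \<in> unit_vectors_off S"
      using j by (auto simp: unit_vectors_off_def) (auto simp: axis_def)
  qed (use F(1) S in \<open>auto intro!: continuous_intros\<close>)
  then obtain h :: "real \<times> complex \<Rightarrow> real^'n" where h: "continuous_on ({0..1} \<times> sphere 0 1) h"
      "h ` ({0..1} \<times> sphere 0 1) \<subseteq> unit_vectors_off S"
      "\<And>x. x \<in> sphere 0 1 \<Longrightarrow> h (0, x) = F x *v axis j 1" "\<And>x. x \<in> sphere 0 1 \<Longrightarrow> h (1, x) = axis j 1"
    by (rule homotopic_with_canon_TrueE) blast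
  obtain Q :: "real \<times> complex \<Rightarrow> real^'n^'n" where Q: "continuous_on ({0..1} \<times> sphere 0 1) Q"
    "\<And>p. p \<in> {0..1} \<times> sphere 0 1 \<Longrightarrow> Q p \<in> rot_fix S"
    "\<And>z. z \<in> sphere 0 1 \<Longrightarrow> Q (0, z) = mat 1"
    "\<And>t z. t \<in> {0..1} \<Longrightarrow> z \<in> sphere 0 1 \<Longrightarrow> (Q (t, z) ** F z) *v axis j 1 = h (t, z)"
    "\<And>t z z'. t \<in> {0..1} \<Longrightarrow> (\<And>s. s \<in> {0..1} \<Longrightarrow> h (s, z) = h (s, z')) \<Longrightarrow> Q (t, z) = Q (t, z')"
    using rot_fix_homotopy_lift[OF compact_sphere F j h(1-3)] by blast
  have G: "Q (t, z) ** F z \<in> rot_fix S" if "t \<in> {0..1}" "z \<in> sphere 0 1" for t z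
    by (rule rot_fix_mult[OF Q(2)]) (use that F in auto)
  show ?thesis
  proof
    show "homotopic_with_canon (\<lambda>_. True) (sphere 0 1) {A. rotation_matrix A} F (\<lambda>z. Q (1, z) ** F z)"
      unfolding homotopic_with_canon_True_iff
    proof (intro exI conjI ballI)
      show "continuous_on ({0..1} \<times> sphere 0 1) (\<lambda>p. Q p ** F (snd p))"
        by (intro continuous_intros Q continuous_on_compose2[OF F(1)]) auto
      show "(\<lambda>p. Q p ** F (snd p)) ` ({0..1} \<times> sphere 0 1) \<subseteq> {A. rotation_matrix A}"
        using G by (auto simp: rot_fix_def)
    qed (use Q(3) in auto)
    show "(\<lambda>z. Q (1, z) ** F z) ` sphere 0 1 \<subseteq> rot_fix (insert j S)"
      using G[of 1] Q(4)[of 1] h(4) by (auto simp: rot_fix_def)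
  qed
qed

text \<open>Indices are fixed one at a time. Two coordinates remain free, since the column of the
  next step would be a loop in a circle and need not contract.\<close>

lemma circle_map_rot_fix_reduce_iter:
  fixes F :: "complex \<Rightarrow> real^'n^'n"
  assumes F: "continuous_on (sphere 0 1) F" "F ` sphere 0 1 \<subseteq> rot_fix {}"
    and S: "card (- S) \<ge> 2"
  obtains F' where "homotopic_with_canon (\<lambda>_. True) (sphere 0 1) {A. rotation_matrix A} F F'"
    "F' ` sphere 0 1 \<subseteq> rot_fix S"
proof -
  have "\<exists>F'. homotopic_with_canon (\<lambda>_. True) (sphere 0 1) {A. rotation_matrix A} F F' \<and>
    F' ` sphere 0 1 \<subseteq> rot_fix S"
    using finite[of S] S
  proof (induction S rule: finite_induct)
    case empty
    have "homotopic_with_canon (\<lambda>_. True) (sphere 0 1) {A. rotation_matrix A} F F"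
      using F by (auto simp: homotopic_with_refl rot_fix_empty)
    then show ?case using F(2) by blast
  next
    case (insert j S)
    have "- S = insert j (- insert j S)" using insert.hyps by auto
    then have "card (- S) = Suc (card (- insert j S))"
      by (metis ComplD card_insert_disjoint finite insertI1)
    with insert.prems have c3: "card (- S) \<ge> 3" by linarith
    with insert.IH obtain F1 where F1: "homotopic_with_canon (\<lambda>_. True) (sphere 0 1) {A. rotation_matrix A} F F1"
      "F1 ` sphere 0 1 \<subseteq> rot_fix S" by fastforce
    have "continuous_on (sphere 0 1) F1" using homotopic_with_imp_continuous[OF F1(1)] by blast
    then obtain F2 where "homotopic_with_canon (\<lambda>_. True) (sphere 0 1) {A. rotation_matrix A} F1 F2"
      "F2 ` sphere 0 1 \<subseteq> rot_fix (insert j S)"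
      using circle_map_rot_fix_reduce[OF _ F1(2) insert.hyps(2) c3] by blast
    with F1(1) show ?case using homotopic_with_trans by blast
  qed
  then show ?thesis using that by blast
qed

text \<open>Collapsing the boundary turns \<open>u\<close> into a map on the 2-sphere, which is null
  in a sphere of dimension at least three. The resulting homotopy may move the boundary values; it
  only keeps them equal to each other at each time, so that a single rotation can undo the motion
  later.\<close>

lemma disc_map_const_boundary_null:
  fixes u :: "complex \<Rightarrow> real^'n"
  assumes u: "continuous_on (cball 0 1) u" "u ` cball 0 1 \<subseteq> unit_vectors_off S"
    and bd: "\<And>z. z \<in> sphere 0 1 \<Longrightarrow> u z = c" and S: "card (- S) \<ge> 4"
  obtains h where "continuous_on ({0..1::real} \<times> cball 0 1) h"
    "h ` ({0..1} \<times> cball 0 1) \<subseteq> unit_vectors_off S"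
    "\<And>z. z \<in> cball 0 1 \<Longrightarrow> h (0, z) = u z"
    "\<And>z. z \<in> cball 0 1 \<Longrightarrow> h (1, z) = c"
    "\<And>t z z'. z \<in> sphere 0 1 \<Longrightarrow> z' \<in> sphere 0 1 \<Longrightarrow> h (t, z) = h (t, z')"
proof -
  \<comment> \<open>The standard collapse of the disc onto the 2-sphere: the height is
    \<open>2 |z|^2 - 1\<close>, so the centre goes to the south pole and the boundary circle to the
    north pole \<open>(0, 1)\<close>.\<close>
  define w :: "complex \<Rightarrow> complex \<times> real"
    where "w = (\<lambda>z. ((2 * sqrt (1 - (norm z)\<^sup>2)) *\<^sub>R z, 2 * (norm z)\<^sup>2 - 1))"
  have cw: "continuous_on (cball 0 1) w"
    unfolding w_def by (intro continuous_intros)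
  have ws: "w z \<in> sphere 0 1" if "z \<in> cball 0 1" for z
  proof -
    have r: "(norm z)\<^sup>2 \<le> 1" using that by (simp add: power_le_one)
    have "(norm (w z))\<^sup>2 = (2 * sqrt (1 - (norm z)\<^sup>2) * norm z)\<^sup>2 + (2 * (norm z)\<^sup>2 - 1)\<^sup>2"
      using r by (simp add: w_def norm_Pair)
    also have "\<dots> = 4 * (1 - (norm z)\<^sup>2) * (norm z)\<^sup>2 + (2 * (norm z)\<^sup>2 - 1)\<^sup>2"
      using r by (simp add: power_mult_distrib)
    also have "\<dots> = 1" by (simp add: power2_eq_square algebra_simps)
    finally show ?thesis by (simp add: norm_eq_1 power2_norm_eq_inner)
  qed
  have surj: "w ` cball 0 1 = sphere 0 1"
  proof (intro equalityI subsetI)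
    fix p :: "complex \<times> real" assume p: "p \<in> sphere 0 1"
    obtain y s where ys: "p = (y, s)" by (cases p)
    have n: "(norm y)\<^sup>2 + s\<^sup>2 = 1"
      using p by (simp add: ys norm_Pair real_sqrt_eq_1_iff)
    have s: "\<bar>s\<bar> \<le> 1"
      using n by (metis abs_le_square_iff abs_one le_add_same_cancel2 one_power2 zero_le_power2)
    show "p \<in> w ` cball 0 1"
    proof (cases "s = 1")
      case True
      then have "y = 0" using n by simp
      then have "w 1 = p" by (simp add: w_def ys True)
      then show ?thesis by force
    next
      case False
      with s have s1: "1 - s > 0" by linarith
      \<comment> \<open>Solving \<open>2 |z|^2 - 1 = s\<close> gives
        \<open>|z|^2 = (1 + s) / 2\<close>, so the scalar factor in \<open>w\<close> equals
        \<open>sqrt (2 (1 - s))\<close> and has to be divided out.\<close>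
      define z where "z = (1 / sqrt (2 * (1 - s))) *\<^sub>R y"
      have nz: "(norm z)\<^sup>2 = (1 + s) / 2"
      proof -
        have "(norm z)\<^sup>2 = (norm y)\<^sup>2 / (2 * (1 - s))"
          using s1 by (simp add: z_def power_divide)
        also have "(norm y)\<^sup>2 = (1 - s) * (1 + s)" using n by (simp add: power2_eq_square algebra_simps)
        also have "(1 - s) * (1 + s) / (2 * (1 - s)) = (1 + s) / 2"
          using s1 by (simp add: divide_simps)
        finally show ?thesis .
      qed
      have "2 * sqrt (1 - (norm z)\<^sup>2) = sqrt (2 * (1 - s))"
      proof -
        have "(2 * sqrt ((1 - s) / 2))\<^sup>2 = 2 * (1 - s)" using s1 by (simp add: power_mult_distrib)
        then have "sqrt (2 * (1 - s)) = 2 * sqrt ((1 - s) / 2)"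
          using s1 by (intro real_sqrt_unique) auto
        moreover have "1 - (norm z)\<^sup>2 = (1 - s) / 2" unfolding nz by (simp add: field_simps)
        ultimately show ?thesis by simp
      qed
      then have "(2 * sqrt (1 - (norm z)\<^sup>2)) *\<^sub>R z = y"
        using s1 by (simp add: z_def)
      then have "w z = p"
        by (simp add: w_def ys nz add_divide_distrib)
      moreover have "(norm z)\<^sup>2 \<le> 1" using nz s by simp
      then have "norm z \<le> 1" by (simp add: power_le_one_iff)
      ultimately show ?thesis by force
    qed
  qed (use ws in auto)
  have fib: "u z = u z'" if "z \<in> cball 0 1" "z' \<in> cball 0 1" "w z = w z'" for z z'
  proof -
    have "(norm z)\<^sup>2 = (norm z')\<^sup>2" using that(3) by (simp add: w_def)
    then have n: "norm z = norm z'" by simp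
    show ?thesis
    proof (cases "norm z = 1")
      case False
      then have "1 - (norm z)\<^sup>2 \<noteq> 0"
        by (simp add: power2_eq_1_iff) (use norm_ge_zero[of z] in linarith)
      then have "z = z'" using that(3) n by (simp add: w_def)
      then show ?thesis by simp
    qed (use bd n in auto)
  qed
  \<comment> \<open>A continuous surjection from a compact to a Hausdorff space is a quotient map,
    so \<open>u\<close> descends to the sphere.\<close>
  have q: "quotient_map (top_of_set (cball 0 1)) (top_of_set (sphere 0 1)) w"
    using cw ws surj
    by (intro T1_Spaces.continuous_imp_quotient_map) (auto simp: Hausdorff_space_subtopology compact_space_subtopology)
  have uc: "continuous_map (top_of_set (cball 0 1)) (top_of_set (unit_vectors_off S)) u"
    using u by auto
  have fib': "u z = u z'" if "z \<in> topspace (top_of_set (cball 0 1))"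
    "z' \<in> topspace (top_of_set (cball 0 1))" "w z = w z'" for z z'
    using fib[of z z'] that by simp
  obtain g where g: "continuous_map (top_of_set (sphere 0 1)) (top_of_set (unit_vectors_off S)) g"
    "\<And>z. z \<in> topspace (top_of_set (cball 0 1)) \<Longrightarrow> g (w z) = u z"
    by (rule quotient_map_lift_exists[OF q uc], rule fib', assumption+) (rule that, assumption+)
  have "u 1 = c" using bd by simp
  then have c: "c \<in> unit_vectors_off S" using u(2) by (auto simp: image_subset_iff)
  have "homotopic_with_canon (\<lambda>_. True) (sphere 0 1) (unit_vectors_off S) g (\<lambda>_. c)"
    by (rule sphere_map_unit_vectors_off_null) (use g(1) c S in auto)
  then obtain k :: "real \<times> (complex \<times> real) \<Rightarrow> real^'n" where k: "continuous_on ({0..1} \<times> sphere 0 1) k" "k ` ({0..1} \<times> sphere 0 1) \<subseteq> unit_vectors_off S"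
    "\<And>x. x \<in> sphere 0 1 \<Longrightarrow> k (0, x) = g x" "\<And>x. x \<in> sphere 0 1 \<Longrightarrow> k (1, x) = c"
    by (rule homotopic_with_canon_TrueE) blast
  show ?thesis
  proof (rule that[of "\<lambda>(t, z). k (t, w z)"])
    show "continuous_on ({0..1} \<times> cball 0 1) (\<lambda>(t, z). k (t, w z))"
      unfolding case_prod_beta'
      by (intro continuous_on_compose2[OF k(1)] continuous_intros continuous_on_compose2[OF cw])
         (use ws in auto)
    show "(\<lambda>(t, z). k (t, w z)) ` ({0..1} \<times> cball 0 1) \<subseteq> unit_vectors_off S"
      using k(2) ws by (auto simp: image_subset_iff)
  next
    show "(case (0, z) of (t, z) \<Rightarrow> k (t, w z)) = u z" if "z \<in> cball 0 1" for z
      using that k(3)[OF ws[OF that]] g(2) by simp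
    show "(case (1, z) of (t, z) \<Rightarrow> k (t, w z)) = c" if "z \<in> cball 0 1" for z
      using k(4)[OF ws[OF that]] by simp
    show "(case (t, z) of (t, z) \<Rightarrow> k (t, w z)) = (case (t, z') of (t, z) \<Rightarrow> k (t, w z))"
      if "z \<in> sphere 0 1" "z' \<in> sphere 0 1" for t z z'
      using that by (simp add: w_def)
  qed
qed

text \<open>On the boundary \<open>F\<close> already fixes the axis of \<open>j\<close>, so its
  column is constant there and the lifted homotopy ends at one rotation \<open>R\<close> all along
  the circle. As \<open>R\<close> fixes that axis too, composing with its transpose restores the
  boundary values without leaving the stabilizer.\<close>

lemma disc_map_rot_fix_reduce:
  fixes F :: "complex \<Rightarrow> real^'n^'n"
  assumes F: "continuous_on (cball 0 1) F" "F ` cball 0 1 \<subseteq> rot_fix S"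
    and bd: "F ` sphere 0 1 \<subseteq> rot_fix (insert j S)" and j: "j \<notin> S" and S: "card (- S) \<ge> 4"
  obtains F' where "continuous_on (cball 0 1) F'" "F' ` cball 0 1 \<subseteq> rot_fix (insert j S)"
    "\<And>z. z \<in> sphere 0 1 \<Longrightarrow> F' z = F z"
proof -
  define u where "u = (\<lambda>z. F z *v axis j 1)"
  have cu: "continuous_on (cball 0 1) u" unfolding u_def by (intro continuous_intros F)
  have uS: "u ` cball 0 1 \<subseteq> unit_vectors_off S"
    unfolding u_def using F(2) j by (auto simp: image_subset_iff intro!: rot_fix_column)
  have ubd: "u z = axis j 1" if "z \<in> sphere 0 1" for z
    using bd[THEN subsetD, OF imageI[OF that]] by (simp add: u_def rot_fix_def)
  obtain h :: "real \<times> complex \<Rightarrow> real^'n" where h: "continuous_on ({0..1::real} \<times> cball 0 1) h"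
    "h ` ({0..1} \<times> cball 0 1) \<subseteq> unit_vectors_off S"
    "\<And>z. z \<in> cball 0 1 \<Longrightarrow> h (0, z) = u z"
    "\<And>z. z \<in> cball 0 1 \<Longrightarrow> h (1, z) = axis j 1"
    "\<And>t z z'. z \<in> sphere 0 1 \<Longrightarrow> z' \<in> sphere 0 1 \<Longrightarrow> h (t, z) = h (t, z')"
    by (rule disc_map_const_boundary_null[OF cu uS _ S], rule ubd, assumption) (rule that, assumption+)
  obtain Q :: "real \<times> complex \<Rightarrow> real^'n^'n" where Q: "continuous_on ({0..1} \<times> cball 0 1) Q"
    "\<And>p. p \<in> {0..1} \<times> cball 0 1 \<Longrightarrow> Q p \<in> rot_fix S"
    "\<And>z. z \<in> cball 0 1 \<Longrightarrow> Q (0, z) = mat 1"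
    "\<And>t z. t \<in> {0..1} \<Longrightarrow> z \<in> cball 0 1 \<Longrightarrow> (Q (t, z) ** F z) *v axis j 1 = h (t, z)"
    "\<And>t z z'. t \<in> {0..1} \<Longrightarrow> (\<And>s. s \<in> {0..1} \<Longrightarrow> h (s, z) = h (s, z')) \<Longrightarrow> Q (t, z) = Q (t, z')"
    using rot_fix_homotopy_lift[OF compact_cball F j h(1,2) h(3)[unfolded u_def]] by blast
  define R where "R = Q (1, 1)"
  have RS: "R \<in> rot_fix S" unfolding R_def by (rule Q(2)) auto
  then have R: "rotation_matrix R" by (simp add: rot_fix_def)
  have Qbd: "Q (1, z) = R" if "z \<in> sphere 0 1" for z
    unfolding R_def by (rule Q(5), simp, rule h(5)) (use that in auto)
  have "F 1 *v axis j 1 = axis j 1" using ubd[of 1] by (simp add: u_def)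
  then have "R *v axis j 1 = axis j 1"
    using Q(4)[of 1 1] h(4)[of 1] by (simp add: R_def matrix_vector_mul_assoc[symmetric])
  then have RR: "R \<in> rot_fix (insert j S)" using RS by (simp add: rot_fix_def)
  show ?thesis
  proof
    show "continuous_on (cball 0 1) (\<lambda>z. transpose R ** (Q (1, z) ** F z))"
      by (intro continuous_intros F continuous_on_compose2[OF Q(1)]) auto
    have "Q (1, z) ** F z \<in> rot_fix (insert j S)" if "z \<in> cball 0 1" for z
    proof -
      have "Q (1, z) ** F z \<in> rot_fix S"
        using that F(2) by (intro rot_fix_mult Q(2)) auto
      then show ?thesis using Q(4)[of 1 z] h(4)[of z] that by (simp add: rot_fix_def)
    qed
    then show "(\<lambda>z. transpose R ** (Q (1, z) ** F z)) ` cball 0 1 \<subseteq> rot_fix (insert j S)"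
      using RR by (auto intro!: rot_fix_mult[of "transpose R"] rot_fix_transpose)
    show "transpose R ** (Q (1, z) ** F z) = F z" if "z \<in> sphere 0 1" for z
      using Qbd[OF that] rotation_transpose_mult(1)[OF R] by (simp add: matrix_mul_assoc)
  qed
qed

text \<open>Three coordinates stay free: one step further the column would lie in a 2-sphere, where
  maps from the collapsed disc need not be null.\<close>

lemma disc_map_rot_fix_reduce_iter:
  fixes F :: "complex \<Rightarrow> real^'n^'n"
  assumes F: "continuous_on (cball 0 1) F" "F ` cball 0 1 \<subseteq> rot_fix {}"
    and bd: "F ` sphere 0 1 \<subseteq> rot_fix S" and S: "card (- S) \<ge> 3"
  obtains F' where "continuous_on (cball 0 1) F'" "F' ` cball 0 1 \<subseteq> rot_fix S"
    "\<And>z. z \<in> sphere 0 1 \<Longrightarrow> F' z = F z"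
proof -
  have "\<exists>F'. continuous_on (cball 0 1) F' \<and> F' ` cball 0 1 \<subseteq> rot_fix S \<and> (\<forall>z \<in> sphere 0 1. F' z = F z)"
    using finite[of S] S bd
  proof (induction S rule: finite_induct)
    case empty
    then show ?case using F by auto
  next
    case (insert j S)
    have "- S = insert j (- insert j S)" using insert.hyps by auto
    then have "card (- S) = Suc (card (- insert j S))"
      by (metis ComplD card_insert_disjoint finite insertI1)
    with insert.prems have c4: "card (- S) \<ge> 4" by linarith
    have "F ` sphere 0 1 \<subseteq> rot_fix S" using insert.prems by (auto simp: rot_fix_def)
    with insert.IH c4 obtain F1 where F1: "continuous_on (cball 0 1) F1" "F1 ` cball 0 1 \<subseteq> rot_fix S"
      "\<forall>z \<in> sphere 0 1. F1 z = F z" by fastforce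
    have "F1 ` sphere 0 1 \<subseteq> rot_fix (insert j S)" using F1(3) insert.prems(2) by auto
    then obtain F2 where "continuous_on (cball 0 1) F2" "F2 ` cball 0 1 \<subseteq> rot_fix (insert j S)"
      "\<And>z. z \<in> sphere 0 1 \<Longrightarrow> F2 z = F1 z"
      using disc_map_rot_fix_reduce[OF F1(1,2) _ insert.hyps(2) c4] by blast
    with F1(3) show ?case by auto
  qed
  then show ?thesis using that by blast
qed

section \<open>A full turn is essential\<close>

lemma cis_minus_pi_eq: "cis (- pi) = -1"
  by (simp add: complex_eq_iff)

text \<open>At \<open>cis t\<close> a square root differs from \<open>cis (t / 2)\<close> by a
  continuous sign, which cannot change, whereas \<open>cis (t / 2)\<close> itself changes sign after
  one turn.\<close>

lemma no_circle_square_root: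
  assumes "continuous_on (sphere (0::complex) 1) r"
  shows "\<not> (\<forall>z \<in> sphere 0 1. (r z)\<^sup>2 = z)"
proof
  assume sq: "\<forall>z \<in> sphere 0 1. (r z)\<^sup>2 = z"
  define f where "f = (\<lambda>t::real. r (cis t) * cis (- t / 2))"
  have c: "continuous_on {0..2*pi} f"
    unfolding f_def cis_conv_exp
    by (intro continuous_intros continuous_on_compose2[OF assms]) auto
  have "(f t)\<^sup>2 = 1" for t
  proof -
    have "(f t)\<^sup>2 = (r (cis t))\<^sup>2 * (cis (- t / 2))\<^sup>2" by (simp add: f_def power_mult_distrib)
    also have "\<dots> = cis t * cis (- t)" using sq by (simp add: power2_eq_square cis_mult)
    also have "\<dots> = 1" by (simp add: cis_mult)
    finally show ?thesis .
  qed
  then have "f ` {0..2*pi} \<subseteq> {1, -1}" by (auto simp: power2_eq_1_iff)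
  moreover have "connected (f ` {0..2*pi})" using c by (intro connected_continuous_image) auto
  ultimately have "f 0 = f (2*pi)"
    using connected_finite_iff_sing[of "f ` {0..2*pi}"] finite_subset[of _ "{1, -1 :: complex}"]
    by (metis (no_types, lifting) atLeastAtMost_iff empty_iff finite.emptyI finite.insertI imageI order_refl pi_ge_zero
        singletonD zero_le_mult_iff zero_le_numeral)
  then have "r 1 = - r 1" by (simp add: f_def cis_minus_pi_eq)
  then have "r 1 = 0" by simp
  moreover have "(r 1)\<^sup>2 = 1" using sq by simp
  ultimately show False by simp
qed

section \<open>Sections of a field of projectors over the disc\<close>

lemma norm_matrix_vector_mult_le:
  fixes A :: "real^'n^'m"
  shows "norm (A *v x) \<le> norm A * norm x"
proof -
  have "norm (A *v x) = L2_set (\<lambda>i. \<bar>A $ i \<bullet> x\<bar>) UNIV"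
    by (simp add: norm_vec_def matrix_vector_mul_component)
  also have "\<dots> \<le> L2_set (\<lambda>i. norm (A $ i) * norm x) UNIV"
    by (intro L2_set_mono) (simp_all add: Cauchy_Schwarz_ineq2)
  also have "\<dots> = norm A * norm x"
    by (simp add: norm_vec_def[of A] L2_set_left_distrib)
  finally show ?thesis .
qed

text \<open>A vector in the image of the projector at the centre is carried outward along each
  radius, being projected anew at every sample point. When two projectors differ by less than 1 in
  norm, neither kills a nonzero vector in the image of the other, so the vector survives every
  step.\<close>

lemma idempotent_section:
  fixes P :: "complex \<Rightarrow> real^'m^'m"
  assumes P: "continuous_on (cball 0 1) P" and idem: "\<And>z. z \<in> cball 0 1 \<Longrightarrow> P z ** P z = P z"
    and w: "P 0 *v w \<noteq> 0"
  obtains v where "continuous_on (cball 0 1) v" "\<And>z. z \<in> cball 0 1 \<Longrightarrow> v z \<noteq> 0"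
    "\<And>z. z \<in> cball 0 1 \<Longrightarrow> P z *v v z = v z"
proof -
  have "uniformly_continuous_on (cball 0 1) P"
    using P by (intro compact_uniformly_continuous) auto
  then obtain d where d: "d > 0"
    and dP: "\<And>p p'. p \<in> cball 0 1 \<Longrightarrow> p' \<in> cball 0 1 \<Longrightarrow> dist p' p < d \<Longrightarrow> dist (P p') (P p) < 1"
    unfolding uniformly_continuous_on_def by (meson zero_less_one)
  obtain N :: nat where N: "N > 0" "1 / real N < d"
    using d real_arch_inverse[of d] by (auto simp: inverse_eq_divide)
  \<comment> \<open>Sample points on the radius from the centre to \<open>z\<close>; the last one,
    for \<open>k = N\<close>, is \<open>z\<close> itself.\<close>
  define p where "p = (\<lambda>z k. (real k / real N) *\<^sub>R (z::complex))"
  define v where "v = rec_nat (\<lambda>z. P 0 *v w) (\<lambda>k u z. P (p z (Suc k)) *v u z)"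
  have v0: "v 0 z = P 0 *v w" and vS: "v (Suc k) z = P (p z (Suc k)) *v v k z" for k z
    by (simp_all add: v_def)
  have p: "p z k \<in> cball 0 1" if "z \<in> cball 0 1" "k \<le> N" for z k
    using that N mult_mono[of "real k / real N" 1 "norm z" 1] by (simp add: p_def field_simps)
  have step: "norm (P (p z (Suc k)) - P (p z k)) < 1" if "z \<in> cball 0 1" "k < N" for z k
  proof -
    have "dist (p z (Suc k)) (p z k) = norm (1 / real N) * norm z"
      unfolding p_def dist_norm scaleR_diff_left[symmetric] norm_scaleR
      by (simp add: diff_divide_distrib[symmetric])
    also have "\<dots> \<le> 1 / real N" using that N by (simp add: divide_le_cancel)
    finally show ?thesis
      using dP[OF p[of z k] p[of z "Suc k"]] that N by (simp add: dist_norm)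
  qed
  have main: "v k z \<noteq> 0 \<and> P (p z k) *v v k z = v k z" if "z \<in> cball 0 1" "k \<le> N" for z k
    using that(2)
  proof (induction k)
    case 0
    then show ?case
      using w idem[of 0] by (simp add: v0 p_def matrix_vector_mul_assoc)
  next
    case (Suc k)
    then have IH: "v k z \<noteq> 0" "P (p z k) *v v k z = v k z" by auto
    have "v (Suc k) z - v k z = (P (p z (Suc k)) - P (p z k)) *v v k z"
      by (simp add: vS matrix_vector_mult_diff_rdistrib IH(2))
    then have "norm (v (Suc k) z - v k z) \<le> norm (P (p z (Suc k)) - P (p z k)) * norm (v k z)"
      by (simp add: norm_matrix_vector_mult_le)
    also have "\<dots> < norm (v k z)"
      using step[OF that(1), of k] Suc.prems IH(1) by (simp add: field_simps)
    finally have "v (Suc k) z \<noteq> 0" by auto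
    moreover have "P (p z (Suc k)) *v v (Suc k) z = v (Suc k) z"
      unfolding vS using idem[OF p[OF that(1) Suc.prems]] by (simp add: matrix_vector_mul_assoc)
    ultimately show ?case by simp
  qed
  have cv: "continuous_on (cball 0 1) (v k)" if "k \<le> N" for k
    using that
  proof (induction k)
    case (Suc k)
    have "(\<lambda>z. p z (Suc k)) ` cball 0 1 \<subseteq> cball 0 1"
      using p[OF _ Suc.prems] by blast
    moreover have "continuous_on (cball 0 1) (\<lambda>z. p z (Suc k))"
      unfolding p_def by (intro continuous_intros)
    ultimately have "continuous_on (cball 0 1) (\<lambda>z. P (p z (Suc k)))"
      by (intro continuous_on_compose2[OF P])
    moreover have "continuous_on (cball 0 1) (v k)" using Suc by simp
    ultimately have "continuous_on (cball 0 1) (\<lambda>z. P (p z (Suc k)) *v v k z)"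
      by (intro continuous_intros)
    then show ?case by (simp add: vS cong: continuous_on_cong)
  qed (simp add: v0 cong: continuous_on_cong)
  show ?thesis
  proof
    show "continuous_on (cball 0 1) (v N)" by (rule cv) simp
    have "p z N = z" for z using N by (simp add: p_def)
    then show "v N z \<noteq> 0" "P z *v v N z = v N z" if "z \<in> cball 0 1" for z
      using main[of z N] that by auto
  qed
qed

text \<open>For the rotation \<open>B\<close> given by the unit quaternion \<open>q = (w, x, y, z)\<close>, this is \<open>4 q q\<^sup>T\<close>.\<close>

definition quat_matrix :: "real^3^3 \<Rightarrow> real^4^4" where
  "quat_matrix B = vector
    [vector [1 + B$1$1 + B$2$2 + B$3$3, B$3$2 - B$2$3, B$1$3 - B$3$1, B$2$1 - B$1$2],
     vector [B$3$2 - B$2$3, 1 + B$1$1 - B$2$2 - B$3$3, B$1$2 + B$2$1, B$1$3 + B$3$1],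
     vector [B$1$3 - B$3$1, B$1$2 + B$2$1, 1 - B$1$1 + B$2$2 - B$3$3, B$2$3 + B$3$2],
     vector [B$2$1 - B$1$2, B$1$3 + B$3$1, B$2$3 + B$3$2, 1 - B$1$1 - B$2$2 + B$3$3]]"

text \<open>Rotations preserve the cross product, so each column of \<open>B\<close> is the cross
  product of the other two in cyclic order; the identities are the entries of these three
  equations.\<close>

lemma rotation_matrix_3_cofactors:
  fixes B :: "real^3^3"
  assumes "rotation_matrix B"
  shows "B$2$1 * B$3$2 - B$3$1 * B$2$2 = B$1$3" "B$3$1 * B$1$2 - B$1$1 * B$3$2 = B$2$3"
    "B$1$1 * B$2$2 - B$2$1 * B$1$2 = B$3$3"
    "B$2$2 * B$3$3 - B$3$2 * B$2$3 = B$1$1" "B$3$2 * B$1$3 - B$1$2 * B$3$3 = B$2$1"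
    "B$1$2 * B$2$3 - B$2$2 * B$1$3 = B$3$1"
    "B$2$3 * B$3$1 - B$3$3 * B$2$1 = B$1$2" "B$3$3 * B$1$1 - B$1$3 * B$3$1 = B$2$2"
    "B$1$3 * B$2$1 - B$2$3 * B$1$1 = B$3$2"
proof -
  have "cross3 (B *v axis 1 1) (B *v axis 2 1) = B *v axis 3 1"
    "cross3 (B *v axis 2 1) (B *v axis 3 1) = B *v axis 1 1"
    "cross3 (B *v axis 3 1) (B *v axis 1 1) = B *v axis 2 1"
    by (simp_all only: cross_rotation_matrix[OF assms] cross_basis)
  then show "B$2$1 * B$3$2 - B$3$1 * B$2$2 = B$1$3" "B$3$1 * B$1$2 - B$1$1 * B$3$2 = B$2$3"
    "B$1$1 * B$2$2 - B$2$1 * B$1$2 = B$3$3"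
    "B$2$2 * B$3$3 - B$3$2 * B$2$3 = B$1$1" "B$3$2 * B$1$3 - B$1$2 * B$3$3 = B$2$1"
    "B$1$2 * B$2$3 - B$2$2 * B$1$3 = B$3$1"
    "B$2$3 * B$3$1 - B$3$3 * B$2$1 = B$1$2" "B$3$3 * B$1$1 - B$1$3 * B$3$1 = B$2$2"
    "B$1$3 * B$2$1 - B$2$3 * B$1$1 = B$3$2"
    by (simp_all add: matrix_vector_mult_basis column_def cross3_def vec_eq_iff forall_3)
qed

lemma quat_matrix_entries:
  "quat_matrix B $ 1 $ 1 = 1 + B$1$1 + B$2$2 + B$3$3" "quat_matrix B $ 1 $ 2 = B$3$2 - B$2$3"
  "quat_matrix B $ 1 $ 3 = B$1$3 - B$3$1" "quat_matrix B $ 1 $ 4 = B$2$1 - B$1$2"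
  "quat_matrix B $ 2 $ 1 = B$3$2 - B$2$3" "quat_matrix B $ 2 $ 2 = 1 + B$1$1 - B$2$2 - B$3$3"
  "quat_matrix B $ 2 $ 3 = B$1$2 + B$2$1" "quat_matrix B $ 2 $ 4 = B$1$3 + B$3$1"
  "quat_matrix B $ 3 $ 1 = B$1$3 - B$3$1" "quat_matrix B $ 3 $ 2 = B$1$2 + B$2$1"
  "quat_matrix B $ 3 $ 3 = 1 - B$1$1 + B$2$2 - B$3$3" "quat_matrix B $ 3 $ 4 = B$2$3 + B$3$2"
  "quat_matrix B $ 4 $ 1 = B$2$1 - B$1$2" "quat_matrix B $ 4 $ 2 = B$1$3 + B$3$1"
  "quat_matrix B $ 4 $ 3 = B$2$3 + B$3$2" "quat_matrix B $ 4 $ 4 = 1 - B$1$1 - B$2$2 + B$3$3"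
  by (simp_all add: quat_matrix_def vector_def)

text \<open>Since \<open>q\<close> is a unit vector, a quarter of \<open>4 q q^T\<close> is the
  projector onto the line of \<open>q\<close>, which is determined by \<open>B\<close> although
  \<open>q\<close> is so only up to sign. The proof works with the entries of \<open>B\<close> alone
  and never chooses \<open>q\<close>.\<close>

lemma quat_matrix_square:
  assumes "rotation_matrix B"
  shows "quat_matrix B ** quat_matrix B = 4 *\<^sub>R quat_matrix B"
proof -
  have "transpose B ** B = mat 1" "B ** transpose B = mat 1"
    using assms by (simp_all add: rotation_transpose_mult)
  then have o: "B$i$1 * B$j$1 + B$i$2 * B$j$2 + B$i$3 * B$j$3 = (if i = j then 1 else 0)"
      "B$1$i * B$1$j + B$2$i * B$2$j + B$3$i * B$3$j = (if i = j then 1 else 0)" for i j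
    by (simp_all add: matrix_matrix_mult_def transpose_def mat_def vec_eq_iff sum_3)
  have o: "B$1$1 * B$1$1 + B$1$2 * B$1$2 + B$1$3 * B$1$3 = 1"
    "B$2$1 * B$2$1 + B$2$2 * B$2$2 + B$2$3 * B$2$3 = 1"
    "B$3$1 * B$3$1 + B$3$2 * B$3$2 + B$3$3 * B$3$3 = 1"
    "B$1$1 * B$2$1 + B$1$2 * B$2$2 + B$1$3 * B$2$3 = 0"
    "B$1$1 * B$3$1 + B$1$2 * B$3$2 + B$1$3 * B$3$3 = 0"
    "B$2$1 * B$3$1 + B$2$2 * B$3$2 + B$2$3 * B$3$3 = 0"
    "B$1$1 * B$1$1 + B$2$1 * B$2$1 + B$3$1 * B$3$1 = 1"
    "B$1$2 * B$1$2 + B$2$2 * B$2$2 + B$3$2 * B$3$2 = 1"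
    "B$1$3 * B$1$3 + B$2$3 * B$2$3 + B$3$3 * B$3$3 = 1"
    "B$1$1 * B$1$2 + B$2$1 * B$2$2 + B$3$1 * B$3$2 = 0"
    "B$1$1 * B$1$3 + B$2$1 * B$2$3 + B$3$1 * B$3$3 = 0"
    "B$1$2 * B$1$3 + B$2$2 * B$2$3 + B$3$2 * B$3$3 = 0"
    using o[of 1 1] o[of 2 2] o[of 3 3] o[of 1 2] o[of 1 3] o[of 2 3] by simp_all
  note c = rotation_matrix_3_cofactors[OF assms]
  note oc = o[simplified algebra_simps] c[simplified algebra_simps]
  show ?thesis
    unfolding vec_eq_iff forall_4 matrix_matrix_mult_def
    \<comment> \<open>After expansion every entry is a linear combination of the orthogonality and
      cofactor relations, with the products of entries of \<open>B\<close> as unknowns.\<close>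
    by (simp add: sum_4 quat_matrix_entries algebra_simps) (intro conjI; use oc in linarith)
qed

section \<open>Rotations in a coordinate plane\<close>

definition plane_rot :: "'n \<Rightarrow> 'n \<Rightarrow> complex \<Rightarrow> real^'n^'n" where
  "plane_rot a b z = (\<chi> i j. (if i = a \<and> j = a \<or> i = b \<and> j = b then 1 else 0) * Re z
     + (if i = b \<and> j = a then 1 else if i = a \<and> j = b then -1 else 0) * Im z
     + (if i = j \<and> i \<noteq> a \<and> i \<noteq> b then 1 else 0))"

lemma plane_rot_mult_vec:
  assumes "a \<noteq> b"
  shows "(plane_rot a b z *v x) $ i = (if i = a then Re z * x $ a - Im z * x $ b
     else if i = b then Im z * x $ a + Re z * x $ b else x $ i)"
proof -
  have "(plane_rot a b z *v x) $ i = (\<Sum>j\<in>UNIV. plane_rot a b z $ i $ j * x $ j)"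
    by (simp add: matrix_vector_mult_def)
  also have "\<dots> = (\<Sum>j\<in>UNIV. (if j = a then plane_rot a b z $ i $ a * x $ a else 0)
       + (if j = b then plane_rot a b z $ i $ b * x $ b else 0)
       + (if j = i then (if i = a \<or> i = b then 0 else x $ i) else 0))"
    by (rule sum.cong) (use assms in \<open>auto simp: plane_rot_def\<close>)
  also have "\<dots> = plane_rot a b z $ i $ a * x $ a + plane_rot a b z $ i $ b * x $ b
       + (if i = a \<or> i = b then 0 else x $ i)"
    by (simp add: sum.distrib)
  finally show ?thesis using assms by (auto simp: plane_rot_def)
qed

lemma plane_rot_mult:
  assumes "a \<noteq> b"
  shows "plane_rot a b z ** plane_rot a b w = plane_rot a b (z * w)"
  unfolding matrix_eq matrix_vector_mul_assoc[symmetric]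
  using assms by (auto simp: vec_eq_iff plane_rot_mult_vec algebra_simps)

lemma plane_rot_1: "a \<noteq> b \<Longrightarrow> plane_rot a b 1 = mat 1"
  unfolding matrix_eq by (auto simp: vec_eq_iff plane_rot_mult_vec)

lemma transpose_plane_rot: "a \<noteq> b \<Longrightarrow> transpose (plane_rot a b z) = plane_rot a b (cnj z)"
  unfolding vec_eq_iff transpose_def
proof (intro allI)
  fix i j
  assume "a \<noteq> b"
  then show "(\<chi> i j. plane_rot a b z $ j $ i) $ i $ j = plane_rot a b (cnj z) $ i $ j"
    by (cases "i = a"; cases "i = b"; cases "j = a"; cases "j = b"; simp add: plane_rot_def)
qed

lemma continuous_on_plane_rot [continuous_intros]:
  assumes "continuous_on S f"
  shows "continuous_on S (\<lambda>x. plane_rot a b (f x))"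
  unfolding plane_rot_def using assms by (intro continuous_intros)

lemma rotation_plane_rot:
  fixes a b :: "'n::finite"
  assumes "a \<noteq> b" "norm z = 1"
  shows "rotation_matrix (plane_rot a b z)"
proof (rule rotation_matrix_connected[of "sphere 0 1" "plane_rot a b" 1])
  show "orthogonal_matrix (plane_rot a b w)" if "w \<in> sphere 0 1" for w
  proof -
    have "cnj w * w = 1" using that complex_norm_square[of w] by (simp add: mult.commute)
    then show ?thesis
      using assms by (simp add: orthogonal_matrix transpose_plane_rot plane_rot_mult plane_rot_1)
  qed
qed (use assms in \<open>auto simp: plane_rot_1 connected_sphere intro!: continuous_intros\<close>)

lemma plane_rot_in_rot_fix:
  assumes "a \<noteq> b" "norm z = 1" "a \<notin> S" "b \<notin> S"
  shows "plane_rot a b z \<in> rot_fix S"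
proof -
  have "plane_rot a b z *v axis i 1 = axis i 1" if "i \<in> S" for i
    using assms that by (auto simp: vec_eq_iff plane_rot_mult_vec axis_def)
  then show ?thesis using assms by (simp add: rot_fix_def rotation_plane_rot)
qed

lemma rot_fix_entry:
  assumes "A \<in> rot_fix S" "i \<in> S"
  shows "A $ k $ i = (if k = i then 1 else 0)" "A $ i $ k = (if k = i then 1 else 0)"
proof -
  have "A *v axis i 1 = axis i 1" "transpose A *v axis i 1 = axis i 1"
    using assms rot_fix_transpose[of A S] by (auto simp: rot_fix_def)
  then have "(A *v axis i 1) $ k = axis i 1 $ k" "(transpose A *v axis i 1) $ k = axis i 1 $ k"
    by simp_all
  then show "A $ k $ i = (if k = i then 1 else 0)" "A $ i $ k = (if k = i then 1 else 0)"
    unfolding matrix_vector_mult_basis column_def transpose_def by (simp_all add: axis_def)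
qed

text \<open>Indexes three chosen coordinates by the type \<open>3\<close>, so that the block of a
  rotation fixing all other axes becomes a matrix to which the quaternion formula applies.\<close>

definition sel3 :: "'n \<Rightarrow> 'n \<Rightarrow> 'n \<Rightarrow> 3 \<Rightarrow> 'n" where
  "sel3 a b c i = (if i = 1 then a else if i = 2 then b else c)"

lemma sel3_simps [simp]: "sel3 a b c 1 = a" "sel3 a b c 2 = b" "sel3 a b c 3 = c"
  by (simp_all add: sel3_def)

definition block3 :: "'n \<Rightarrow> 'n \<Rightarrow> 'n \<Rightarrow> real^'n^'n \<Rightarrow> real^3^3" where
  "block3 a b c A = (\<chi> i j. A $ (sel3 a b c i) $ (sel3 a b c j))"

text \<open>Off the three coordinates \<open>A\<close> agrees with the identity, so the sums in
  \<open>transpose A ** A\<close> only run over these coordinates.\<close>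

lemma orthogonal_block3:
  fixes a b c :: "'n::finite"
  assumes "A \<in> rot_fix (- {a, b, c})" "a \<noteq> b" "a \<noteq> c" "b \<noteq> c"
  shows "orthogonal_matrix (block3 a b c A)"
proof -
  let ?e = "sel3 a b c"
  have "(transpose A ** A) $ (?e i) $ (?e j) = (mat 1 :: real^'n^'n) $ (?e i) $ (?e j)" for i j
    using assms(1) by (simp add: rot_fix_def rotation_transpose_mult)
  moreover have "(transpose A ** A) $ (?e i) $ (?e j) =
      (\<Sum>k\<in>{a, b, c}. A $ k $ (?e i) * A $ k $ (?e j))" for i j
  proof -
    have m: "?e i \<in> {a, b, c}" using exhaust_3[of i] by auto
    have "(transpose A ** A) $ (?e i) $ (?e j) = (\<Sum>k\<in>UNIV. A $ k $ (?e i) * A $ k $ (?e j))"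
      by (simp add: matrix_matrix_mult_def transpose_def)
    also have "\<dots> = (\<Sum>k\<in>{a, b, c}. A $ k $ (?e i) * A $ k $ (?e j))"
      using m by (intro sum.mono_neutral_right) (auto simp: rot_fix_entry[OF assms(1)])
    finally show ?thesis .
  qed
  ultimately have "(\<Sum>k\<in>{a, b, c}. A $ k $ (?e i) * A $ k $ (?e j)) =
      (mat 1 :: real^'n^'n) $ (?e i) $ (?e j)" for i j by metis
  then have "transpose (block3 a b c A) ** block3 a b c A = mat 1"
    using assms(2-4)
    by (simp add: vec_eq_iff forall_3 matrix_matrix_mult_def transpose_def sum_3 block3_def mat_def algebra_simps)
  then show ?thesis by (simp add: orthogonal_matrix)
qed

text \<open>Once the disc is reduced to three coordinates, the projectors onto the quaternion lines
  have a nowhere vanishing section \<open>v\<close>. Over the boundary point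
  \<open>cis \<theta>\<close> the line is spanned by
  \<open>(cos (\<theta> / 2), 0, 0, sin (\<theta> / 2))\<close>, so the first and last entries of
  \<open>v\<close> form a complex number whose direction is a square root of the boundary
  point.\<close>

lemma plane_rot_not_disc_boundary:
  fixes F :: "complex \<Rightarrow> real^'n^'n" and a b :: 'n
  assumes ab: "a \<noteq> b" and n: "CARD('n) \<ge> 3"
    and F: "continuous_on (cball 0 1) F" "\<And>z. z \<in> cball 0 1 \<Longrightarrow> rotation_matrix (F z)"
    and bd: "\<And>z. z \<in> sphere 0 1 \<Longrightarrow> F z = plane_rot a b z"
  shows False
proof -
  have "card {a, b} < card (UNIV :: 'n set)" using n ab by simp
  then have "{a, b} \<noteq> UNIV" by auto
  then obtain c where "c \<notin> {a, b}" by blast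
  then have c: "a \<noteq> c" "b \<noteq> c" by auto
  let ?S = "- {a, b, c}"
  obtain G where G: "continuous_on (cball 0 1) G" "G ` cball 0 1 \<subseteq> rot_fix ?S"
    "\<And>z. z \<in> sphere 0 1 \<Longrightarrow> G z = F z"
  proof (rule disc_map_rot_fix_reduce_iter[OF F(1), of ?S])
    show "F ` cball 0 1 \<subseteq> rot_fix {}" using F(2) by (auto simp: rot_fix_empty)
    show "F ` sphere 0 1 \<subseteq> rot_fix ?S"
      using ab bd plane_rot_in_rot_fix[of a b _ ?S] by auto
    show "3 \<le> card (- ?S)" using ab c by simp
  qed blast
  define M where "M = (\<lambda>z. quat_matrix (block3 a b c (G z)))"
  have ent: "block3 a b c A $ 1 $ 1 = A $ a $ a" "block3 a b c A $ 1 $ 2 = A $ a $ b"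
    "block3 a b c A $ 1 $ 3 = A $ a $ c" "block3 a b c A $ 2 $ 1 = A $ b $ a"
    "block3 a b c A $ 2 $ 2 = A $ b $ b" "block3 a b c A $ 2 $ 3 = A $ b $ c"
    "block3 a b c A $ 3 $ 1 = A $ c $ a" "block3 a b c A $ 3 $ 2 = A $ c $ b"
    "block3 a b c A $ 3 $ 3 = A $ c $ c" for A
    by (simp_all add: block3_def)
  have cB: "continuous_on (cball 0 1) (\<lambda>z. block3 a b c (G z))"
    unfolding block3_def by (intro continuous_intros G)
  have "G 1 = mat 1" using G(3)[of 1] bd[of 1] plane_rot_1[OF ab] by simp
  \<comment> \<open>At the boundary point 1 the rotation is the identity; from there the determinant
    of the block is followed over the disc.\<close>
  then have B1: "block3 a b c (G 1) = mat 1"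
    using ab c by (simp add: vec_eq_iff forall_3 ent mat_def)
  have rB: "rotation_matrix (block3 a b c (G z))" if "z \<in> cball 0 1" for z
  proof (rule rotation_matrix_connected[OF _ cB, of 1])
    show "orthogonal_matrix (block3 a b c (G x))" if "x \<in> cball 0 1" for x
      using G(2) that ab c by (intro orthogonal_block3) auto
  qed (use that B1 in \<open>auto simp: convex_connected\<close>)
  have cM: "continuous_on (cball 0 1) M"
    unfolding M_def continuous_on_matrix_iff forall_4 quat_matrix_entries ent
    by (intro conjI continuous_intros G)
  obtain w where w: "M 0 *v w \<noteq> 0"
  proof -
    \<comment> \<open>The trace of \<open>4 q q^T\<close> is 4 for every unit \<open>q\<close>, so
      the matrix is nonzero at the centre.\<close>
    have "M 0 $ 1 $ 1 + M 0 $ 2 $ 2 + M 0 $ 3 $ 3 + M 0 $ 4 $ 4 = 4"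
      by (simp add: M_def quat_matrix_entries)
    then have "M 0 \<noteq> 0" by auto
    then have "\<not> (\<forall>w. M 0 *v w = 0 *v w)" by (simp only: matrix_eq[symmetric] not_False_eq_True)
    then show ?thesis using that by auto
  qed
  obtain v where v: "continuous_on (cball 0 1) v" "\<And>z. z \<in> cball 0 1 \<Longrightarrow> v z \<noteq> 0"
    "\<And>z. z \<in> cball 0 1 \<Longrightarrow> ((1/4) *\<^sub>R M z) *v v z = v z"
  proof (rule idempotent_section[of "\<lambda>z. (1/4) *\<^sub>R M z" w])
    show "continuous_on (cball 0 1) (\<lambda>z. (1/4) *\<^sub>R M z)" by (intro continuous_intros cM)
    show "(1/4) *\<^sub>R M z ** (1/4) *\<^sub>R M z = (1/4) *\<^sub>R M z" if "z \<in> cball 0 1" for z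
      using quat_matrix_square[OF rB[OF that]]
      by (simp add: M_def scalar_matrix_assoc[symmetric] matrix_scalar_ac)
    show "((1/4) *\<^sub>R M 0) *v w \<noteq> 0" using w by (simp add: scaleR_matrix_vector_assoc[symmetric])
  qed blast
  define p where "p = (\<lambda>z. Complex (v z $ 1) (v z $ 4))"
  define r where "r = (\<lambda>z. p z / of_real (norm (p z)))"
  have key: "p z \<noteq> 0 \<and> (r z)\<^sup>2 = z" if z: "z \<in> sphere 0 1" for z
  proof -
    have G': "G z = plane_rot a b z" using G(3) bd z by simp
    have zc: "z \<in> cball 0 1" using z by simp
    have Mv: "M z *v v z = 4 *\<^sub>R v z"
    proof -
      have "(1/4) *\<^sub>R (M z *v v z) = v z" using v(3)[OF zc] by (simp add: scaleR_matrix_vector_assoc)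
      then have "4 *\<^sub>R ((1/4) *\<^sub>R (M z *v v z)) = 4 *\<^sub>R v z" by simp
      then show ?thesis by simp
    qed
    have "(M z *v v z) $ i = (\<Sum>j\<in>UNIV. M z $ i $ j * v z $ j)" for i
      by (simp add: matrix_vector_mult_def)
    then have eq: "(\<Sum>j\<in>UNIV. M z $ i $ j * v z $ j) = 4 * v z $ i" for i
      by (metis Mv vector_scaleR_component real_scaleR_def)
    have pe: "plane_rot a b z $ a $ a = Re z" "plane_rot a b z $ a $ b = - Im z" "plane_rot a b z $ b $ a = Im z"
      "plane_rot a b z $ b $ b = Re z" "plane_rot a b z $ c $ c = 1" "plane_rot a b z $ c $ a = 0"
      "plane_rot a b z $ c $ b = 0" "plane_rot a b z $ a $ c = 0" "plane_rot a b z $ b $ c = 0"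
      using ab c by (simp_all add: plane_rot_def)
    note E = M_def G' quat_matrix_entries ent pe sum_4
    have e1: "(2 + 2 * Re z) * v z $ 1 + 2 * Im z * v z $ 4 = 4 * v z $ 1" using eq[of 1] by (simp add: E)
    have e2: "v z $ 2 = 0" using eq[of 2] by (simp add: E)
    have e3: "v z $ 3 = 0" using eq[of 3] by (simp add: E)
    have e4: "2 * Im z * v z $ 1 + (2 - 2 * Re z) * v z $ 4 = 4 * v z $ 4" using eq[of 4] by (simp add: E)
    \<comment> \<open>The eigenvector equations say that the reflection sending \<open>p\<close> to
      \<open>z * cnj p\<close> fixes \<open>p z\<close>. Multiplying by \<open>p z\<close> shows
      that its square is \<open>z\<close> times a positive number.\<close>
    have pz: "p z = z * cnj (p z)"
      using e1 e4 by (simp add: complex_eq_iff p_def algebra_simps)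
    have p0: "p z \<noteq> 0"
    proof
      assume "p z = 0"
      then have "v z = 0" using e2 e3 by (simp add: p_def vec_eq_iff forall_4 complex_eq_iff)
      then show False using v(2)[OF zc] by simp
    qed
    have "(p z)\<^sup>2 = z * (p z * cnj (p z))"
      by (subst power2_eq_square, subst (2) pz) (simp add: algebra_simps)
    also have "p z * cnj (p z) = (of_real (norm (p z)))\<^sup>2"
      by (metis complex_norm_square of_real_power)
    finally show ?thesis using p0 by (simp add: r_def power_divide)
  qed
  have "continuous_on (sphere 0 1) v" using v(1) by (rule continuous_on_subset) auto
  then have cp: "continuous_on (sphere 0 1) p"
    unfolding p_def Complex_eq by (intro continuous_intros)
  have "continuous_on (sphere 0 1) r"
    unfolding r_def using key cp by (intro continuous_intros) auto
  then show False using no_circle_square_root key by blast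
qed

text \<open>The number \<open>z\<close> is read off the column of \<open>a\<close>. Dividing
  \<open>A\<close> by \<open>plane_rot a b z\<close> leaves a rotation that fixes every axis except
  possibly that of \<open>b\<close>; it is diagonal, and the determinant forces the last entry to be
  1.\<close>

lemma rot_fix_plane:
  fixes a b :: "'n::finite"
  assumes A: "A \<in> rot_fix (- {a, b})" and ab: "a \<noteq> b"
  shows "A = plane_rot a b (Complex (A $ a $ a) (A $ b $ a))" "norm (Complex (A $ a $ a) (A $ b $ a)) = 1"
proof -
  define z where "z = Complex (A $ a $ a) (A $ b $ a)"
  have o: "orthogonal_matrix A" using A by (simp add: rot_fix_def rotation_matrix_def)
  have Aa: "A *v axis a 1 = plane_rot a b z *v axis a 1"
    using rot_fix_entry(2)[OF A] ab
    unfolding matrix_vector_mult_basis column_def by (auto simp: vec_eq_iff plane_rot_def z_def)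
  show nz: "norm (Complex (A $ a $ a) (A $ b $ a)) = 1"
  proof -
    have "(norm z)\<^sup>2 = (\<Sum>k\<in>{a, b}. (A $ k $ a)\<^sup>2)"
      using ab by (simp add: z_def cmod_power2)
    also have "\<dots> = (\<Sum>k\<in>UNIV. (A $ k $ a)\<^sup>2)"
      using rot_fix_entry(2)[OF A] ab by (intro sum.mono_neutral_left) auto
    also have "\<dots> = (A *v axis a 1) \<bullet> (A *v axis a 1)"
      by (simp add: matrix_vector_mult_basis column_def inner_vec_def power2_eq_square)
    also have "\<dots> = 1" by (simp add: orthogonal_matrix_dot[OF o] inner_axis_axis)
    finally show ?thesis by (simp add: z_def abs_square_eq_1)
  qed
  define B where "B = transpose (plane_rot a b z) ** A"
  have Rz: "plane_rot a b z \<in> rot_fix (- {a, b})"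
    using ab nz by (intro plane_rot_in_rot_fix) (auto simp: z_def)
  then have rz: "rotation_matrix (plane_rot a b z)" by (simp add: rot_fix_def)
  have BS: "B \<in> rot_fix (- {a, b})" unfolding B_def by (intro rot_fix_mult rot_fix_transpose A Rz)
  have "B *v axis a 1 = axis a 1"
    unfolding B_def matrix_vector_mul_assoc[symmetric] Aa
    unfolding matrix_vector_mul_assoc rotation_transpose_mult[OF rz] by simp
  then have B: "B \<in> rot_fix (- {b})" using BS by (auto simp: rot_fix_def)
  have off: "B $ i $ j = 0" if "i \<noteq> j" for i j
    using rot_fix_entry(1)[OF B, of j i] rot_fix_entry(2)[OF B, of i j] that by (cases "i = b") auto
  have "det B = (\<Prod>i\<in>UNIV. B $ i $ i)"
    by (rule det_diagonal) (rule off)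
  also have "\<dots> = (\<Prod>i\<in>{b}. B $ i $ i)"
    using rot_fix_entry[OF B] by (intro prod.mono_neutral_right) auto
  finally have "B $ b $ b = 1" using B by (simp add: rot_fix_def rotation_matrix_def)
  then have "B $ i $ j = (if i = j then 1 else 0)" for i j
    using rot_fix_entry(1)[OF B, of j i] rot_fix_entry(2)[OF B, of i j] by (cases "i = b"; cases "j = b") auto
  then have "B = mat 1" by (simp add: vec_eq_iff mat_def)
  then have "plane_rot a b z ** (transpose (plane_rot a b z) ** A) = plane_rot a b z"
    by (simp add: B_def)
  then show "A = plane_rot a b (Complex (A $ a $ a) (A $ b $ a))"
    unfolding matrix_mul_assoc rotation_transpose_mult[OF rz] z_def[symmetric] by simp
qed

section \<open>The fundamental group of the rotation group\<close>

text \<open>Null-homotopy is encoded as an extension over the disc because extensions can be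
  multiplied and transposed pointwise.\<close>

definition circle_null :: "(complex \<Rightarrow> real^'n^'n) \<Rightarrow> bool" where
  "circle_null F \<longleftrightarrow> (\<exists>G. continuous_on (cball 0 1) G \<and> (\<forall>z\<in>cball 0 1. rotation_matrix (G z)) \<and>
     (\<forall>z\<in>sphere 0 1. G z = F z))"

lemma circle_null_iff_homotopic:
  fixes F :: "complex \<Rightarrow> real^'n^'n"
  shows "circle_null F \<longleftrightarrow>
    (\<exists>c. homotopic_with_canon (\<lambda>_. True) (sphere 0 1) {A. rotation_matrix A} F (\<lambda>_. c))"
  unfolding nullhomotopic_from_sphere_extension circle_null_def by (auto simp: Pi_iff)

lemma circle_null_homotopic_cong:
  fixes F :: "complex \<Rightarrow> real^'n^'n"
  assumes "homotopic_with_canon (\<lambda>_. True) (sphere 0 1) {A. rotation_matrix A} F F'"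
  shows "circle_null F \<longleftrightarrow> circle_null F'"
  unfolding circle_null_iff_homotopic using assms homotopic_with_trans homotopic_with_symD by metis

lemma circle_null_mult:
  "circle_null F \<Longrightarrow> circle_null G \<Longrightarrow> circle_null (\<lambda>z. F z ** G z)"
proof -
  assume "circle_null F" "circle_null G"
  then obtain f g where "continuous_on (cball 0 1) f" "\<forall>z\<in>cball 0 1. rotation_matrix (f z)" "\<forall>z\<in>sphere 0 1. f z = F z"
    "continuous_on (cball 0 1) g" "\<forall>z\<in>cball 0 1. rotation_matrix (g z)" "\<forall>z\<in>sphere 0 1. g z = G z"
    unfolding circle_null_def by blast
  then show ?thesis
    unfolding circle_null_def
    by (intro exI[of _ "\<lambda>z. f z ** g z"]) (auto intro!: continuous_intros rotation_matrix_mult)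
qed

lemma circle_null_transpose: "circle_null F \<Longrightarrow> circle_null (\<lambda>z. transpose (F z))"
proof -
  assume "circle_null F"
  then obtain f where "continuous_on (cball 0 1) f" "\<forall>z\<in>cball 0 1. rotation_matrix (f z)" "\<forall>z\<in>sphere 0 1. f z = F z"
    unfolding circle_null_def by blast
  then show ?thesis
    unfolding circle_null_def
    by (intro exI[of _ "\<lambda>z. transpose (f z)"]) (auto intro!: continuous_intros)
qed

lemma circle_null_const: "rotation_matrix A \<Longrightarrow> circle_null (\<lambda>_. A)"
  unfolding circle_null_def by (intro exI[of _ "\<lambda>_. A"]) auto

lemma circle_null_cong:
  assumes "\<And>z. norm z = 1 \<Longrightarrow> F z = G z"
  shows "circle_null F \<longleftrightarrow> circle_null G"
  unfolding circle_null_def using assms by simp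

lemma homotopic_rotation_mult:
  fixes F :: "complex \<Rightarrow> real^'n^'n"
  assumes "homotopic_with_canon (\<lambda>_. True) (sphere 0 1) {A. rotation_matrix A} F F'"
    and "homotopic_with_canon (\<lambda>_. True) (sphere 0 1) {A. rotation_matrix A} G G'"
  shows "homotopic_with_canon (\<lambda>_. True) (sphere 0 1) {A. rotation_matrix A} (\<lambda>z. F z ** G z) (\<lambda>z. F' z ** G' z)"
proof -
  obtain h :: "real \<times> complex \<Rightarrow> real^'n^'n" where h: "continuous_on ({0..1::real} \<times> sphere 0 1) h"
    "h ` ({0..1} \<times> sphere 0 1) \<subseteq> {A. rotation_matrix A}"
    "\<And>x. x \<in> sphere 0 1 \<Longrightarrow> h (0, x) = F x" "\<And>x. x \<in> sphere 0 1 \<Longrightarrow> h (1, x) = F' x"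
    using assms(1) unfolding homotopic_with_canon_True_iff by auto
  obtain k :: "real \<times> complex \<Rightarrow> real^'n^'n" where k: "continuous_on ({0..1::real} \<times> sphere 0 1) k"
    "k ` ({0..1} \<times> sphere 0 1) \<subseteq> {A. rotation_matrix A}"
    "\<And>x. x \<in> sphere 0 1 \<Longrightarrow> k (0, x) = G x" "\<And>x. x \<in> sphere 0 1 \<Longrightarrow> k (1, x) = G' x"
    using assms(2) unfolding homotopic_with_canon_True_iff by auto
  show ?thesis
    unfolding homotopic_with_canon_True_iff
  proof (intro exI conjI ballI)
    show "continuous_on ({0..1} \<times> sphere 0 1) (\<lambda>p. h p ** k p)" by (intro continuous_intros h k)
    show "(\<lambda>p. h p ** k p) ` ({0..1} \<times> sphere 0 1) \<subseteq> {A. rotation_matrix A}"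
      using h(2) k(2) by (fastforce simp: image_subset_iff intro!: rotation_matrix_mult)
  qed (simp_all add: h k)
qed

section \<open>Powers of a plane rotation as maps on the circle\<close>

lemma homotopic_plane_rot:
  fixes a b :: "'n::finite" and f g :: "complex \<Rightarrow> complex"
  assumes "a \<noteq> b" "homotopic_with_canon (\<lambda>_. True) (sphere 0 1) (sphere 0 1) f g"
  shows "homotopic_with_canon (\<lambda>_. True) (sphere 0 1) {A. rotation_matrix A} (\<lambda>z. plane_rot a b (f z)) (\<lambda>z. plane_rot a b (g z))"
proof -
  have "homotopic_with_canon (\<lambda>_. True) (sphere 0 1) {A. rotation_matrix A} (plane_rot a b \<circ> f) (plane_rot a b \<circ> g)"
    by (rule homotopic_with_compose_continuous_left[OF assms(2)])
      (use assms(1) in \<open>auto intro!: continuous_intros rotation_plane_rot\<close>)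
  then show ?thesis by (simp add: o_def)
qed

text \<open>Conjugating by the rotation by \<open>\<pi>\<close> in the plane of \<open>b\<close> and \<open>c\<close> reverses the loop, and this
  conjugation is isotopic to the identity.\<close>

lemma plane_rot_homotopic_inverse:
  fixes a b :: "'n::finite"
  assumes ab: "a \<noteq> b" and n: "CARD('n) \<ge> 3"
  shows "homotopic_with_canon (\<lambda>_. True) (sphere 0 1) {A. rotation_matrix A}
     (plane_rot a b) (\<lambda>z. plane_rot a b (cnj z))"
proof -
  have "card {a, b} < card (UNIV :: 'n set)" using n ab by simp
  then have "{a, b} \<noteq> UNIV" by auto
  then obtain c where "c \<notin> {a, b}" by blast
  then have c: "a \<noteq> c" "b \<noteq> c" by auto
  define D where "D = (\<lambda>s. plane_rot b c (cis (pi * s)))"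
  have rD: "rotation_matrix (D s)" for s unfolding D_def using c by (intro rotation_plane_rot) auto
  show ?thesis
    unfolding homotopic_with_canon_True_iff
  proof (intro exI conjI ballI)
    show "continuous_on ({0..1} \<times> sphere 0 1) (\<lambda>p. D (fst p) ** (plane_rot a b (snd p) ** transpose (D (fst p))))"
      unfolding D_def cis_conv_exp by (intro continuous_intros)
    show "(\<lambda>p. D (fst p) ** (plane_rot a b (snd p) ** transpose (D (fst p)))) ` ({0..1} \<times> sphere 0 1) \<subseteq> {A. rotation_matrix A}"
      using ab by (auto intro!: rotation_matrix_mult rotation_plane_rot simp: rD)
    show "D (fst (0, x)) ** (plane_rot a b (snd (0, x)) ** transpose (D (fst (0, x)))) = plane_rot a b x" for x
      using c by (simp add: D_def plane_rot_1)
    show "D (fst (1, x)) ** (plane_rot a b (snd (1, x)) ** transpose (D (fst (1, x)))) = plane_rot a b (cnj x)" for x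
      using ab c unfolding matrix_eq matrix_vector_mul_assoc[symmetric]
      by (auto simp: D_def transpose_plane_rot vec_eq_iff plane_rot_mult_vec)
  qed
qed

text \<open>In the pointwise product for \<open>z * z\<close> one factor may be replaced by its
  inverse up to homotopy, and \<open>z * cnj z = 1\<close> on the circle.\<close>

lemma circle_null_plane_rot_square:
  fixes a b :: "'n::finite"
  assumes ab: "a \<noteq> b" and n: "CARD('n) \<ge> 3"
  shows "circle_null (\<lambda>z. plane_rot a b (z\<^sup>2) :: real^'n^'n)"
proof -
  have "homotopic_with_canon (\<lambda>_. True) (sphere 0 1) {A. rotation_matrix A} (plane_rot a b) (plane_rot a b)"
    using ab by (auto simp: homotopic_with_refl intro!: continuous_intros rotation_plane_rot)
  from homotopic_rotation_mult[OF this plane_rot_homotopic_inverse[OF ab n]]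
  have "circle_null (\<lambda>z. plane_rot a b z ** plane_rot a b z) \<longleftrightarrow> circle_null (\<lambda>z. plane_rot a b z ** plane_rot a b (cnj z))"
    by (rule circle_null_homotopic_cong)
  also have "\<dots> \<longleftrightarrow> circle_null (\<lambda>z. mat 1 :: real^'n^'n)"
  proof (rule circle_null_cong)
    fix z :: complex assume "norm z = 1"
    then have "z * cnj z = 1" by (simp add: complex_norm_square[symmetric])
    then show "plane_rot a b z ** plane_rot a b (cnj z) = mat 1" using ab by (simp add: plane_rot_mult plane_rot_1)
  qed
  finally show ?thesis
    using ab by (simp add: plane_rot_mult power2_eq_square circle_null_const)
qed

text \<open>Pointwise products give the nonnegative even powers, transposes the negative
  ones.\<close>

lemma circle_null_plane_rot_power_int:
  fixes a b :: "'n::finite"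
  assumes ab: "a \<noteq> b" and n: "CARD('n) \<ge> 3"
  shows "circle_null (\<lambda>z. plane_rot a b (z powi (2 * k)) :: real^'n^'n)"
proof -
  have nat: "circle_null (\<lambda>z. plane_rot a b ((z\<^sup>2) ^ m) :: real^'n^'n)" for m
  proof (induction m)
    case 0
    then show ?case using ab by (simp add: plane_rot_1 circle_null_const)
  next
    case (Suc m)
    from circle_null_mult[OF circle_null_plane_rot_square[OF ab n] this]
    show ?case using ab by (simp add: plane_rot_mult)
  qed
  show ?thesis
  proof (cases "k \<ge> 0")
    case True
    then show ?thesis using nat[of "nat k"] by (simp add: power_int_def power_mult nat_mult_distrib)
  next
    case False
    have "circle_null (\<lambda>z. transpose (plane_rot a b ((z\<^sup>2) ^ nat (- k))) :: real^'n^'n)"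
      by (intro circle_null_transpose nat)
    also have "?this \<longleftrightarrow> ?thesis"
    proof (rule circle_null_cong)
      fix z :: complex assume z: "norm z = 1"
      have "z * cnj z = 1" using z by (simp add: complex_norm_square[symmetric])
      then have "cnj z = inverse z" by (metis inverse_unique)
      moreover have "nat (- (2 * k)) = 2 * nat (- k)" by simp
      ultimately have "cnj ((z\<^sup>2) ^ nat (- k)) = z powi (2 * k)"
        using False by (simp add: power_int_def power_mult nat_mult_distrib power_inverse[symmetric] flip: power_mult)
      then show "transpose (plane_rot a b ((z\<^sup>2) ^ nat (- k))) = plane_rot a b (z powi (2 * k))"
        using ab by (simp add: transpose_plane_rot)
    qed
    finally show ?thesis .
  qed
qed

text \<open>A continuous logarithm along the parametrized circle yields an angle
  \<open>\<theta>\<close> that increases by \<open>2 \<pi> k\<close> in total. The straight-line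
  homotopy from \<open>\<theta>\<close> to the linear function with the same end values passes
  through closed loops, and the linear function describes the power \<open>k\<close> times the
  constant \<open>cis (\<theta> 0)\<close>.\<close>

lemma circle_self_map_homotopic_power:
  fixes f :: "complex \<Rightarrow> complex"
  assumes f: "continuous_on (sphere 0 1) f" "\<And>z. norm z = 1 \<Longrightarrow> norm (f z) = 1"
  obtains c k where "norm c = 1" "homotopic_with_canon (\<lambda>_. True) (sphere 0 1) (sphere 0 1) f (\<lambda>z. c * z powi k)"
proof -
  define p where "p = (\<lambda>t::real. f (exp (2 * of_real pi * of_real t * \<i>)))"
  have ne: "norm (exp (2 * of_real pi * of_real t * \<i>)) = 1" for t by (simp add: norm_exp)
  have cp: "continuous_on {0..1} p"
    unfolding p_def by (intro continuous_on_compose2[OF f(1)] continuous_intros) (simp add: ne image_subset_iff)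
  have np: "norm (p t) = 1" for t unfolding p_def by (rule f(2)[OF ne])
  then have p0: "p t \<noteq> 0" for t by (metis norm_zero zero_neq_one)
  obtain g where g: "continuous_on {0..1} g" "\<And>t. t \<in> {0..1} \<Longrightarrow> p t = exp (g t)"
    using continuous_logarithm_on_contractible[OF cp] p0 convex_imp_contractible by (metis convex_real_interval(5))
  define \<theta> where "\<theta> = (\<lambda>t. Im (g t))"
  have ct: "continuous_on {0..1} \<theta>" unfolding \<theta>_def by (intro continuous_intros g)
  have pt: "p t = cis (\<theta> t)" if "t \<in> {0..1}" for t
  proof -
    have "norm (exp (g t)) = 1" using np[of t] g(2)[OF that] by simp
    then have "Re (g t) = 0" by simp
    then show ?thesis using g(2)[OF that] by (simp add: \<theta>_def exp_eq_polar)
  qed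
  have "exp (g 1) = exp (g 0)"
  proof -
    have "p 1 = p 0" by (simp add: p_def exp_two_pi_i' mult.commute mult.assoc)
    then show ?thesis using g(2) by simp
  qed
  then obtain k :: int where k: "g 1 = g 0 + (of_int (2 * k) * pi) * \<i>"
    using exp_eq by blast
  then have k': "\<theta> 1 = \<theta> 0 + 2 * pi * of_int k" by (simp add: \<theta>_def)
  define q where "q = (\<lambda>t. cis (\<theta> 0 + 2 * pi * of_int k * t))"
  have "homotopic_loops (sphere 0 1) p q"
    unfolding homotopic_loops
  proof (intro exI conjI ballI)
    let ?h = "\<lambda>y. cis ((1 - fst y) * \<theta> (snd y) + fst y * (\<theta> 0 + 2 * pi * of_int k * snd y))"
    show "continuous_on ({0..1} \<times> {0..1}) ?h"
      unfolding cis_conv_exp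
      by (intro continuous_intros continuous_on_compose2[OF ct]) auto
    show "?h \<in> {0..1} \<times> {0..1} \<rightarrow> sphere 0 1" by auto
    show "?h (0, t) = p t" if "t \<in> {0..1}" for t using pt[OF that] by simp
    show "?h (1, t) = q t" if "t \<in> {0..1}" for t by (simp add: q_def)
    show "pathfinish (?h \<circ> Pair s) = pathstart (?h \<circ> Pair s)" if "s \<in> {0..1}" for s
    proof -
      have "(1 - s) * \<theta> 1 + s * (\<theta> 0 + 2 * pi * of_int k * 1) = \<theta> 0 + 2 * pi * of_int k"
        unfolding k' by (simp add: algebra_simps)
      moreover have "(1 - s) * \<theta> 0 + s * (\<theta> 0 + 2 * pi * of_int k * 0) = \<theta> 0" by (simp add: algebra_simps)
      moreover have "cis (\<theta> 0 + 2 * pi * of_int k) = cis (\<theta> 0)"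
        by (simp add: cis_mult[symmetric] cis_multiple_2pi)
      ultimately show ?thesis by (simp add: pathfinish_def pathstart_def)
    qed
  qed
  from homotopic_loops_imp_homotopic_circlemaps[OF this]
  have "homotopic_with_canon (\<lambda>h. True) (sphere 0 1) (sphere 0 1)
     (p \<circ> (\<lambda>z. Arg2pi z / (2 * pi))) (q \<circ> (\<lambda>z. Arg2pi z / (2 * pi)))" .
  then have "homotopic_with_canon (\<lambda>_. True) (sphere 0 1) (sphere 0 1) f (\<lambda>z. cis (\<theta> 0) * z powi k)"
  proof (rule homotopic_with_eq)
    fix z :: complex assume "z \<in> topspace (top_of_set (sphere 0 1))"
    then have z: "norm z = 1" by simp
    then have ze: "z = cis (Arg2pi z)" using complex_norm_eq_1_exp[of z] by (simp add: cis_conv_exp mult.commute)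
    then show "f z = (p \<circ> (\<lambda>z. Arg2pi z / (2 * pi))) z"
      by (simp add: p_def cis_conv_exp mult.commute)
    show "cis (\<theta> 0) * z powi k = (q \<circ> (\<lambda>z. Arg2pi z / (2 * pi))) z"
      by (subst ze) (simp add: q_def cis_mult cis_power_int)
  qed auto
  then show ?thesis by (rule that[rotated]) simp
qed

text \<open>After the reduction to a plane the loop is a power \<open>z powi k\<close> up to a
  constant. Even powers are null, and for odd \<open>k\<close> dividing by one full turn leaves an
  even power. This bounds the order of the fundamental group by two.\<close>

lemma circle_map_rotation_classification:
  fixes F :: "complex \<Rightarrow> real^'n^'n" and a b :: 'n
  assumes ab: "a \<noteq> b" and n: "CARD('n) \<ge> 3"
    and F: "continuous_on (sphere 0 1) F" "\<And>z. norm z = 1 \<Longrightarrow> rotation_matrix (F z)"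
  shows "circle_null F \<or> circle_null (\<lambda>z. transpose (plane_rot a b z) ** F z)"
proof -
  have FS: "F ` sphere 0 1 \<subseteq> rot_fix {}" using F(2) by (auto simp: rot_fix_empty)
  have "card (- (- {a, b})) \<ge> 2" using ab by simp
  from circle_map_rot_fix_reduce_iter[OF F(1) FS this] obtain F' where
    F': "homotopic_with_canon (\<lambda>_. True) (sphere 0 1) {A. rotation_matrix A} F F'"
    "F' ` sphere 0 1 \<subseteq> rot_fix (- {a, b})" by blast
  have cF': "continuous_on (sphere 0 1) F'" using homotopic_with_imp_continuous[OF F'(1)] by blast
  define f where "f = (\<lambda>z. Complex (F' z $ a $ a) (F' z $ b $ a))"
  have "continuous_on (sphere 0 1) f"
    unfolding f_def Complex_eq by (intro continuous_intros cF')
  moreover have "norm (f z) = 1" if "norm z = 1" for z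
    unfolding f_def using F'(2) that ab by (intro rot_fix_plane) auto
  ultimately obtain c k where ck: "norm c = 1"
    "homotopic_with_canon (\<lambda>_. True) (sphere 0 1) (sphere 0 1) f (\<lambda>z. c * z powi k)"
    by (rule circle_self_map_homotopic_power)
  have "F' z = plane_rot a b (f z)" if "norm z = 1" for z
    unfolding f_def using F'(2) that ab by (intro rot_fix_plane) auto
  then have "homotopic_with_canon (\<lambda>_. True) (sphere 0 1) {A. rotation_matrix A} F' (\<lambda>z. plane_rot a b (c * z powi k))"
    by (intro homotopic_with_eq[OF homotopic_plane_rot[OF ab ck(2)]]) auto
  with F'(1) have hom: "homotopic_with_canon (\<lambda>_. True) (sphere 0 1) {A. rotation_matrix A} F (\<lambda>z. plane_rot a b (c * z powi k))"
    by (rule homotopic_with_trans)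
  have nc: "circle_null (\<lambda>z. plane_rot a b (c * z powi (2 * m)))" for m
    using circle_null_mult[OF circle_null_const[OF rotation_plane_rot[OF ab ck(1)]] circle_null_plane_rot_power_int[OF ab n, of m]]
    by (simp add: plane_rot_mult[OF ab])
  show ?thesis
  proof (cases "even k")
    case True
    then obtain m where "k = 2 * m" by blast
    then show ?thesis using nc[of m] circle_null_homotopic_cong[OF hom] by blast
  next
    case False
    then obtain m where m: "k = 2 * m + 1" by (elim oddE)
    have "homotopic_with_canon (\<lambda>_. True) (sphere 0 1) {A. rotation_matrix A}
        (\<lambda>z. transpose (plane_rot a b z)) (\<lambda>z. transpose (plane_rot a b z))"
      using ab by (auto simp: homotopic_with_refl intro!: continuous_intros rotation_plane_rot)
    from homotopic_rotation_mult[OF this hom] circle_null_homotopic_cong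
    have "circle_null (\<lambda>z. transpose (plane_rot a b z) ** F z) \<longleftrightarrow>
        circle_null (\<lambda>z. transpose (plane_rot a b z) ** plane_rot a b (c * z powi k))" by blast
    also have "\<dots> \<longleftrightarrow> circle_null (\<lambda>z. plane_rot a b (c * z powi (2 * m)))"
    proof (rule circle_null_cong)
      fix z :: complex assume z: "norm z = 1"
      have "z * cnj z = 1" using z by (simp add: complex_norm_square[symmetric])
      moreover have "z \<noteq> 0" using z by auto
      then have "z powi k = z powi (2 * m) * z" by (simp add: m power_int_add)
      ultimately have "cnj z * (c * z powi k) = c * z powi (2 * m)" by (simp add: algebra_simps)
      then show "transpose (plane_rot a b z) ** plane_rot a b (c * z powi k) = plane_rot a b (c * z powi (2 * m))"
        by (simp only: transpose_plane_rot[OF ab] plane_rot_mult[OF ab])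
    qed
    finally show ?thesis using nc by simp
  qed
qed

lemma not_circle_null_plane_rot:
  fixes a b :: "'n::finite"
  assumes "a \<noteq> b" "CARD('n) \<ge> 3"
  shows "\<not> circle_null (plane_rot a b :: complex \<Rightarrow> real^'n^'n)"
  using plane_rot_not_disc_boundary[OF assms] unfolding circle_null_def by blast

text \<open>Path connectedness is extracted from the reduction of circle maps, applied to a constant
  map: its homotopy, evaluated at the point 1, joins \<open>A\<close> to a rotation in a plane,
  which is unwound through its angle.\<close>

lemma rotation_path_from_one:
  fixes A :: "real^'n^'n"
  assumes n: "CARD('n) \<ge> 3" and A: "rotation_matrix A"
  obtains C where "continuous_on {0..1::real} C" "\<And>t. t \<in> {0..1} \<Longrightarrow> rotation_matrix (C t)"
    "C 0 = mat 1" "C 1 = A"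
proof -
  obtain a b :: 'n where ab: "a \<noteq> b"
    using n by (metis (full_types) One_nat_def card_1_singleton_iff UNIV_eq_I insertI1 singletonD
        numeral_le_one_iff semiring_norm(70))
  have FS: "(\<lambda>_::complex. A) ` sphere 0 1 \<subseteq> rot_fix {}" using A by (auto simp: rot_fix_empty)
  have "card (- (- {a, b})) \<ge> 2" using ab by simp
  from circle_map_rot_fix_reduce_iter[OF continuous_on_const FS this] obtain F' where
    F': "homotopic_with_canon (\<lambda>_. True) (sphere (0::complex) 1) {A. rotation_matrix A} (\<lambda>_. A) F'"
    "F' ` sphere 0 1 \<subseteq> rot_fix (- {a, b})" by blast
  obtain h :: "real \<times> complex \<Rightarrow> real^'n^'n" where h: "continuous_on ({0..1::real} \<times> sphere 0 1) h"
    "h ` ({0..1} \<times> sphere 0 1) \<subseteq> {A. rotation_matrix A}"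
    "\<And>x. x \<in> sphere 0 1 \<Longrightarrow> h (0, x) = A" "\<And>x. x \<in> sphere 0 1 \<Longrightarrow> h (1, x) = F' x"
    using F'(1) unfolding homotopic_with_canon_True_iff by auto
  have "F' 1 \<in> rot_fix (- {a, b})" using F'(2) by auto
  then obtain z where z: "F' 1 = plane_rot a b z" "norm z = 1" using rot_fix_plane ab by metis
  define \<alpha> where "\<alpha> = Arg2pi z"
  have za: "z = cis \<alpha>" using z(2) complex_norm_eq_1_exp[of z] by (simp add: \<alpha>_def cis_conv_exp mult.commute)
  \<comment> \<open>\<open>h (1 - t, 1)\<close> runs from \<open>plane_rot a b z\<close> to \<open>A\<close>.\<close>
  define C where "C = (\<lambda>t. h (1 - t, 1) ** plane_rot a b (cis ((t - 1) * \<alpha>)))"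
  show ?thesis
  proof
    show "continuous_on {0..1} C"
      unfolding C_def cis_conv_exp
      by (intro continuous_intros continuous_on_compose2[OF h(1)]) auto
    show "rotation_matrix (C t)" if "t \<in> {0..1}" for t
      unfolding C_def using that h(2) ab by (intro rotation_matrix_mult rotation_plane_rot) (auto simp: image_subset_iff)
    show "C 0 = mat 1" using h(4)[of 1] ab by (simp add: C_def z za plane_rot_mult cis_mult plane_rot_1)
    show "C 1 = A" using h(3)[of 1] ab by (simp add: C_def plane_rot_1)
  qed
qed

section \<open>Based loops of rotations and maps on the circle\<close>

definition rotation_loop :: "(real \<Rightarrow> real^'n^'n) \<Rightarrow> bool" where
  "rotation_loop \<gamma> \<longleftrightarrow> continuous_on {0..1} \<gamma> \<and> (\<forall>t\<in>{0..1}. rotation_matrix (\<gamma> t)) \<and> \<gamma> 0 = \<gamma> 1"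

text \<open>The homotopy relative to the endpoints that \<open>essential_loop\<close> negates, in
  matrix coordinates and written as a map on the square that starts from the constant loop.\<close>

definition null_loop :: "(real \<Rightarrow> real^'n^'n) \<Rightarrow> bool" where
  "null_loop \<gamma> \<longleftrightarrow> (\<exists>H :: real \<times> real \<Rightarrow> real^'n^'n.
     continuous_on ({0..1} \<times> {0..1}) H \<and> (\<forall>p\<in>{0..1} \<times> {0..1}. rotation_matrix (H p)) \<and>
     (\<forall>t\<in>{0..1}. H (0, t) = \<gamma> 0) \<and> (\<forall>t\<in>{0..1}. H (1, t) = \<gamma> t) \<and>
     (\<forall>s\<in>{0..1}. H (s, 0) = \<gamma> 0 \<and> H (s, 1) = \<gamma> 0))"

abbreviation circle_loop :: "(real \<Rightarrow> real^'n^'n) \<Rightarrow> complex \<Rightarrow> real^'n^'n" where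
  "circle_loop \<gamma> \<equiv> \<gamma> \<circ> (\<lambda>z. Arg2pi z / (2 * pi))"

lemma circle_loop_exp:
  assumes "\<gamma> 0 = \<gamma> 1" "t \<in> {0..1}"
  shows "circle_loop \<gamma> (cis (2 * pi * t)) = \<gamma> t"
proof (cases "t = 1")
  case False
  have "Arg2pi (cis (2 * pi * t)) = 2 * pi * t"
  proof (rule Arg2pi_unique[of 1])
    show "2 * pi * t < 2 * pi" using assms False by (simp add: less_le)
  qed (use assms in \<open>auto simp: cis_conv_exp\<close>)
  then show ?thesis by simp
next
  case True
  have "Arg2pi (1::complex) = 0" using Arg2pi_of_real[of 1] by simp
  then show ?thesis using True assms by simp
qed

lemma circle_null_loop_homotopy:
  fixes h :: "real \<times> real \<Rightarrow> real^'n^'n"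
  assumes "continuous_on ({0..1} \<times> {0..1}) h" "\<And>p. p \<in> {0..1} \<times> {0..1} \<Longrightarrow> rotation_matrix (h p)"
    and "\<And>s. s \<in> {0..1} \<Longrightarrow> h (s, 0) = h (s, 1)"
  shows "circle_null (circle_loop (\<lambda>t. h (0, t))) \<longleftrightarrow> circle_null (circle_loop (\<lambda>t. h (1, t)))"
proof -
  have "homotopic_loops {A. rotation_matrix A} (\<lambda>t. h (0, t)) (\<lambda>t. h (1, t))"
    unfolding homotopic_loops
    by (intro exI[of _ h]) (use assms in \<open>auto simp: pathfinish_def pathstart_def\<close>)
  from circle_null_homotopic_cong[OF homotopic_loops_imp_homotopic_circlemaps[OF this]]
  show ?thesis .
qed

text \<open>One direction forgets the base point. For the other, a disc map restricts to circles of
  radius \<open>s\<close> whose starting points move; dividing by the value at the starting point,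
  as a group allows, turns this free contraction into a based one.\<close>

lemma null_loop_iff_circle_null:
  fixes \<gamma> :: "real \<Rightarrow> real^'n^'n"
  assumes "rotation_loop \<gamma>"
  shows "null_loop \<gamma> \<longleftrightarrow> circle_null (circle_loop \<gamma>)"
proof
  assume "null_loop \<gamma>"
  then obtain H :: "real \<times> real \<Rightarrow> real^'n^'n" where H: "continuous_on ({0..1} \<times> {0..1}) H" "\<forall>p\<in>{0..1} \<times> {0..1}. rotation_matrix (H p)"
     "\<forall>t\<in>{0..1}. H (0, t) = \<gamma> 0" "\<forall>t\<in>{0..1}. H (1, t) = \<gamma> t"
     "\<forall>s\<in>{0..1}. H (s, 0) = \<gamma> 0 \<and> H (s, 1) = \<gamma> 0"
    unfolding null_loop_def by blast
  have "circle_null (circle_loop (\<lambda>t. H (0, t))) \<longleftrightarrow> circle_null (circle_loop (\<lambda>t. H (1, t)))"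
    by (rule circle_null_loop_homotopy) (use H in auto)
  moreover have "Arg2pi z / (2 * pi) \<in> {0..1}" for z
    using Arg2pi_ge_0[of z] Arg2pi_lt_2pi[of z] by (simp add: divide_le_eq)
  then have "circle_loop (\<lambda>t. H (0, t)) z = \<gamma> 0" "circle_loop (\<lambda>t. H (1, t)) z = circle_loop \<gamma> z" for z
    using H(3,4) by simp_all
  moreover have "circle_null (\<lambda>_. \<gamma> 0)"
    using assms by (intro circle_null_const) (auto simp: rotation_loop_def)
  ultimately show "circle_null (circle_loop \<gamma>)"
    using circle_null_cong[of "circle_loop (\<lambda>t. H (0, t))" "\<lambda>_. \<gamma> 0"]
      circle_null_cong[of "circle_loop (\<lambda>t. H (1, t))" "circle_loop \<gamma>"] by blast
next
  assume "circle_null (circle_loop \<gamma>)"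
  then obtain G where G: "continuous_on (cball 0 1) G" "\<forall>z\<in>cball 0 1. rotation_matrix (G z)"
     "\<forall>z\<in>sphere 0 1. G z = circle_loop \<gamma> z"
    unfolding circle_null_def by blast
  have \<gamma>: "\<gamma> 0 = \<gamma> 1" using assms by (simp add: rotation_loop_def)
  have Gg: "G (cis (2 * pi * t)) = \<gamma> t" if "t \<in> {0..1}" for t
    using G(3) circle_loop_exp[OF \<gamma> that] by simp
  \<comment> \<open>The transposed factor pins the starting point of each circle to the identity,
    and \<open>\<gamma> 0\<close> translates it back to the base point of the loop.\<close>
  define H where "H = (\<lambda>p. \<gamma> 0 ** (transpose (G (of_real (fst p))) ** G (of_real (fst p) * cis (2 * pi * snd p))))"
  have mem: "of_real s \<in> cball (0::complex) 1" "of_real s * cis (2 * pi * t) \<in> cball (0::complex) 1" if "s \<in> {0..1}" for s t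
    using that by (auto simp: norm_mult)
  have r0: "rotation_matrix (\<gamma> 0)" using assms by (auto simp: rotation_loop_def)
  have rH: "transpose (G (of_real s)) ** G (of_real s) = mat 1" if "s \<in> {0..1}" for s
    using G(2) mem(1)[OF that] by (simp add: rotation_transpose_mult)
  show "null_loop \<gamma>"
    unfolding null_loop_def
  proof (intro exI[of _ H] conjI ballI)
    show "continuous_on ({0..1} \<times> {0..1}) H"
      unfolding H_def cis_conv_exp
      by (intro continuous_intros continuous_on_compose2[OF G(1)])
        (use mem in \<open>auto simp: cis_conv_exp norm_mult\<close>)
    show "rotation_matrix (H p)" if "p \<in> {0..1} \<times> {0..1}" for p
      unfolding H_def using that G(2) mem r0 by (auto intro!: rotation_matrix_mult)
    show "H (0, t) = \<gamma> 0" if "t \<in> {0..1}" for t using rH[of 0] by (simp add: H_def)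
    show "H (s, 0) = \<gamma> 0" "H (s, 1) = \<gamma> 0" if "s \<in> {0..1}" for s
      using rH[OF that] by (simp_all add: H_def cis_multiple_2pi[of 1, simplified])
    show "H (1, t) = \<gamma> t" if "t \<in> {0..1}" for t
    proof -
      have "G 1 = \<gamma> 0" using Gg[of 0] by simp
      then show ?thesis using Gg[OF that] rotation_transpose_mult(2)[OF r0] by (simp add: H_def matrix_mul_assoc)
    qed
  qed
qed

lemma rotation_loop_mult: "rotation_loop \<gamma> \<Longrightarrow> rotation_loop \<delta> \<Longrightarrow> rotation_loop (\<lambda>t. \<gamma> t ** \<delta> t)"
  by (auto simp: rotation_loop_def intro!: continuous_intros rotation_matrix_mult)

lemma rotation_loop_transpose: "rotation_loop \<gamma> \<Longrightarrow> rotation_loop (\<lambda>t. transpose (\<gamma> t))"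
  by (auto simp: rotation_loop_def intro!: continuous_intros)

lemma null_loop_transpose: "rotation_loop \<gamma> \<Longrightarrow> null_loop \<gamma> \<Longrightarrow> null_loop (\<lambda>t. transpose (\<gamma> t))"
  using circle_null_transpose by (fastforce simp: null_loop_iff_circle_null rotation_loop_transpose o_def)

text \<open>Nullity is detected on the circle, so free homotopies suffice. This is how loops in
  different fibres are compared.\<close>

lemma null_loop_homotopy:
  fixes h :: "real \<times> real \<Rightarrow> real^'n^'n"
  assumes "continuous_on ({0..1} \<times> {0..1}) h" "\<And>p. p \<in> {0..1} \<times> {0..1} \<Longrightarrow> rotation_matrix (h p)"
    and "\<And>s. s \<in> {0..1} \<Longrightarrow> h (s, 0) = h (s, 1)"
  shows "null_loop (\<lambda>t. h (0, t)) \<longleftrightarrow> null_loop (\<lambda>t. h (1, t))"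
proof -
  have "rotation_loop (\<lambda>t. h (s, t))" if "s \<in> {0..1}" for s
    unfolding rotation_loop_def using that assms
    by (auto intro!: continuous_on_compose2[OF assms(1)] continuous_intros)
  then show ?thesis
    using circle_null_loop_homotopy[OF assms] by (simp add: null_loop_iff_circle_null)
qed

text \<open>The loop is a full turn in a coordinate plane. Its last two properties say that the
  fundamental group has order two: the loop is essential, and every essential loop is homotopic to
  it.\<close>

lemma exists_essential_rotation_loop:
  assumes n: "CARD('n) \<ge> 3"
  obtains \<beta> :: "real \<Rightarrow> real^'n^'n" where "rotation_loop \<beta>" "\<beta> 0 = mat 1" "\<not> null_loop \<beta>"
    "\<And>\<gamma>. rotation_loop \<gamma> \<Longrightarrow> \<not> null_loop \<gamma> \<Longrightarrow> null_loop (\<lambda>t. transpose (\<beta> t) ** \<gamma> t)"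
proof -
  have "\<exists>a b :: 'n. a \<noteq> b"
  proof (rule ccontr)
    assume "\<nexists>a b :: 'n. a \<noteq> b"
    then have "UNIV = {undefined :: 'n}" by auto
    then have "CARD('n) = 1" by (metis is_singletonI is_singleton_altdef)
    with n show False by simp
  qed
  then obtain a b :: 'n where ab: "a \<noteq> b" by blast
  define \<beta> where "\<beta> = (\<lambda>t::real. plane_rot a b (cis (2 * pi * t)))"
  have l: "rotation_loop \<beta>"
    unfolding rotation_loop_def
  proof (intro conjI ballI)
    show "continuous_on {0..1} \<beta>" unfolding \<beta>_def cis_conv_exp by (intro continuous_intros)
    show "rotation_matrix (\<beta> t)" for t unfolding \<beta>_def using ab by (intro rotation_plane_rot) auto
    show "\<beta> 0 = \<beta> 1" by (simp add: \<beta>_def cis_multiple_2pi[of 1, simplified])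
  qed
  have cl: "circle_loop \<beta> z = plane_rot a b z" if "norm z = 1" for z
    using complex_norm_eq_1_exp[of z] that by (simp add: \<beta>_def cis_conv_exp mult.commute)
  show ?thesis
  proof
    show "rotation_loop \<beta>" by (rule l)
    show "\<beta> 0 = mat 1" using ab by (simp add: \<beta>_def plane_rot_1)
    show "\<not> null_loop \<beta>"
      using not_circle_null_plane_rot[OF ab n] circle_null_cong[of "circle_loop \<beta>" "plane_rot a b", OF cl]
        null_loop_iff_circle_null[OF l] by blast
    fix \<gamma> :: "real \<Rightarrow> real^'n^'n"
    assume g: "rotation_loop \<gamma>" "\<not> null_loop \<gamma>"
    have "path \<gamma>" "path_image \<gamma> \<subseteq> {A. rotation_matrix A}" "pathfinish \<gamma> = pathstart \<gamma>"
      using g(1) by (auto simp: rotation_loop_def path_def path_image_def pathfinish_def pathstart_def)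
    then have "homotopic_loops {A. rotation_matrix A} \<gamma> \<gamma>" by (simp add: homotopic_loops_refl)
    from homotopic_with_imp_continuous[OF homotopic_loops_imp_homotopic_circlemaps[OF this]]
    have "continuous_on (sphere 0 1) (circle_loop \<gamma>)" by blast
    moreover have "Arg2pi z / (2 * pi) \<in> {0..1}" for z
      using Arg2pi_ge_0[of z] Arg2pi_lt_2pi[of z] by (simp add: divide_le_eq)
    then have "rotation_matrix (circle_loop \<gamma> z)" for z using g(1) by (simp add: rotation_loop_def)
    ultimately have "circle_null (circle_loop \<gamma>) \<or> circle_null (\<lambda>z. transpose (plane_rot a b z) ** circle_loop \<gamma> z)"
      by (intro circle_map_rotation_classification[OF ab n])
    then have "circle_null (\<lambda>z. transpose (plane_rot a b z) ** circle_loop \<gamma> z)"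
      using g null_loop_iff_circle_null by blast
    moreover have "circle_null (\<lambda>z. transpose (plane_rot a b z) ** circle_loop \<gamma> z) \<longleftrightarrow>
        circle_null (circle_loop (\<lambda>t. transpose (\<beta> t) ** \<gamma> t))"
      by (rule circle_null_cong) (use cl in \<open>simp add: o_def\<close>)
    moreover have "rotation_loop (\<lambda>t. transpose (\<beta> t) ** \<gamma> t)"
      by (intro rotation_loop_mult rotation_loop_transpose l g)
    ultimately show "null_loop (\<lambda>t. transpose (\<beta> t) ** \<gamma> t)"
      using null_loop_iff_circle_null by blast
  qed
qed

abbreviation unit_interval :: "real topology" where
  "unit_interval \<equiv> top_of_set {0..1}"

section \<open>Homotopy lifting\<close>

text \<open>Local triviality without a model fibre: \<open>T (x, c)\<close> moves the point
  \<open>x\<close> into the fibre over the nearby point \<open>c\<close> and leaves it in place when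
  it already lies there.\<close>

locale transport_fibration =
  fixes P :: "'p topology" and B :: "'b topology" and p :: "'p \<Rightarrow> 'b"
  assumes continuous_p: "continuous_map P B p"
    and local_transport: "\<And>b. b \<in> topspace B \<Longrightarrow> \<exists>U T. openin B U \<and> b \<in> U \<and>
      continuous_map (prod_topology (subtopology P {x \<in> topspace P. p x \<in> U}) (subtopology B U)) P T \<and>
      (\<forall>x \<in> topspace P. p x \<in> U \<longrightarrow> T (x, p x) = x \<and> (\<forall>c \<in> U. p (T (x, c)) = c))"
begin

definition lift_over :: "'z topology \<Rightarrow> ('z \<Rightarrow> 'b) \<Rightarrow> ('z \<Rightarrow> 'p) \<Rightarrow> bool" where
  "lift_over Z h s \<longleftrightarrow> continuous_map Z P s \<and> (\<forall>z\<in>topspace Z. p (s z) = h z)"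

text \<open>Transport along the vertical segments between two height functions. Points over which the
  homotopy is constant keep their lift, which gives the relative lifting property.\<close>

definition transportable :: "'z topology \<Rightarrow> ('z \<times> real \<Rightarrow> 'b) \<Rightarrow> ('z \<Rightarrow> real) \<Rightarrow> ('z \<Rightarrow> real) \<Rightarrow> bool" where
  "transportable Z H \<tau> \<tau>' \<longleftrightarrow> (\<forall>s. lift_over Z (\<lambda>z. H (z, \<tau> z)) s \<longrightarrow>
     (\<exists>s'. lift_over Z (\<lambda>z. H (z, \<tau>' z)) s' \<and>
       (\<forall>z\<in>topspace Z. (\<forall>t\<in>{0..1}. H (z, t) = H (z, 0)) \<longrightarrow> s' z = s z)))"

lemma transportable_refl: "transportable Z H \<tau> \<tau>"
  unfolding transportable_def by blast

lemma transportable_trans: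
  assumes "transportable Z H \<tau> \<tau>'" "transportable Z H \<tau>' \<tau>''"
  shows "transportable Z H \<tau> \<tau>''"
  unfolding transportable_def
proof (intro allI impI)
  fix s assume "lift_over Z (\<lambda>z. H (z, \<tau> z)) s"
  with assms(1) obtain s' where s': "lift_over Z (\<lambda>z. H (z, \<tau>' z)) s'"
    "\<forall>z\<in>topspace Z. (\<forall>t\<in>{0..1}. H (z, t) = H (z, 0)) \<longrightarrow> s' z = s z"
    unfolding transportable_def by blast
  with assms(2) obtain s'' where s'': "lift_over Z (\<lambda>z. H (z, \<tau>'' z)) s''"
    "\<forall>z\<in>topspace Z. (\<forall>t\<in>{0..1}. H (z, t) = H (z, 0)) \<longrightarrow> s'' z = s' z"
    unfolding transportable_def by blast
  show "\<exists>s'. lift_over Z (\<lambda>z. H (z, \<tau>'' z)) s' \<and>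
      (\<forall>z\<in>topspace Z. (\<forall>t\<in>{0..1}. H (z, t) = H (z, 0)) \<longrightarrow> s' z = s z)"
  proof (intro exI conjI ballI impI)
    fix z assume z: "z \<in> topspace Z" "\<forall>t\<in>{0..1}. H (z, t) = H (z, 0)"
    have "s'' z = s' z" using s''(2) z by blast
    also have "s' z = s z" using s'(2) z by blast
    finally show "s'' z = s z" .
  qed (rule s''(1))
qed

text \<open>Inside \<open>V\<close> the lift is moved by \<open>T\<close>, outside \<open>C\<close>
  it is left alone. On the overlap the two heights agree, so \<open>T\<close> acts as the identity
  and the two definitions paste over an open cover.\<close>

lemma transportable_step:
  fixes Z :: "'z topology"
  assumes H: "continuous_map (prod_topology Z unit_interval) B H"
    and \<tau>: "\<And>z. z \<in> topspace Z \<Longrightarrow> \<tau> z \<in> {0..1}"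
    and \<tau>': "continuous_map Z euclideanreal \<tau>'" "\<And>z. z \<in> topspace Z \<Longrightarrow> \<tau>' z \<in> {0..1}"
    and V: "openin Z V" and C: "closedin Z C" "C \<subseteq> V"
    and eq: "\<And>z. z \<in> topspace Z - C \<Longrightarrow> \<tau>' z = \<tau> z"
    and U: "openin B U"
    and T: "continuous_map (prod_topology (subtopology P {x \<in> topspace P. p x \<in> U}) (subtopology B U)) P T"
      "\<And>x. x \<in> topspace P \<Longrightarrow> p x \<in> U \<Longrightarrow> T (x, p x) = x"
      "\<And>x c. x \<in> topspace P \<Longrightarrow> p x \<in> U \<Longrightarrow> c \<in> U \<Longrightarrow> p (T (x, c)) = c"
    and HU: "\<And>z. z \<in> V \<Longrightarrow> H (z, \<tau> z) \<in> U" "\<And>z. z \<in> V \<Longrightarrow> H (z, \<tau>' z) \<in> U"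
  shows "transportable Z H \<tau> \<tau>'"
  unfolding transportable_def
proof (intro allI impI)
  fix s assume "lift_over Z (\<lambda>z. H (z, \<tau> z)) s"
  then have s: "continuous_map Z P s" "\<And>z. z \<in> topspace Z \<Longrightarrow> p (s z) = H (z, \<tau> z)"
    by (auto simp: lift_over_def)
  have Vsub: "V \<subseteq> topspace Z" using V by (rule openin_subset)
  have sP: "s z \<in> topspace P" if "z \<in> topspace Z" for z
    using s(1) that by (auto simp: continuous_map_def)
  define f where "f = (\<lambda>z. T (s z, H (z, \<tau>' z)))"
  define s' where "s' = (\<lambda>z. if z \<in> V then f z else s z)"
  have feq: "f z = s z" if "z \<in> V" "H (z, \<tau>' z) = H (z, \<tau> z)" for z
    using that T(2)[of "s z"] sP[of z] s(2)[of z] HU(1)[of z] Vsub by (auto simp: f_def)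
  have H\<tau>': "continuous_map Z B (\<lambda>z. H (z, \<tau>' z))"
  proof -
    have "continuous_map Z (prod_topology Z unit_interval) (\<lambda>z. (z, \<tau>' z))"
      using \<tau>' by (auto simp: continuous_map_pairwise o_def continuous_map_in_subtopology)
    from continuous_map_compose[OF this H] show ?thesis by (simp add: o_def)
  qed
  have "continuous_map Z P s'"
  proof (rule pasting_lemma[where I = "{True, False}" and T = "\<lambda>b. if b then V else topspace Z - C" and f = "\<lambda>b. if b then f else s"])
    show "continuous_map (subtopology Z (if b then V else topspace Z - C)) P (if b then f else s)" for b
    proof (cases b)
      case True
      have "continuous_map (subtopology Z V) (prod_topology (subtopology P {x \<in> topspace P. p x \<in> U}) (subtopology B U)) (\<lambda>z. (s z, H (z, \<tau>' z)))"
        using s HU Vsub H\<tau>' sP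
        by (auto simp: continuous_map_pairwise o_def continuous_map_in_subtopology continuous_map_from_subtopology)
      from continuous_map_compose[OF this T(1)] True show ?thesis by (simp add: o_def f_def)
    next
      case False
      then show ?thesis using s(1) by (simp add: continuous_map_from_subtopology)
    qed
    fix b c z assume "z \<in> topspace Z \<inter> (if b then V else topspace Z - C) \<inter> (if c then V else topspace Z - C)"
    then show "(if b then f else s) z = (if c then f else s) z"
      using feq[of z] eq[of z] by (auto split: if_splits)
  next
    fix z assume "z \<in> topspace Z"
    then show "\<exists>b. b \<in> {True, False} \<and> z \<in> (if b then V else topspace Z - C) \<and> s' z = (if b then f else s) z"
      using C by (cases "z \<in> V") (auto simp: s'_def)
  qed (use V C in auto)
  moreover have "p (s' z) = H (z, \<tau>' z)" if z: "z \<in> topspace Z" for z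
  proof (cases "z \<in> V")
    case True
    then show ?thesis using T(3)[OF sP[OF z], of "H (z, \<tau>' z)"] HU[OF True] s(2)[OF z] by (simp add: s'_def f_def)
  next
    case False
    moreover from this have "\<tau>' z = \<tau> z" using C z by (intro eq) blast
    ultimately show ?thesis using s(2)[OF z] by (simp add: s'_def)
  qed
  moreover have "s' z = s z" if "z \<in> topspace Z" "\<forall>t\<in>{0..1}. H (z, t) = H (z, 0)" for z
  proof -
    have "H (z, \<tau>' z) = H (z, 0)" "H (z, \<tau> z) = H (z, 0)"
      using that(2) \<tau>[OF that(1)] \<tau>'(2)[OF that(1)] by blast+
    then show ?thesis using feq[of z] by (simp add: s'_def)
  qed
  ultimately show "\<exists>s'. lift_over Z (\<lambda>z. H (z, \<tau>' z)) s' \<and>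
      (\<forall>z\<in>topspace Z. (\<forall>t\<in>{0..1}. H (z, t) = H (z, 0)) \<longrightarrow> s' z = s z)"
    unfolding lift_over_def by blast
qed

text \<open>Near the time \<open>x\<close> each point of \<open>Z\<close> has a neighbourhood on
  which \<open>H\<close> stays in one of the sets \<open>U\<close> with a transport. Finitely many
  of them cover \<open>Z\<close>, and the height is raised from \<open>a\<close> to \<open>b\<close>
  over one after another, through functions that exist by complete regularity.\<close>

lemma transportable_local:
  fixes Z :: "'z topology"
  assumes Z: "compact_space Z" "Hausdorff_space Z"
    and H: "continuous_map (prod_topology Z unit_interval) B H" and x: "x \<in> {0..1}"
  shows "\<exists>d>0. \<forall>a b. 0 \<le> a \<and> b \<le> 1 \<and> a \<le> x \<and> x \<le> b \<and> b - a < d \<longrightarrow> transportable Z H (\<lambda>_. a) (\<lambda>_. b)"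
proof -
  have cr: "completely_regular_space Z"
    using Z compact_Hausdorff_or_regular_imp_normal_space normal_imp_completely_regular_space by blast
  define good where "good = (\<lambda>z U T V d f. openin B U \<and>
      continuous_map (prod_topology (subtopology P {x \<in> topspace P. p x \<in> U}) (subtopology B U)) P T \<and>
      (\<forall>x \<in> topspace P. p x \<in> U \<longrightarrow> T (x, p x) = x \<and> (\<forall>c \<in> U. p (T (x, c)) = c)) \<and>
      openin Z V \<and> d > (0::real) \<and> (\<forall>y\<in>V. \<forall>t\<in>{0..1}. \<bar>t - x\<bar> < d \<longrightarrow> H (y, t) \<in> U) \<and>
      continuous_map Z unit_interval f \<and> f z = (0::real) \<and> f ` (topspace Z - V) \<subseteq> {1})"
  have "\<exists>U T V d f. good z U T V d f" if z: "z \<in> topspace Z" for z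
  proof -
    have "H (z, x) \<in> topspace B" using H z x by (auto simp: continuous_map_def)
    then obtain U T where UT: "openin B U" "H (z, x) \<in> U"
      "continuous_map (prod_topology (subtopology P {x \<in> topspace P. p x \<in> U}) (subtopology B U)) P T"
      "\<forall>x \<in> topspace P. p x \<in> U \<longrightarrow> T (x, p x) = x \<and> (\<forall>c \<in> U. p (T (x, c)) = c)"
      using local_transport by meson
    have "openin (prod_topology Z unit_interval) {w \<in> topspace (prod_topology Z unit_interval). H w \<in> U}"
      using H UT(1) by (rule openin_continuous_map_preimage)
    moreover have "(z, x) \<in> {w \<in> topspace (prod_topology Z unit_interval). H w \<in> U}" using z x UT by simp
    ultimately obtain V W where VW: "openin Z V" "openin unit_interval W" "z \<in> V" "x \<in> W"
      "V \<times> W \<subseteq> {w \<in> topspace (prod_topology Z unit_interval). H w \<in> U}"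
      unfolding openin_prod_topology_alt by meson
    then obtain d where d: "d > 0" "\<forall>t\<in>{0..1}. dist t x < d \<longrightarrow> t \<in> W"
      unfolding openin_euclidean_subtopology_iff by blast
    have "closedin Z (topspace Z - V)" using VW(1) by blast
    then obtain f where f: "continuous_map Z unit_interval f" "f z = 0" "f ` (topspace Z - V) \<subseteq> {1}"
      using cr[unfolded completely_regular_space_def, rule_format, of "topspace Z - V" z] z VW(3) by auto
    have "\<forall>y\<in>V. \<forall>t\<in>{0..1}. \<bar>t - x\<bar> < d \<longrightarrow> H (y, t) \<in> U"
    proof (intro ballI impI)
      fix y t assume "y \<in> V" "t \<in> {0..1}" "\<bar>t - x\<bar> < d"
      then have "(y, t) \<in> V \<times> W" using d(2) by (simp add: dist_real_def)
      then show "H (y, t) \<in> U" using VW(5) by blast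
    qed
    then show ?thesis
      unfolding good_def
      by (intro exI[of _ U] exI[of _ T] exI[of _ V] exI[of _ d] exI[of _ f] conjI UT VW(1) d(1) f)
  qed
  then obtain U T V d f where g: "\<And>z. z \<in> topspace Z \<Longrightarrow> good z (U z) (T z) (V z) (d z) (f z)"
    by metis
  note g = g[unfolded good_def]
  have U: "openin B (U z)" and
    T: "continuous_map (prod_topology (subtopology P {x \<in> topspace P. p x \<in> U z}) (subtopology B (U z))) P (T z)"
      "\<forall>x \<in> topspace P. p x \<in> U z \<longrightarrow> T z (x, p x) = x \<and> (\<forall>c \<in> U z. p (T z (x, c)) = c)" and
    V: "openin Z (V z)" and d: "d z > 0" and
    HU: "\<forall>y\<in>V z. \<forall>t\<in>{0..1}. \<bar>t - x\<bar> < d z \<longrightarrow> H (y, t) \<in> U z" and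
    f: "continuous_map Z unit_interval (f z)" "f z z = 0" "f z ` (topspace Z - V z) \<subseteq> {1}"
    if "z \<in> topspace Z" for z
    using g[OF that] by blast+
  \<comment> \<open>The level 1/4 here and the level 1/2 below leave room for the bump functions:
    each equals 1 on \<open>N z\<close> and vanishes off a closed set contained in
    \<open>V z\<close>.\<close>
  define N where "N = (\<lambda>z. {y \<in> topspace Z. f z y < 1/4})"
  have fe: "continuous_map Z euclideanreal (f z)" if "z \<in> topspace Z" for z
    using f(1)[OF that] by (simp add: continuous_map_in_subtopology)
  have "openin Z (N z)" if "z \<in> topspace Z" for z
    using openin_continuous_map_preimage[OF fe[OF that], of "{..<1/4}"] by (simp add: N_def)
  moreover have "topspace Z \<subseteq> \<Union> (N ` topspace Z)"
    using f(2) by (auto simp: N_def)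
  ultimately obtain \<F> where \<F>: "finite \<F>" "\<F> \<subseteq> N ` topspace Z" "topspace Z \<subseteq> \<Union> \<F>"
    using Z(1) unfolding compact_space_alt by (metis (no_types, lifting) imageE)
  then obtain F where F: "finite F" "F \<subseteq> topspace Z" "topspace Z \<subseteq> (\<Union>z\<in>F. N z)"
    by (metis finite_subset_image)
  \<comment> \<open>The 1 is a default for empty \<open>F\<close>, where a minimum over the
    distances alone would be meaningless.\<close>
  define \<delta> where "\<delta> = Min (insert 1 (d ` F))"
  have \<delta>: "\<delta> > 0" "\<And>z. z \<in> F \<Longrightarrow> \<delta> \<le> d z"
    using F d by (auto simp: \<delta>_def)
  show ?thesis
  proof (intro exI[of _ \<delta>] conjI allI impI)
    fix a b assume ab: "0 \<le> a \<and> b \<le> 1 \<and> a \<le> x \<and> x \<le> b \<and> b - a < \<delta>"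
    define bump where "bump = (\<lambda>z y. max 0 (min 1 (2 - 4 * f z y)))"
    have range: "a + (b - a) * u \<in> {0..1} \<and> \<bar>a + (b - a) * u - x\<bar> < \<delta>" if "0 \<le> u" "u \<le> 1" for u
    proof -
      have "(b - a) * u \<ge> 0" "(b - a) * u \<le> b - a" using that ab by (auto intro: mult_left_le)
      then have "a + (b - a) * u \<ge> a" "a + (b - a) * u \<le> b" by linarith+
      then show ?thesis using ab by (auto simp: abs_if)
    qed
    have "\<exists>m. continuous_map Z euclideanreal m \<and> (\<forall>y\<in>topspace Z. 0 \<le> m y \<and> m y \<le> 1) \<and>
        (\<forall>z\<in>G. \<forall>y\<in>topspace Z. bump z y \<le> m y) \<and> transportable Z H (\<lambda>_. a) (\<lambda>y. a + (b - a) * m y)"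
      if "finite G" "G \<subseteq> F" for G
      using that
    proof (induction G rule: finite_induct)
      case empty
      show ?case by (intro exI[of _ "\<lambda>_. 0"]) (auto simp: transportable_refl)
    next
      case (insert z G)
      then obtain m where m: "continuous_map Z euclideanreal m" "\<And>y. y \<in> topspace Z \<Longrightarrow> 0 \<le> m y \<and> m y \<le> 1"
        "\<And>z y. z \<in> G \<Longrightarrow> y \<in> topspace Z \<Longrightarrow> bump z y \<le> m y" "transportable Z H (\<lambda>_. a) (\<lambda>y. a + (b - a) * m y)"
        by auto
      have z: "z \<in> topspace Z" using insert.prems F(2) by auto
      \<comment> \<open>The maximum changes the height only where the new bump is positive, hence
        inside \<open>V z\<close>. After all of \<open>F\<close> has been treated the height is
        \<open>b\<close> everywhere, because every point lies in some \<open>N z\<close>.\<close>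
      define m' where "m' = (\<lambda>y. max (bump z y) (m y))"
      have cm': "continuous_map Z euclideanreal m'"
        unfolding m'_def bump_def by (intro continuous_intros fe[OF z] m) auto
      have m'01: "0 \<le> m' y \<and> m' y \<le> 1" if "y \<in> topspace Z" for y
        using m(2)[OF that] by (auto simp: m'_def bump_def)
      have "transportable Z H (\<lambda>y. a + (b - a) * m y) (\<lambda>y. a + (b - a) * m' y)"
      proof (rule transportable_step[OF H _ _ _ V[OF z] _ _ _ U[OF z] T(1)[OF z], where C = "{y \<in> topspace Z. f z y \<le> 1/2}"])
        show "a + (b - a) * m y \<in> {0..1}" if "y \<in> topspace Z" for y using range m(2)[OF that] by blast
        show "a + (b - a) * m' y \<in> {0..1}" if "y \<in> topspace Z" for y using range m'01[OF that] by blast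
        show "continuous_map Z euclideanreal (\<lambda>y. a + (b - a) * m' y)" by (intro continuous_intros cm')
        show "closedin Z {y \<in> topspace Z. f z y \<le> 1/2}"
          using closedin_continuous_map_preimage[OF fe[OF z], of "{..1/2}"] by simp
        show "{y \<in> topspace Z. f z y \<le> 1/2} \<subseteq> V z"
          using f(3)[OF z] by (fastforce simp: image_subset_iff)
        show "a + (b - a) * m' y = a + (b - a) * m y" if "y \<in> topspace Z - {y \<in> topspace Z. f z y \<le> 1/2}" for y
        proof -
          have "bump z y = 0" "m y \<ge> 0" using that m(2)[of y] by (auto simp: bump_def)
          then show ?thesis by (simp add: m'_def max_def)
        qed
        have Vz: "y \<in> topspace Z" if "y \<in> V z" for y using V[OF z] openin_subset that by blast
        have "H (y, a + (b - a) * u) \<in> U z" if "y \<in> V z" "0 \<le> u" "u \<le> 1" for y u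
        proof -
          have "\<delta> \<le> d z" using \<delta>(2)[of z] insert.prems by simp
          then show ?thesis using HU[OF z] that range[of u] by fastforce
        qed
        then show "H (y, a + (b - a) * m y) \<in> U z" "H (y, a + (b - a) * m' y) \<in> U z" if "y \<in> V z" for y
          using m(2)[OF Vz[OF that]] m'01[OF Vz[OF that]] that by blast+
      qed (use T(2)[OF z] in auto)
      with m(4) have "transportable Z H (\<lambda>_. a) (\<lambda>y. a + (b - a) * m' y)" by (rule transportable_trans)
      moreover have "bump z' y \<le> m' y" if "z' \<in> insert z G" "y \<in> topspace Z" for z' y
        using that m(3)[of z' y] by (auto simp: m'_def)
      ultimately show ?case using cm' m'01 by blast
    qed
    from this[OF F(1) order_refl] obtain m where m: "\<And>y. y \<in> topspace Z \<Longrightarrow> 0 \<le> m y \<and> m y \<le> 1"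
        "\<And>z y. z \<in> F \<Longrightarrow> y \<in> topspace Z \<Longrightarrow> bump z y \<le> m y" "transportable Z H (\<lambda>_. a) (\<lambda>y. a + (b - a) * m y)"
      by blast
    have m1: "m y = 1" if y: "y \<in> topspace Z" for y
    proof -
      obtain z where "z \<in> F" "y \<in> N z" using F(3) y by blast
      then have "bump z y = 1" by (simp add: N_def bump_def)
      then show ?thesis using m(2)[OF \<open>z \<in> F\<close> y] m(1)[OF y] by simp
    qed
    have "lift_over Z (\<lambda>y. H (y, a + (b - a) * m y)) s = lift_over Z (\<lambda>y. H (y, b)) s" for s
      unfolding lift_over_def by (simp add: m1)
    then show "transportable Z H (\<lambda>_. a) (\<lambda>_. b)"
      using m(3) unfolding transportable_def by simp
  qed (rule \<delta>)
qed

text \<open>Short steps exist around each time, and transitivity of transport lets the Bolzano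
  principle assemble them over the whole interval. Points over which the homotopy rests are moved by
  no step.\<close>

lemma homotopy_lifting:
  fixes Z :: "'z topology"
  assumes Z: "compact_space Z" "Hausdorff_space Z"
    and H: "continuous_map (prod_topology Z unit_interval) B H" and s: "lift_over Z (\<lambda>z. H (z, 0)) s"
  obtains s' where "lift_over Z (\<lambda>z. H (z, 1)) s'"
    "\<And>z. z \<in> topspace Z \<Longrightarrow> (\<And>t. t \<in> {0..1} \<Longrightarrow> H (z, t) = H (z, 0)) \<Longrightarrow> s' z = s z"
proof -
  have "0 \<le> (0::real) \<longrightarrow> (1::real) \<le> 1 \<longrightarrow> transportable Z H (\<lambda>_. 0) (\<lambda>_. 1)"
  proof (rule Bolzano[where P = "\<lambda>a b. 0 \<le> a \<longrightarrow> b \<le> 1 \<longrightarrow> transportable Z H (\<lambda>_. a) (\<lambda>_. b)"])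
    fix x :: real assume "0 \<le> x" "x \<le> 1"
    then show "\<exists>d>0. \<forall>a b. a \<le> x \<and> x \<le> b \<and> b - a < d \<longrightarrow> 0 \<le> a \<longrightarrow> b \<le> 1 \<longrightarrow> transportable Z H (\<lambda>_. a) (\<lambda>_. b)"
      using transportable_local[OF Z H, of x] by auto
  qed (auto intro: transportable_trans)
  then have "transportable Z H (\<lambda>_. 0) (\<lambda>_. 1)" by simp
  with s obtain s' where s': "lift_over Z (\<lambda>z. H (z, 1)) s'"
    "\<forall>z\<in>topspace Z. (\<forall>t\<in>{0..1}. H (z, t) = H (z, 0)) \<longrightarrow> s' z = s z"
    unfolding transportable_def by blast
  show ?thesis
    by (rule that[OF s'(1)]) (use s'(2) in blast)
qed

end

section \<open>Extension of lifts over a cylinder on a CW-complex\<close>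

lemma topspace_disc: "topspace (disc n) = {x. (\<forall>i\<ge>n. x i = 0) \<and> (\<Sum>i<n. (x i)\<^sup>2) \<le> 1}"
  by (auto simp: disc_def topspace_Euclidean_space)

lemma continuous_map_into_disc:
  "continuous_map W (disc n) f \<longleftrightarrow> (\<forall>i. continuous_map W euclideanreal (\<lambda>w. f w i)) \<and> f ` topspace W \<subseteq> topspace (disc n)"
  unfolding disc_def Euclidean_space_def continuous_map_in_subtopology continuous_map_componentwise_UNIV
  by (auto simp: image_subset_iff Pi_iff)

lemma Hausdorff_disc: "Hausdorff_space (disc n)"
  unfolding disc_def Euclidean_space_def
  by (intro Hausdorff_space_subtopology) (simp add: Hausdorff_space_product_topology)

text \<open>Points of \<open>Euclidean_space n\<close> are sequences that vanish from index
  \<open>n\<close> on, so the disc is a closed subset of a product of intervals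
  \<open>[-1, 1]\<close> over all natural numbers, which is compact by Tychonoff.\<close>

lemma compact_disc: "compact_space (disc n)"
proof -
  let ?P = "product_topology (\<lambda>_. euclideanreal) (UNIV :: nat set)"
  let ?K = "PiE UNIV (\<lambda>_::nat. {-1..1::real})"
  have K: "compactin ?P ?K" by (simp add: compactin_PiE)
  have c: "continuous_map ?P euclideanreal (\<lambda>x. x i)" for i
    using continuous_map_product_projection[of i UNIV "\<lambda>_. euclideanreal"] by simp
  have "closedin ?P {x \<in> topspace ?P. (\<Sum>i<n. (x i)\<^sup>2) \<in> {..1}}"
    by (rule closedin_continuous_map_preimage[where Y = euclideanreal]) (auto intro!: continuous_intros c)
  moreover have "closedin ?P {x \<in> topspace ?P. x i \<in> {0}}" for i
    by (rule closedin_continuous_map_preimage[OF c]) auto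
  then have "closedin ?P (\<Inter>i\<in>{n..}. {x \<in> topspace ?P. x i \<in> {0}})"
    by (intro closedin_INT) auto
  ultimately have "closedin ?P ({x \<in> topspace ?P. (\<Sum>i<n. (x i)\<^sup>2) \<in> {..1}} \<inter>
      (\<Inter>i\<in>{n..}. {x \<in> topspace ?P. x i \<in> {0}}))"
    by (rule closedin_Int)
  also have "({x \<in> topspace ?P. (\<Sum>i<n. (x i)\<^sup>2) \<in> {..1}} \<inter>
      (\<Inter>i\<in>{n..}. {x \<in> topspace ?P. x i \<in> {0}})) = topspace (disc n)"
    by (auto simp: topspace_disc)
  finally have cl: "closedin ?P (topspace (disc n))" .
  have "topspace (disc n) \<subseteq> ?K"
  proof
    fix x assume x: "x \<in> topspace (disc n)"
    have "\<bar>x i\<bar> \<le> 1" for i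
    proof (cases "i < n")
      case True
      then have "(x i)\<^sup>2 \<le> (\<Sum>i<n. (x i)\<^sup>2)" by (intro member_le_sum) auto
      also have "\<dots> \<le> 1" using x by (simp add: topspace_disc)
      finally show ?thesis by (simp add: abs_square_le_1)
    qed (use x in \<open>simp add: topspace_disc\<close>)
    then show "x \<in> ?K" by (auto simp: abs_le_iff)
  qed
  then have "compactin ?P (topspace (disc n))"
    using closed_compactin[OF K _ cl] by blast
  moreover have "disc n = subtopology ?P (topspace (disc n))"
    unfolding disc_def Euclidean_space_def subtopology_subtopology by (simp add: topspace_Euclidean_space Int_commute)
  ultimately show ?thesis by (metis compact_space_subtopology)
qed

lemma compact_space_disc_prod: "compact_space (prod_topology (disc n) unit_interval)"
  by (simp add: compact_space_prod_topology compact_disc compact_space_subtopology)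

lemma Hausdorff_space_disc_prod: "Hausdorff_space (prod_topology (disc n) unit_interval)"
  by (simp add: Hausdorff_space_prod_topology Hausdorff_disc Hausdorff_space_subtopology)

context transport_fibration
begin

text \<open>A disc times the interval retracts to its bottom and sides by central projection from \<open>(0, 2)\<close>:
  the point \<open>(x, t)\<close> runs along \<open>(x / \<mu>, 2 - (2 - t) / \<mu>)\<close>.\<close>

lemma disc_lift_extension:
  fixes h :: "(nat \<Rightarrow> real) \<times> real \<Rightarrow> 'b"
  defines "A n \<equiv> {(x, t) \<in> topspace (disc n) \<times> {0..1}. t = 0 \<or> x \<in> disc_boundary n}"
  assumes h: "continuous_map (prod_topology (disc n) unit_interval) B h"
    and s: "lift_over (subtopology (prod_topology (disc n) unit_interval) (A n)) h s"
  obtains s' where "lift_over (prod_topology (disc n) unit_interval) h s'" "\<And>z. z \<in> A n \<Longrightarrow> s' z = s z"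
proof -
  let ?Z = "prod_topology (disc n) unit_interval"
  define nrm where "nrm = (\<lambda>x::nat \<Rightarrow> real. sqrt (\<Sum>i<n. (x i)\<^sup>2))"
  \<comment> \<open>The scale at which the ray leaves the cylinder. It meets the side at scale
    \<open>|x|\<close> and the bottom at scale \<open>1 - t / 2\<close>; as the scale decreases from
    1, the larger of the two is reached first.\<close>
  define m where "m = (\<lambda>z::(nat \<Rightarrow> real) \<times> real. max (nrm (fst z)) (1 - snd z / 2))"
  \<comment> \<open>Time 0 is the exit point and time 1 the given point, so the homotopy
    \<open>c\<close> starts in \<open>A n\<close>, where the lift is prescribed, and ends at the
    identity.\<close>
  define \<mu> where "\<mu> = (\<lambda>(z, s). (1 - s) * m z + s)"
  define c where "c = (\<lambda>w::((nat \<Rightarrow> real) \<times> real) \<times> real. ((\<lambda>i. fst (fst w) i / \<mu> w), 2 - (2 - snd (fst w)) / \<mu> w))"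
  have disc_iff: "x \<in> topspace (disc n) \<longleftrightarrow> (\<forall>i\<ge>n. x i = 0) \<and> nrm x \<le> 1" for x
    by (simp add: topspace_disc nrm_def)
  have bd_iff: "x \<in> disc_boundary n \<longleftrightarrow> x \<in> topspace (disc n) \<and> nrm x = 1" for x
    by (auto simp: disc_boundary_def nrm_def)
  have m: "m z \<ge> 1/2" "m z \<le> 1" "nrm (fst z) \<le> m z" "1 - snd z / 2 \<le> m z" if "z \<in> topspace ?Z" for z
  proof -
    show 1: "1 - snd z / 2 \<le> m z" "nrm (fst z) \<le> m z" by (simp_all add: m_def)
    show "m z \<le> 1" using that by (auto simp: m_def disc_iff)
    show "m z \<ge> 1/2" using that 1(1) by auto
  qed
  have \<mu>b: "m z \<le> \<mu> (z, s)" "\<mu> (z, s) \<le> 1" if "z \<in> topspace ?Z" "s \<in> {0..1}" for z s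
  proof -
    have "s * m z \<le> s * 1" "(1 - s) * m z \<le> (1 - s) * 1" using that m(2)[OF that(1)] by (intro mult_left_mono; simp)+
    then show "m z \<le> \<mu> (z, s)" "\<mu> (z, s) \<le> 1" by (simp_all add: \<mu>_def algebra_simps)
  qed
  have \<mu>0: "\<mu> (z, s) > 0" if "z \<in> topspace ?Z" "s \<in> {0..1}" for z s
    using \<mu>b[OF that] m(1)[OF that(1)] by linarith
  have nrm_div: "nrm (\<lambda>i. x i / u) = nrm x / u" if "u > 0" for x u
  proof -
    have "(\<Sum>i<n. (x i / u)\<^sup>2) = (\<Sum>i<n. (x i)\<^sup>2) / u\<^sup>2" by (simp add: power_divide sum_divide_distrib)
    then show ?thesis using that by (simp add: nrm_def real_sqrt_divide)
  qed
  have c_mem: "c (z, s) \<in> topspace ?Z" if "z \<in> topspace ?Z" "s \<in> {0..1}" for z s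
  proof -
    obtain x t where z: "z = (x, t)" by (cases z)
    have xt: "x \<in> topspace (disc n)" "0 \<le> t" "t \<le> 1" using that z by auto
    note b = \<mu>b[OF that] \<mu>0[OF that] m[OF that(1)]
    have "nrm x / \<mu> (z, s) \<le> 1" using b z by simp
    moreover have "(2 - t) / \<mu> (z, s) \<le> 2" using b z by (simp add: divide_le_eq)
    moreover have "1 \<le> (2 - t) / \<mu> (z, s)" using b xt by (simp add: le_divide_eq)
    ultimately show ?thesis
      using xt b(3) by (simp add: c_def z disc_iff nrm_div[unfolded z])
  qed
  have c1: "c (z, 1) = z" for z by (simp add: c_def \<mu>_def)
  \<comment> \<open>Points of \<open>A n\<close> rest during the homotopy, so relative lifting
    preserves the prescribed values.\<close>
  have cA: "c (z, s) = z" if "z \<in> A n" for z s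
  proof -
    have "m z = 1" using that by (auto simp: A_def m_def bd_iff disc_iff)
    then show ?thesis by (simp add: c_def \<mu>_def)
  qed
  have c0: "c (z, 0) \<in> A n" if "z \<in> topspace ?Z" for z
  proof -
    obtain x t where z: "z = (x, t)" by (cases z)
    note b = m[OF that]
    have mem: "c (z, 0) \<in> topspace ?Z" using c_mem[OF that] by simp
    have "m z = nrm x \<or> m z = 1 - t / 2" unfolding z m_def max_def by simp
    then consider "m z = nrm x" | "m z = 1 - t / 2" by blast
    then show ?thesis
    proof cases
      case 1
      then have "nrm x > 0" using b by linarith
      then have "nrm (fst (c (z, 0))) = 1"
        using 1 b z by (simp add: c_def \<mu>_def nrm_div)
      then show ?thesis using mem by (auto simp: A_def bd_iff)
    next
      case 2
      then have "snd (c (z, 0)) = 0" using b z by (simp add: c_def \<mu>_def field_simps)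
      then show ?thesis using mem by (auto simp: A_def)
    qed
  qed
  let ?ZI = "prod_topology ?Z unit_interval"
  have cx: "continuous_map ?ZI euclideanreal (\<lambda>w. fst (fst w) i)" for i
  proof -
    have "continuous_map (disc n) euclideanreal (\<lambda>x. x i)"
      using continuous_map_into_disc[of "disc n" n id] by simp
    from continuous_map_compose[OF continuous_map_compose[OF continuous_map_fst continuous_map_fst] this]
    show ?thesis by (simp add: o_def)
  qed
  have I: "continuous_map unit_interval euclideanreal (\<lambda>t. t)" by simp
  have ct: "continuous_map ?ZI euclideanreal (\<lambda>w. snd (fst w))"
    using continuous_map_compose[OF continuous_map_compose[OF continuous_map_fst continuous_map_snd] I] by (simp add: o_def)
  have cs: "continuous_map ?ZI euclideanreal (\<lambda>w. snd w)"
    using continuous_map_compose[OF continuous_map_snd I] by (simp add: o_def)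
  have c\<mu>: "continuous_map ?ZI euclideanreal \<mu>"
    unfolding \<mu>_def m_def nrm_def case_prod_beta'
    by (intro continuous_intros cx ct cs) auto
  have \<mu>ne: "\<mu> w \<noteq> 0" if "w \<in> topspace ?ZI" for w using \<mu>0[of "fst w" "snd w"] that by auto
  have cc: "continuous_map ?ZI ?Z c"
  proof (rule continuous_map_pairedI[of _ _ "\<lambda>w. fst (c w)" _ "\<lambda>w. snd (c w)", simplified])
    show "continuous_map ?ZI (disc n) (\<lambda>w. fst (c w))"
      unfolding continuous_map_into_disc
    proof (intro conjI allI)
      show "continuous_map ?ZI euclideanreal (\<lambda>w. fst (c w) i)" for i
        unfolding c_def fst_conv by (intro continuous_intros cx c\<mu>) (use \<mu>ne in auto)
      show "(\<lambda>w. fst (c w)) ` topspace ?ZI \<subseteq> topspace (disc n)" using c_mem by fastforce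
    qed
    show "continuous_map ?ZI unit_interval (\<lambda>w. snd (c w))"
      unfolding continuous_map_in_subtopology
    proof
      show "continuous_map ?ZI euclideanreal (\<lambda>w. snd (c w))"
        unfolding c_def snd_conv by (intro continuous_intros ct c\<mu>) (use \<mu>ne in auto)
      show "(\<lambda>w. snd (c w)) \<in> topspace ?ZI \<rightarrow> {0..1}" using c_mem by fastforce
    qed
  qed
  have H: "continuous_map ?ZI B (\<lambda>w. h (c w))"
    using continuous_map_compose[OF cc h] by (simp add: o_def)
  have s0: "lift_over ?Z (\<lambda>z. h (c (z, 0))) (\<lambda>z. s (c (z, 0)))"
    unfolding lift_over_def
  proof (intro conjI ballI)
    have "continuous_map ?Z ?ZI (\<lambda>z. (z, 0))" by (simp add: continuous_map_pairedI)
    from continuous_map_compose[OF this cc]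
    have "continuous_map ?Z (subtopology ?Z (A n)) (\<lambda>z. c (z, 0))"
      using c0 by (auto simp: continuous_map_in_subtopology o_def)
    from continuous_map_compose[OF this, of P s] s
    show "continuous_map ?Z P (\<lambda>z. s (c (z, 0)))" by (simp add: o_def lift_over_def)
    show "p (s (c (z, 0))) = h (c (z, 0))" if "z \<in> topspace ?Z" for z
      using s c0[OF that] c_mem[OF that, of 0] by (simp add: lift_over_def)
  qed
  obtain s' where s': "lift_over ?Z (\<lambda>z. h (c (z, 1))) s'"
    "\<And>z. z \<in> topspace ?Z \<Longrightarrow> (\<And>t. t \<in> {0..1} \<Longrightarrow> h (c (z, t)) = h (c (z, 0))) \<Longrightarrow> s' z = s (c (z, 0))"
    using homotopy_lifting[OF compact_space_disc_prod Hausdorff_space_disc_prod H s0] by blast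
  show ?thesis
  proof
    show "lift_over ?Z h s'" using s'(1) by (simp add: c1)
    show "s' z = s z" if "z \<in> A n" for z
    proof -
      have "z \<in> topspace ?Z" using that by (auto simp: A_def)
      from s'(2)[OF this] show ?thesis by (simp add: cA[OF that])
    qed
  qed
qed

end

section \<open>Continuity on the product of a cell complex with the interval\<close>

lemma continuous_map_fst_line:
  assumes "y \<in> topspace Y" "continuous_map (prod_topology Y unit_interval) W f"
  shows "continuous_map unit_interval W (\<lambda>t. f (y, t))"
proof -
  have "continuous_map unit_interval (prod_topology Y unit_interval) (\<lambda>t. (y, t))"
    using assms(1) by (simp add: continuous_map_pairedI)
  from continuous_map_compose[OF this assms(2)] show ?thesis by (simp add: o_def)
qed

text \<open>A product with a compact interval keeps the weak topology. Around \<open>t0\<close> a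
  compact interval \<open>J\<close> is fixed; the points \<open>x\<close> whose segment over
  \<open>J\<close> leaves \<open>V\<close> form a closed set, because within each piece
  \<open>K\<close> they are the image of a closed set under projection along the compact
  \<open>J\<close>.\<close>

lemma continuous_map_prod_weak_topology:
  fixes X :: "'a topology" and s :: "'a \<times> real \<Rightarrow> 'p"
  assumes weak: "\<And>A. A \<subseteq> topspace X \<Longrightarrow> (\<And>K. K \<in> \<K> \<Longrightarrow> closedin X (A \<inter> K)) \<Longrightarrow> closedin X A"
    and clo: "\<And>K. K \<in> \<K> \<Longrightarrow> closedin X K" and cov: "topspace X \<subseteq> \<Union>\<K>"
    and s: "\<And>K. K \<in> \<K> \<Longrightarrow> continuous_map (prod_topology (subtopology X K) unit_interval) P s"
  shows "continuous_map (prod_topology X unit_interval) P s"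
proof -
  let ?XI = "prod_topology X unit_interval"
  have sP: "s w \<in> topspace P" if w: "w \<in> topspace ?XI" for w
  proof -
    obtain K where K: "K \<in> \<K>" "fst w \<in> K" using cov w by auto
    have "w \<in> topspace (prod_topology (subtopology X K) unit_interval)" using w K(2) by auto
    then show ?thesis using s[OF K(1)] by (auto simp: continuous_map_def)
  qed
  have "openin ?XI {w \<in> topspace ?XI. s w \<in> V}" if V: "openin P V" for V
    unfolding openin_prod_topology_alt
  proof (intro allI impI)
    fix x0 t0 assume xt: "(x0, t0) \<in> {w \<in> topspace ?XI. s w \<in> V}"
    then have x0: "x0 \<in> topspace X" and t0: "t0 \<in> {0..1}" and sV: "s (x0, t0) \<in> V" by auto
    obtain K0 where K0: "K0 \<in> \<K>" "x0 \<in> K0" using cov x0 by auto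
    have "x0 \<in> topspace (subtopology X K0)" using K0 x0 by simp
    then have "continuous_map unit_interval P (\<lambda>t. s (x0, t))"
      by (rule continuous_map_fst_line[OF _ s[OF K0(1)]])
    then have "openin unit_interval {t \<in> topspace unit_interval. s (x0, t) \<in> V}"
      using V by (rule openin_continuous_map_preimage)
    moreover have "t0 \<in> {t \<in> topspace unit_interval. s (x0, t) \<in> V}" using t0 sV by simp
    ultimately obtain e where e0: "e > 0"
        "\<forall>t\<in>{0..1}. dist t t0 < e \<longrightarrow> t \<in> {t \<in> topspace unit_interval. s (x0, t) \<in> V}"
      unfolding openin_euclidean_subtopology_iff by blast
    have e: "e > 0" "\<And>t. t \<in> {0..1} \<Longrightarrow> dist t t0 < e \<Longrightarrow> s (x0, t) \<in> V"
      using e0 by auto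
    define J where "J = cball t0 (e/2) \<inter> {0..1}"
    have J: "compactin unit_interval J" unfolding J_def by (simp add: compactin_subtopology compact_Int)
    have JV: "s (x0, t) \<in> V" if "t \<in> J" for t
      using e that by (auto simp: J_def dist_commute)
    define A where "A = {x \<in> topspace X. \<exists>t\<in>J. s (x, t) \<notin> V}"
    have "closedin X A"
    proof (rule weak)
      fix K assume K: "K \<in> \<K>"
      let ?KJ = "prod_topology (subtopology X K) (subtopology unit_interval J)"
      have "continuous_map ?KJ P s"
        using continuous_map_from_subtopology[OF s[OF K], of "topspace (subtopology X K) \<times> J"]
        unfolding prod_topology_subtopology(2)[of _ unit_interval J] .
      then have "closedin ?KJ {w \<in> topspace ?KJ. s w \<in> topspace P - V}"
        using V by (intro closedin_continuous_map_preimage) auto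
      moreover have "closed_map ?KJ (subtopology X K) fst"
        using J by (intro closed_map_fst) (simp add: compact_space_subtopology)
      ultimately have "closedin (subtopology X K) (fst ` {w \<in> topspace ?KJ. s w \<in> topspace P - V})"
        unfolding closed_map_def by blast
      moreover have "fst ` {w \<in> topspace ?KJ. s w \<in> topspace P - V} = A \<inter> K"
      proof (intro equalityI subsetI)
        fix x assume x: "x \<in> A \<inter> K"
        then obtain t where t: "t \<in> J" "s (x, t) \<notin> V" by (auto simp: A_def)
        have "(x, t) \<in> {w \<in> topspace ?KJ. s w \<in> topspace P - V}"
          using x t sP[of "(x, t)"] by (auto simp: A_def J_def)
        then show "x \<in> fst ` {w \<in> topspace ?KJ. s w \<in> topspace P - V}" by force
      qed (auto simp: A_def)
      ultimately have "closedin (subtopology X K) (A \<inter> K)" by simp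
      then show "closedin X (A \<inter> K)" using clo[OF K] closedin_trans_full by blast
    qed (auto simp: A_def)
    show "\<exists>U W. openin X U \<and> openin unit_interval W \<and> x0 \<in> U \<and> t0 \<in> W \<and> U \<times> W \<subseteq> {w \<in> topspace ?XI. s w \<in> V}"
    proof (intro exI conjI)
      show "openin X (topspace X - A)" using \<open>closedin X A\<close> by blast
      show "openin unit_interval (ball t0 (e/2) \<inter> {0..1})" by (simp add: openin_open_Int Int_commute)
      show "x0 \<in> topspace X - A" using x0 JV by (auto simp: A_def)
      show "(topspace X - A) \<times> (ball t0 (e/2) \<inter> {0..1}) \<subseteq> {w \<in> topspace ?XI. s w \<in> V}"
        by (auto simp: A_def J_def)
    qed (use t0 e in auto)
  qed
  then show ?thesis using sP by (auto simp: continuous_map_def)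
qed

text \<open>The characteristic map times the interval maps a compact space onto a Hausdorff one and
  is therefore a quotient map, so continuity over a closed cell can be tested on the disc.\<close>

lemma continuous_map_disc_image:
  fixes X :: "'a topology" and s :: "'a \<times> real \<Rightarrow> 'p"
  assumes X: "Hausdorff_space X" and \<Psi>: "continuous_map (disc m) X \<Psi>"
    and s: "continuous_map (prod_topology (disc m) unit_interval) P (\<lambda>(z, t). s (\<Psi> z, t))"
  shows "continuous_map (prod_topology (subtopology X (\<Psi> ` topspace (disc m))) unit_interval) P s"
proof -
  let ?K = "subtopology X (\<Psi> ` topspace (disc m))"
  have sub: "\<Psi> ` topspace (disc m) \<subseteq> topspace X" using \<Psi> by (auto simp: continuous_map_def)
  let ?f = "\<lambda>(z, t::real). (\<Psi> z, t)"
  have c: "continuous_map (prod_topology (disc m) unit_interval) (prod_topology ?K unit_interval) ?f"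
    using \<Psi> by (auto simp: continuous_map_prod_top continuous_map_in_subtopology)
  moreover have "?f ` topspace (prod_topology (disc m) unit_interval) = topspace (prod_topology ?K unit_interval)"
    using sub by (force simp: image_iff)
  ultimately have "quotient_map (prod_topology (disc m) unit_interval) (prod_topology ?K unit_interval) ?f"
    using X by (intro T1_Spaces.continuous_imp_quotient_map compact_space_disc_prod)
      (simp_all add: Hausdorff_space_prod_topology Hausdorff_space_subtopology)
  moreover have "s \<circ> ?f = (\<lambda>(z, t). s (\<Psi> z, t))" by (auto simp: fun_eq_iff)
  ultimately show ?thesis using s by (metis continuous_compose_quotient_map)
qed

lemma disc_eq_interior_Un_boundary: "topspace (disc n) = disc_interior n \<union> disc_boundary n"
  by (auto simp: disc_interior_def disc_boundary_def topspace_disc)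

context transport_fibration
begin

text \<open>Induction over skeleta. Over an \<open>n\<close>-cell the lift is prescribed on the
  bottom of the cylinder by \<open>s0\<close> and on its side by the previous stage, and
  \<open>disc_lift_extension\<close> fills in the rest. The weak topology makes the union of all
  stages continuous.\<close>

theorem CW_lift_extension:
  fixes X :: "'a topology" and h :: "'a \<times> real \<Rightarrow> 'b"
  assumes HX: "Hausdorff_space X" and CW: "CW_structure X C"
    and h: "continuous_map (prod_topology X unit_interval) B h" and s0: "lift_over X (\<lambda>x. h (x, 0)) s0"
  obtains s where "lift_over (prod_topology X unit_interval) h s" "\<And>x. x \<in> topspace X \<Longrightarrow> s (x, 0) = s0 x"
proof -
  note D = CW[unfolded CW_structure_def]
  note cells = D[THEN conjunct1] and disjoint = D[THEN conjunct2, THEN conjunct1]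
    and covers = D[THEN conjunct2, THEN conjunct2, THEN conjunct1]
    and boundary = D[THEN conjunct2, THEN conjunct2, THEN conjunct2, THEN conjunct1]
    and weak_top = D[THEN conjunct2, THEN conjunct2, THEN conjunct2, THEN conjunct2]
  let ?Z = "\<lambda>n. prod_topology (disc n) unit_interval"
  have cont: "continuous_map (disc m) X \<Phi>" and inj: "inj_on \<Phi> (disc_interior m)" if "(m, \<Phi>) \<in> C" for m \<Phi>
  proof -
    have "continuous_map (disc m) X \<Phi> \<and> homeomorphic_map (subtopology (disc m) (disc_interior m))
          (subtopology X (\<Phi> ` disc_interior m)) \<Phi>"
      using bspec[OF cells that] by (simp only: prod.case)
    moreover have "disc_interior m \<subseteq> topspace (disc m)" by (auto simp: disc_interior_def)
    ultimately show "continuous_map (disc m) X \<Phi>" "inj_on \<Phi> (disc_interior m)"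
      by (auto simp: homeomorphic_eq_everything_map Int_absorb1)
  qed
  have disj: "m = k \<and> \<Phi> = \<Psi>" if "(m, \<Phi>) \<in> C" "(k, \<Psi>) \<in> C" "x \<in> \<Phi> ` disc_interior m" "x \<in> \<Psi> ` disc_interior k" for m k \<Phi> \<Psi> x
  proof (rule ccontr)
    assume "\<not> ?thesis"
    then have "(m, \<Phi>) \<noteq> (k, \<Psi>)" by simp
    moreover have "\<forall>(k, \<Psi>)\<in>C. (m, \<Phi>) \<noteq> (k, \<Psi>) \<longrightarrow> \<Phi> ` disc_interior m \<inter> \<Psi> ` disc_interior k = {}"
      using bspec[OF disjoint that(1)] by (simp only: prod.case)
    from bspec[OF this that(2)]
    have "(m, \<Phi>) \<noteq> (k, \<Psi>) \<longrightarrow> \<Phi> ` disc_interior m \<inter> \<Psi> ` disc_interior k = {}" by (simp only: prod.case)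
    ultimately have "\<Phi> ` disc_interior m \<inter> \<Psi> ` disc_interior k = {}" by (rule mp[rotated])
    then show False using that by blast
  qed
  have bdry: "\<exists>F. finite F \<and> F \<subseteq> {(k, \<Psi>) \<in> C. k < m} \<and> \<Phi> ` disc_boundary m \<subseteq> (\<Union>(k, \<Psi>) \<in> F. \<Psi> ` disc_interior k)"
    if "(m, \<Phi>) \<in> C" for m \<Phi>
    using bspec[OF boundary that] by (simp only: prod.case)
  have cover: "(\<Union>(m, \<Phi>) \<in> C. \<Phi> ` disc_interior m) = topspace X"
    by (rule covers)
  have weak: "closedin X A" if "A \<subseteq> topspace X"
    "\<And>m \<Phi>. (m, \<Phi>) \<in> C \<Longrightarrow> closedin X (A \<inter> (X closure_of (\<Phi> ` disc_interior m)))" for A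
  proof -
    have "\<forall>(m, \<Phi>)\<in>C. closedin X (A \<inter> (X closure_of (\<Phi> ` disc_interior m)))"
      using that(2) by (intro ballI) (simp only: split_paired_all prod.case)
    with weak_top[rule_format, OF that(1)] show ?thesis by (rule iffD2)
  qed
  \<comment> \<open>The \<open>(n - 1)\<close>-skeleton, written as the union of the open cells of
    dimension below \<open>n\<close>.\<close>
  define low where "low = (\<lambda>n. \<Union>(m, \<Phi>) \<in> {(m, \<Phi>) \<in> C. m < n}. \<Phi> ` disc_interior m)"
  have low_iff: "x \<in> low n \<longleftrightarrow> (\<exists>m \<Phi>. (m, \<Phi>) \<in> C \<and> m < n \<and> x \<in> \<Phi> ` disc_interior m)" for x n
    unfolding low_def by blast
  have low_mono: "low m \<subseteq> low n" if "m \<le> n" for m n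
    using that unfolding subset_iff low_iff by (meson less_le_trans)
  have bd_low: "\<Phi> ` disc_boundary m \<subseteq> low m" if m: "(m, \<Phi>) \<in> C" for m \<Phi>
  proof -
    obtain F where F: "F \<subseteq> {(k, \<Psi>) \<in> C. k < m}" "\<Phi> ` disc_boundary m \<subseteq> (\<Union>(k, \<Psi>) \<in> F. \<Psi> ` disc_interior k)"
      using bdry[OF m] by blast
    have "(\<Union>(k, \<Psi>) \<in> F. \<Psi> ` disc_interior k) \<subseteq> low m" unfolding low_def by (rule UN_mono[OF F(1)]) simp
    with F(2) show ?thesis by (rule subset_trans)
  qed
  have im_low: "\<Phi> ` topspace (disc m) \<subseteq> low (Suc m)" if "(m, \<Phi>) \<in> C" for m \<Phi>
  proof -
    have "\<Phi> ` disc_interior m \<subseteq> low (Suc m)" unfolding subset_iff low_iff using that by (meson lessI)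
    then show ?thesis
      using bd_low[OF that] low_mono[of m "Suc m"] by (auto simp: disc_eq_interior_Un_boundary)
  qed
  \<comment> \<open>A lift is controlled only through the characteristic maps of the cells treated
    so far; elsewhere the values of a stage are arbitrary.\<close>
  define ok where "ok = (\<lambda>s m \<Phi>. lift_over (?Z m) (\<lambda>(z, t). h (\<Phi> z, t)) (\<lambda>(z, t). s (\<Phi> z, t)) \<and>
      (\<forall>z\<in>topspace (disc m). s (\<Phi> z, 0) = s0 (\<Phi> z)))"
  have ok_cong: "ok s' m \<Phi>" if "ok s m \<Phi>" "\<And>z t. z \<in> topspace (disc m) \<Longrightarrow> s' (\<Phi> z, t) = s (\<Phi> z, t)" for s s' m \<Phi>
    using that(1) unfolding ok_def lift_over_def
    by (auto simp: that(2) elim!: continuous_map_eq)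
  define Q where "Q = (\<lambda>n s. \<forall>m \<Phi>. (m, \<Phi>) \<in> C \<longrightarrow> m < n \<longrightarrow> ok s m \<Phi>)"
  have hom: "continuous_map (?Z m) B (\<lambda>(z, t). h (\<Phi> z, t))" if "(m, \<Phi>) \<in> C" for m \<Phi>
  proof -
    have "continuous_map (?Z m) (prod_topology X unit_interval) (\<lambda>(z, t). (\<Phi> z, t))"
      using cont[OF that] by (simp add: continuous_map_prod_top)
    from continuous_map_compose[OF this h] show ?thesis by (simp add: o_def case_prod_beta')
  qed
  have step: "\<exists>s'. Q (Suc n) s' \<and> (\<forall>x\<in>low n. \<forall>t. s' (x, t) = s (x, t))" if Qs: "Q n s" for n s
  proof -
    let ?A = "{(x, t) \<in> topspace (disc n) \<times> {0..1}. t = 0 \<or> x \<in> disc_boundary n}"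
    have sb: "s (x, 0) = s0 x \<and> (\<forall>t\<in>{0..1}. p (s (x, t)) = h (x, t))" if "x \<in> low n" for x
    proof -
      obtain m \<Phi> z where m: "(m, \<Phi>) \<in> C" "m < n" "z \<in> disc_interior m" "x = \<Phi> z"
        using \<open>x \<in> low n\<close> unfolding low_iff by blast
      then have "z \<in> topspace (disc m)" by (simp add: disc_interior_def)
      then show ?thesis using Qs m unfolding Q_def ok_def lift_over_def by auto
    qed
    have "\<exists>\<tau>. lift_over (?Z n) (\<lambda>(z, t). h (\<Phi> z, t)) \<tau> \<and>
        (\<forall>z\<in>topspace (disc n). \<tau> (z, 0) = s0 (\<Phi> z)) \<and> (\<forall>z\<in>disc_boundary n. \<forall>t\<in>{0..1}. \<tau> (z, t) = s (\<Phi> z, t))"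
      if \<Phi>: "(n, \<Phi>) \<in> C" for \<Phi>
    proof -
      \<comment> \<open>The bottom needs a clause of its own: \<open>s\<close> is known only over
        the lower skeleton, while at time 0 the interior of the cell is governed by
        \<open>s0\<close>.\<close>
      define g where "g = (\<lambda>(z, t::real). if t = 0 then s0 (\<Phi> z) else s (\<Phi> z, t))"
      have gb: "g (z, t) = s (\<Phi> z, t)" if "z \<in> disc_boundary n" for z t
        using sb[of "\<Phi> z"] bd_low[OF \<Phi>] that by (auto simp: g_def)
      obtain F where F: "finite F" "F \<subseteq> {(k, \<Psi>) \<in> C. k < n}" "\<Phi> ` disc_boundary n \<subseteq> (\<Union>(k, \<Psi>) \<in> F. \<Psi> ` disc_interior k)"
        using bdry[OF \<Phi>] by blast
      \<comment> \<open>A finite closed cover of the bottom and the side. Continuity of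
        \<open>s\<close> is known on the image of each single closed cell, so the side is split by
        the lower cells that contain the image of the boundary, finitely many by
        closure-finiteness.\<close>
      define TT where "TT = (\<lambda>i. case i of None \<Rightarrow> topspace (disc n) \<times> {0::real}
         | Some (k, \<Psi>) \<Rightarrow> {z \<in> topspace (disc n). z \<in> disc_boundary n \<and> \<Phi> z \<in> \<Psi> ` topspace (disc k)} \<times> {0..1})"
      define ff where "ff = (\<lambda>i :: (nat \<times> ((nat \<Rightarrow> real) \<Rightarrow> 'a)) option. case i of None \<Rightarrow> (\<lambda>(z, t::real). s0 (\<Phi> z)) | Some _ \<Rightarrow> (\<lambda>(z, t). s (\<Phi> z, t)))"
      have "continuous_map (subtopology (?Z n) ?A) P g"
      proof (rule pasting_lemma_closed[where I = "insert None (Some ` F)" and T = "\<lambda>i. ?A \<inter> TT i" and f = ff])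
        show "finite (insert None (Some ` F))" using F by simp
        fix i assume i: "i \<in> insert None (Some ` F)"
        have "closedin (?Z n) (TT i)"
        proof (cases i)
          case None
          have "closedin unit_interval {0::real}" by (rule closed_subset) auto
          then show ?thesis unfolding TT_def None option.case by (simp add: closedin_prod_Times_iff)
        next
          case (Some c)
          obtain k \<Psi> where c: "c = (k, \<Psi>)" by (cases c)
          then have k: "(k, \<Psi>) \<in> C" using i Some F(2) by auto
          have "compactin X (\<Psi> ` topspace (disc k))"
            using image_compactin[OF _ cont[OF k]] compact_disc[of k] by (simp add: compact_space_def)
          then have "closedin X (\<Psi> ` topspace (disc k))" using HX by (simp add: compactin_imp_closedin)
          then have 1: "closedin (disc n) {z \<in> topspace (disc n). \<Phi> z \<in> \<Psi> ` topspace (disc k)}"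
            by (rule closedin_continuous_map_preimage[OF cont[OF \<Phi>]])
          have cz: "continuous_map (disc n) euclideanreal (\<lambda>z. z i)" for i
            using continuous_map_into_disc[of "disc n" n id] by simp
          have "continuous_map (disc n) euclideanreal (\<lambda>z. \<Sum>i<n. (z i)\<^sup>2)"
            by (intro continuous_intros cz) auto
          then have "closedin (disc n) {z \<in> topspace (disc n). (\<Sum>i<n. (z i)\<^sup>2) \<in> {1}}"
            by (rule closedin_continuous_map_preimage) simp
          with 1 have "closedin (disc n) ({z \<in> topspace (disc n). \<Phi> z \<in> \<Psi> ` topspace (disc k)} \<inter> {z \<in> topspace (disc n). (\<Sum>i<n. (z i)\<^sup>2) \<in> {1}})"
            by (rule closedin_Int)
          also have "\<dots> = {z \<in> topspace (disc n). z \<in> disc_boundary n \<and> \<Phi> z \<in> \<Psi> ` topspace (disc k)}"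
            by (auto simp: disc_boundary_def)
          finally show ?thesis unfolding TT_def Some c option.case prod.case
            using closedin_topspace[of unit_interval] by (simp add: closedin_prod_Times_iff)
        qed
        then show "closedin (subtopology (?Z n) ?A) (?A \<inter> TT i)"
          by (rule closedin_subtopology_Int_closed)
        show "continuous_map (subtopology (subtopology (?Z n) ?A) (?A \<inter> TT i)) P (ff i)"
        proof (cases i)
          case None
          have "continuous_map (?Z n) P (\<lambda>w. s0 (\<Phi> (fst w)))"
            using continuous_map_compose[OF continuous_map_compose[OF continuous_map_fst cont[OF \<Phi>]], of P s0] s0
            by (simp add: o_def lift_over_def)
          then show ?thesis by (simp add: ff_def None case_prod_beta' continuous_map_from_subtopology)
        next
          case (Some c)
          obtain k \<Psi> where c: "c = (k, \<Psi>)" by (cases c)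
          then have k: "(k, \<Psi>) \<in> C" "k < n" using i Some F(2) by auto
          then have "continuous_map (?Z k) P (\<lambda>(z, t). s (\<Psi> z, t))"
            using Qs unfolding Q_def ok_def lift_over_def by blast
          then have sc: "continuous_map (prod_topology (subtopology X (\<Psi> ` topspace (disc k))) unit_interval) P s"
            by (rule continuous_map_disc_image[OF HX cont[OF k(1)]])
          let ?D = "{z \<in> topspace (disc n). z \<in> disc_boundary n \<and> \<Phi> z \<in> \<Psi> ` topspace (disc k)}"
          have "continuous_map (subtopology (disc n) ?D) (subtopology X (\<Psi> ` topspace (disc k))) \<Phi>"
            using cont[OF \<Phi>] by (auto simp: continuous_map_in_subtopology continuous_map_from_subtopology)
          then have "continuous_map (prod_topology (subtopology (disc n) ?D) unit_interval)
              (prod_topology (subtopology X (\<Psi> ` topspace (disc k))) unit_interval) (\<lambda>(z, t). (\<Phi> z, t))"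
            by (simp add: continuous_map_prod_top)
          from continuous_map_compose[OF this sc]
          have "continuous_map (subtopology (?Z n) (TT i)) P (ff i)"
            by (simp add: prod_topology_subtopology(1)[of "disc n"] TT_def ff_def Some c o_def case_prod_beta')
          then show ?thesis
            unfolding subtopology_subtopology by (rule continuous_map_from_subtopology_mono) auto
        qed
      next
        fix i j w
        assume "i \<in> insert None (Some ` F)" "j \<in> insert None (Some ` F)"
          "w \<in> topspace (subtopology (?Z n) ?A) \<inter> (?A \<inter> TT i) \<inter> (?A \<inter> TT j)"
        moreover have "ff i w = g w" if "w \<in> TT i" for i
        proof (cases i)
          case None
          then show ?thesis using that by (auto simp: TT_def ff_def g_def)
        next
          case (Some c)
          then have "fst w \<in> disc_boundary n" using that by (auto simp: TT_def)
          then have "g (fst w, snd w) = s (\<Phi> (fst w), snd w)" by (rule gb)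
          then show ?thesis by (simp add: ff_def Some case_prod_beta')
        qed
        ultimately show "ff i w = ff j w" by simp
      next
        fix w assume w: "w \<in> topspace (subtopology (?Z n) ?A)"
        obtain z t where zt: "w = (z, t)" by (cases w)
        have zt': "z \<in> topspace (disc n)" "t \<in> {0..1}" "t = 0 \<or> z \<in> disc_boundary n" "w \<in> ?A" using w by (auto simp: zt)
        show "\<exists>j. j \<in> insert None (Some ` F) \<and> w \<in> ?A \<inter> TT j \<and> g w = ff j w"
        proof (cases "t = 0")
          case True
          then show ?thesis using zt' by (intro exI[of _ None]) (auto simp: TT_def ff_def g_def zt)
        next
          case False
          then have b: "z \<in> disc_boundary n" using zt' by simp
          then have "\<Phi> z \<in> (\<Union>(k, \<Psi>) \<in> F. \<Psi> ` disc_interior k)" using F(3) by blast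
          then obtain k \<Psi> where k: "(k, \<Psi>) \<in> F" "\<Phi> z \<in> \<Psi> ` disc_interior k" by blast
          moreover have "disc_interior k \<subseteq> topspace (disc k)" by (auto simp: disc_interior_def)
          ultimately have "\<Phi> z \<in> \<Psi> ` topspace (disc k)" by blast
          then show ?thesis using zt' k(1) b gb[OF b]
            by (intro exI[of _ "Some (k, \<Psi>)"]) (auto simp: TT_def ff_def zt)
        qed
      qed
      moreover have "p (g w) = (case w of (z, t) \<Rightarrow> h (\<Phi> z, t))" if w: "w \<in> ?A" for w
      proof -
        obtain z t where zt: "w = (z, t)" by (cases w)
        have zt': "z \<in> topspace (disc n)" "t \<in> {0..1}" "t = 0 \<or> z \<in> disc_boundary n" using w by (auto simp: zt)
        show ?thesis
        proof (cases "t = 0")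
          case True
          have "\<Phi> z \<in> topspace X" using cont[OF \<Phi>] zt' by (auto simp: continuous_map_def)
          then show ?thesis using s0 True by (simp add: zt g_def lift_over_def)
        next
          case False
          then have b: "z \<in> disc_boundary n" using zt' by simp
          then have "\<Phi> z \<in> low n" using bd_low[OF \<Phi>] by blast
          then show ?thesis using sb zt'(2) by (simp add: zt gb[OF b])
        qed
      qed
      ultimately have "lift_over (subtopology (?Z n) ?A) (\<lambda>(z, t). h (\<Phi> z, t)) g"
        unfolding lift_over_def by auto
      from disc_lift_extension[OF hom[OF \<Phi>] this] obtain \<tau> where
        \<tau>: "lift_over (?Z n) (\<lambda>(z, t). h (\<Phi> z, t)) \<tau>" "\<And>w. w \<in> ?A \<Longrightarrow> \<tau> w = g w" by blast
      show ?thesis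
      proof (intro exI[of _ \<tau>] conjI ballI \<tau>(1))
        show "\<tau> (z, 0) = s0 (\<Phi> z)" if "z \<in> topspace (disc n)" for z
          using \<tau>(2)[of "(z, 0)"] that by (simp add: g_def)
        show "\<tau> (z, t) = s (\<Phi> z, t)" if "z \<in> disc_boundary n" "t \<in> {0..1}" for z t
          using \<tau>(2)[of "(z, t)"] that gb[OF that(1)] by (simp add: disc_boundary_def)
      qed
    qed
    then obtain \<tau> where \<tau>: "\<And>\<Phi>. (n, \<Phi>) \<in> C \<Longrightarrow> lift_over (?Z n) (\<lambda>(z, t). h (\<Phi> z, t)) (\<tau> \<Phi>) \<and>
        (\<forall>z\<in>topspace (disc n). \<tau> \<Phi> (z, 0) = s0 (\<Phi> z)) \<and> (\<forall>z\<in>disc_boundary n. \<forall>t\<in>{0..1}. \<tau> \<Phi> (z, t) = s (\<Phi> z, t))"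
      by metis
    \<comment> \<open>A point off the lower skeleton that lies in an open \<open>n\<close>-cell lies
      in only one, and it has only one preimage in the interior of the disc; so the choices made
      here are forced.\<close>
    define s' where "s' = (\<lambda>(x, t). if x \<in> low n then s (x, t) else
       (let \<Phi> = SOME \<Phi>. (n, \<Phi>) \<in> C \<and> x \<in> \<Phi> ` disc_interior n in \<tau> \<Phi> (inv_into (disc_interior n) \<Phi> x, t)))"
    have s'_low: "s' (x, t) = s (x, t)" if "x \<in> low n" for x t using that by (simp add: s'_def)
    have s'_top: "s' (\<Phi> z, t) = \<tau> \<Phi> (z, t)" if \<Phi>: "(n, \<Phi>) \<in> C" and z: "z \<in> topspace (disc n)" and t: "t \<in> {0..1}" for \<Phi> z t
    proof (cases "z \<in> disc_boundary n")
      case True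
      then have "\<Phi> z \<in> low n" using bd_low[OF \<Phi>] by blast
      then show ?thesis using s'_low \<tau>[OF \<Phi>] True t by simp
    next
      case False
      then have zi: "z \<in> disc_interior n" using z by (simp add: disc_eq_interior_Un_boundary)
      have "\<Phi> z \<notin> low n"
      proof
        assume "\<Phi> z \<in> low n"
        then obtain m \<Psi> where "(m, \<Psi>) \<in> C" "m < n" "\<Phi> z \<in> \<Psi> ` disc_interior m" unfolding low_iff by blast
        with disj[OF \<Phi> this(1), of "\<Phi> z"] zi show False by auto
      qed
      moreover have "(SOME \<Phi>'. (n, \<Phi>') \<in> C \<and> \<Phi> z \<in> \<Phi>' ` disc_interior n) = \<Phi>"
      proof (rule some_equality)
        show "(n, \<Phi>) \<in> C \<and> \<Phi> z \<in> \<Phi> ` disc_interior n" using \<Phi> zi by blast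
        show "\<Phi>' = \<Phi>" if "(n, \<Phi>') \<in> C \<and> \<Phi> z \<in> \<Phi>' ` disc_interior n" for \<Phi>'
          using disj[of n \<Phi>' n \<Phi> "\<Phi> z"] that \<Phi> zi by blast
      qed
      ultimately show ?thesis using inj[OF \<Phi>] zi by (simp add: s'_def Let_def)
    qed
    have "Q (Suc n) s'"
      unfolding Q_def
    proof (intro allI impI)
      fix m \<Phi> assume m: "(m, \<Phi>) \<in> C" "m < Suc n"
      show "ok s' m \<Phi>"
      proof (cases "m = n")
        case True
        then have \<Phi>: "(n, \<Phi>) \<in> C" using m by simp
        have "lift_over (?Z n) (\<lambda>(z, t). h (\<Phi> z, t)) (\<lambda>(z, t). s' (\<Phi> z, t))"
          using \<tau>[OF \<Phi>] unfolding lift_over_def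
          by (auto simp: s'_top[OF \<Phi>] elim!: continuous_map_eq)
        then show ?thesis using \<tau>[OF \<Phi>] s'_top[OF \<Phi>] by (simp add: ok_def True)
      next
        case False
        then have mn: "m < n" using m by simp
        have oks: "ok s m \<Phi>" using Qs m(1) mn unfolding Q_def by blast
        have \<Phi>low: "\<Phi> z \<in> low n" if "z \<in> topspace (disc m)" for z
          using im_low[OF m(1)] low_mono[of "Suc m" n] mn that by auto
        show ?thesis by (rule ok_cong[OF oks]) (rule s'_low[OF \<Phi>low])
      qed
    qed
    then show ?thesis using s'_low by blast
  qed
  \<comment> \<open>No cell has dimension below 0, so the recursion may start anywhere.\<close>
  have "Q 0 undefined" by (simp add: Q_def)
  then have "\<exists>S. \<forall>n. Q n (S n) \<and> (\<forall>x\<in>low n. \<forall>t. S (Suc n) (x, t) = S n (x, t))"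
    using step by (intro dependent_nat_choice) blast+
  then obtain S where S: "\<And>n. Q n (S n)" "\<And>n x t. x \<in> low n \<Longrightarrow> S (Suc n) (x, t) = S n (x, t)" by blast
  have S_mono: "S (n + k) (x, t) = S n (x, t)" if "x \<in> low n" for n k x t
  proof (induction k)
    case (Suc k)
    have "x \<in> low (n + k)" using that low_mono[of n "n + k"] by auto
    then show ?case using S(2) Suc by simp
  qed simp
  \<comment> \<open>Later stages never change a lift over a skeleton already treated, so any stage
    that has reached \<open>x\<close> gives the same value; the least one is taken.\<close>
  define s where "s = (\<lambda>(x, t). S (LEAST n. x \<in> low n) (x, t))"
  have s_low: "s (x, t) = S n (x, t)" if "x \<in> low n" for x t n
  proof -
    have "(LEAST n. x \<in> low n) \<le> n" "x \<in> low (LEAST n. x \<in> low n)" using that by (auto intro: Least_le LeastI)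
    then show ?thesis using S_mono[of x "LEAST n. x \<in> low n" "n - (LEAST n. x \<in> low n)" t] by (simp add: s_def)
  qed
  have oks: "ok s m \<Phi>" if m: "(m, \<Phi>) \<in> C" for m \<Phi>
  proof (rule ok_cong)
    show "ok (S (Suc m)) m \<Phi>" using S(1)[of "Suc m"] m unfolding Q_def by blast
    show "s (\<Phi> z, t) = S (Suc m) (\<Phi> z, t)" if "z \<in> topspace (disc m)" for z t
      using im_low[OF m] that by (intro s_low) auto
  qed
  have cell: "\<exists>m \<Phi> z. (m, \<Phi>) \<in> C \<and> z \<in> topspace (disc m) \<and> x = \<Phi> z" if "x \<in> topspace X" for x
  proof -
    have "x \<in> (\<Union>(m, \<Phi>) \<in> C. \<Phi> ` disc_interior m)" using that cover by simp
    then show ?thesis by (auto simp: disc_interior_def)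
  qed
  show ?thesis
  proof
    show "lift_over (prod_topology X unit_interval) h s"
      unfolding lift_over_def
    proof (intro conjI ballI)
      show "continuous_map (prod_topology X unit_interval) P s"
      proof (rule continuous_map_prod_weak_topology[where \<K> = "(\<lambda>(m, \<Phi>). X closure_of (\<Phi> ` disc_interior m)) ` C"])
        show "closedin X A" if "A \<subseteq> topspace X"
          "\<And>K. K \<in> (\<lambda>(m, \<Phi>). X closure_of (\<Phi> ` disc_interior m)) ` C \<Longrightarrow> closedin X (A \<inter> K)" for A
        proof (rule weak[OF that(1)])
          fix m \<Phi> assume "(m, \<Phi>) \<in> C"
          from imageI[OF this, of "\<lambda>(m, \<Phi>). X closure_of (\<Phi> ` disc_interior m)"]
          show "closedin X (A \<inter> (X closure_of (\<Phi> ` disc_interior m)))" by (intro that(2)) simp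
        qed
        show "topspace X \<subseteq> \<Union> ((\<lambda>(m, \<Phi>). X closure_of (\<Phi> ` disc_interior m)) ` C)"
        proof
          fix x assume x: "x \<in> topspace X"
          then obtain m \<Phi> where m: "(m, \<Phi>) \<in> C" "x \<in> \<Phi> ` disc_interior m" using cover by blast
          then have "x \<in> X closure_of (\<Phi> ` disc_interior m)" using x by (simp add: in_closure_of) blast
          then show "x \<in> \<Union> ((\<lambda>(m, \<Phi>). X closure_of (\<Phi> ` disc_interior m)) ` C)" using m(1) by blast
        qed
        fix K assume "K \<in> (\<lambda>(m, \<Phi>). X closure_of (\<Phi> ` disc_interior m)) ` C"
        then obtain m \<Phi> where m: "(m, \<Phi>) \<in> C" "K = X closure_of (\<Phi> ` disc_interior m)" by auto
        show "closedin X K" by (simp add: m(2))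
        have "compactin X (\<Phi> ` topspace (disc m))"
          using image_compactin[OF _ cont[OF m(1)]] compact_disc[of m] by (simp add: compact_space_def)
        then have "closedin X (\<Phi> ` topspace (disc m))" using HX by (simp add: compactin_imp_closedin)
        \<comment> \<open>The weak topology refers to closures of open cells; each is contained in
          the image of the closed disc, which is compact and hence closed.\<close>
        then have sub: "K \<subseteq> \<Phi> ` topspace (disc m)"
          unfolding m(2) by (intro closure_of_minimal) (auto simp: disc_interior_def)
        have "continuous_map (?Z m) P (\<lambda>(z, t). s (\<Phi> z, t))"
          using oks[OF m(1)] by (simp add: ok_def lift_over_def)
        then have "continuous_map (prod_topology (subtopology X (\<Phi> ` topspace (disc m))) unit_interval) P s"
          by (rule continuous_map_disc_image[OF HX cont[OF m(1)]])
        then show "continuous_map (prod_topology (subtopology X K) unit_interval) P s"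
          unfolding prod_topology_subtopology(1)[of X]
          by (rule continuous_map_from_subtopology_mono) (use sub in auto)
      qed
      show "p (s w) = h w" if w0: "w \<in> topspace (prod_topology X unit_interval)" for w
      proof -
        obtain x t where w: "w = (x, t)" "x \<in> topspace X" "t \<in> {0..1}" using w0 by auto
        obtain m \<Phi> z where "(m, \<Phi>) \<in> C" "z \<in> topspace (disc m)" "x = \<Phi> z" using cell[OF w(2)] by blast
        then show ?thesis using oks w by (auto simp: ok_def lift_over_def)
      qed
    qed
    show "s (x, 0) = s0 x" if x: "x \<in> topspace X" for x
    proof -
      obtain m \<Phi> z where "(m, \<Phi>) \<in> C" "z \<in> topspace (disc m)" "x = \<Phi> z" using cell[OF x] by blast
      then show ?thesis using oks by (auto simp: ok_def)
    qed
  qed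
qed

end

section \<open>Gram-Schmidt orthonormalization\<close>

text \<open>The domains are topologies such as a cylinder over \<open>X\<close> rather than types.
  Translating continuity into limits at points brings in the rules for limits of sums, products and
  components.\<close>

lemma continuous_map_euclidean_iff_tendsto:
  "continuous_map Z euclidean f \<longleftrightarrow> (\<forall>z\<in>topspace Z. (f \<longlongrightarrow> f z) (atin Z z))"
  by (simp add: continuous_map_atin limitin_canonical_iff)

lemma continuous_map_vecI:
  fixes f :: "'z \<Rightarrow> 'c::topological_space^'n"
  assumes "\<And>i. continuous_map Z euclidean (\<lambda>z. f z $ i)"
  shows "continuous_map Z euclidean f"
  using assms unfolding continuous_map_euclidean_iff_tendsto by (auto intro: vec_tendstoI)

lemma continuous_map_vec_nth:
  fixes f :: "'z \<Rightarrow> 'c::topological_space^'n"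
  assumes "continuous_map Z euclidean f"
  shows "continuous_map Z euclidean (\<lambda>z. f z $ i)"
  using assms unfolding continuous_map_euclidean_iff_tendsto by (auto intro: tendsto_vec_nth)

lemma continuous_map_matrix_mult:
  fixes f :: "'z \<Rightarrow> real^'n^'m" and g :: "'z \<Rightarrow> real^'k^'n"
  assumes "continuous_map Z euclidean f" "continuous_map Z euclidean g"
  shows "continuous_map Z euclidean (\<lambda>z. f z ** g z)"
  using assms unfolding continuous_map_euclidean_iff_tendsto matrix_matrix_mult_def
  by (intro ballI vec_tendstoI, simp only: vec_lambda_beta, intro tendsto_sum tendsto_mult tendsto_vec_nth) blast+

lemma continuous_map_matrix_vector_mult:
  fixes f :: "'z \<Rightarrow> real^'n^'m" and g :: "'z \<Rightarrow> real^'n"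
  assumes "continuous_map Z euclidean f" "continuous_map Z euclidean g"
  shows "continuous_map Z euclidean (\<lambda>z. f z *v g z)"
  using assms unfolding continuous_map_euclidean_iff_tendsto matrix_vector_mult_def
  by (intro ballI vec_tendstoI, simp only: vec_lambda_beta, intro tendsto_sum tendsto_mult tendsto_vec_nth) blast+

lemma continuous_map_transpose:
  fixes f :: "'z \<Rightarrow> real^'n^'m"
  assumes "continuous_map Z euclidean f"
  shows "continuous_map Z euclidean (\<lambda>z. transpose (f z))"
  using assms unfolding continuous_map_euclidean_iff_tendsto transpose_def
  by (intro ballI vec_tendstoI, simp only: vec_lambda_beta, intro tendsto_vec_nth) blast

lemma continuous_map_special_orthogonal:
  "continuous_map Z special_orthogonal F \<longleftrightarrow> continuous_map Z euclidean F \<and> (\<forall>z\<in>topspace Z. rotation_matrix (F z))"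
  by (auto simp: special_orthogonal_def continuous_map_in_subtopology)

definition positive_forms :: "(real^'n^'n) set" where
  "positive_forms = {M. (\<forall>x y. x \<bullet> (M *v y) = y \<bullet> (M *v x)) \<and> (\<forall>x. x \<noteq> 0 \<longrightarrow> x \<bullet> (M *v x) > 0)}"

text \<open>The vectors are built as continuous functions of the form \<open>M\<close>, one axis at
  a time. The span condition is carried along because it keeps the next axis outside the span of the
  earlier vectors, so the remainder \<open>u\<close> never vanishes.\<close>

lemma gram_schmidt_family:
  fixes S :: "'n::finite set"
  shows "\<exists>e :: 'n \<Rightarrow> real^'n^'n \<Rightarrow> real^'n. (\<forall>i\<in>S. continuous_on positive_forms (e i)) \<and>
     (\<forall>M\<in>positive_forms. (\<forall>i\<in>S. \<forall>j\<in>S. e i M \<bullet> (M *v e j M) = (if i = j then 1 else 0)) \<and>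
        (\<forall>i\<in>S. e i M \<in> span ((\<lambda>i. axis i 1) ` S)))"
  using finite[of S]
proof (induction S rule: finite_induct)
  case (insert k S)
  then obtain e :: "'n \<Rightarrow> real^'n^'n \<Rightarrow> real^'n" where e: "\<And>i. i \<in> S \<Longrightarrow> continuous_on positive_forms (e i)"
    "\<And>M i j. M \<in> positive_forms \<Longrightarrow> i \<in> S \<Longrightarrow> j \<in> S \<Longrightarrow> e i M \<bullet> (M *v e j M) = (if i = j then 1 else 0)"
    "\<And>M i. M \<in> positive_forms \<Longrightarrow> i \<in> S \<Longrightarrow> e i M \<in> span ((\<lambda>i. axis i 1) ` S)"
    by blast
  let ?k = "axis k 1 :: real^'n"
  define u where "u = (\<lambda>M. ?k - (\<Sum>i\<in>S. (?k \<bullet> (M *v e i M)) *\<^sub>R e i M))"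
  define q where "q = (\<lambda>M. u M \<bullet> (M *v u M))"
  define f where "f = (\<lambda>M. (1 / sqrt (q M)) *\<^sub>R u M)"
  have kS: "?k \<notin> span ((\<lambda>i. axis i 1) ` S)"
  proof
    assume "?k \<in> span ((\<lambda>i. axis i 1) ` S)"
    moreover have "subspace {v :: real^'n. v $ k = 0}" by (rule subspace_special_hyperplane)
    moreover have "(\<lambda>i. axis i 1) ` S \<subseteq> {v :: real^'n. v $ k = 0}"
      using insert.hyps(2) by (auto simp: axis_def)
    ultimately have "?k \<in> {v. v $ k = 0}" using span_minimal by blast
    then show False by simp
  qed
  have u0: "u M \<noteq> 0" if "M \<in> positive_forms" for M
  proof
    assume "u M = 0"
    then have "?k = (\<Sum>i\<in>S. (?k \<bullet> (M *v e i M)) *\<^sub>R e i M)" by (simp add: u_def)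
    also have "\<dots> \<in> span ((\<lambda>i. axis i 1) ` S)" using e(3)[OF that] by (intro span_sum span_scale)
    finally show False using kS by blast
  qed
  have q0: "q M > 0" if "M \<in> positive_forms" for M
    using u0[OF that] that by (simp add: q_def positive_forms_def)
  have cu: "continuous_on positive_forms u"
    unfolding u_def by (intro continuous_intros e)
  have cf: "continuous_on positive_forms f"
    unfolding f_def q_def by (intro continuous_intros cu) (use q0 in \<open>force simp: q_def\<close>)
  have uo: "u M \<bullet> (M *v e j M) = 0" if M: "M \<in> positive_forms" and j: "j \<in> S" for M j
  proof -
    have "u M \<bullet> (M *v e j M) = ?k \<bullet> (M *v e j M) - (\<Sum>i\<in>S. (?k \<bullet> (M *v e i M)) * (e i M \<bullet> (M *v e j M)))"
      by (simp add: u_def inner_diff_left inner_sum_left)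
    also have "(\<Sum>i\<in>S. (?k \<bullet> (M *v e i M)) * (e i M \<bullet> (M *v e j M))) = (\<Sum>i\<in>S. if i = j then ?k \<bullet> (M *v e i M) else 0)"
      by (rule sum.cong) (simp_all add: e(2)[OF M _ j])
    also have "\<dots> = ?k \<bullet> (M *v e j M)" using j insert.hyps(1) by simp
    finally show ?thesis by simp
  qed
  have ff: "f M \<bullet> (M *v f M) = 1" if "M \<in> positive_forms" for M
  proof -
    have "f M \<bullet> (M *v f M) = q M / (sqrt (q M) * sqrt (q M))"
      by (simp add: f_def q_def matrix_vector_mult_scaleR)
    then show ?thesis using q0[OF that] by simp
  qed
  have fo: "f M \<bullet> (M *v e j M) = 0" "e j M \<bullet> (M *v f M) = 0" if M: "M \<in> positive_forms" and j: "j \<in> S" for M j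
  proof -
    show 1: "f M \<bullet> (M *v e j M) = 0" using uo[OF that] by (simp add: f_def)
    have "e j M \<bullet> (M *v f M) = f M \<bullet> (M *v e j M)" using M unfolding positive_forms_def by blast
    with 1 show "e j M \<bullet> (M *v f M) = 0" by simp
  qed
  have es: "e i M \<in> span ((\<lambda>i. axis i 1) ` insert k S)" if "M \<in> positive_forms" "i \<in> S" for M i
    using e(3)[OF that] span_mono[of "(\<lambda>i. axis i 1) ` S" "(\<lambda>i. axis i 1 :: real^'n) ` insert k S"] by auto
  have fs: "f M \<in> span ((\<lambda>i. axis i 1) ` insert k S)" if M: "M \<in> positive_forms" for M
    unfolding f_def u_def
    by (rule span_scale, rule span_diff, rule span_base, simp, rule span_sum, rule span_scale, rule es[OF M])
  show ?case
  proof (intro exI[of _ "e(k := f)"] conjI ballI)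
    show "continuous_on positive_forms ((e(k := f)) i)" if "i \<in> insert k S" for i
      using that e(1) cf by auto
    show "(e(k := f)) i M \<bullet> (M *v (e(k := f)) j M) = (if i = j then 1 else 0)"
      if "M \<in> positive_forms" "i \<in> insert k S" "j \<in> insert k S" for M i j
      using that insert.hyps(2) e(2)[OF that(1)] ff[OF that(1)] fo[OF that(1)] by auto
    show "(e(k := f)) i M \<in> span ((\<lambda>i. axis i 1) ` insert k S)" if "M \<in> positive_forms" "i \<in> insert k S" for M i
      using that fs es by auto
  qed
qed auto

text \<open>The orthonormal basis may have the wrong orientation. Multiplying one coordinate by the
  sign of the determinant repairs this continuously, since the determinant never vanishes.\<close>

lemma gram_schmidt:
  obtains C :: "real^'n^'n \<Rightarrow> real^'n^'n" where "continuous_on positive_forms C"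
    "\<And>M x y. M \<in> positive_forms \<Longrightarrow> (C M *v x) \<bullet> (M *v (C M *v y)) = x \<bullet> y"
    "\<And>M. M \<in> positive_forms \<Longrightarrow> det (C M) > 0"
proof -
  obtain e :: "'n \<Rightarrow> real^'n^'n \<Rightarrow> real^'n" where e0: "\<forall>i\<in>UNIV. continuous_on positive_forms (e i)"
    "\<forall>M\<in>positive_forms. (\<forall>i\<in>UNIV. \<forall>j\<in>UNIV. e i M \<bullet> (M *v e j M) = (if i = j then 1 else 0)) \<and>
        (\<forall>i\<in>UNIV. e i M \<in> span ((\<lambda>i. axis i 1) ` UNIV))"
    using gram_schmidt_family[of "UNIV :: 'n set"] by blast
  have e: "continuous_on positive_forms (e i)"
    "M \<in> positive_forms \<Longrightarrow> e i M \<bullet> (M *v e j M) = (if i = j then 1 else 0)" for M i j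
    using e0 by simp_all
  define A where "A = (\<lambda>M. \<chi> a i. e i M $ a)"
  have cA: "continuous_on positive_forms A" unfolding A_def by (intro continuous_intros e)
  have Ae: "A M *v x = (\<Sum>i\<in>UNIV. x $ i *\<^sub>R e i M)" for M x
    by (simp add: matrix_mult_sum A_def column_def scalar_mult_eq_scaleR vec_lambda_eta)
  have AM: "(A M *v x) \<bullet> (M *v (A M *v y)) = x \<bullet> y" if M: "M \<in> positive_forms" for M x y
  proof -
    have "M *v (A M *v y) = (\<Sum>j\<in>UNIV. y $ j *\<^sub>R (M *v e j M))"
      by (simp add: Ae linear_sum[OF matrix_vector_mul_linear] matrix_vector_mult_scaleR)
    then have "(A M *v x) \<bullet> (M *v (A M *v y)) = (\<Sum>i\<in>UNIV. \<Sum>j\<in>UNIV. x $ i * y $ j * (e i M \<bullet> (M *v e j M)))"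
      by (simp add: Ae inner_sum_left inner_sum_right sum_distrib_left) (subst sum.swap, simp add: algebra_simps)
    also have "\<dots> = (\<Sum>i\<in>UNIV. \<Sum>j\<in>UNIV. if i = j then x $ i * y $ j else 0)"
      by (intro sum.cong) (simp_all add: e(2)[OF M])
    also have "\<dots> = x \<bullet> y" by (simp add: inner_vec_def)
    finally show ?thesis .
  qed
  have dA: "det (A M) \<noteq> 0" if M: "M \<in> positive_forms" for M
  proof -
    have "inj ((*v) (A M))"
    proof (rule injI)
      fix x y assume "A M *v x = A M *v y"
      then have "A M *v (x - y) = 0" by (simp add: matrix_vector_mult_diff_distrib)
      then have "(x - y) \<bullet> (x - y) = 0" using AM[OF M, of "x - y" "x - y"] by simp
      then show "x = y" by simp
    qed
    then show ?thesis
      using det_nz_iff_inj[of "(*v) (A M)"] by (simp add: matrix_of_matrix_vector_mul)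
  qed
  \<comment> \<open>Any coordinate can carry the change of sign.\<close>
  define d :: 'n where "d = undefined"
  define D :: "real^'n^'n \<Rightarrow> real^'n^'n"
    where "D = (\<lambda>M. \<chi> i j. if i = j then (if i = d then sgn (det (A M)) else 1) else 0)"
  have dD: "det (D M) = sgn (det (A M))" for M
  proof -
    have "det (D M) = (\<Prod>i\<in>UNIV. D M $ i $ i)" by (rule det_diagonal) (simp add: D_def)
    also have "\<dots> = (\<Prod>i\<in>UNIV. if i = d then sgn (det (A M)) else 1)" by (simp add: D_def)
    also have "\<dots> = sgn (det (A M))" by simp
    finally show ?thesis .
  qed
  have Dx: "(D M *v x) $ i = (if i = d then sgn (det (A M)) else 1) * x $ i" for M x i
  proof -
    have "(D M *v x) $ i = (\<Sum>j\<in>UNIV. if j = i then (if i = d then sgn (det (A M)) else 1) * x $ i else 0)"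
      unfolding matrix_vector_mult_def vec_lambda_beta by (rule sum.cong) (auto simp: D_def)
    then show ?thesis by simp
  qed
  have DD: "(D M *v x) \<bullet> (D M *v y) = x \<bullet> y" if M: "M \<in> positive_forms" for M x y
  proof -
    have "sgn (det (A M)) * sgn (det (A M)) = 1" using dA[OF M] by (simp add: sgn_if)
    then show ?thesis unfolding inner_vec_def by (intro sum.cong) (simp_all add: Dx)
  qed
  have cD: "continuous_on positive_forms D"
  proof -
    have "continuous_on positive_forms (\<lambda>M. sgn (det (A M)))" using dA cA by (intro continuous_intros) auto
    then have "continuous_on positive_forms (\<lambda>M. D M $ i $ j)" for i j
      by (cases "i = j"; cases "i = d") (simp_all add: D_def)
    then show ?thesis by (simp add: continuous_on_matrix_iff)
  qed
  show ?thesis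
  proof (rule that[of "\<lambda>M. A M ** D M"])
    show "continuous_on positive_forms (\<lambda>M. A M ** D M)" by (intro continuous_intros cA cD)
    show "((A M ** D M) *v x) \<bullet> (M *v ((A M ** D M) *v y)) = x \<bullet> y" if "M \<in> positive_forms" for M x y
      using AM[OF that] DD[OF that] by (simp add: matrix_vector_mul_assoc[symmetric])
    show "det (A M ** D M) > 0" if "M \<in> positive_forms" for M
      using dA[OF that] by (simp add: det_mul dD sgn_if)
  qed
qed

section \<open>Frames of an oriented bundle\<close>

lemma bundle_chart_inverse:
  assumes "bundle_chart E U \<phi>"
  obtains \<psi> where
    "continuous_map (prod_topology (subtopology (base E) U) euclidean) (total E) \<phi>"
    "continuous_map (subtopology (total E) {v. proj E v \<in> U}) (prod_topology (subtopology (base E) U) euclidean) \<psi>"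
    "\<And>b x. b \<in> U \<Longrightarrow> \<psi> (\<phi> (b, x)) = (b, x)" "\<And>b x. b \<in> U \<Longrightarrow> \<phi> (b, x) \<in> fibre E b"
    "\<And>v. v \<in> topspace (total E) \<Longrightarrow> proj E v \<in> U \<Longrightarrow> \<phi> (proj E v, snd (\<psi> v)) = v"
proof -
  have U: "openin (base E) U" "U \<subseteq> topspace (base E)"
    and hm: "homeomorphic_map (prod_topology (subtopology (base E) U) euclidean) (subtopology (total E) {v. proj E v \<in> U}) \<phi>"
    and fr: "\<And>b. b \<in> U \<Longrightarrow> frame E b (\<lambda>x. \<phi> (b, x))"
    using assms openin_subset by (auto simp: bundle_chart_def)
  from hm obtain \<psi> where \<psi>: "homeomorphic_maps (prod_topology (subtopology (base E) U) euclidean) (subtopology (total E) {v. proj E v \<in> U}) \<phi> \<psi>"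
    unfolding homeomorphic_map_maps by blast
  have fib: "\<phi> (b, x) \<in> fibre E b" if "b \<in> U" for b x
    using fr[OF that] by (auto simp: frame_def bij_betw_def)
  have inv1: "\<psi> (\<phi> (b, x)) = (b, x)" if "b \<in> U" for b x
    using \<psi> that U(2) by (auto simp: homeomorphic_maps_def)
  show ?thesis
  proof (rule that[of \<psi>])
    show "continuous_map (prod_topology (subtopology (base E) U) euclidean) (total E) \<phi>"
      using \<psi> by (simp add: homeomorphic_maps_def continuous_map_in_subtopology)
    show "continuous_map (subtopology (total E) {v. proj E v \<in> U}) (prod_topology (subtopology (base E) U) euclidean) \<psi>"
      using \<psi> by (simp add: homeomorphic_maps_def)
    show "\<phi> (proj E v, snd (\<psi> v)) = v" if v: "v \<in> topspace (total E)" "proj E v \<in> U" for v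
    proof -
      have e: "\<phi> (\<psi> v) = v" using \<psi> v by (auto simp: homeomorphic_maps_def)
      have "\<psi> v \<in> topspace (prod_topology (subtopology (base E) U) euclidean)"
        using \<psi> v by (auto simp: homeomorphic_maps_def continuous_map_def)
      then have "fst (\<psi> v) \<in> U" by auto
      from fib[OF this, of "snd (\<psi> v)"] e have "proj E v = fst (\<psi> v)" by (simp add: fibre_def)
      then show ?thesis using e by simp
    qed
  qed (use inv1 fib in auto)
qed

text \<open>All oriented frames, not only the orthonormal ones, under pointwise convergence. As
  frames are linear, this amounts to convergence on a basis.\<close>

definition frame_space :: "('b, 'e, 'n::finite) bundle_data \<Rightarrow> (real^'n \<Rightarrow> 'e) topology" where
  "frame_space E = subtopology (product_topology (\<lambda>_. total E) UNIV) (\<Union>b\<in>topspace (base E). orient E b)"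

locale oriented_bundle =
  fixes E :: "('b, 'e, 'n::finite) bundle_data"
  assumes oriented: "oriented_euclidean_vector_bundle E"
begin

lemma orient_frame:
  assumes "b \<in> topspace (base E)" "L \<in> orient E b"
  shows "L x \<in> fibre E b" "L x \<in> topspace (total E)" "proj E (L x) = b" "bij_betw L UNIV (fibre E b)"
    "L (x + y) = vadd E (L x) (L y)" "L (c *\<^sub>R x) = vscale E c (L x)"
proof -
  have "frame E b L"
    using oriented assms by (auto simp: oriented_euclidean_vector_bundle_def bundle_orientation_def)
  then show "bij_betw L UNIV (fibre E b)" "L (x + y) = vadd E (L x) (L y)" "L (c *\<^sub>R x) = vscale E c (L x)"
    by (auto simp: frame_def)
  then show "L x \<in> fibre E b" by (auto simp: bij_betw_def)
  then show "L x \<in> topspace (total E)" "proj E (L x) = b" by (auto simp: fibre_def)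
qed

lemma orient_eq:
  assumes "b \<in> topspace (base E)" "L \<in> orient E b"
  shows "orient E b = {L \<circ> (\<lambda>x. A *v x) | A. det A > 0}"
  using oriented assms unfolding oriented_euclidean_vector_bundle_def bundle_orientation_def by blast

lemma orient_nonempty: "b \<in> topspace (base E) \<Longrightarrow> orient E b \<noteq> {}"
  using oriented unfolding oriented_euclidean_vector_bundle_def bundle_orientation_def by blast

lemma oriented_chart:
  assumes "b \<in> topspace (base E)"
  obtains U \<phi> where "b \<in> U" "openin (base E) U" "bundle_chart E U \<phi>" "\<And>c. c \<in> U \<Longrightarrow> (\<lambda>x. \<phi> (c, x)) \<in> orient E c"
proof -
  obtain U \<phi> where "b \<in> U" "bundle_chart E U \<phi>" "\<forall>c\<in>U. (\<lambda>x. \<phi> (c, x)) \<in> orient E c"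
    using oriented assms unfolding oriented_euclidean_vector_bundle_def bundle_orientation_def by meson
  moreover from this have "openin (base E) U" by (simp add: bundle_chart_def)
  ultimately show ?thesis using that by blast
qed

lemma continuous_proj: "continuous_map (total E) (base E) (proj E)"
  using oriented by (simp add: oriented_euclidean_vector_bundle_def vector_bundle_def)

lemma topspace_frame_space: "topspace (frame_space E) = (\<Union>b\<in>topspace (base E). orient E b)"
  using orient_frame(2) by (auto simp: frame_space_def PiE_def extensional_def)

lemma continuous_map_frame_space:
  "continuous_map Z (frame_space E) s \<longleftrightarrow> (\<forall>x. continuous_map Z (total E) (\<lambda>z. s z x)) \<and>
     (\<forall>z\<in>topspace Z. \<exists>b\<in>topspace (base E). s z \<in> orient E b)"
  unfolding frame_space_def continuous_map_in_subtopology continuous_map_componentwise_UNIV by auto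

text \<open>A frame is moved to a nearby fibre by keeping its coordinates in a chart. Such a move
  need not preserve the metric, which is why lifting uses all oriented frames. The base point of a
  frame is read off at the zero vector.\<close>

lemma frame_space_transport: "transport_fibration (frame_space E) (base E) (\<lambda>L. proj E (L 0))"
proof
  have ev: "continuous_map (frame_space E) (total E) (\<lambda>L. L x)" for x
    using continuous_map_frame_space[of "frame_space E" id] by simp
  from continuous_map_compose[OF ev continuous_proj]
  show "continuous_map (frame_space E) (base E) (\<lambda>L. proj E (L 0))" by (simp add: o_def)
  fix b assume "b \<in> topspace (base E)"
  then obtain U \<phi> where U: "b \<in> U" "openin (base E) U" "bundle_chart E U \<phi>" "\<And>c. c \<in> U \<Longrightarrow> (\<lambda>x. \<phi> (c, x)) \<in> orient E c"
    by (rule oriented_chart) blast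
  have UB: "U \<subseteq> topspace (base E)" using U(2) openin_subset by blast
  from U(3) obtain \<psi> where \<psi>: "continuous_map (prod_topology (subtopology (base E) U) euclidean) (total E) \<phi>"
    "continuous_map (subtopology (total E) {v. proj E v \<in> U}) (prod_topology (subtopology (base E) U) euclidean) \<psi>"
    "\<And>b x. b \<in> U \<Longrightarrow> \<psi> (\<phi> (b, x)) = (b, x)" "\<And>b x. b \<in> U \<Longrightarrow> \<phi> (b, x) \<in> fibre E b"
    "\<And>v. v \<in> topspace (total E) \<Longrightarrow> proj E v \<in> U \<Longrightarrow> \<phi> (proj E v, snd (\<psi> v)) = v"
    by (rule bundle_chart_inverse) blast
  define T :: "(real^'n \<Rightarrow> 'e) \<times> 'b \<Rightarrow> real^'n \<Rightarrow> 'e" where "T = (\<lambda>(L, c). \<lambda>x. \<phi> (c, snd (\<psi> (L x))))"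
  let ?P = "subtopology (frame_space E) {L \<in> topspace (frame_space E). proj E (L 0) \<in> U}"
  have TO: "T (L, c) \<in> orient E c" if L: "L \<in> topspace (frame_space E)" "proj E (L 0) \<in> U" "c \<in> U" for L c
  proof -
    obtain b' where b': "b' \<in> topspace (base E)" "L \<in> orient E b'" using L(1) by (auto simp: topspace_frame_space)
    then have b'U: "b' \<in> U" using L(2) orient_frame(3) by simp
    obtain A where A: "L = (\<lambda>x. \<phi> (b', x)) \<circ> (\<lambda>x. A *v x)" "det A > 0"
      using b' orient_eq[OF b'(1) U(4)[OF b'U]] by blast
    have "T (L, c) = (\<lambda>x. \<phi> (c, x)) \<circ> (\<lambda>x. A *v x)"
      by (simp add: T_def A(1) \<psi>(3)[OF b'U] fun_eq_iff)
    then show ?thesis using orient_eq[OF _ U(4)[OF L(3)]] UB L(3) A(2) by auto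
  qed
  have prU: "proj E (L x) = proj E (L 0)" "L x \<in> topspace (total E)" if "L \<in> topspace (frame_space E)" for L x
    using that orient_frame by (auto simp: topspace_frame_space)
  have T: "continuous_map (prod_topology ?P (subtopology (base E) U)) (frame_space E) T"
    unfolding continuous_map_frame_space
  proof (intro conjI allI ballI)
    fix x
    have "continuous_map ?P (subtopology (total E) {v. proj E v \<in> U}) (\<lambda>L. L x)"
      unfolding continuous_map_in_subtopology
    proof (intro conjI funcsetI continuous_map_from_subtopology[OF ev])
      show "L x \<in> {v. proj E v \<in> U}" if "L \<in> topspace ?P" for L
        using that prU(1)[of L x] by simp
    qed
    from continuous_map_compose[OF continuous_map_compose[OF continuous_map_compose[OF continuous_map_fst this] \<psi>(2)] continuous_map_snd]
    have "continuous_map (prod_topology ?P (subtopology (base E) U)) euclidean (\<lambda>w. snd (\<psi> (fst w x)))"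
      by (simp add: o_def)
    then have "continuous_map (prod_topology ?P (subtopology (base E) U)) (prod_topology (subtopology (base E) U) euclidean)
        (\<lambda>w. (snd w, snd (\<psi> (fst w x))))"
      by (intro continuous_map_pairedI continuous_map_snd)
    from continuous_map_compose[OF this \<psi>(1)]
    show "continuous_map (prod_topology ?P (subtopology (base E) U)) (total E) (\<lambda>z. T z x)"
      by (simp add: o_def T_def case_prod_beta')
  next
    fix w assume "w \<in> topspace (prod_topology ?P (subtopology (base E) U))"
    then show "\<exists>b\<in>topspace (base E). T w \<in> orient E b"
      using TO[of "fst w" "snd w"] UB by auto
  qed
  show "\<exists>U T. openin (base E) U \<and> b \<in> U \<and>
      continuous_map (prod_topology (subtopology (frame_space E) {L \<in> topspace (frame_space E). proj E (L 0) \<in> U})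
        (subtopology (base E) U)) (frame_space E) T \<and>
      (\<forall>L\<in>topspace (frame_space E). proj E (L 0) \<in> U \<longrightarrow> T (L, proj E (L 0)) = L \<and> (\<forall>c\<in>U. proj E (T (L, c) 0) = c))"
  proof (intro exI[of _ U] exI[of _ T] conjI ballI impI)
    fix L assume L: "L \<in> topspace (frame_space E)" "proj E (L 0) \<in> U"
    show "T (L, proj E (L 0)) = L"
    proof
      fix x show "T (L, proj E (L 0)) x = L x"
        using \<psi>(5)[of "L x"] prU[OF L(1), of x] L(2) by (simp add: T_def)
    qed
    show "proj E (T (L, c) 0) = c" if "c \<in> U" for c
      using orient_frame(3)[OF _ TO[OF L that]] UB that by auto
  qed (use U T in auto)
qed

text \<open>In a chart a frame is a matrix whose columns are its values at the axes. These vary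
  continuously, so continuity at each fixed vector gives continuity with a moving vector
  \<open>w z\<close>.\<close>

lemma continuous_map_frame_apply:
  fixes Z :: "'z topology"
  assumes s: "\<And>x. continuous_map Z (total E) (\<lambda>z. s z x)"
    and o: "\<And>z. z \<in> topspace Z \<Longrightarrow> h z \<in> topspace (base E) \<and> s z \<in> orient E (h z)"
    and w: "continuous_map Z euclidean w"
  shows "continuous_map Z (total E) (\<lambda>z. s z (w z))"
proof -
  have hE: "h z = proj E (s z x)" if "z \<in> topspace Z" for z x
    using orient_frame(3)[of "h z" "s z" x] o[OF that] by simp
  have h: "continuous_map Z (base E) h"
    using continuous_map_compose[OF s[of 0] continuous_proj] hE[of _ 0]
    by (auto simp: o_def elim!: continuous_map_eq)
  have "\<forall>b\<in>topspace (base E). \<exists>U. b \<in> U \<and> openin (base E) U \<and>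
      continuous_map (subtopology Z {z \<in> topspace Z. h z \<in> U}) (total E) (\<lambda>z. s z (w z))"
  proof
    fix b assume "b \<in> topspace (base E)"
    then obtain U \<phi> where U: "b \<in> U" "openin (base E) U" "bundle_chart E U \<phi>" "\<And>c. c \<in> U \<Longrightarrow> (\<lambda>x. \<phi> (c, x)) \<in> orient E c"
      by (rule oriented_chart) blast
    from U(3) obtain \<psi> where \<psi>: "continuous_map (prod_topology (subtopology (base E) U) euclidean) (total E) \<phi>"
      "continuous_map (subtopology (total E) {v. proj E v \<in> U}) (prod_topology (subtopology (base E) U) euclidean) \<psi>"
      "\<And>b x. b \<in> U \<Longrightarrow> \<psi> (\<phi> (b, x)) = (b, x)" "\<And>b x. b \<in> U \<Longrightarrow> \<phi> (b, x) \<in> fibre E b"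
      "\<And>v. v \<in> topspace (total E) \<Longrightarrow> proj E v \<in> U \<Longrightarrow> \<phi> (proj E v, snd (\<psi> v)) = v"
      by (rule bundle_chart_inverse) blast
    let ?Z = "subtopology Z {z \<in> topspace Z. h z \<in> U}"
    define K where "K = (\<lambda>z. \<chi> i j. snd (\<psi> (s z (axis j 1))) $ i)"
    have sz: "continuous_map ?Z euclidean (\<lambda>z. snd (\<psi> (s z x)))" for x
    proof -
      have "continuous_map ?Z (subtopology (total E) {v. proj E v \<in> U}) (\<lambda>z. s z x)"
        using hE[of _ x] by (auto simp: continuous_map_in_subtopology continuous_map_from_subtopology[OF s])
      from continuous_map_compose[OF continuous_map_compose[OF this \<psi>(2)] continuous_map_snd]
      show ?thesis by (simp add: o_def)
    qed
    have cK: "continuous_map ?Z euclidean K"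
      unfolding K_def by (intro continuous_map_vecI) (simp add: continuous_map_vec_nth[OF sz])
    have "continuous_map ?Z euclidean (\<lambda>z. K z *v w z)"
      by (rule continuous_map_matrix_vector_mult[OF cK continuous_map_from_subtopology[OF w]])
    moreover have "continuous_map ?Z (subtopology (base E) U) h"
      by (auto simp: continuous_map_in_subtopology continuous_map_from_subtopology[OF h])
    ultimately have "continuous_map ?Z (prod_topology (subtopology (base E) U) euclidean) (\<lambda>z. (h z, K z *v w z))"
      by (rule continuous_map_pairedI[rotated])
    from continuous_map_compose[OF this \<psi>(1)]
    have c: "continuous_map ?Z (total E) (\<lambda>z. \<phi> (h z, K z *v w z))" by (simp add: o_def)
    have "\<phi> (h z, K z *v w z) = s z (w z)" if z: "z \<in> topspace Z" "h z \<in> U" for z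
    proof -
      obtain A where A: "s z = (\<lambda>x. \<phi> (h z, x)) \<circ> (\<lambda>x. A *v x)"
        using o[OF z(1)] orient_eq[OF _ U(4)[OF z(2)]] by blast
      have "K z = A"
        by (simp add: K_def A \<psi>(3)[OF z(2)] matrix_vector_mult_basis column_def vec_eq_iff)
      then show ?thesis by (simp add: A)
    qed
    then have "continuous_map ?Z (total E) (\<lambda>z. s z (w z))"
      using c by (auto elim!: continuous_map_eq)
    then show "\<exists>U. b \<in> U \<and> openin (base E) U \<and>
      continuous_map (subtopology Z {z \<in> topspace Z. h z \<in> U}) (total E) (\<lambda>z. s z (w z))"
      using U by blast
  qed
  then obtain U where U: "\<And>b. b \<in> topspace (base E) \<Longrightarrow> b \<in> U b \<and> openin (base E) (U b) \<and>
      continuous_map (subtopology Z {z \<in> topspace Z. h z \<in> U b}) (total E) (\<lambda>z. s z (w z))" by metis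
  show ?thesis
  proof (rule pasting_lemma[where I = "topspace (base E)" and T = "\<lambda>b. {z \<in> topspace Z. h z \<in> U b}" and f = "\<lambda>_ z. s z (w z)"])
    show "openin Z {z \<in> topspace Z. h z \<in> U b}" if "b \<in> topspace (base E)" for b
      using U[OF that] h by (intro openin_continuous_map_preimage) auto
    show "\<exists>j. j \<in> topspace (base E) \<and> z \<in> {z \<in> topspace Z. h z \<in> U j} \<and> s z (w z) = s z (w z)" if "z \<in> topspace Z" for z
      using o[OF that] U[of "h z"] that by blast
  qed (use U in auto)
qed

lemma continuous_map_vinner:
  assumes "continuous_map Z (total E) u" "continuous_map Z (total E) v" "\<And>z. z \<in> topspace Z \<Longrightarrow> proj E (u z) = proj E (v z)"
  shows "continuous_map Z euclideanreal (\<lambda>z. vinner E (u z) (v z))"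
proof -
  have i: "continuous_map (subtopology (prod_topology (total E) (total E)) {(u, v). proj E u = proj E v}) euclideanreal (\<lambda>(u, v). vinner E u v)"
    using oriented by (simp add: oriented_euclidean_vector_bundle_def euclidean_metric_def)
  have "continuous_map Z (subtopology (prod_topology (total E) (total E)) {(u, v). proj E u = proj E v}) (\<lambda>z. (u z, v z))"
    using assms by (auto simp: continuous_map_in_subtopology continuous_map_pairedI)
  from continuous_map_compose[OF this i] show ?thesis by (simp add: o_def)
qed

definition gram :: "(real^'n \<Rightarrow> 'e) \<Rightarrow> real^'n^'n" where
  "gram L = (\<chi> i j. vinner E (L (axis i 1)) (L (axis j 1)))"

lemma vinner_facts:
  assumes "b \<in> topspace (base E)" "u \<in> fibre E b" "v \<in> fibre E b" "w \<in> fibre E b"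
  shows "vinner E u v = vinner E v u" "vinner E (vadd E u v) w = vinner E u w + vinner E v w"
    "vinner E (vscale E c u) v = c * vinner E u v" "u \<noteq> vscale E 0 u \<Longrightarrow> vinner E u u > 0"
  using oriented assms unfolding oriented_euclidean_vector_bundle_def euclidean_metric_def by blast+

lemma gram:
  assumes b: "b \<in> topspace (base E)" and L: "L \<in> orient E b"
  shows "vinner E (L x) (L y) = x \<bullet> (gram L *v y)" "gram L \<in> positive_forms"
proof -
  note F = orient_frame[OF b L]
  have lin: "linear (\<lambda>x. vinner E (L x) v)" if "v \<in> fibre E b" for v
    by (rule linearI) (simp_all only: F(5,6) vinner_facts(2)[OF b F(1) F(1) that] vinner_facts(3)[OF b F(1) that that], simp)
  have sym: "vinner E (L x) (L y) = vinner E (L y) (L x)" for x y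
    by (rule vinner_facts(1)[OF b F(1) F(1) F(1)[of 0]])
  have exp: "x = (\<Sum>i\<in>UNIV. x $ i *\<^sub>R axis i 1)" for x :: "real^'n"
    using basis_expansion[of x] by (simp add: scalar_mult_eq_scaleR)
  have e: "vinner E (L x) v = (\<Sum>i\<in>UNIV. x $ i * vinner E (L (axis i 1)) v)" if "v \<in> fibre E b" for x v
    by (subst exp[of x], subst linear_sum[OF lin[OF that]], simp add: linear_scale[OF lin[OF that]])
  show main: "vinner E (L x) (L y) = x \<bullet> (gram L *v y)" for x y
  proof -
    have "vinner E (L (axis i 1)) (L y) = (\<Sum>j\<in>UNIV. y $ j * vinner E (L (axis i 1)) (L (axis j 1)))" for i
    proof -
      have "vinner E (L (axis i 1)) (L y) = vinner E (L y) (L (axis i 1))" by (rule sym)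
      also have "\<dots> = (\<Sum>j\<in>UNIV. y $ j * vinner E (L (axis j 1)) (L (axis i 1)))" by (rule e[OF F(1)])
      also have "\<dots> = (\<Sum>j\<in>UNIV. y $ j * vinner E (L (axis i 1)) (L (axis j 1)))"
        by (intro sum.cong refl arg_cong2[of _ _ _ _ "(*)"] sym)
      finally show ?thesis .
    qed
    then show ?thesis
      by (simp add: e[OF F(1), of x y] inner_vec_def matrix_vector_mult_def gram_def mult.commute)
  qed
  have "x \<bullet> (gram L *v x) > 0" if "x \<noteq> 0" for x
  proof -
    \<comment> \<open>Scaling by 0 stands for the zero vector of the fibre; injectivity of the frame
      separates it from \<open>L x\<close>.\<close>
    have "L x \<noteq> L (0 *\<^sub>R x)" using F(4) that by (auto simp: bij_betw_def inj_eq)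
    then have "L x \<noteq> vscale E 0 (L x)" by (metis F(6))
    then have "vinner E (L x) (L x) > 0" using vinner_facts(4)[OF b F(1) F(1) F(1)] by blast
    then show ?thesis by (simp add: main)
  qed
  moreover have "x \<bullet> (gram L *v y) = y \<bullet> (gram L *v x)" for x y
    using sym[of x y] by (simp add: main)
  ultimately show "gram L \<in> positive_forms" by (simp add: positive_forms_def)
qed

end

section \<open>Trivialization over a suspension\<close>

lemma continuous_map_susp_map: "continuous_map (prod_topology X unit_interval) (suspension X) susp_map"
  unfolding continuous_map_def
proof (intro conjI allI impI funcsetI)
  fix z assume "z \<in> topspace (prod_topology X unit_interval)"
  then show "susp_map z \<in> topspace (suspension X)"
    by (auto simp: topspace_suspension susp_points_def)
next
  fix W assume "openin (suspension X) W"
  then show "openin (prod_topology X unit_interval) {z \<in> topspace (prod_topology X unit_interval). susp_map z \<in> W}"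
    by (simp add: openin_suspension)
qed

lemma susp_map_simps [simp]:
  "susp_map (x, 0) = South" "susp_map (x, 1) = North"
  by (simp_all add: susp_map_def)

lemma susp_pointsI: "x \<in> topspace X \<Longrightarrow> t \<in> {0..1} \<Longrightarrow> susp_map (x, t) \<in> susp_points X"
  "South \<in> susp_points X" "North \<in> susp_points X"
  by (auto simp: susp_points_def)

lemma susp_points_cases:
  assumes "b \<in> susp_points X"
  obtains "b = South" | "b = North" | x t where "x \<in> topspace X" "t \<in> {0..1}" "b = susp_map (x, t)"
  using assms unfolding susp_points_def by auto

text \<open>The closure of an open cell is compact, being closed in the image of a disc, so a set
  that is closed on compact sets is closed on each cell closure. The property serves paths of gauge
  transformations, because the compact-open topology sees maps on compact sets only.\<close>

lemma CW_complex_k_space: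
  assumes "CW_complex X"
  shows "k_space X"
proof -
  obtain C where H: "Hausdorff_space X" and C: "CW_structure X C"
    using assms by (auto simp: CW_complex_def)
  note D = C[unfolded CW_structure_def]
  note cells = D[THEN conjunct1]
    and weak = D[THEN conjunct2, THEN conjunct2, THEN conjunct2, THEN conjunct2]
  show ?thesis
    unfolding k_space_def
  proof (intro allI impI iffI)
    fix S assume S: "S \<subseteq> topspace X"
    { fix K assume "closedin X S" "compactin X K"
      then show "closedin (subtopology X K) (K \<inter> S)" by (simp add: closedin_subtopology_Int_closed)
    }
    assume K: "\<forall>K. compactin X K \<longrightarrow> closedin (subtopology X K) (K \<inter> S)"
    have "closedin X (S \<inter> (X closure_of (\<Phi> ` disc_interior n)))" if c: "(n, \<Phi>) \<in> C" for n \<Phi>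
    proof -
      have \<Phi>: "continuous_map (disc n) X \<Phi>" using bspec[OF cells c] by simp
      have comp: "compactin X (\<Phi> ` topspace (disc n))"
        using image_compactin[OF _ \<Phi>] compact_disc[of n] by (simp add: compact_space_def)
      then have "closedin X (\<Phi> ` topspace (disc n))" using H by (simp add: compactin_imp_closedin)
      then have "X closure_of (\<Phi> ` disc_interior n) \<subseteq> \<Phi> ` topspace (disc n)"
        by (intro closure_of_minimal) (auto simp: disc_interior_def)
      then have "compactin X (X closure_of (\<Phi> ` disc_interior n))"
        using closed_compactin[OF comp] by simp
      then have "closedin (subtopology X (X closure_of (\<Phi> ` disc_interior n))) ((X closure_of (\<Phi> ` disc_interior n)) \<inter> S)"
        using K by blast
      then show ?thesis by (metis closedin_closure_of closedin_trans_full inf_commute)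
    qed
    then have "\<forall>(n, \<Phi>)\<in>C. closedin X (S \<inter> (X closure_of (\<Phi> ` disc_interior n)))" by blast
    with weak[rule_format, OF S] show "closedin X S" by (rule iffD2)
  qed
qed

text \<open>Over an open set the quotient map remains a quotient map, and so does its product with
  the interval, which is locally compact. The hypotheses at the poles settle the empty space, whose
  suspension consists of two isolated points that no segment reaches.\<close>

lemma continuous_map_suspension_open:
  fixes X :: "'a topology" and f :: "real \<times> 'a susp \<Rightarrow> 'c"
  assumes U: "openin (suspension X) U"
    and f: "continuous_map (prod_topology unit_interval
        (subtopology (prod_topology X unit_interval) {z \<in> topspace (prod_topology X unit_interval). susp_map z \<in> U})) W
        (\<lambda>(s, z). f (s, susp_map z))"
    and S: "South \<in> U \<Longrightarrow> continuous_map unit_interval W (\<lambda>s. f (s, South))"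
    and N: "North \<in> U \<Longrightarrow> continuous_map unit_interval W (\<lambda>s. f (s, North))"
  shows "continuous_map (prod_topology unit_interval (subtopology (suspension X) U)) W f"
proof (cases "topspace X = {}")
  case False
  let ?XI = "prod_topology X unit_interval"
  let ?V = "{z \<in> topspace ?XI. susp_map z \<in> U}"
  have "quotient_map ?XI (suspension X) susp_map" by (rule quotient_map_susp_map[OF False])
  then have "quotient_map (subtopology ?XI ?V) (subtopology (suspension X) U) susp_map"
    by (rule quotient_map_restriction) (use U in auto)
  then have q: "quotient_map (prod_topology unit_interval (subtopology ?XI ?V)) (prod_topology unit_interval (subtopology (suspension X) U))
      (\<lambda>(s, z). (s, susp_map z))"
    by (intro quotient_map_prod_right)
      (auto simp: compact_imp_locally_compact_space compact_space_subtopology Hausdorff_space_subtopology)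
  have "f \<circ> (\<lambda>(s, z). (s, susp_map z)) = (\<lambda>(s, z). f (s, susp_map z))" by (simp add: fun_eq_iff)
  with f have "continuous_map (prod_topology unit_interval (subtopology ?XI ?V)) W (f \<circ> (\<lambda>(s, z). (s, susp_map z)))" by simp
  then show ?thesis by (rule continuous_compose_quotient_map[OF q])
next
  case True
  then have top: "topspace (suspension X) = {South, North}" by (simp add: topspace_suspension susp_points_def)
  have op: "openin (suspension X) {b}" if "b \<in> {South, North}" for b
    using that True by (simp add: openin_suspension susp_points_def)
  show ?thesis
  proof (rule pasting_lemma[where I = "U \<inter> {South, North}" and T = "\<lambda>b. {0..1} \<times> {b}" and f = "\<lambda>_. f"])
    fix b assume b: "b \<in> U \<inter> {South, North}"
    have "openin (subtopology (suspension X) U) {b}"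
      using op[of b] b by (auto simp: openin_subtopology intro!: exI[of _ "{b}"])
    then show "openin (prod_topology unit_interval (subtopology (suspension X) U)) ({0..1} \<times> {b})"
      using openin_topspace[of unit_interval] by (simp add: openin_prod_Times_iff)
    have "continuous_map unit_interval W (\<lambda>s. f (s, b))" using b S N by auto
    from continuous_map_compose[OF continuous_map_fst this]
    have "continuous_map (prod_topology unit_interval (subtopology (suspension X) U)) W (\<lambda>w. f (fst w, b))" by (simp add: o_def)
    then have "continuous_map (subtopology (prod_topology unit_interval (subtopology (suspension X) U)) ({0..1} \<times> {b})) W (\<lambda>w. f (fst w, b))"
      by (rule continuous_map_from_subtopology)
    then show "continuous_map (subtopology (prod_topology unit_interval (subtopology (suspension X) U)) ({0..1} \<times> {b})) W f"
      by (rule continuous_map_eq) auto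
  qed (use top in auto)
qed

lemma continuous_map_suspension:
  fixes X :: "'a topology" and f :: "real \<times> 'a susp \<Rightarrow> 'c"
  assumes f: "continuous_map (prod_topology unit_interval (prod_topology X unit_interval)) W (\<lambda>(s, z). f (s, susp_map z))"
    and S: "continuous_map unit_interval W (\<lambda>s. f (s, South))"
    and N: "continuous_map unit_interval W (\<lambda>s. f (s, North))"
  shows "continuous_map (prod_topology unit_interval (suspension X)) W f"
proof -
  have eq: "{z \<in> topspace (prod_topology X unit_interval). susp_map z \<in> topspace (suspension X)} = topspace (prod_topology X unit_interval)"
    using continuous_map_image_subset_topspace[OF continuous_map_susp_map[of X]] by blast
  have "continuous_map (prod_topology unit_interval (subtopology (suspension X) (topspace (suspension X)))) W f"
    by (rule continuous_map_suspension_open[OF openin_topspace _ S N]) (simp only: eq subtopology_topspace f)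
  then show ?thesis by simp
qed

lemma continuous_map_compact_open_eval:
  fixes K :: "'k topology" and S :: "'s topology"
  assumes \<psi>: "continuous_map S (compact_open Y Z) \<psi>" and c: "continuous_map K Y c"
    and K: "compact_space K" "Hausdorff_space K"
  shows "continuous_map (prod_topology S K) Z (\<lambda>(s, k). \<psi> s (c k))"
proof -
  let ?sub = "\<lambda>C U. {f \<in> extensional (topspace Y). continuous_map Y Z f \<and> f ` C \<subseteq> U}"
  have sub: "openin (compact_open Y Z) (?sub C U)" if "compactin Y C" "openin Z U" for C U
    unfolding compact_open_def by (rule topology_generated_by_Basis) (use that in blast)
  have top: "f \<in> extensional (topspace Y) \<and> continuous_map Y Z f" if "f \<in> topspace (compact_open Y Z)" for f
    using that unfolding compact_open_def topology_generated_by_topspace by blast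
  have \<psi>c: "continuous_map Y Z (\<psi> s)" if "s \<in> topspace S" for s
  proof -
    have "\<psi> s \<in> topspace (compact_open Y Z)"
      using continuous_map_image_subset_topspace[OF \<psi>] that by auto
    from top[OF this] show ?thesis ..
  qed
  have \<psi>e: "\<psi> s \<in> extensional (topspace Y)" if "s \<in> topspace S" for s
  proof -
    have "\<psi> s \<in> topspace (compact_open Y Z)"
      using continuous_map_image_subset_topspace[OF \<psi>] that by auto
    from top[OF this] show ?thesis ..
  qed
  have reg: "neighbourhood_base_of (closedin K) K"
    using compact_Hausdorff_imp_regular_space[OF K] neighbourhood_base_of_closedin by blast
  have "openin (prod_topology S K) {w \<in> topspace (prod_topology S K). (case w of (s, k) \<Rightarrow> \<psi> s (c k)) \<in> V}"
    if V: "openin Z V" for V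
    unfolding openin_prod_topology_alt
  proof (intro allI impI)
    fix s0 k0 assume "(s0, k0) \<in> {w \<in> topspace (prod_topology S K). (case w of (s, k) \<Rightarrow> \<psi> s (c k)) \<in> V}"
    then have s0: "s0 \<in> topspace S" and k0: "k0 \<in> topspace K" and in_V: "\<psi> s0 (c k0) \<in> V" by auto
    have "continuous_map K Z (\<lambda>k. \<psi> s0 (c k))"
      using continuous_map_compose[OF c \<psi>c[OF s0]] by (simp add: o_def)
    then have "openin K {k \<in> topspace K. \<psi> s0 (c k) \<in> V}" using V by (rule openin_continuous_map_preimage)
    then obtain Ok C where OC: "openin K Ok" "closedin K C" "k0 \<in> Ok" "Ok \<subseteq> C" "C \<subseteq> {k \<in> topspace K. \<psi> s0 (c k) \<in> V}"
      using reg k0 in_V unfolding neighbourhood_base_of by (metis (mono_tags, lifting) mem_Collect_eq)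
    have "compactin K C" using K(1) OC(2) by (simp add: closedin_compact_space)
    then have cC: "compactin Y (c ` C)" using c by (rule image_compactin)
    have "openin S {s \<in> topspace S. \<psi> s \<in> ?sub (c ` C) V}"
      by (rule openin_continuous_map_preimage[OF \<psi> sub[OF cC V]])
    moreover have "\<psi> s0 \<in> ?sub (c ` C) V"
      using OC(5) \<psi>c[OF s0] \<psi>e[OF s0] by blast
    ultimately show "\<exists>U W. openin S U \<and> openin K W \<and> s0 \<in> U \<and> k0 \<in> W \<and>
        U \<times> W \<subseteq> {w \<in> topspace (prod_topology S K). (case w of (s, k) \<Rightarrow> \<psi> s (c k)) \<in> V}"
    proof (intro exI conjI)
      show "{s \<in> topspace S. \<psi> s \<in> ?sub (c ` C) V} \<times> Ok \<subseteq>
          {w \<in> topspace (prod_topology S K). (case w of (s, k) \<Rightarrow> \<psi> s (c k)) \<in> V}"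
      proof
        fix w assume w: "w \<in> {s \<in> topspace S. \<psi> s \<in> ?sub (c ` C) V} \<times> Ok"
        obtain s k where sk: "w = (s, k)" by (cases w)
        then have "\<psi> s ` c ` C \<subseteq> V" "k \<in> C" "s \<in> topspace S" using w OC(4) by auto
        moreover have "k \<in> topspace K" using \<open>k \<in> C\<close> OC(5) by blast
        ultimately show "w \<in> {w \<in> topspace (prod_topology S K). (case w of (s, k) \<Rightarrow> \<psi> s (c k)) \<in> V}"
          by (auto simp: sk)
      qed
    qed (use OC s0 in simp_all)
  qed
  moreover have "\<psi> s (c k) \<in> topspace Z" if "s \<in> topspace S" "k \<in> topspace K" for s k
    using \<psi>c[OF that(1)] c that(2) by (auto simp: continuous_map_def)
  ultimately show ?thesis by (auto simp: continuous_map_def)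
qed

text \<open>By the tube lemma the parameters \<open>s\<close> for which \<open>\<psi> s\<close>
  sends a compact set into a given open set form an open set.\<close>

lemma continuous_map_into_compact_open:
  assumes F: "continuous_map (prod_topology S Y) Z (\<lambda>(s, y). \<psi> s y)"
    and ext: "\<And>s. s \<in> topspace S \<Longrightarrow> \<psi> s \<in> extensional (topspace Y)"
  shows "continuous_map S (compact_open Y Z) \<psi>"
proof -
  have \<psi>c: "continuous_map Y Z (\<psi> s)" if "s \<in> topspace S" for s
  proof -
    have "continuous_map Y (prod_topology S Y) (\<lambda>y. (s, y))" using that by (simp add: continuous_map_pairedI)
    from continuous_map_compose[OF this F] show ?thesis by (simp add: o_def)
  qed
  show ?thesis
    unfolding compact_open_def
  proof (rule continuous_on_generated_topo)
    fix W assume "W \<in> {{f \<in> extensional (topspace Y). continuous_map Y Z f \<and> f ` K \<subseteq> U} | K U. compactin Y K \<and> openin Z U}"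
    then obtain K U where W: "W = {f \<in> extensional (topspace Y). continuous_map Y Z f \<and> f ` K \<subseteq> U}"
      and K: "compactin Y K" and U: "openin Z U" by blast
    let ?O = "{w \<in> topspace (prod_topology S Y). (case w of (s, y) \<Rightarrow> \<psi> s y) \<in> U}"
    have O: "openin (prod_topology S Y) ?O" using F U by (rule openin_continuous_map_preimage)
    have KY: "K \<subseteq> topspace Y" using K by (rule compactin_subset_topspace)
    show "openin S (\<psi> -` W \<inter> topspace S)"
    proof (subst openin_subopen, intro ballI)
      fix s assume s: "s \<in> \<psi> -` W \<inter> topspace S"
      then have "{s} \<times> K \<subseteq> ?O" using KY by (auto simp: W)
      from tube_lemma_right[OF O K _ this] s obtain A B where AB: "openin S A" "s \<in> A" "K \<subseteq> B" "A \<times> B \<subseteq> ?O"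
        by auto
      have A01: "A \<subseteq> topspace S" using openin_subset[OF AB(1)] .
      have "A \<subseteq> \<psi> -` W \<inter> topspace S"
      proof
        fix r assume r: "r \<in> A"
        then have r01: "r \<in> topspace S" using A01 by blast
        have "\<psi> r ` K \<subseteq> U"
        proof (rule image_subsetI)
          fix k assume "k \<in> K"
          then have "(r, k) \<in> A \<times> B" using AB(3) r by blast
          with AB(4) have "(r, k) \<in> ?O" by (rule subsetD)
          then show "\<psi> r k \<in> U" by simp
        qed
        then show "r \<in> \<psi> -` W \<inter> topspace S" using r01 ext[OF r01] \<psi>c[OF r01] by (simp add: W)
      qed
      with AB show "\<exists>T. openin S T \<and> s \<in> T \<and> T \<subseteq> \<psi> -` W \<inter> topspace S" by blast
    qed
  next
    have "\<psi> s \<in> {f \<in> extensional (topspace Y). continuous_map Y Z f \<and> f ` {} \<subseteq> {}}" if "s \<in> topspace S" for s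
      using ext[OF that] \<psi>c[OF that] by simp
    moreover have "{f \<in> extensional (topspace Y). continuous_map Y Z f \<and> f ` {} \<subseteq> {}} \<in>
      {{f \<in> extensional (topspace Y). continuous_map Y Z f \<and> f ` K \<subseteq> U} | K U. compactin Y K \<and> openin Z U}"
      by (rule CollectI, rule exI[of _ "{}"], rule exI[of _ "{}"]) simp
    ultimately show "\<psi> ` topspace S \<subseteq>
      \<Union> {{f \<in> extensional (topspace Y). continuous_map Y Z f \<and> f ` K \<subseteq> U} | K U. compactin Y K \<and> openin Z U}"
      using image_subsetI[where f = \<psi> and A = "topspace S"] UnionI by (metis (no_types, lifting))
  qed
qed

section \<open>Orthonormal frames\<close>

context oriented_bundle
begin

definition orthonormalized :: "(real^'n^'n \<Rightarrow> real^'n^'n) \<Rightarrow> (real^'n \<Rightarrow> 'e) \<Rightarrow> real^'n \<Rightarrow> 'e" where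
  "orthonormalized C L x = L (C (gram L) *v x)"

lemma orient_compose:
  assumes "b \<in> topspace (base E)" "L \<in> orient E b" "det A > 0"
  shows "(\<lambda>x. L (A *v x)) \<in> orient E b"
proof -
  have "L \<circ> (\<lambda>x. A *v x) \<in> orient E b" using orient_eq[OF assms(1,2)] assms(3) by blast
  then show ?thesis by (simp add: o_def)
qed

text \<open>The inner products are the entries of the transition matrix. It preserves norms because
  both frames are isometric, and its determinant is positive because both are oriented.\<close>

lemma orthonormal_frame_change:
  assumes b: "b \<in> topspace (base E)" and L: "L \<in> orient E b" "L' \<in> orient E b"
    and iso: "\<And>x y. vinner E (L x) (L y) = x \<bullet> y" "\<And>x y. vinner E (L' x) (L' y) = x \<bullet> y"
  shows "rotation_matrix (\<chi> i j. vinner E (L (axis i 1)) (L' (axis j 1)))"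
    "L' x = L ((\<chi> i j. vinner E (L (axis i 1)) (L' (axis j 1))) *v x)"
proof -
  obtain A where A: "L' = L \<circ> (\<lambda>x. A *v x)" "det A > 0" using orient_eq[OF b L(1)] L(2) by blast
  have e: "(\<chi> i j. vinner E (L (axis i 1)) (L' (axis j 1))) = A"
    by (simp add: vec_eq_iff A(1) iso(1) inner_axis' matrix_vector_mult_basis column_def)
  have "norm (A *v x) = norm x" for x
    using iso(1)[of "A *v x" "A *v x"] iso(2)[of x x] by (simp add: A(1) norm_eq)
  then have "orthogonal_matrix A"
    using orthogonal_transformation_matrix[of "(*v) A"] by (simp add: orthogonal_transformation)
  then have "rotation_matrix A" using A(2) det_orthogonal_matrix[of A] by (auto simp: rotation_matrix_def)
  then show "rotation_matrix (\<chi> i j. vinner E (L (axis i 1)) (L' (axis j 1)))"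
    "L' x = L ((\<chi> i j. vinner E (L (axis i 1)) (L' (axis j 1))) *v x)"
    unfolding e by (simp_all add: A(1))
qed

end

text \<open>A single frame at the south pole is lifted along all segments of the suspension and
  orthonormalized. The frames that arrive over the north pole depend on the segment; comparing them
  with one fixed frame defines \<open>g\<close>.\<close>

lemma suspension_trivialization:
  fixes E :: "('a susp, 'e, 'n::finite) bundle_data"
  assumes E: "oriented_euclidean_vector_bundle E" and base: "base E = suspension X" and X: "CW_complex X"
  obtains frm :: "'a susp \<Rightarrow> real^'n \<Rightarrow> 'e" and g :: "'a \<Rightarrow> real^'n^'n" where
    "\<And>b. b \<in> susp_points X \<Longrightarrow> frm b \<in> orient E b"
    "\<And>b x y. b \<in> susp_points X \<Longrightarrow> vinner E (frm b x) (frm b y) = x \<bullet> y"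
    "continuous_map X special_orthogonal g"
    "\<And>v. continuous_map (prod_topology X unit_interval) (total E)
       (\<lambda>(x, t). if t = 1 then frm North (g x *v v) else frm (susp_map (x, t)) v)"
proof -
  interpret oriented_bundle E by standard (rule E)
  interpret transport_fibration "frame_space E" "base E" "\<lambda>L. proj E (L 0)" by (rule frame_space_transport)
  let ?XI = "prod_topology X unit_interval"
  have pts: "topspace (base E) = susp_points X" by (simp add: base topspace_suspension)
  obtain C0 where HX: "Hausdorff_space X" and C0: "CW_structure X C0"
    using X by (auto simp: CW_complex_def)
  obtain L0 where L0: "L0 \<in> orient E South" using orient_nonempty[of South] susp_pointsI(2)[of X] by (auto simp: pts)
  obtain L1 where L1: "L1 \<in> orient E North" using orient_nonempty[of North] susp_pointsI(3)[of X] by (auto simp: pts)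
  have So: "South \<in> topspace (base E)" "North \<in> topspace (base E)" by (simp_all add: pts susp_pointsI)
  have h: "continuous_map ?XI (base E) susp_map" unfolding base by (rule continuous_map_susp_map)
  have s0: "lift_over X (\<lambda>x. susp_map (x, 0)) (\<lambda>_. L0)"
    using L0 So orient_frame(3)[OF So(1) L0] by (auto simp: lift_over_def topspace_frame_space)
  obtain s where s: "lift_over ?XI susp_map s" "\<And>x. x \<in> topspace X \<Longrightarrow> s (x, 0) = L0"
    using CW_lift_extension[OF HX C0 h s0] by blast
  have so: "susp_map z \<in> topspace (base E) \<and> s z \<in> orient E (susp_map z)" if z: "z \<in> topspace ?XI" for z
  proof -
    have "s z \<in> topspace (frame_space E)" "proj E (s z 0) = susp_map z"
      using s(1) z by (auto simp: lift_over_def continuous_map_def)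
    then obtain b where "b \<in> topspace (base E)" "s z \<in> orient E b" by (auto simp: topspace_frame_space)
    moreover from this have "b = susp_map z" using orient_frame(3) \<open>proj E (s z 0) = susp_map z\<close> by metis
    ultimately show ?thesis by simp
  qed
  obtain C :: "real^'n^'n \<Rightarrow> real^'n^'n" where C: "continuous_on positive_forms C"
    "\<And>M x y. M \<in> positive_forms \<Longrightarrow> (C M *v x) \<bullet> (M *v (C M *v y)) = x \<bullet> y"
    "\<And>M. M \<in> positive_forms \<Longrightarrow> det (C M) > 0" by (rule gram_schmidt) blast
  let ?N = "orthonormalized C"
  have N: "?N L \<in> orient E b" "vinner E (?N L x) (?N L y) = x \<bullet> y" if "b \<in> topspace (base E)" "L \<in> orient E b" for b L x y
  proof -
    note G = gram[OF that]
    show "?N L \<in> orient E b" using orient_compose[OF that C(3)[OF G(2)]] by (simp add: orthonormalized_def[abs_def])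
    show "vinner E (?N L x) (?N L y) = x \<bullet> y" by (simp add: orthonormalized_def G(1) C(2)[OF G(2)])
  qed
  \<comment> \<open>The north pole is one point and carries one frame, so the fixed
    \<open>L1\<close> replaces the various limits of lifted frames; \<open>g\<close> records the
    discrepancy.\<close>
  define frm where "frm = (\<lambda>b. case b of South \<Rightarrow> ?N L0 | North \<Rightarrow> ?N L1 | Level x t \<Rightarrow> ?N (s (x, t)))"
  define g where "g = (\<lambda>x. \<chi> i j. vinner E (?N L1 (axis i 1)) (?N (s (x, 1)) (axis j 1)))"
  have fl: "frm (susp_map (x, t)) = ?N (s (x, t))" if "x \<in> topspace X" "t \<in> {0..1}" "t \<noteq> 1" for x t
    using that s(2)[of x] by (auto simp: frm_def susp_map_def)
  have cs: "continuous_map ?XI (total E) (\<lambda>z. s z v)" for v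
    using s(1) by (simp add: lift_over_def continuous_map_frame_space)
  have cgram: "continuous_map ?XI (top_of_set positive_forms) (\<lambda>z. gram (s z))"
    unfolding continuous_map_in_subtopology
  proof
    show "continuous_map ?XI euclidean (\<lambda>z. gram (s z))"
    proof (intro continuous_map_vecI)
      fix i j
      have "continuous_map ?XI euclideanreal (\<lambda>z. vinner E (s z (axis i 1)) (s z (axis j 1)))"
      proof (rule continuous_map_vinner[OF cs cs])
        fix z assume "z \<in> topspace ?XI"
        then show "proj E (s z (axis i 1)) = proj E (s z (axis j 1))" using so orient_frame(3) by metis
      qed
      then show "continuous_map ?XI euclideanreal (\<lambda>z. gram (s z) $ i $ j)" by (simp add: gram_def)
    qed
    show "(\<lambda>z. gram (s z)) \<in> topspace ?XI \<rightarrow> positive_forms" using so gram(2) by blast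
  qed
  have "continuous_map (top_of_set positive_forms) euclidean C" using C(1) by simp
  from continuous_map_compose[OF cgram this]
  have cC: "continuous_map ?XI euclidean (\<lambda>z. C (gram (s z)))" by (simp add: o_def)
  have cN: "continuous_map ?XI (total E) (\<lambda>z. ?N (s z) v)" for v
    unfolding orthonormalized_def
    by (rule continuous_map_frame_apply[OF cs so]) (auto intro: continuous_map_matrix_vector_mult cC)
  have top1: "(x, 1) \<in> topspace ?XI" if "x \<in> topspace X" for x using that by simp
  have g1: "rotation_matrix (g x)" "?N (s (x, 1)) v = ?N L1 (g x *v v)" if "x \<in> topspace X" for x v
  proof -
    have o1: "s (x, 1) \<in> orient E North" using so[OF top1[OF that]] by simp
    note change = orthonormal_frame_change[OF So(2) N(1)[OF So(2) L1] N(1)[OF So(2) o1] N(2)[OF So(2) L1] N(2)[OF So(2) o1]]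
    show "rotation_matrix (g x)" unfolding g_def by (rule change(1))
    show "?N (s (x, 1)) v = ?N L1 (g x *v v)" unfolding g_def by (rule change(2))
  qed
  show ?thesis
  proof (rule that[of frm g])
    fix b assume "b \<in> susp_points X"
    then have "\<exists>L. L \<in> orient E b \<and> b \<in> topspace (base E) \<and> frm b = ?N L"
    proof (cases rule: susp_points_cases)
      case (3 x t)
      show ?thesis
      proof (cases "t = 1")
        case True
        then show ?thesis using 3 L1 So by (auto simp: frm_def)
      next
        case False
        have "(x, t) \<in> topspace ?XI" using 3 by simp
        from so[OF this] show ?thesis unfolding 3(3) fl[OF 3(1,2) False] by blast
      qed
    qed (use L0 L1 So in \<open>auto simp: frm_def\<close>)
    then show "frm b \<in> orient E b" "vinner E (frm b x) (frm b y) = x \<bullet> y" for x y using N by auto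
  next
    have "continuous_map X ?XI (\<lambda>x. (x, 1))" by (simp add: continuous_map_pairedI)
    from continuous_map_compose[OF this cN]
    have c1: "continuous_map X (total E) (\<lambda>x. ?N (s (x, 1)) v)" for v by (simp add: o_def)
    have LN: "?N L1 v \<in> topspace (total E)" for v using orient_frame(2)[OF So(2) N(1)[OF So(2) L1]] .
    show "continuous_map X special_orthogonal g"
      unfolding continuous_map_special_orthogonal
    proof
      show "continuous_map X euclidean g"
      proof (intro continuous_map_vecI)
        fix i j
        have "continuous_map X euclideanreal (\<lambda>x. vinner E (?N L1 (axis i 1)) (?N (s (x, 1)) (axis j 1)))"
        proof (rule continuous_map_vinner)
          fix x assume x: "x \<in> topspace X"
          have o1: "s (x, 1) \<in> orient E North" using so[OF top1[OF x]] by simp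
          show "proj E (?N L1 (axis i 1)) = proj E (?N (s (x, 1)) (axis j 1))"
            using orient_frame(3)[OF So(2) N(1)[OF So(2) L1]] orient_frame(3)[OF So(2) N(1)[OF So(2) o1]] by simp
        qed (use c1 LN in auto)
        then show "continuous_map X euclideanreal (\<lambda>x. g x $ i $ j)" by (simp add: g_def)
      qed
    qed (use g1 in auto)
    fix v
    show "continuous_map ?XI (total E) (\<lambda>(x, t). if t = 1 then frm North (g x *v v) else frm (susp_map (x, t)) v)"
      using cN[of v] by (rule continuous_map_eq) (use g1 fl in \<open>auto simp: frm_def\<close>)
  qed
qed

section \<open>Gauge transformations in coordinates\<close>

locale trivialized_bundle = oriented_bundle E for E :: "('a susp, 'e, 'n::finite) bundle_data" +
  fixes X :: "'a topology" and frm :: "'a susp \<Rightarrow> real^'n \<Rightarrow> 'e" and g :: "'a \<Rightarrow> real^'n^'n"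
  assumes base: "base E = suspension X"
    and k_space_X: "k_space X" and Hausdorff_X: "Hausdorff_space X"
    and frm_orient: "b \<in> susp_points X \<Longrightarrow> frm b \<in> orient E b"
    and frm_inner: "b \<in> susp_points X \<Longrightarrow> vinner E (frm b x) (frm b y) = x \<bullet> y"
    and continuous_g: "continuous_map X special_orthogonal g"
    and continuous_frm: "continuous_map (prod_topology X unit_interval) (total E)
       (\<lambda>(x, t). if t = 1 then frm North (g x *v v) else frm (susp_map (x, t)) v)"
begin

abbreviation XI :: "('a \<times> real) topology" where "XI \<equiv> prod_topology X unit_interval"

text \<open>The continuous frame over the cylinder: at height 1 the factor \<open>g\<close> restores
  the limit of the frames along each segment.\<close>

definition fr :: "'a \<times> real \<Rightarrow> real^'n \<Rightarrow> 'e" where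
  "fr z v = (if snd z = 1 then frm North (g (fst z) *v v) else frm (susp_map z) v)"

text \<open>The matrix of \<open>gauge_of d\<close> in the frame \<open>fr z\<close>. Over the north
  pole the change of frame turns into conjugation by \<open>g\<close>.\<close>

definition tw :: "('a susp \<Rightarrow> real^'n^'n) \<Rightarrow> 'a \<times> real \<Rightarrow> real^'n^'n" where
  "tw d z = (if snd z = 1 then transpose (g (fst z)) ** d North ** g (fst z) else d (susp_map z))"

definition coord :: "'a susp \<Rightarrow> 'e \<Rightarrow> real^'n" where
  "coord b v = (\<chi> i. vinner E (frm b (axis i 1)) v)"

definition gauge_of :: "('a susp \<Rightarrow> real^'n^'n) \<Rightarrow> 'e \<Rightarrow> 'e" where
  "gauge_of d = (\<lambda>v\<in>topspace (total E). frm (proj E v) (d (proj E v) *v coord (proj E v) v))"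

text \<open>A family of gauge transformations in coordinates: over the north pole the frame \<open>frm North\<close>
  differs from the limit of the frames along \<open>{x} \<times> [0, 1)\<close> by the clutching map \<open>g\<close>.\<close>

definition twisted_family :: "(real \<Rightarrow> 'a susp \<Rightarrow> real^'n^'n) \<Rightarrow> bool" where
  "twisted_family d \<longleftrightarrow> continuous_map unit_interval special_orthogonal (\<lambda>s. d s South) \<and>
     continuous_map unit_interval special_orthogonal (\<lambda>s. d s North) \<and>
     continuous_map (prod_topology unit_interval XI) special_orthogonal (\<lambda>(s, z). tw (d s) z)"

section \<open>Frames, coordinates and the matrix of a gauge transformation\<close>

lemma points: "topspace (base E) = susp_points X"
  by (simp add: base topspace_suspension)

lemma g_rot: "x \<in> topspace X \<Longrightarrow> rotation_matrix (g x)"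
  using continuous_g by (simp add: continuous_map_special_orthogonal)

lemma susp_map_points: "z \<in> topspace XI \<Longrightarrow> susp_map z \<in> susp_points X"
  by (auto intro: susp_pointsI)

lemma susp_map_1: "snd z = 1 \<Longrightarrow> susp_map z = North"
  by (cases z) simp

lemma fr_orient: "z \<in> topspace XI \<Longrightarrow> fr z \<in> orient E (susp_map z)"
proof (cases "snd z = 1")
  case True
  assume z: "z \<in> topspace XI"
  then have "rotation_matrix (g (fst z))" by (auto intro: g_rot)
  then have "(\<lambda>v. frm North (g (fst z) *v v)) \<in> orient E North"
    by (intro orient_compose) (auto simp: points frm_orient susp_pointsI rotation_matrix_def)
  then show ?thesis using True by (simp add: fr_def[abs_def] susp_map_1)
next
  case False
  assume "z \<in> topspace XI"
  then show ?thesis using False frm_orient[OF susp_map_points] by (simp add: fr_def[abs_def])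
qed

lemma fr_inner: "z \<in> topspace XI \<Longrightarrow> vinner E (fr z x) (fr z y) = x \<bullet> y"
proof (cases "snd z = 1")
  case True
  assume z: "z \<in> topspace XI"
  then have "orthogonal_matrix (g (fst z))" using g_rot[of "fst z"] by (auto simp: rotation_matrix_def)
  then show ?thesis using True by (simp add: fr_def frm_inner susp_pointsI orthogonal_matrix_dot)
qed (simp add: fr_def frm_inner susp_map_points)

lemma continuous_fr: "continuous_map XI (total E) (\<lambda>z. fr z v)"
  using continuous_frm[of v] by (rule continuous_map_eq) (auto simp: fr_def)

lemma coord_frm: "b \<in> susp_points X \<Longrightarrow> coord b (frm b x) = x"
  by (simp add: coord_def frm_inner inner_axis' vec_eq_iff)

lemma frm_fibre: "b \<in> susp_points X \<Longrightarrow> frm b x \<in> fibre E b"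
  and frm_total: "b \<in> susp_points X \<Longrightarrow> frm b x \<in> topspace (total E)"
  and proj_frm: "b \<in> susp_points X \<Longrightarrow> proj E (frm b x) = b"
  using orient_frame(1-3)[of b "frm b"] by (simp_all add: points frm_orient)

lemma fibre_frm:
  assumes "b \<in> susp_points X" "v \<in> fibre E b"
  obtains x where "v = frm b x"
  using orient_frame(4)[of b "frm b"] assms by (auto simp: points frm_orient bij_betw_def)

lemma total_cases:
  assumes "v \<in> topspace (total E)"
  obtains b x where "b \<in> susp_points X" "v = frm b x"
proof -
  have b: "proj E v \<in> susp_points X"
    using continuous_map_image_subset_topspace[OF continuous_proj] assms by (auto simp: points)
  moreover have "v \<in> fibre E (proj E v)" using assms by (simp add: fibre_def)
  ultimately show ?thesis using fibre_frm that by metis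
qed

lemma gauge_of_frm: "b \<in> susp_points X \<Longrightarrow> gauge_of d (frm b x) = frm b (d b *v x)"
  by (simp add: gauge_of_def frm_total proj_frm coord_frm)

lemma gauge_of_fr:
  assumes "z \<in> topspace XI"
  shows "gauge_of d (fr z v) = fr z (tw d z *v v)"
proof (cases "snd z = 1")
  case True
  have "rotation_matrix (g (fst z))" using assms by (auto intro: g_rot)
  then have "g (fst z) ** (transpose (g (fst z)) ** d North ** g (fst z)) = d North ** g (fst z)"
    by (simp add: matrix_mul_assoc rotation_transpose_mult)
  then show ?thesis using True by (simp add: fr_def tw_def gauge_of_frm susp_pointsI matrix_vector_mul_assoc)
qed (simp add: fr_def tw_def gauge_of_frm susp_map_points[OF assms])

lemma gauge_of_ext: "gauge_of d \<in> extensional (topspace (total E))"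
  by (simp add: gauge_of_def)

lemma gauge_of_cong: "(\<And>b. b \<in> susp_points X \<Longrightarrow> d b = d' b) \<Longrightarrow> gauge_of d = gauge_of d'"
proof
  fix v assume d: "\<And>b. b \<in> susp_points X \<Longrightarrow> d b = d' b"
  show "gauge_of d v = gauge_of d' v"
  proof (cases "v \<in> topspace (total E)")
    case True
    then show ?thesis by (rule total_cases) (simp add: gauge_of_frm d)
  qed (simp add: gauge_of_def)
qed

lemma gauge_of_one: "gauge_of (\<lambda>_. mat 1) = gauge_one E"
proof
  fix v show "gauge_of (\<lambda>_. mat 1) v = gauge_one E v"
  proof (cases "v \<in> topspace (total E)")
    case True
    then have "gauge_of (\<lambda>_. mat 1) v = v" by (rule total_cases) (simp add: gauge_of_frm)
    with True show ?thesis by (simp add: gauge_one_def)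
  qed (simp add: gauge_of_def gauge_one_def)
qed

lemma gauge_of_inj:
  assumes "gauge_of d = gauge_of d'" "b \<in> susp_points X"
  shows "d b = d' b"
proof -
  have "frm b (d b *v x) = frm b (d' b *v x)" for x
    using assms gauge_of_frm by metis
  then have "d b *v x = d' b *v x" for x using coord_frm[OF assms(2)] by metis
  then show ?thesis by (simp add: matrix_eq)
qed

lemma twisted_family_rot:
  assumes d: "twisted_family d" and s: "s \<in> {0..1}" and b: "b \<in> susp_points X"
  shows "rotation_matrix (d s b)"
  using b
proof (cases rule: susp_points_cases)
  case (3 x t)
  show ?thesis
  proof (cases "t = 1")
    case True
    then show ?thesis using 3 d s by (simp add: twisted_family_def continuous_map_special_orthogonal)
  next
    case False
    have "(s, (x, t)) \<in> topspace (prod_topology unit_interval XI)" using 3 s by simp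
    then have "rotation_matrix (tw (d s) (x, t))" using d by (auto simp: twisted_family_def continuous_map_special_orthogonal)
    then show ?thesis using False 3 by (simp add: tw_def)
  qed
qed (use d s in \<open>auto simp: twisted_family_def continuous_map_special_orthogonal\<close>)

text \<open>Over a chart set \<open>U\<close> a vector \<open>y\<close> of the chart is fixed at the
  outset; the resulting map on \<open>U\<close> is tested on the cylinder, where \<open>fr\<close>
  and \<open>tw\<close> are continuous. The images of a chart frame form an oriented frame again, so
  \<open>continuous_map_frame_apply\<close> lets the vector vary.\<close>

lemma continuous_gauge_of:
  assumes d: "twisted_family d"
  shows "continuous_map (prod_topology unit_interval (total E)) (total E) (\<lambda>(s, v). gauge_of (d s) v)"
proof -
  let ?IE = "prod_topology unit_interval (total E)"
  have projB: "proj E v \<in> topspace (base E)" if "v \<in> topspace (total E)" for v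
    using continuous_map_image_subset_topspace[OF continuous_proj] that by blast
  have "\<exists>U. b \<in> U \<and> openin (base E) U \<and>
      continuous_map (subtopology ?IE ({0..1} \<times> {v \<in> topspace (total E). proj E v \<in> U})) (total E) (\<lambda>(s, v). gauge_of (d s) v)"
    if bB: "b \<in> topspace (base E)" for b
  proof -
    obtain U \<phi> where U: "b \<in> U" "openin (base E) U" "bundle_chart E U \<phi>" "\<And>c. c \<in> U \<Longrightarrow> (\<lambda>x. \<phi> (c, x)) \<in> orient E c"
      using bB by (rule oriented_chart) blast
    have UB: "U \<subseteq> topspace (base E)" using U(2) openin_subset by blast
    from U(3) obtain \<psi> where \<psi>: "continuous_map (prod_topology (subtopology (base E) U) euclidean) (total E) \<phi>"
      "continuous_map (subtopology (total E) {v. proj E v \<in> U}) (prod_topology (subtopology (base E) U) euclidean) \<psi>"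
      "\<And>b x. b \<in> U \<Longrightarrow> \<psi> (\<phi> (b, x)) = (b, x)" "\<And>b x. b \<in> U \<Longrightarrow> \<phi> (b, x) \<in> fibre E b"
      "\<And>v. v \<in> topspace (total E) \<Longrightarrow> proj E v \<in> U \<Longrightarrow> \<phi> (proj E v, snd (\<psi> v)) = v"
      by (rule bundle_chart_inverse) blast
    let ?V = "{z \<in> topspace XI. susp_map z \<in> U}"
    have Upt: "c \<in> susp_points X" if "c \<in> U" for c using UB that by (auto simp: points)
    have \<phi>frm: "\<phi> (c, y) = frm c (coord c (\<phi> (c, y)))" if "c \<in> U" for c y
      using fibre_frm[OF Upt[OF that] \<psi>(4)[OF that, of y]] coord_frm[OF Upt[OF that]] by metis
    have pole: "continuous_map unit_interval (total E) (\<lambda>s. gauge_of (d s) (\<phi> (c, y)))"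
      if c: "c \<in> U" and dc: "continuous_map unit_interval special_orthogonal (\<lambda>s. d s c)" for c y
    proof -
      have "continuous_map unit_interval (total E) (\<lambda>s. frm c (d s c *v coord c (\<phi> (c, y))))"
      proof (rule continuous_map_frame_apply[where h = "\<lambda>_. c"])
        show "continuous_map unit_interval euclidean (\<lambda>s. d s c *v coord c (\<phi> (c, y)))"
          using dc by (intro continuous_map_matrix_vector_mult) (auto simp: continuous_map_special_orthogonal)
      qed (use c Upt frm_orient frm_total in \<open>auto simp: points\<close>)
      moreover have "gauge_of (d s) (\<phi> (c, y)) = frm c (d s c *v coord c (\<phi> (c, y)))" for s
        by (subst \<phi>frm[OF c]) (rule gauge_of_frm[OF Upt[OF c]])
      ultimately show ?thesis by simp
    qed
    have C: "continuous_map (prod_topology unit_interval (subtopology (base E) U)) (total E) (\<lambda>(s, c). gauge_of (d s) (\<phi> (c, y)))" for y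
      unfolding base
    proof (rule continuous_map_suspension_open)
      show "openin (suspension X) U" using U(2) by (simp add: base)
      let ?Z = "prod_topology unit_interval (subtopology XI ?V)"
      \<comment> \<open>The coordinates of the chart vector in the frame \<open>fr\<close>, on which
        the gauge transformation acts through the continuous matrix \<open>tw\<close>.\<close>
      define N where "N = (\<lambda>z. (\<chi> i. vinner E (fr z (axis i 1)) (\<phi> (susp_map z, y))))"
      have VXI: "z \<in> topspace XI \<and> susp_map z \<in> U" if "w \<in> topspace ?Z" "z = snd w" for w z
        using that by auto
      have c\<phi>: "continuous_map (subtopology XI ?V) (total E) (\<lambda>z. \<phi> (susp_map z, y))"
      proof -
        have "continuous_map (subtopology XI ?V) (subtopology (base E) U) susp_map"
          unfolding base using continuous_map_susp_map[of X]
          by (auto simp: continuous_map_in_subtopology continuous_map_from_subtopology)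
        then have "continuous_map (subtopology XI ?V) (prod_topology (subtopology (base E) U) euclidean) (\<lambda>z. (susp_map z, y))"
          by (intro continuous_map_pairedI) auto
        from continuous_map_compose[OF this \<psi>(1)] show ?thesis by (simp add: o_def)
      qed
      have \<phi>fr: "\<phi> (susp_map z, y) = fr z (N z)" if z: "z \<in> topspace XI" "susp_map z \<in> U" for z
      proof -
        have "bij_betw (fr z) UNIV (fibre E (susp_map z))"
          using orient_frame(4) fr_orient[OF z(1)] susp_map_points[OF z(1)] points by blast
        then obtain x where x: "\<phi> (susp_map z, y) = fr z x" using \<psi>(4)[OF z(2), of y] by (auto simp: bij_betw_def)
        then have "N z = x" by (simp add: N_def fr_inner[OF z(1)] inner_axis' vec_eq_iff)
        with x show ?thesis by simp
      qed
      have cN: "continuous_map (subtopology XI ?V) euclidean N"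
        unfolding N_def
      proof (rule continuous_map_vecI, unfold vec_lambda_beta, rule continuous_map_vinner)
        show "continuous_map (subtopology XI ?V) (total E) (\<lambda>z. fr z (axis i 1))" for i
          by (rule continuous_map_from_subtopology[OF continuous_fr])
        show "proj E (fr z (axis i 1)) = proj E (\<phi> (susp_map z, y))" if "z \<in> topspace (subtopology XI ?V)" for z i
        proof -
          have z: "z \<in> topspace XI" "susp_map z \<in> U" using that by auto
          have "proj E (fr z (axis i 1)) = susp_map z" "proj E (fr z (N z)) = susp_map z"
            using orient_frame(3) fr_orient[OF z(1)] susp_map_points[OF z(1)] points by blast+
          then show ?thesis by (simp add: \<phi>fr[OF z])
        qed
      qed (rule c\<phi>)
      have ctw: "continuous_map ?Z euclidean (\<lambda>w. tw (d (fst w)) (snd w))"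
      proof -
        have "continuous_map (prod_topology unit_interval XI) euclidean (\<lambda>w. tw (d (fst w)) (snd w))"
          using d by (simp add: twisted_family_def continuous_map_special_orthogonal case_prod_beta')
        then show ?thesis unfolding prod_topology_subtopology(2)[of unit_interval XI]
          by (rule continuous_map_from_subtopology)
      qed
      have cfr: "continuous_map ?Z (total E) (\<lambda>w. fr (snd w) x)" for x
        using continuous_map_compose[OF continuous_map_snd continuous_map_from_subtopology[OF continuous_fr]] by (simp add: o_def)
      have "continuous_map ?Z (total E) (\<lambda>w. fr (snd w) (tw (d (fst w)) (snd w) *v N (snd w)))"
      proof (rule continuous_map_frame_apply[where h = "\<lambda>w. susp_map (snd w)"])
        show "continuous_map ?Z (total E) (\<lambda>w. fr (snd w) x)" for x by (rule cfr)
        show "continuous_map ?Z euclidean (\<lambda>w. tw (d (fst w)) (snd w) *v N (snd w))"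
          using continuous_map_compose[OF continuous_map_snd cN] by (intro continuous_map_matrix_vector_mult ctw) (simp add: o_def)
        show "susp_map (snd w) \<in> topspace (base E) \<and> fr (snd w) \<in> orient E (susp_map (snd w))" if "w \<in> topspace ?Z" for w
          using VXI[OF that refl] fr_orient susp_map_points points by blast
      qed
      then show "continuous_map ?Z (total E) (\<lambda>(s, z). case (s, susp_map z) of (s, c) \<Rightarrow> gauge_of (d s) (\<phi> (c, y)))"
      proof (rule continuous_map_eq)
        fix w assume w: "w \<in> topspace ?Z"
        note z = VXI[OF w refl]
        show "fr (snd w) (tw (d (fst w)) (snd w) *v N (snd w)) = (case w of (s, z) \<Rightarrow> case (s, susp_map z) of (s, c) \<Rightarrow> gauge_of (d s) (\<phi> (c, y)))"
          using z by (simp add: case_prod_beta' \<phi>fr gauge_of_fr)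
      qed
    next
      assume "South \<in> U"
      then show "continuous_map unit_interval (total E) (\<lambda>s. case (s, South) of (s, c) \<Rightarrow> gauge_of (d s) (\<phi> (c, y)))"
        using d by (simp add: twisted_family_def pole)
    next
      assume "North \<in> U"
      then show "continuous_map unit_interval (total E) (\<lambda>s. case (s, North) of (s, c) \<Rightarrow> gauge_of (d s) (\<phi> (c, y)))"
        using d by (simp add: twisted_family_def pole)
    qed
    let ?W = "subtopology (total E) {v \<in> topspace (total E). proj E v \<in> U}"
    let ?IW = "prod_topology unit_interval ?W"
    have W: "?W = subtopology (total E) {v. proj E v \<in> U}"
    proof -
      have "{v \<in> topspace (total E). proj E v \<in> U} = topspace (total E) \<inter> {v. proj E v \<in> U}" by auto
      then show ?thesis by (simp only: subtopology_restrict)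
    qed
    have pW: "continuous_map ?W (subtopology (base E) U) (proj E)"
      using continuous_proj by (auto simp: continuous_map_in_subtopology continuous_map_from_subtopology)
    \<comment> \<open>A point of the total space is its chart coordinate inserted into a chart
      frame. The gauge transformation is absorbed into the frame, which is continuous at fixed
      vectors by \<open>C\<close>.\<close>
    have "continuous_map ?IW (total E) (\<lambda>w. (\<lambda>x. gauge_of (d (fst w)) (\<phi> (proj E (snd w), x))) (snd (\<psi> (snd w))))"
    proof (rule continuous_map_frame_apply[where h = "\<lambda>w. proj E (snd w)"])
      fix x
      have "continuous_map ?IW (prod_topology unit_interval (subtopology (base E) U)) (\<lambda>w. (fst w, proj E (snd w)))"
        using continuous_map_compose[OF continuous_map_snd pW]
        by (intro continuous_map_pairedI continuous_map_fst) (simp add: o_def)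
      from continuous_map_compose[OF this C]
      show "continuous_map ?IW (total E) (\<lambda>w. gauge_of (d (fst w)) (\<phi> (proj E (snd w), x)))" by (simp add: o_def)
    next
      fix w assume w: "w \<in> topspace ?IW"
      let ?c = "proj E (snd w)" and ?s = "fst w"
      have c: "?c \<in> U" "?s \<in> {0..1}" using w by auto
      have cB: "?c \<in> topspace (base E)" using c UB by blast
      have cp: "?c \<in> susp_points X" using cB by (simp add: points)
      obtain A where A: "(\<lambda>x. \<phi> (?c, x)) = frm ?c \<circ> (\<lambda>x. A *v x)" "det A > 0"
        using orient_eq[OF cB frm_orient[OF cp]] U(4)[OF c(1)] by blast
      have "gauge_of (d ?s) (\<phi> (?c, x)) = frm ?c ((d ?s ?c ** A) *v x)" for x
        using fun_cong[OF A(1), of x] by (simp add: gauge_of_frm[OF cp] matrix_vector_mul_assoc)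
      moreover have "det (d ?s ?c ** A) > 0"
        using twisted_family_rot[OF d c(2) cp] A(2) by (simp add: det_mul rotation_matrix_def)
      ultimately show "?c \<in> topspace (base E) \<and> (\<lambda>x. gauge_of (d ?s) (\<phi> (?c, x))) \<in> orient E ?c"
        using orient_compose[OF cB frm_orient[OF cp], of "d ?s ?c ** A"] cB by simp
    next
      show "continuous_map ?IW euclidean (\<lambda>w. snd (\<psi> (snd w)))"
        using continuous_map_compose[OF continuous_map_compose[OF continuous_map_snd \<psi>(2)[folded W]] continuous_map_snd] by (simp add: o_def)
    qed
    then have "continuous_map ?IW (total E) (\<lambda>(s, v). gauge_of (d s) v)"
      by (rule continuous_map_eq) (use \<psi>(5) in \<open>auto simp: case_prod_beta'\<close>)
    moreover have "?IW = subtopology ?IE ({0..1} \<times> {v \<in> topspace (total E). proj E v \<in> U})"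
      by (simp add: prod_topology_subtopology(2)[of unit_interval "total E"])
    ultimately show ?thesis using U by (intro exI[of _ U]) simp
  qed
  then have "\<forall>b\<in>topspace (base E). \<exists>U. b \<in> U \<and> openin (base E) U \<and>
      continuous_map (subtopology ?IE ({0..1} \<times> {v \<in> topspace (total E). proj E v \<in> U})) (total E) (\<lambda>(s, v). gauge_of (d s) v)"
    by (intro ballI)
  from bchoice[OF this] obtain U where U: "\<And>b. b \<in> topspace (base E) \<Longrightarrow> b \<in> U b \<and> openin (base E) (U b) \<and>
      continuous_map (subtopology ?IE ({0..1} \<times> {v \<in> topspace (total E). proj E v \<in> U b})) (total E) (\<lambda>(s, v). gauge_of (d s) v)"
    by (elim exE) (rule that, drule (1) bspec, assumption)
  show ?thesis
  proof (rule pasting_lemma[where I = "topspace (base E)" and T = "\<lambda>b. {0..1} \<times> {v \<in> topspace (total E). proj E v \<in> U b}"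
        and f = "\<lambda>_ (s, v). gauge_of (d s) v"])
    show "openin ?IE ({0..1} \<times> {v \<in> topspace (total E). proj E v \<in> U b})" if b: "b \<in> topspace (base E)" for b
    proof -
      have "openin (total E) {v \<in> topspace (total E). proj E v \<in> U b}"
        using continuous_proj U[OF b] by (intro openin_continuous_map_preimage) auto
      then show ?thesis using openin_topspace[of unit_interval] by (simp add: openin_prod_Times_iff)
    qed
    show "\<exists>j. j \<in> topspace (base E) \<and> w \<in> {0..1} \<times> {v \<in> topspace (total E). proj E v \<in> U j} \<and>
        (case w of (s, v) \<Rightarrow> gauge_of (d s) v) = (case w of (s, v) \<Rightarrow> gauge_of (d s) v)" if w: "w \<in> topspace ?IE" for w
    proof -
      have v: "snd w \<in> topspace (total E)" "fst w \<in> {0..1}" using w by auto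
      then show ?thesis using U[OF projB[OF v(1)]] projB[OF v(1)] by (intro exI[of _ "proj E (snd w)"]) (auto simp: mem_Times_iff)
    qed
  qed (use U in auto)
qed

end

section \<open>Points and evaluation in the compact-open topology\<close>

lemma topspace_compact_open:
  "topspace (compact_open Y Z) = {f \<in> extensional (topspace Y). continuous_map Y Z f}"
proof -
  have "{f \<in> extensional (topspace Y). continuous_map Y Z f \<and> f ` {} \<subseteq> {}} \<in>
      {{f \<in> extensional (topspace Y). continuous_map Y Z f \<and> f ` K \<subseteq> U} | K U. compactin Y K \<and> openin Z U}"
    by (rule CollectI, rule exI[of _ "{}"], rule exI[of _ "{}"]) simp
  then show ?thesis unfolding compact_open_def topology_generated_by_topspace by (intro equalityI) blast+
qed

lemma continuous_map_compact_open_point: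
  assumes "y \<in> topspace Y"
  shows "continuous_map (compact_open Y Z) Z (\<lambda>f. f y)"
  unfolding continuous_map_def
proof (intro conjI funcsetI allI impI)
  show "f y \<in> topspace Z" if "f \<in> topspace (compact_open Y Z)" for f
    using that assms continuous_map_image_subset_topspace by (fastforce simp: topspace_compact_open)
  fix U assume U: "openin Z U"
  have "openin (compact_open Y Z) {f \<in> extensional (topspace Y). continuous_map Y Z f \<and> f ` {y} \<subseteq> U}"
    unfolding compact_open_def by (rule topology_generated_by_Basis) (use U assms in \<open>auto intro!: exI[of _ "{y}"] exI[of _ U]\<close>)
  moreover have "{f \<in> topspace (compact_open Y Z). f y \<in> U} = {f \<in> extensional (topspace Y). continuous_map Y Z f \<and> f ` {y} \<subseteq> U}"
    by (auto simp: topspace_compact_open)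
  ultimately show "openin (compact_open Y Z) {f \<in> topspace (compact_open Y Z). f y \<in> U}" by simp
qed

lemma continuous_map_special_orthogonal_mult:
  "continuous_map Z special_orthogonal F \<Longrightarrow> continuous_map Z special_orthogonal G \<Longrightarrow>
    continuous_map Z special_orthogonal (\<lambda>z. F z ** G z)"
  unfolding continuous_map_special_orthogonal by (simp add: continuous_map_matrix_mult rotation_matrix_mult)

lemma continuous_map_special_orthogonal_transpose:
  "continuous_map Z special_orthogonal F \<Longrightarrow> continuous_map Z special_orthogonal (\<lambda>z. transpose (F z))"
  unfolding continuous_map_special_orthogonal by (simp add: continuous_map_transpose)

context trivialized_bundle
begin

section \<open>The rotation group of a single fibre\<close>

definition fibre_act :: "'a susp \<Rightarrow> real^'n^'n \<Rightarrow> 'e \<Rightarrow> 'e" where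
  "fibre_act b A = (\<lambda>v\<in>fibre E b. frm b (A *v coord b v))"

lemma fibre_act_frm: "b \<in> susp_points X \<Longrightarrow> fibre_act b A (frm b x) = frm b (A *v x)"
  by (simp add: fibre_act_def frm_fibre coord_frm)

lemma restrict_gauge_of:
  assumes "b \<in> susp_points X"
  shows "restrict (gauge_of d) (fibre E b) = fibre_act b (d b)"
proof
  fix v show "restrict (gauge_of d) (fibre E b) v = fibre_act b (d b) v"
  proof (cases "v \<in> fibre E b")
    case True
    then obtain x where "v = frm b x" using fibre_frm[OF assms] by blast
    then show ?thesis using True by (simp add: gauge_of_frm[OF assms] fibre_act_frm[OF assms])
  qed (simp add: fibre_act_def)
qed

lemma frm_add: "b \<in> susp_points X \<Longrightarrow> vadd E (frm b x) (frm b y) = frm b (x + y)"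
  and frm_scale: "b \<in> susp_points X \<Longrightarrow> vscale E c (frm b x) = frm b (c *\<^sub>R x)"
  using orient_frame(5,6)[of b "frm b"] by (simp_all add: points frm_orient)

lemma fibre_act_rotation:
  assumes b: "b \<in> susp_points X" and A: "rotation_matrix A"
  shows "fibre_act b A \<in> fibre_rotations E b"
proof -
  have cb: "fibre_act b A (frm b x) = frm b (A *v x)" for x by (rule fibre_act_frm[OF b])
  have ex: "\<exists>x. v = frm b x" if "v \<in> fibre E b" for v using fibre_frm[OF b that] by blast
  have o: "orthogonal_matrix A" using A by (simp add: rotation_matrix_def)
  show ?thesis
    unfolding fibre_rotations_def
  proof (intro CollectI conjI ballI allI)
    show "fibre_act b A \<in> fibre E b \<rightarrow>\<^sub>E fibre E b" using frm_fibre[OF b] by (auto simp: fibre_act_def)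
    fix u v assume uv: "u \<in> fibre E b" "v \<in> fibre E b"
    obtain x y where xy: "u = frm b x" "v = frm b y" using ex uv by blast
    show "fibre_act b A (vadd E u v) = vadd E (fibre_act b A u) (fibre_act b A v)"
      by (simp add: xy cb frm_add[OF b] matrix_vector_right_distrib)
    show "vinner E (fibre_act b A u) (fibre_act b A v) = vinner E u v"
      by (simp add: xy cb frm_inner[OF b] orthogonal_matrix_dot[OF o])
  next
    fix c u assume "u \<in> fibre E b"
    then obtain x where x: "u = frm b x" using ex by blast
    show "fibre_act b A (vscale E c u) = vscale E c (fibre_act b A u)"
      by (simp add: x cb frm_scale[OF b] matrix_vector_mult_scaleR)
  next
    fix L assume L: "L \<in> orient E b"
    have bB: "b \<in> topspace (base E)" using b by (simp add: points)
    obtain M where M: "L = frm b \<circ> (\<lambda>x. M *v x)" "det M > 0" using orient_eq[OF bB frm_orient[OF b]] L by blast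
    have "fibre_act b A \<circ> L = (\<lambda>x. frm b ((A ** M) *v x))" by (simp add: fun_eq_iff M(1) cb matrix_vector_mul_assoc)
    moreover have "det (A ** M) > 0" using A M(2) by (simp add: det_mul rotation_matrix_def)
    ultimately show "fibre_act b A \<circ> L \<in> orient E b" using orient_compose[OF bB frm_orient[OF b]] by simp
  qed
qed

text \<open>Inverts \<open>fibre_act b\<close> on rotations of the fibre. Each entry needs only the
  value at one frame vector, which makes it continuous in the compact-open topology.\<close>

definition entries :: "'a susp \<Rightarrow> ('e \<Rightarrow> 'e) \<Rightarrow> real^'n^'n" where
  "entries b f = (\<chi> i j. vinner E (frm b (axis i 1)) (f (frm b (axis j 1))))"

lemma fibre_rotation_entries:
  assumes b: "b \<in> susp_points X" and f: "f \<in> fibre_rotations E b"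
  shows "rotation_matrix (entries b f)" "f (frm b x) = frm b (entries b f *v x)" "f = fibre_act b (entries b f)"
proof -
  have bB: "b \<in> topspace (base E)" using b by (simp add: points)
  have fo: "f \<circ> frm b \<in> orient E b" using f frm_orient[OF b] unfolding fibre_rotations_def by blast
  have iso: "vinner E ((f \<circ> frm b) x) ((f \<circ> frm b) y) = x \<bullet> y" for x y
  proof -
    have "vinner E (f (frm b x)) (f (frm b y)) = vinner E (frm b x) (frm b y)"
      using f frm_fibre[OF b] unfolding fibre_rotations_def by blast
    then show ?thesis by (simp add: frm_inner[OF b])
  qed
  note ch = orthonormal_frame_change[OF bB frm_orient[OF b] fo frm_inner[OF b] iso]
  have e: "entries b f = (\<chi> i j. vinner E (frm b (axis i 1)) ((f \<circ> frm b) (axis j 1)))" by (simp add: entries_def)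
  show "rotation_matrix (entries b f)" unfolding e by (rule ch(1))
  show fx: "f (frm b x) = frm b (entries b f *v x)" for x using ch(2)[of x] unfolding e by simp
  show "f = fibre_act b (entries b f)"
  proof
    fix v show "f v = fibre_act b (entries b f) v"
    proof (cases "v \<in> fibre E b")
      case True
      then obtain x where "v = frm b x" using fibre_frm[OF b] by blast
      then show ?thesis by (simp add: fx fibre_act_frm[OF b])
    next
      case False
      have "f \<in> extensional (fibre E b)" using f by (auto simp: fibre_rotations_def PiE_def)
      then show ?thesis using False by (simp add: fibre_act_def extensional_def)
    qed
  qed
qed

lemma entries_fibre_act: "b \<in> susp_points X \<Longrightarrow> entries b (fibre_act b A) = A"
  by (simp add: entries_def fibre_act_frm frm_inner inner_axis' matrix_vector_mult_basis column_def vec_eq_iff)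

text \<open>Joint continuity of the action gives one direction, evaluation at the frame vectors the
  other. Essential loops in a fibre can thereby be decided on matrices.\<close>

lemma fibre_SO_homeomorphic:
  assumes b: "b \<in> susp_points X"
  shows "homeomorphic_maps special_orthogonal (fibre_SO E b) (fibre_act b) (entries b)"
proof -
  let ?F = "subtopology (total E) (fibre E b)"
  have topF: "topspace ?F = fibre E b" by (auto simp: fibre_def)
  have bB: "b \<in> topspace (base E)" using b by (simp add: points)
  have "continuous_map (prod_topology special_orthogonal ?F) ?F (\<lambda>(A, v). fibre_act b A v)"
    unfolding continuous_map_in_subtopology
  proof
    let ?Z = "prod_topology (special_orthogonal :: (real^'n^'n) topology) ?F"
    have "continuous_map ?F euclidean (coord b)"
      unfolding coord_def
    proof (rule continuous_map_vecI, unfold vec_lambda_beta, rule continuous_map_vinner)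
      show "continuous_map ?F (total E) (\<lambda>v. frm b (axis i 1))" for i using frm_total[OF b] by simp
      show "continuous_map ?F (total E) (\<lambda>v. v)" by (simp add: continuous_map_from_subtopology)
      show "proj E (frm b (axis i 1)) = proj E v" if "v \<in> topspace ?F" for v i
        using that proj_frm[OF b] unfolding topF by (simp add: fibre_def)
    qed
    from continuous_map_compose[OF continuous_map_snd this]
    have c: "continuous_map ?Z euclidean (\<lambda>w. coord b (snd w))" by (simp add: o_def)
    have "continuous_map special_orthogonal euclidean (\<lambda>A. A :: real^'n^'n)"
      by (simp add: special_orthogonal_def)
    from continuous_map_compose[OF continuous_map_fst[of _ ?F] this]
    have m: "continuous_map ?Z euclidean (\<lambda>w. fst w)" by (simp add: o_def)
    have "continuous_map ?Z (total E) (\<lambda>w. frm b (fst w *v coord b (snd w)))"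
      by (rule continuous_map_frame_apply[where h = "\<lambda>_. b" and s = "\<lambda>_. frm b"])
        (use b bB frm_orient frm_total in \<open>auto intro: continuous_map_matrix_vector_mult m c\<close>)
    then show "continuous_map ?Z (total E) (\<lambda>(A, v). fibre_act b A v)"
      by (rule continuous_map_eq) (auto simp: fibre_act_def fibre_def)
    show "(\<lambda>(A, v). fibre_act b A v) \<in> topspace ?Z \<rightarrow> fibre E b"
      using frm_fibre[OF b] by (auto simp: fibre_act_def fibre_def)
  qed
  then have "continuous_map special_orthogonal (compact_open ?F ?F) (fibre_act b)"
    by (rule continuous_map_into_compact_open) (simp only: topF fibre_act_def restrict_extensional)
  then have c1: "continuous_map special_orthogonal (fibre_SO E b) (fibre_act b)"
    unfolding fibre_SO_def continuous_map_in_subtopology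
    using fibre_act_rotation[OF b] by (auto simp: special_orthogonal_def)
  have c2: "continuous_map (fibre_SO E b) special_orthogonal (entries b)"
    unfolding continuous_map_special_orthogonal
  proof
    show "continuous_map (fibre_SO E b) euclidean (entries b)"
      unfolding entries_def
    proof (rule continuous_map_vecI, rule continuous_map_vecI, unfold vec_lambda_beta, rule continuous_map_vinner)
      fix i j
      have ev: "continuous_map (fibre_SO E b) ?F (\<lambda>f. f (frm b (axis j 1)))"
        unfolding fibre_SO_def
        by (intro continuous_map_from_subtopology continuous_map_compact_open_point) (simp only: topF frm_fibre[OF b])
      then show "continuous_map (fibre_SO E b) (total E) (\<lambda>f. f (frm b (axis j 1)))"
        by (simp add: continuous_map_in_subtopology)
      show "continuous_map (fibre_SO E b) (total E) (\<lambda>f. frm b (axis i 1))" using frm_total[OF b] by simp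
      show "proj E (frm b (axis i 1)) = proj E (f (frm b (axis j 1)))" if "f \<in> topspace (fibre_SO E b)" for f
      proof -
        have "f (frm b (axis j 1)) \<in> topspace ?F" using continuous_map_image_subset_topspace[OF ev] that by blast
        then show ?thesis unfolding topF by (simp add: fibre_def proj_frm[OF b])
      qed
    qed
    show "\<forall>f\<in>topspace (fibre_SO E b). rotation_matrix (entries b f)"
      using fibre_rotation_entries(1)[OF b] by (simp add: fibre_SO_def)
  qed
  show ?thesis
    unfolding homeomorphic_maps_def
    using c1 c2 entries_fibre_act[OF b] fibre_rotation_entries(3)[OF b, symmetric] by (auto simp: fibre_SO_def)
qed

text \<open>Homotopies relative to the endpoints are carried back and forth by the homeomorphism
  \<open>fibre_act b\<close>. A symmetry step intervenes because \<open>null_loop\<close> starts at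
  the constant loop and \<open>essential_loop\<close> refers to a homotopy ending there.\<close>

lemma essential_loop_fibre:
  assumes b: "b \<in> susp_points X" and \<gamma>: "rotation_loop \<gamma>"
    and \<rho>: "\<And>t. t \<in> {0..1} \<Longrightarrow> \<rho> t = fibre_act b (\<gamma> t)"
  shows "essential_loop (fibre_SO E b) \<rho> \<longleftrightarrow> \<not> null_loop \<gamma>"
proof -
  have c1: "continuous_map special_orthogonal (fibre_SO E b) (fibre_act b)"
    and c2: "continuous_map (fibre_SO E b) special_orthogonal (entries b)"
    using fibre_SO_homeomorphic[OF b] by (simp_all add: homeomorphic_maps_def)
  have so: "continuous_map (top_of_set S) special_orthogonal c \<longleftrightarrow> continuous_on S c \<and> (\<forall>x\<in>S. rotation_matrix (c x))"
    for S and c :: "'s::topological_space \<Rightarrow> real^'n^'n" by (simp add: continuous_map_special_orthogonal)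
  have "continuous_map unit_interval special_orthogonal \<gamma>" using \<gamma> by (simp add: so rotation_loop_def)
  from continuous_map_compose[OF this c1] have p: "pathin (fibre_SO E b) \<rho>"
    unfolding pathin_def by (rule continuous_map_eq) (simp add: \<rho>)
  have ends: "\<rho> 0 = fibre_act b (\<gamma> 0)" "\<rho> 0 = \<rho> 1" using \<rho>[of 0] \<rho>[of 1] \<gamma> by (auto simp: rotation_loop_def)
  let ?P = "\<lambda>\<sigma>. \<sigma> 0 = \<rho> 0 \<and> \<sigma> 1 = \<rho> (0::real)"
  have iff: "homotopic_with ?P unit_interval (fibre_SO E b) f f' \<longleftrightarrow>
     (\<exists>h. continuous_map (prod_topology unit_interval unit_interval) (fibre_SO E b) h \<and>
        (\<forall>x\<in>topspace unit_interval. h (0, x) = f x) \<and> (\<forall>x\<in>topspace unit_interval. h (1, x) = f' x) \<and> (\<forall>t\<in>{0..1}. ?P (\<lambda>x. h (t, x))))" for f f'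
    by (rule homotopic_with) auto
  have "homotopic_with ?P unit_interval (fibre_SO E b) \<rho> (\<lambda>_. \<rho> 0) \<longleftrightarrow> null_loop \<gamma>"
  proof
    assume "null_loop \<gamma>"
    then obtain H :: "real \<times> real \<Rightarrow> real^'n^'n" where H: "continuous_on ({0..1} \<times> {0..1}) H" "\<forall>p\<in>{0..1} \<times> {0..1}. rotation_matrix (H p)"
     "\<forall>t\<in>{0..1}. H (0, t) = \<gamma> 0" "\<forall>t\<in>{0..1}. H (1, t) = \<gamma> t"
     "\<forall>s\<in>{0..1}. H (s, 0) = \<gamma> 0 \<and> H (s, 1) = \<gamma> 0"
      unfolding null_loop_def by blast
    have "continuous_map (top_of_set ({0..1} \<times> {0..1})) special_orthogonal H" using H(1,2) by (simp add: so)
    from continuous_map_compose[OF this c1]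
    have ch: "continuous_map (prod_topology unit_interval unit_interval) (fibre_SO E b) (\<lambda>p. fibre_act b (H p))" by (simp add: o_def)
    have "homotopic_with ?P unit_interval (fibre_SO E b) (\<lambda>_. \<rho> 0) \<rho>"
      unfolding iff
    proof (intro exI conjI ballI)
      show "continuous_map (prod_topology unit_interval unit_interval) (fibre_SO E b) (\<lambda>p. fibre_act b (H p))" by (rule ch)
    qed (use H(3-5) \<rho> ends in auto)
    then show "homotopic_with ?P unit_interval (fibre_SO E b) \<rho> (\<lambda>_. \<rho> 0)" by (rule homotopic_with_symD)
  next
    assume "homotopic_with ?P unit_interval (fibre_SO E b) \<rho> (\<lambda>_. \<rho> 0)"
    then have "homotopic_with ?P unit_interval (fibre_SO E b) (\<lambda>_. \<rho> 0) \<rho>" by (rule homotopic_with_symD)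
    then obtain h where h: "continuous_map (prod_topology unit_interval unit_interval) (fibre_SO E b) h"
      "\<forall>x\<in>topspace unit_interval. h (0, x) = \<rho> 0" "\<forall>x\<in>topspace unit_interval. h (1, x) = \<rho> x" "\<forall>t\<in>{0..1}. ?P (\<lambda>x. h (t, x))"
      unfolding iff by blast
    from continuous_map_compose[OF h(1) c2]
    have c: "continuous_map (top_of_set ({0..1} \<times> {0..1})) special_orthogonal (\<lambda>p. entries b (h p))" by (simp add: o_def)
    have e0: "entries b (\<rho> 0) = \<gamma> 0" using ends entries_fibre_act[OF b] by simp
    show "null_loop \<gamma>"
      unfolding null_loop_def
    proof (intro exI[of _ "\<lambda>p. entries b (h p)"] conjI)
      show "continuous_on ({0..1} \<times> {0..1}) (\<lambda>p. entries b (h p))" "\<forall>p\<in>{0..1} \<times> {0..1}. rotation_matrix (entries b (h p))"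
        using c by (auto simp: so)
      show "\<forall>t\<in>{0..1}. entries b (h (0, t)) = \<gamma> 0" using h(2) e0 by simp
      show "\<forall>t\<in>{0..1}. entries b (h (1, t)) = \<gamma> t" using h(3) \<rho> entries_fibre_act[OF b] by simp
      show "\<forall>s\<in>{0..1}. entries b (h (s, 0)) = \<gamma> 0 \<and> entries b (h (s, 1)) = \<gamma> 0" using h(4) e0 by simp
    qed
  qed
  then show ?thesis using p ends by (simp add: essential_loop_def)
qed

section \<open>Families of gauge transformations and paths in the gauge group\<close>

lemma tw_mult: "z \<in> topspace XI \<Longrightarrow> tw (\<lambda>b. d b ** d' b) z = tw d z ** tw d' z"
proof (cases "snd z = 1")
  case True
  assume "z \<in> topspace XI"
  then have "rotation_matrix (g (fst z))" by (auto intro: g_rot)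
  then have "(transpose (g (fst z)) ** d North ** g (fst z)) ** (transpose (g (fst z)) ** d' North ** g (fst z)) =
      transpose (g (fst z)) ** d North ** ((g (fst z) ** transpose (g (fst z))) ** d' North) ** g (fst z)"
    by (simp add: matrix_mul_assoc)
  also have "\<dots> = transpose (g (fst z)) ** (d North ** d' North) ** g (fst z)"
    using \<open>rotation_matrix (g (fst z))\<close> by (simp add: rotation_transpose_mult matrix_mul_assoc)
  finally show ?thesis using True by (simp add: tw_def)
qed (simp add: tw_def)

lemma tw_transpose: "tw (\<lambda>b. transpose (d b)) z = transpose (tw d z)"
  by (simp add: tw_def matrix_transpose_mul matrix_mul_assoc)

lemma tw_north_one: "z \<in> topspace XI \<Longrightarrow> d North = mat 1 \<Longrightarrow> tw d z = d (susp_map z)"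
proof (cases "snd z = 1")
  case True
  assume "z \<in> topspace XI" "d North = mat 1"
  then show ?thesis using g_rot[of "fst z"] True by (auto simp: tw_def susp_map_1 rotation_transpose_mult)
qed (simp add: tw_def)

lemma twisted_family_mult:
  assumes "twisted_family d" "twisted_family d'"
  shows "twisted_family (\<lambda>s b. d s b ** d' s b)"
  unfolding twisted_family_def
proof (intro conjI)
  have "continuous_map (prod_topology unit_interval XI) special_orthogonal
      (\<lambda>w. (case w of (s, z) \<Rightarrow> tw (d s) z) ** (case w of (s, z) \<Rightarrow> tw (d' s) z))"
    using assms by (intro continuous_map_special_orthogonal_mult) (simp_all add: twisted_family_def)
  then show "continuous_map (prod_topology unit_interval XI) special_orthogonal (\<lambda>(s, z). tw (\<lambda>b. d s b ** d' s b) z)"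
  proof (rule continuous_map_eq)
    fix w assume "w \<in> topspace (prod_topology unit_interval XI)"
    then have "snd w \<in> topspace XI" by auto
    from tw_mult[OF this, of "d (fst w)" "d' (fst w)"]
    show "(case w of (s, z) \<Rightarrow> tw (d s) z) ** (case w of (s, z) \<Rightarrow> tw (d' s) z) = (case w of (s, z) \<Rightarrow> tw (\<lambda>b. d s b ** d' s b) z)"
      by (simp add: case_prod_unfold)
  qed
qed (use assms in \<open>auto simp only: twisted_family_def intro!: continuous_map_special_orthogonal_mult\<close>)

lemma twisted_family_transpose:
  assumes "twisted_family d"
  shows "twisted_family (\<lambda>s b. transpose (d s b))"
  unfolding twisted_family_def
proof (intro conjI)
  have "continuous_map (prod_topology unit_interval XI) special_orthogonal (\<lambda>w. transpose (case w of (s, z) \<Rightarrow> tw (d s) z))"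
    using assms by (intro continuous_map_special_orthogonal_transpose) (simp add: twisted_family_def)
  then show "continuous_map (prod_topology unit_interval XI) special_orthogonal (\<lambda>(s, z). tw (\<lambda>b. transpose (d s b)) z)"
    by (simp add: tw_transpose case_prod_unfold)
qed (use assms in \<open>auto simp only: twisted_family_def intro!: continuous_map_special_orthogonal_transpose\<close>)

text \<open>Transposing the matrices inverts the gauge transformation, and the transposed family is
  twisted again, so the inverse is continuous as well.\<close>

lemma gauge_of_in_gauge_group:
  assumes d: "twisted_family d" and s: "s \<in> {0..1}"
  shows "gauge_of (d s) \<in> topspace (gauge_group E)"
proof -
  have c: "continuous_map (total E) (total E) (gauge_of (d s))" if d: "twisted_family d" for d
  proof -
    have "continuous_map (total E) (prod_topology unit_interval (total E)) (\<lambda>v. (s, v))" using s by (simp add: continuous_map_pairedI)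
    from continuous_map_compose[OF this continuous_gauge_of[OF d]] show ?thesis by (simp add: o_def)
  qed
  have inv: "gauge_of (\<lambda>b. transpose (d s b)) (gauge_of (d s) v) = v" "gauge_of (d s) (gauge_of (\<lambda>b. transpose (d s b)) v) = v" if v: "v \<in> topspace (total E)" for v
  proof -
    obtain b x where b: "b \<in> susp_points X" "v = frm b x" using v by (rule total_cases)
    show "gauge_of (\<lambda>b. transpose (d s b)) (gauge_of (d s) v) = v" "gauge_of (d s) (gauge_of (\<lambda>b. transpose (d s b)) v) = v"
      using rotation_transpose_mult[OF twisted_family_rot[OF d s b(1)]] unfolding b(2) gauge_of_frm[OF b(1)]
      by (simp_all only: matrix_vector_mul_assoc matrix_vector_mul_lid)
  qed
  have "homeomorphic_maps (total E) (total E) (gauge_of (d s)) (gauge_of (\<lambda>b. transpose (d s b)))"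
    unfolding homeomorphic_maps_def using c[OF d] c[OF twisted_family_transpose[OF d]] inv by simp
  then have "homeomorphic_map (total E) (total E) (gauge_of (d s))" unfolding homeomorphic_map_maps by blast
  moreover have "restrict (gauge_of (d s)) (fibre E b) \<in> fibre_rotations E b" if "b \<in> topspace (base E)" for b
    using that fibre_act_rotation twisted_family_rot[OF d s] by (simp add: points restrict_gauge_of)
  ultimately show ?thesis using c[OF d] gauge_of_ext by (simp add: gauge_group_def topspace_compact_open)
qed

lemma pathin_gauge_of:
  assumes d: "twisted_family d"
  shows "pathin (gauge_group E) (\<lambda>s. gauge_of (d s))"
proof -
  have "continuous_map unit_interval (compact_open (total E) (total E)) (\<lambda>s. gauge_of (d s))"
    by (rule continuous_map_into_compact_open[OF continuous_gauge_of[OF d]]) (rule gauge_of_ext)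
  then show ?thesis
    using gauge_of_in_gauge_group[OF d] unfolding pathin_def gauge_group_def
    by (auto simp: continuous_map_in_subtopology)
qed

lemma gauge_restrict:
  assumes "f \<in> topspace (gauge_group E)" "b \<in> susp_points X"
  shows "restrict f (fibre E b) \<in> fibre_rotations E b"
  using assms by (simp add: gauge_group_def points)

lemma gauge_eq_gauge_of:
  assumes f: "f \<in> topspace (gauge_group E)"
  shows "f = gauge_of (\<lambda>b. entries b (restrict f (fibre E b)))"
proof
  fix v show "f v = gauge_of (\<lambda>b. entries b (restrict f (fibre E b))) v"
  proof (cases "v \<in> topspace (total E)")
    case True
    then obtain b x where b: "b \<in> susp_points X" "v = frm b x" by (rule total_cases)
    then show ?thesis
      using fibre_rotation_entries(2)[OF b(1) gauge_restrict[OF f b(1)], of x] frm_fibre[OF b(1)]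
      by (simp add: gauge_of_frm)
  next
    case False
    have "f \<in> extensional (topspace (total E))" using f by (simp add: gauge_group_def topspace_compact_open)
    then show ?thesis using False by (simp add: gauge_of_def extensional_def)
  qed
qed

text \<open>The converse of \<open>pathin_gauge_of\<close>. The compact-open topology gives joint
  continuity over compact sets only; these suffice because \<open>X\<close> is a k-space and remains
  one after products with compact intervals.\<close>

lemma pathin_gauge_group:
  assumes \<psi>: "pathin (gauge_group E) \<psi>"
  obtains d where "twisted_family d" "\<And>s. s \<in> {0..1} \<Longrightarrow> \<psi> s = gauge_of (d s)"
proof -
  define d where "d = (\<lambda>s b. entries b (restrict (\<psi> s) (fibre E b)))"
  have top: "\<psi> s \<in> topspace (gauge_group E)" if "s \<in> {0..1}" for s
    using continuous_map_image_subset_topspace[OF \<psi>[unfolded pathin_def]] that by auto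
  have \<psi>d: "\<psi> s = gauge_of (d s)" if "s \<in> {0..1}" for s
    unfolding d_def by (rule gauge_eq_gauge_of[OF top[OF that]])
  have drot: "rotation_matrix (d s b)" if "s \<in> {0..1}" "b \<in> susp_points X" for s b
    unfolding d_def by (rule fibre_rotation_entries(1)[OF that(2) gauge_restrict[OF top[OF that(1)] that(2)]])
  have co: "continuous_map unit_interval (compact_open (total E) (total E)) \<psi>"
    using \<psi> by (simp add: pathin_def gauge_group_def continuous_map_in_subtopology)
  have pole: "continuous_map unit_interval special_orthogonal (\<lambda>s. d s b)" if b: "b \<in> susp_points X" for b
    unfolding continuous_map_special_orthogonal
  proof
    have "continuous_map unit_interval euclideanreal (\<lambda>s. vinner E (frm b (axis i 1)) (\<psi> s (frm b (axis j 1))))" for i j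
    proof (rule continuous_map_vinner)
      show "continuous_map unit_interval (total E) (\<lambda>s. frm b (axis i 1))" using frm_total[OF b] by simp
      show "continuous_map unit_interval (total E) (\<lambda>s. \<psi> s (frm b (axis j 1)))"
        using continuous_map_compose[OF co continuous_map_compact_open_point[OF frm_total[OF b]]] by (simp add: o_def)
      show "proj E (frm b (axis i 1)) = proj E (\<psi> s (frm b (axis j 1)))" if "s \<in> topspace unit_interval" for s
        using that by (simp add: \<psi>d gauge_of_frm[OF b] proj_frm[OF b])
    qed
    then show "continuous_map unit_interval euclidean (\<lambda>s. d s b)"
      by (intro continuous_map_vecI) (simp add: d_def entries_def frm_fibre[OF b])
    show "\<forall>s\<in>topspace unit_interval. rotation_matrix (d s b)" using drot b by simp
  qed
  have ev: "continuous_map (prod_topology unit_interval XI) (total E) (\<lambda>(s, z). \<psi> s (fr z v))" for v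
  proof (rule continuous_map_from_k_space)
    show "k_space (prod_topology unit_interval XI)"
      by (intro k_space_prod_topology_left k_space_prod_topology_right k_space_X)
        (auto simp: compact_imp_locally_compact_space compact_space_subtopology Hausdorff_space_subtopology)
    fix K assume K: "compactin (prod_topology unit_interval XI) K"
    \<comment> \<open>A compact set of the product lies in a box over its compact projection to
      \<open>X\<close>, and on such a box evaluation is continuous.\<close>
    let ?X = "subtopology X (fst ` snd ` K)"
    have "continuous_map (prod_topology unit_interval XI) X (fst \<circ> snd)"
      by (rule continuous_map_compose[OF continuous_map_snd continuous_map_fst])
    from image_compactin[OF K this] have KX: "compactin X (fst ` snd ` K)" by (simp add: image_comp)
    let ?K = "prod_topology ?X unit_interval"
    have "continuous_map ?K (total E) (\<lambda>z. fr z v)"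
      unfolding prod_topology_subtopology(1)[of X] by (rule continuous_map_from_subtopology[OF continuous_fr])
    moreover have "compact_space ?K" "Hausdorff_space ?K"
      using KX Hausdorff_X
      by (auto simp: compact_space_prod_topology compact_space_subtopology Hausdorff_space_prod_topology Hausdorff_space_subtopology)
    ultimately have ev: "continuous_map (prod_topology unit_interval ?K) (total E) (\<lambda>(s, z). \<psi> s (fr z v))"
      by (rule continuous_map_compact_open_eval[OF co])
    have eq: "prod_topology unit_interval ?K = subtopology (prod_topology unit_interval XI) ({0..1} \<times> ((fst ` snd ` K) \<times> {0..1}))"
      by (simp add: prod_topology_subtopology(1)[of X] prod_topology_subtopology(2)[of unit_interval XI])
    have sub: "K \<subseteq> {0..1} \<times> ((fst ` snd ` K) \<times> {0..1})"
      using compactin_subset_topspace[OF K] by force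
    show "continuous_map (subtopology (prod_topology unit_interval XI) K) (total E) (\<lambda>(s, z). \<psi> s (fr z v))"
      by (rule continuous_map_from_subtopology_mono[OF ev[unfolded eq] sub])
  qed
  have twe: "tw (d s) z = (\<chi> i j. vinner E (fr z (axis i 1)) (\<psi> s (fr z (axis j 1))))" "rotation_matrix (tw (d s) z)"
    if s: "s \<in> {0..1}" and z: "z \<in> topspace XI" for s z
  proof -
    show "tw (d s) z = (\<chi> i j. vinner E (fr z (axis i 1)) (\<psi> s (fr z (axis j 1))))"
      by (simp add: \<psi>d[OF s] gauge_of_fr[OF z] fr_inner[OF z] inner_axis' matrix_vector_mult_basis column_def vec_eq_iff)
    have "rotation_matrix (g (fst z))" "susp_map z \<in> susp_points X" using z by (auto intro: g_rot susp_map_points)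
    then show "rotation_matrix (tw (d s) z)"
      using drot[OF s] susp_pointsI(3)[of X] by (auto simp: tw_def intro!: rotation_matrix_mult)
  qed
  have "twisted_family d"
    unfolding twisted_family_def
  proof (intro conjI)
    show "continuous_map unit_interval special_orthogonal (\<lambda>s. d s South)" "continuous_map unit_interval special_orthogonal (\<lambda>s. d s North)"
      by (intro pole susp_pointsI)+
    have "continuous_map (prod_topology unit_interval XI) euclideanreal (\<lambda>w. vinner E (fr (snd w) (axis i 1)) (\<psi> (fst w) (fr (snd w) (axis j 1))))" for i j
    proof (rule continuous_map_vinner)
      show "continuous_map (prod_topology unit_interval XI) (total E) (\<lambda>w. fr (snd w) (axis i 1))"
        using continuous_map_compose[OF continuous_map_snd continuous_fr] by (simp add: o_def)
      show "continuous_map (prod_topology unit_interval XI) (total E) (\<lambda>w. \<psi> (fst w) (fr (snd w) (axis j 1)))"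
        using ev by (simp add: case_prod_beta')
      show "proj E (fr (snd w) (axis i 1)) = proj E (\<psi> (fst w) (fr (snd w) (axis j 1)))"
        if "w \<in> topspace (prod_topology unit_interval XI)" for w
      proof -
        have w: "fst w \<in> {0..1}" "snd w \<in> topspace XI" using that by auto
        have "proj E (fr (snd w) x) = susp_map (snd w)" for x
          using orient_frame(3) fr_orient[OF w(2)] susp_map_points[OF w(2)] points by blast
        then show ?thesis by (simp add: \<psi>d[OF w(1)] gauge_of_fr[OF w(2)])
      qed
    qed
    then have "continuous_map (prod_topology unit_interval XI) euclidean
       (\<lambda>w. \<chi> i j. vinner E (fr (snd w) (axis i 1)) (\<psi> (fst w) (fr (snd w) (axis j 1))))"
      by (intro continuous_map_vecI) simp
    then have "continuous_map (prod_topology unit_interval XI) euclidean (\<lambda>(s, z). tw (d s) z)"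
      by (rule continuous_map_eq) (auto simp: twe)
    then show "continuous_map (prod_topology unit_interval XI) special_orthogonal (\<lambda>(s, z). tw (d s) z)"
      unfolding continuous_map_special_orthogonal using twe(2) by auto
  qed
  then show ?thesis using \<psi>d that by blast
qed

end

section \<open>Comparison of gauge components with homotopy classes\<close>

text \<open>\<open>c1\<close> is the finer classification, \<open>c2\<close> the coarser one, and
  \<open>T v\<close> represents the only fine class that may share the coarse class of
  \<open>v\<close>. The induced map \<open>\<phi>\<close> has the fibres
  \<open>{c1 v, c1 (T v)}\<close>, all of size one or all of size two. It is applied to homotopy
  classes and gauge components.\<close>

lemma two_to_one_count:
  fixes c1 :: "'l \<Rightarrow> 'x" and c2 :: "'l \<Rightarrow> 'y"
  assumes fin: "finite (c1 ` L)"
    and c12: "\<And>u v. u \<in> L \<Longrightarrow> v \<in> L \<Longrightarrow> c1 u = c1 v \<Longrightarrow> c2 u = c2 v"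
    and c21: "\<And>u v. u \<in> L \<Longrightarrow> v \<in> L \<Longrightarrow> c2 u = c2 v \<Longrightarrow> c1 u = c1 v \<or> c1 u = c1 (T v)"
    and T: "\<And>v. v \<in> L \<Longrightarrow> T v \<in> L" "\<And>v. v \<in> L \<Longrightarrow> c2 (T v) = c2 v"
  shows "finite (c2 ` L)"
    and "(\<And>v. v \<in> L \<Longrightarrow> c1 (T v) = c1 v) \<Longrightarrow> card (c2 ` L) = card (c1 ` L)"
    and "(\<And>v. v \<in> L \<Longrightarrow> c1 (T v) \<noteq> c1 v) \<Longrightarrow> card (c1 ` L) = 2 * card (c2 ` L)"
proof -
  define \<phi> where "\<phi> = (\<lambda>x. c2 (SOME u. u \<in> L \<and> c1 u = x))"
  have \<phi>: "\<phi> (c1 u) = c2 u" if u: "u \<in> L" for u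
  proof -
    have "(SOME w. w \<in> L \<and> c1 w = c1 u) \<in> L \<and> c1 (SOME w. w \<in> L \<and> c1 w = c1 u) = c1 u"
      by (rule someI[of _ u]) (simp add: u)
    then show ?thesis unfolding \<phi>_def using c12[OF _ u] by blast
  qed
  have im: "c2 ` L = \<phi> ` c1 ` L" using \<phi> by (force simp: image_image)
  then show "finite (c2 ` L)" using fin by simp
  show "card (c2 ` L) = card (c1 ` L)" if t: "\<And>v. v \<in> L \<Longrightarrow> c1 (T v) = c1 v"
    unfolding im
  proof (rule card_image, rule inj_onI)
    fix x y assume "x \<in> c1 ` L" "y \<in> c1 ` L" "\<phi> x = \<phi> y"
    then obtain u v where "u \<in> L" "v \<in> L" "x = c1 u" "y = c1 v" "c2 u = c2 v" using \<phi> by auto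
    then show "x = y" using c21[of u v] t[of v] by auto
  qed
  show "card (c1 ` L) = 2 * card (c2 ` L)" if t: "\<And>v. v \<in> L \<Longrightarrow> c1 (T v) \<noteq> c1 v"
  proof -
    have fib: "card {x \<in> c1 ` L. \<phi> x = y} = 2" if y: "y \<in> \<phi> ` c1 ` L" for y
    proof -
      obtain v where v: "v \<in> L" "y = c2 v" using y \<phi> by auto
      have "{x \<in> c1 ` L. \<phi> x = y} = {c1 v, c1 (T v)}"
      proof (intro equalityI subsetI)
        fix x assume "x \<in> {x \<in> c1 ` L. \<phi> x = y}"
        then obtain u where "u \<in> L" "x = c1 u" "c2 u = c2 v" using \<phi> v by auto
        then show "x \<in> {c1 v, c1 (T v)}" using c21[of u v] v(1) by auto
      qed (use v T \<phi> in auto)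
      then show ?thesis using t[OF v(1)] by (metis card_2_iff)
    qed
    have "card (c1 ` L) = (\<Sum>y\<in>\<phi> ` c1 ` L. card {x \<in> c1 ` L. \<phi> x = y})"
      using sum.image_gen[OF fin, of "\<lambda>_. 1::nat" \<phi>] by simp
    also have "\<dots> = (\<Sum>y\<in>\<phi> ` c1 ` L. 2)" by (rule sum.cong) (simp_all add: fib)
    finally show ?thesis by (simp add: im mult.commute)
  qed
qed

lemma null_loop_conjugate:
  fixes \<gamma> :: "real \<Rightarrow> real^'n^'n"
  assumes "null_loop \<gamma>" "rotation_matrix A"
  shows "null_loop (\<lambda>t. transpose A ** \<gamma> t ** A)"
proof -
  obtain H :: "real \<times> real \<Rightarrow> real^'n^'n" where H: "continuous_on ({0..1} \<times> {0..1}) H" "\<forall>p\<in>{0..1} \<times> {0..1}. rotation_matrix (H p)"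
     "\<forall>t\<in>{0..1}. H (0, t) = \<gamma> 0" "\<forall>t\<in>{0..1}. H (1, t) = \<gamma> t"
     "\<forall>s\<in>{0..1}. H (s, 0) = \<gamma> 0 \<and> H (s, 1) = \<gamma> 0"
    using assms(1) unfolding null_loop_def by blast
  show ?thesis
    unfolding null_loop_def
  proof (intro exI[of _ "\<lambda>p. transpose A ** H p ** A"] conjI ballI)
    show "continuous_on ({0..1} \<times> {0..1}) (\<lambda>p. transpose A ** H p ** A)" by (intro continuous_intros H)
    show "rotation_matrix (transpose A ** H p ** A)" if "p \<in> {0..1} \<times> {0..1}" for p
      using H(2) that assms(2) by (intro rotation_matrix_mult) auto
  qed (use H(3-5) in auto)
qed

context trivialized_bundle
begin

lemma continuous_map_matrix_family:
  "continuous_map (prod_topology unit_interval unit_interval) special_orthogonal B \<longleftrightarrow>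
    continuous_on ({0..1} \<times> {0..1}) B \<and> (\<forall>p\<in>{0..1} \<times> {0..1}. rotation_matrix (B p))"
  for B :: "real \<times> real \<Rightarrow> real^'n^'n"
  by (simp add: continuous_map_special_orthogonal)

text \<open>If the value over the north pole is always the identity, conjugation by \<open>g\<close>
  has no effect there, and twisted families are the same as homotopies of maps from the
  suspension.\<close>

lemma twisted_family_iff:
  assumes N: "\<And>s. s \<in> {0..1} \<Longrightarrow> d s North = mat 1"
  shows "twisted_family d \<longleftrightarrow> continuous_map (prod_topology unit_interval (suspension X)) special_orthogonal (\<lambda>(s, b). d s b)"
proof
  have tw: "(case w of (s, z) \<Rightarrow> tw (d s) z) = (case w of (s, z) \<Rightarrow> d s (susp_map z))"
    if "w \<in> topspace (prod_topology unit_interval XI)" for w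
  proof -
    have "snd w \<in> topspace XI" "fst w \<in> {0..1}" using that by auto
    then show ?thesis using tw_north_one N by (simp add: case_prod_unfold)
  qed
  { assume d: "twisted_family d"
    then have "continuous_map (prod_topology unit_interval XI) special_orthogonal (\<lambda>(s, z). tw (d s) z)" by (simp add: twisted_family_def)
    then have "continuous_map (prod_topology unit_interval XI) special_orthogonal (\<lambda>(s, z). d s (susp_map z))"
      by (rule continuous_map_eq) (rule tw)
    then show "continuous_map (prod_topology unit_interval (suspension X)) special_orthogonal (\<lambda>(s, b). d s b)"
      using d by (intro continuous_map_suspension) (simp_all add: twisted_family_def)
  }
  assume c: "continuous_map (prod_topology unit_interval (suspension X)) special_orthogonal (\<lambda>(s, b). d s b)"
  have pole: "continuous_map unit_interval special_orthogonal (\<lambda>s. d s b)" if "b \<in> susp_points X" for b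
  proof -
    have "continuous_map unit_interval (prod_topology unit_interval (suspension X)) (\<lambda>s. (s, b))"
      using that by (simp add: continuous_map_pairedI topspace_suspension)
    from continuous_map_compose[OF this c] show ?thesis by (simp add: o_def)
  qed
  have "continuous_map (prod_topology unit_interval XI) (prod_topology unit_interval (suspension X)) (\<lambda>w. (fst w, susp_map (snd w)))"
    using continuous_map_compose[OF continuous_map_snd continuous_map_susp_map]
    by (intro continuous_map_pairedI continuous_map_fst) (simp add: o_def)
  from continuous_map_compose[OF this c]
  have "continuous_map (prod_topology unit_interval XI) special_orthogonal (\<lambda>(s, z). d s (susp_map z))"
    by (simp add: o_def case_prod_unfold)
  then have "continuous_map (prod_topology unit_interval XI) special_orthogonal (\<lambda>(s, z). tw (d s) z)"
    by (rule continuous_map_eq) (rule tw[symmetric])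
  then show "twisted_family d" using pole by (simp add: twisted_family_def susp_pointsI)
qed

lemma twisted_family_const:
  assumes "twisted_family d" "r \<in> {0..1}"
  shows "twisted_family (\<lambda>_. d r)"
proof -
  have "continuous_map (prod_topology unit_interval XI) (prod_topology unit_interval XI) (\<lambda>w. (r, snd w))"
    using assms(2) by (intro continuous_map_pairedI continuous_map_snd) simp
  from continuous_map_compose[OF this, of special_orthogonal "\<lambda>(s, z). tw (d s) z"] assms(1)
  have "continuous_map (prod_topology unit_interval XI) special_orthogonal (\<lambda>(s, z). tw (d r) z)"
    by (simp add: twisted_family_def o_def case_prod_unfold)
  moreover have "rotation_matrix (d r South)" "rotation_matrix (d r North)"
    using assms by (auto simp: twisted_family_def continuous_map_special_orthogonal)
  then have "continuous_map unit_interval special_orthogonal (\<lambda>_. d r South)"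
    "continuous_map unit_interval special_orthogonal (\<lambda>_. d r North)"
    unfolding continuous_map_special_orthogonal by simp_all
  ultimately show ?thesis unfolding twisted_family_def by blast
qed

text \<open>A path \<open>B (s, _)\<close> starting at the identity, spread along the suspension
  coordinate. In the frame \<open>fr\<close> it reads
  \<open>transpose (g x) ** B (s, t) ** g x\<close> on the whole cylinder; this is the conjugation
  that the clutching map forces at height 1, so \<open>B (s, 1)\<close> over the north pole extends
  to a gauge transformation that is trivial at the south pole.\<close>

definition pinch :: "(real \<times> real \<Rightarrow> real^'n^'n) \<Rightarrow> real \<Rightarrow> 'a susp \<Rightarrow> real^'n^'n" where
  "pinch B s b = (case b of South \<Rightarrow> mat 1 | North \<Rightarrow> B (s, 1) | Level x t \<Rightarrow> transpose (g x) ** B (s, t) ** g x)"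

lemma pinch_North [simp]: "pinch B s North = B (s, 1)"
  by (simp add: pinch_def)

lemma tw_pinch:
  assumes "(x, t) \<in> topspace XI" "B (s, 0) = mat 1"
  shows "tw (pinch B s) (x, t) = transpose (g x) ** B (s, t) ** g x"
  using assms g_rot[of x] by (auto simp: tw_def pinch_def susp_map_def rotation_transpose_mult)

lemma twisted_family_pinch:
  assumes B: "continuous_on ({0..1} \<times> {0..1}) B" "\<And>p. p \<in> {0..1} \<times> {0..1} \<Longrightarrow> rotation_matrix (B p)"
    and B0: "\<And>s. s \<in> {0..1} \<Longrightarrow> B (s, 0) = mat 1"
  shows "twisted_family (pinch B)"
  unfolding twisted_family_def
proof (intro conjI)
  have cB: "continuous_map (prod_topology unit_interval unit_interval) special_orthogonal B"
    unfolding continuous_map_matrix_family using B by blast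
  have "continuous_map unit_interval (prod_topology unit_interval unit_interval) (\<lambda>s. (s, 1))"
    by (intro continuous_map_pairedI) auto
  from continuous_map_compose[OF this cB]
  show "continuous_map unit_interval special_orthogonal (\<lambda>s. pinch B s North)" by (simp add: o_def pinch_def)
  show "continuous_map unit_interval special_orthogonal (\<lambda>s. pinch B s South)"
    unfolding pinch_def continuous_map_special_orthogonal by simp
  have "continuous_map (prod_topology unit_interval XI) (prod_topology unit_interval unit_interval) (\<lambda>w. (fst w, snd (snd w)))"
    using continuous_map_compose[OF continuous_map_snd continuous_map_snd]
    by (intro continuous_map_pairedI continuous_map_fst) (simp add: o_def)
  from continuous_map_compose[OF this cB]
  have c1: "continuous_map (prod_topology unit_interval XI) special_orthogonal (\<lambda>w. B (fst w, snd (snd w)))" by (simp add: o_def)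
  from continuous_map_compose[OF continuous_map_compose[OF continuous_map_snd continuous_map_fst] continuous_g]
  have c2: "continuous_map (prod_topology unit_interval XI) special_orthogonal (\<lambda>w. g (fst (snd w)))" by (simp add: o_def)
  have "continuous_map (prod_topology unit_interval XI) special_orthogonal
     (\<lambda>w. transpose (g (fst (snd w))) ** B (fst w, snd (snd w)) ** g (fst (snd w)))"
    by (intro continuous_map_special_orthogonal_mult continuous_map_special_orthogonal_transpose c1 c2)
  then show "continuous_map (prod_topology unit_interval XI) special_orthogonal (\<lambda>(s, z). tw (pinch B s) z)"
  proof (rule continuous_map_eq)
    fix w assume w: "w \<in> topspace (prod_topology unit_interval XI)"
    obtain s x t where wst: "w = (s, (x, t))" by (cases w) auto
    have "(x, t) \<in> topspace XI" "s \<in> {0..1}" using w by (auto simp: wst)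
    then show "transpose (g (fst (snd w))) ** B (fst w, snd (snd w)) ** g (fst (snd w)) = (case w of (s, z) \<Rightarrow> tw (pinch B s) z)"
      using tw_pinch[of x t B s] B0 by (simp add: wst)
  qed
qed

lemma pinch_cong:
  assumes "\<And>t. t \<in> {0..1} \<Longrightarrow> B (s, t) = B' (r, t)" "b \<in> susp_points X"
  shows "pinch B s b = pinch B' r b"
  using assms(2)
proof (cases rule: susp_points_cases)
  case (3 x t)
  then show ?thesis using assms(1)[of t] assms(1)[of 1] by (auto simp: pinch_def susp_map_def)
qed (use assms(1)[of 1] in \<open>auto simp: pinch_def\<close>)

lemma pinch_one:
  assumes "\<And>t. t \<in> {0..1} \<Longrightarrow> B (s, t) = mat 1" "b \<in> susp_points X"
  shows "pinch B s b = mat 1"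
  using assms(2)
proof (cases rule: susp_points_cases)
  case (3 x t)
  then show ?thesis using assms(1)[of t] assms(1)[of 1] g_rot[of x] by (auto simp: pinch_def susp_map_def rotation_transpose_mult)
qed (use assms(1)[of 1] in \<open>auto simp: pinch_def\<close>)

text \<open>Every homotopy class, and every path component of the gauge group, is represented by a map
  that is trivial over the north pole.\<close>

definition based :: "('a susp \<Rightarrow> real^'n^'n) set" where
  "based = {u. continuous_map (suspension X) special_orthogonal u \<and> u North = mat 1}"

definition homotopic_susp :: "('a susp \<Rightarrow> real^'n^'n) \<Rightarrow> ('a susp \<Rightarrow> real^'n^'n) \<Rightarrow> bool" where
  "homotopic_susp u v \<longleftrightarrow> homotopic_with (\<lambda>_. True) (suspension X) special_orthogonal u v"

text \<open>Spelled like the members of the quotient in \<open>homotopy_classes\<close>, so that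
  comparing the two sets only requires finding representatives.\<close>

definition hclass :: "('a susp \<Rightarrow> real^'n^'n) \<Rightarrow> ('a susp \<Rightarrow> real^'n^'n) set" where
  "hclass u = {(f, h). homotopic_with (\<lambda>_. True) (suspension X) special_orthogonal f h} `` {u}"

definition gclass :: "('a susp \<Rightarrow> real^'n^'n) \<Rightarrow> ('e \<Rightarrow> 'e) set" where
  "gclass u = path_component_of_set (gauge_group E) (gauge_of u)"

section \<open>Based maps, their homotopy classes and their gauge components\<close>

lemma twisted_family_based: "u \<in> based \<Longrightarrow> twisted_family (\<lambda>_. u)"
proof -
  assume u: "u \<in> based"
  have "continuous_map (prod_topology unit_interval (suspension X)) special_orthogonal (\<lambda>w. u (snd w))"
    using continuous_map_compose[OF continuous_map_snd, of "suspension X" special_orthogonal u] u by (simp add: based_def o_def)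
  then show ?thesis using twisted_family_iff[of "\<lambda>_. u"] u by (simp add: based_def case_prod_unfold)
qed

lemma based_twisted_family:
  assumes "twisted_family d" "r \<in> {0..1}" "d r North = mat 1"
  shows "d r \<in> based"
proof -
  have "twisted_family (\<lambda>_. d r)" by (rule twisted_family_const[OF assms(1,2)])
  then have c: "continuous_map (prod_topology unit_interval (suspension X)) special_orthogonal (\<lambda>(s, b). d r b)"
    using twisted_family_iff[of "\<lambda>_. d r"] assms(3) by simp
  have "continuous_map (suspension X) (prod_topology unit_interval (suspension X)) (\<lambda>b. (0, b))" by (simp add: continuous_map_pairedI)
  from continuous_map_compose[OF this c] show ?thesis using assms(3) by (simp add: based_def o_def)
qed

lemma homotopic_susp_refl: "u \<in> based \<Longrightarrow> homotopic_susp u u"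
  by (simp add: homotopic_susp_def based_def homotopic_with_refl)

lemma hclass_eq_iff: "u \<in> based \<Longrightarrow> v \<in> based \<Longrightarrow> hclass u = hclass v \<longleftrightarrow> homotopic_susp u v"
proof
  assume v: "v \<in> based" and eq: "hclass u = hclass v"
  have "v \<in> hclass u" unfolding eq using homotopic_susp_refl[OF v] by (simp add: hclass_def homotopic_susp_def)
  then show "homotopic_susp u v" by (simp add: hclass_def homotopic_susp_def)
next
  assume "homotopic_susp u v"
  then show "hclass u = hclass v"
    unfolding hclass_def homotopic_susp_def by (auto intro: homotopic_with_trans homotopic_with_symD)
qed

lemma homotopic_susp_twisted_family:
  assumes d: "twisted_family d" "\<And>s. s \<in> {0..1} \<Longrightarrow> d s North = mat 1"
    and u: "\<And>b. b \<in> susp_points X \<Longrightarrow> d 0 b = u b" and v: "\<And>b. b \<in> susp_points X \<Longrightarrow> d 1 b = v b"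
  shows "homotopic_susp u v"
  unfolding homotopic_susp_def
proof (subst homotopic_with)
  have "continuous_map (prod_topology unit_interval (suspension X)) special_orthogonal (\<lambda>(s, b). d s b)"
    using twisted_family_iff d by blast
  then show "\<exists>h. continuous_map (prod_topology unit_interval (suspension X)) special_orthogonal h \<and>
      (\<forall>x\<in>topspace (suspension X). h (0, x) = u x) \<and> (\<forall>x\<in>topspace (suspension X). h (1, x) = v x) \<and> (\<forall>t\<in>{0..1}. True)"
    using u v by (intro exI[of _ "\<lambda>(s, b). d s b"]) (auto simp: topspace_suspension)
qed simp

text \<open>Dividing a free homotopy by its trace over the north pole makes it based; the two ends
  do not change, as they are trivial over the pole already.\<close>

lemma homotopic_susp_imp_twisted_family:
  assumes "u \<in> based" "v \<in> based" "homotopic_susp u v"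
  obtains d where "twisted_family d" "\<And>s. s \<in> {0..1} \<Longrightarrow> d s North = mat 1" "d 0 = u" "d 1 = v"
proof -
  obtain h where h: "continuous_map (prod_topology unit_interval (suspension X)) special_orthogonal h"
    "\<And>b. h (0, b) = u b" "\<And>b. h (1, b) = v b"
    using assms(3) unfolding homotopic_susp_def homotopic_with_def by blast
  have N: "North \<in> topspace (suspension X)" by (simp add: topspace_suspension susp_pointsI)
  define d where "d = (\<lambda>s b. transpose (h (s, North)) ** h (s, b))"
  have dN: "d s North = mat 1" if "s \<in> {0..1}" for s
  proof -
    have "rotation_matrix (h (s, North))" using h(1) that N by (auto simp: continuous_map_special_orthogonal)
    then show ?thesis by (simp add: d_def rotation_transpose_mult)
  qed
  have "continuous_map (prod_topology unit_interval (suspension X)) (prod_topology unit_interval (suspension X)) (\<lambda>w. (fst w, North))"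
    using N by (intro continuous_map_pairedI continuous_map_fst) simp
  from continuous_map_compose[OF this h(1)]
  have "continuous_map (prod_topology unit_interval (suspension X)) special_orthogonal (\<lambda>w. h (fst w, North))" by (simp add: o_def)
  then have "continuous_map (prod_topology unit_interval (suspension X)) special_orthogonal (\<lambda>w. transpose (h (fst w, North)) ** h w)"
    by (intro continuous_map_special_orthogonal_mult continuous_map_special_orthogonal_transpose h)
  then have "twisted_family d" using twisted_family_iff[of d] dN by (simp add: d_def case_prod_unfold)
  moreover have "d 0 = u" "d 1 = v" using assms(1,2) h(2,3) by (auto simp: d_def based_def fun_eq_iff)
  ultimately show ?thesis using that dN by blast
qed

lemma gclass_eqI:
  assumes "twisted_family d" "gauge_of (d 0) = gauge_of u" "gauge_of (d 1) = gauge_of v"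
  shows "gclass u = gclass v"
proof -
  have "path_component_of (gauge_group E) (gauge_of u) (gauge_of v)"
    unfolding path_component_of_def using pathin_gauge_of[OF assms(1)] assms(2,3) by (intro exI[of _ "\<lambda>s. gauge_of (d s)"] conjI) simp_all
  then show ?thesis unfolding gclass_def
    by (metis path_component_of_equiv path_component_of_refl path_component_of_sym path_component_of_trans Collect_cong)
qed

lemma gclass_eqD:
  assumes "u \<in> based" "v \<in> based" "gclass u = gclass v"
  obtains d where "twisted_family d" "\<And>b. b \<in> susp_points X \<Longrightarrow> d 0 b = u b" "\<And>b. b \<in> susp_points X \<Longrightarrow> d 1 b = v b"
proof -
  have "gauge_of v \<in> topspace (gauge_group E)"
    using gauge_of_in_gauge_group[OF twisted_family_based[OF assms(2)], of 0] by simp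
  then have "path_component_of (gauge_group E) (gauge_of v) (gauge_of v)" by (simp add: path_component_of_refl)
  then have "path_component_of (gauge_group E) (gauge_of u) (gauge_of v)" using assms(3) by (auto simp: gclass_def)
  then obtain \<psi> where \<psi>: "pathin (gauge_group E) \<psi>" "\<psi> 0 = gauge_of u" "\<psi> 1 = gauge_of v" unfolding path_component_of_def by blast
  obtain d where d: "twisted_family d" "\<And>s. s \<in> {0..1} \<Longrightarrow> \<psi> s = gauge_of (d s)" using pathin_gauge_group[OF \<psi>(1)] by blast
  have "gauge_of (d 0) = gauge_of u" "gauge_of (d 1) = gauge_of v" using d(2)[of 0] d(2)[of 1] \<psi>(2,3) by simp_all
  then show ?thesis using that[OF d(1)] gauge_of_inj by blast
qed

text \<open>The action of loops of rotations on based maps, through the connecting map of the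
  evaluation of gauge transformations at the north pole. The pinch does not depend on the parameter
  here, so 0 is a dummy.\<close>

definition turn :: "(real \<Rightarrow> real^'n^'n) \<Rightarrow> ('a susp \<Rightarrow> real^'n^'n) \<Rightarrow> 'a susp \<Rightarrow> real^'n^'n" where
  "turn \<gamma> v b = v b ** pinch (\<lambda>(s, t). \<gamma> t) 0 b"

text \<open>The family grows from the trivial map at \<open>s = 0\<close> to the full pinch at
  \<open>s = 1\<close>, and its value over the north pole is \<open>\<gamma> s\<close>. Multiplying
  by it or by its transpose inserts or removes a path of values over the pole;
  \<open>\<gamma>\<close> need not be closed.\<close>

lemma twisted_family_pinch_shrink:
  assumes \<gamma>: "continuous_on {0..1} \<gamma>" "\<And>t. t \<in> {0..1} \<Longrightarrow> rotation_matrix (\<gamma> t)" "\<gamma> 0 = mat 1"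
  shows "twisted_family (pinch (\<lambda>(s, t). \<gamma> (s * t)))"
proof (rule twisted_family_pinch)
  have m: "fst p * snd p \<in> {0..1}" if "p \<in> {0..1} \<times> {0..1}" for p :: "real \<times> real"
    using that by (auto intro: mult_le_one)
  show "continuous_on ({0..1} \<times> {0..1}) (\<lambda>(s, t). \<gamma> (s * t))"
    unfolding case_prod_unfold using m by (intro continuous_on_compose2[OF \<gamma>(1)] continuous_intros) blast
  show "rotation_matrix ((\<lambda>(s, t). \<gamma> (s * t)) p)" if "p \<in> {0..1} \<times> {0..1}" for p
    using \<gamma>(2)[OF m[OF that]] by (simp add: case_prod_unfold)
qed (simp add: \<gamma>(3))

lemma pinch_shrink_0:
  assumes "\<gamma> 0 = mat 1" "b \<in> susp_points X"
  shows "pinch (\<lambda>(s, t). \<gamma> (s * t)) 0 b = mat 1"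
  by (rule pinch_one) (use assms in auto)

lemma pinch_shrink_1:
  assumes "b \<in> susp_points X"
  shows "pinch (\<lambda>(s, t). \<gamma> (s * t)) 1 b = pinch (\<lambda>(s, t). \<gamma> t) 0 b"
  by (rule pinch_cong) (use assms in auto)

lemma rotation_loopD:
  "rotation_loop \<gamma> \<Longrightarrow> continuous_on {0..1} \<gamma>" "rotation_loop \<gamma> \<Longrightarrow> t \<in> {0..1} \<Longrightarrow> rotation_matrix (\<gamma> t)"
  "rotation_loop \<gamma> \<Longrightarrow> \<gamma> 0 = \<gamma> 1" for \<gamma> :: "real \<Rightarrow> real^'n^'n"
  by (auto simp: rotation_loop_def)

lemma turn_based:
  assumes "rotation_loop \<gamma>" "\<gamma> 0 = mat 1" "v \<in> based"
  shows "turn \<gamma> v \<in> based"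
proof -
  have "twisted_family (\<lambda>s b. v b ** pinch (\<lambda>(s, t). \<gamma> t) s b)"
    using assms(1,2) by (intro twisted_family_mult twisted_family_based assms(3) twisted_family_pinch)
      (auto simp: rotation_loop_def case_prod_unfold intro!: continuous_on_compose2[of "{0..1}" \<gamma>] continuous_intros)
  moreover have "\<gamma> 1 = mat 1" using rotation_loopD(3)[OF assms(1)] assms(2) by simp
  then have "v North ** pinch (\<lambda>(s, t). \<gamma> t) 0 North = mat 1" using assms(3) by (simp add: based_def)
  ultimately have "(\<lambda>b. v b ** pinch (\<lambda>(s, t). \<gamma> t) 0 b) \<in> based"
    using based_twisted_family[of "\<lambda>s b. v b ** pinch (\<lambda>(s, t). \<gamma> t) s b" 0] by simp
  then show ?thesis by (simp add: turn_def[abs_def])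
qed

text \<open>The growing pinch joins \<open>v\<close> to its turn. Its value over the north pole runs
  around \<open>\<gamma>\<close>, which a path of gauge transformations may do and a based homotopy
  may not.\<close>

lemma turn_gclass:
  assumes "rotation_loop \<gamma>" "\<gamma> 0 = mat 1" "v \<in> based"
  shows "gclass (turn \<gamma> v) = gclass v"
proof (rule gclass_eqI[symmetric])
  show "twisted_family (\<lambda>s b. v b ** pinch (\<lambda>(s, t). \<gamma> (s * t)) s b)"
    by (intro twisted_family_mult twisted_family_based assms twisted_family_pinch_shrink rotation_loopD)
  show "gauge_of (\<lambda>b. v b ** pinch (\<lambda>(s, t). \<gamma> (s * t)) 0 b) = gauge_of v"
    by (rule gauge_of_cong) (simp add: pinch_shrink_0[of \<gamma>, OF assms(2)])
  show "gauge_of (\<lambda>b. v b ** pinch (\<lambda>(s, t). \<gamma> (s * t)) 1 b) = gauge_of (turn \<gamma> v)"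
    by (rule gauge_of_cong) (simp add: pinch_shrink_1 turn_def)
qed

text \<open>If \<open>H\<close> contracts the loop
  \<open>transpose (\<beta> t) ** \<delta> t\<close>, then multiplying \<open>\<beta>\<close> by
  \<open>H\<close> deforms \<open>\<beta>\<close> into \<open>\<delta>\<close> with fixed ends, and
  the pinch along this deformation stays trivial over the north pole.\<close>

lemma turn_homotopic_susp:
  assumes \<beta>: "rotation_loop \<beta>" "\<beta> 0 = mat 1" and \<delta>: "rotation_loop \<delta>" "\<delta> 0 = mat 1"
    and null: "null_loop (\<lambda>t. transpose (\<beta> t) ** \<delta> t)" and v: "v \<in> based"
  shows "homotopic_susp (turn \<beta> v) (turn \<delta> v)"
proof -
  obtain H :: "real \<times> real \<Rightarrow> real^'n^'n" where H: "continuous_on ({0..1} \<times> {0..1}) H" "\<forall>p\<in>{0..1} \<times> {0..1}. rotation_matrix (H p)"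
     "\<forall>t\<in>{0..1}. H (0, t) = mat 1" "\<forall>t\<in>{0..1}. H (1, t) = transpose (\<beta> t) ** \<delta> t"
     "\<forall>s\<in>{0..1}. H (s, 0) = mat 1 \<and> H (s, 1) = mat 1"
    using null \<beta>(2) \<delta>(2) unfolding null_loop_def by auto
  have \<beta>1: "\<beta> 1 = mat 1" using rotation_loopD(3)[OF \<beta>(1)] \<beta>(2) by simp
  let ?B = "\<lambda>p. \<beta> (snd p) ** H p"
  have B: "twisted_family (pinch ?B)"
  proof (rule twisted_family_pinch)
    show "continuous_on ({0..1} \<times> {0..1}) ?B"
      by (intro continuous_intros H continuous_on_compose2[OF rotation_loopD(1)[OF \<beta>(1)]]) auto
    show "rotation_matrix (?B p)" if "p \<in> {0..1} \<times> {0..1}" for p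
      using that H(2) rotation_loopD(2)[OF \<beta>(1)] by (auto intro!: rotation_matrix_mult)
  qed (use H(5) \<beta>(2) in auto)
  show ?thesis
  proof (rule homotopic_susp_twisted_family[OF twisted_family_mult[OF twisted_family_based[OF v] B]])
    show "v North ** pinch ?B s North = mat 1" if "s \<in> {0..1}" for s
      using v H(5) that \<beta>1 by (simp add: based_def)
    show "v b ** pinch ?B 0 b = turn \<beta> v b" if "b \<in> susp_points X" for b
    proof -
      have "pinch ?B 0 b = pinch (\<lambda>(s, t). \<beta> t) 0 b" by (rule pinch_cong) (use that H(3) in auto)
      then show ?thesis by (simp add: turn_def)
    qed
    show "v b ** pinch ?B 1 b = turn \<delta> v b" if "b \<in> susp_points X" for b
    proof -
      have "\<beta> t ** (transpose (\<beta> t) ** \<delta> t) = \<delta> t" if "t \<in> {0..1}" for t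
        using rotation_transpose_mult(2)[OF rotation_loopD(2)[OF \<beta>(1) that]] by (simp add: matrix_mul_assoc)
      then have "pinch ?B 1 b = pinch (\<lambda>(s, t). \<delta> t) 0 b" by (intro pinch_cong that) (use H(4) in auto)
      then show ?thesis by (simp add: turn_def)
    qed
  qed
qed

lemma turn_null_homotopic_susp:
  assumes \<delta>: "rotation_loop \<delta>" "\<delta> 0 = mat 1" "null_loop \<delta>" and v: "v \<in> based"
  shows "homotopic_susp v (turn \<delta> v)"
proof -
  have l: "rotation_loop (\<lambda>_. mat 1 :: real^'n^'n)" by (simp add: rotation_loop_def)
  have "homotopic_susp (turn (\<lambda>_. mat 1) v) (turn \<delta> v)"
    by (rule turn_homotopic_susp[OF l _ \<delta>(1,2) _ v]) (use \<delta>(3) in \<open>simp_all add: transpose_mat\<close>)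
  moreover have "homotopic_susp v (turn (\<lambda>_. mat 1) v)"
    unfolding homotopic_susp_def
  proof (rule homotopic_with_equal)
    show "v b = turn (\<lambda>_. mat 1) v b" if "b \<in> topspace (suspension X)" for b
      using that pinch_one[of "\<lambda>(s, t). mat 1" 0 b] by (simp add: turn_def topspace_suspension)
  qed (use v in \<open>auto simp: based_def\<close>)
  ultimately show ?thesis unfolding homotopic_susp_def by (rule homotopic_with_trans[rotated])
qed

lemma pinch_transpose:
  "transpose (pinch (\<lambda>(s, t). \<gamma> t) 0 b) = pinch (\<lambda>(s, t). transpose (\<gamma> t)) 0 b"
  by (cases b) (simp_all add: pinch_def matrix_transpose_mul matrix_mul_assoc transpose_mat)

text \<open>Left multiplication by a path from the identity to the inverse of \<open>f North\<close>
  makes \<open>f\<close> based within its homotopy class.\<close>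

lemma image_hclass:
  assumes n: "CARD('n) \<ge> 3"
  shows "hclass ` based = homotopy_classes (suspension X) (special_orthogonal :: (real^'n^'n) topology)"
proof (intro equalityI subsetI)
  fix c assume "c \<in> homotopy_classes (suspension X) (special_orthogonal :: (real^'n^'n) topology)"
  then obtain f where f: "continuous_map (suspension X) special_orthogonal f"
    "c = {(f, h). homotopic_with (\<lambda>_. True) (suspension X) special_orthogonal f h} `` {f}"
    unfolding homotopy_classes_def quotient_def by blast
  have "rotation_matrix (transpose (f North))"
    using f(1) by (simp add: continuous_map_special_orthogonal topspace_suspension susp_pointsI)
  then obtain C where C: "continuous_on {0..1::real} C" "\<And>t. t \<in> {0..1} \<Longrightarrow> rotation_matrix (C t)"
    "C 0 = mat 1" "C 1 = transpose (f North)" using rotation_path_from_one[OF n] by metis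
  define u where "u = (\<lambda>b. transpose (f North) ** f b)"
  have cC: "continuous_map unit_interval special_orthogonal C" using C(1,2) by (simp add: continuous_map_special_orthogonal)
  have h: "continuous_map (prod_topology unit_interval (suspension X)) special_orthogonal (\<lambda>w. C (fst w) ** f (snd w))"
    using continuous_map_compose[OF continuous_map_fst cC] continuous_map_compose[OF continuous_map_snd f(1)]
    by (intro continuous_map_special_orthogonal_mult) (simp_all add: o_def)
  have fu: "homotopic_with (\<lambda>_. True) (suspension X) special_orthogonal f u"
    unfolding homotopic_with_def by (intro exI[of _ "\<lambda>w. C (fst w) ** f (snd w)"]) (use h C(3,4) in \<open>auto simp: u_def\<close>)
  have "u \<in> based"
    using homotopic_with_imp_continuous_maps[OF fu] \<open>rotation_matrix (transpose (f North))\<close>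
    by (simp add: based_def u_def rotation_transpose_mult)
  moreover have "c = hclass u"
    unfolding hclass_def f(2) using fu by (auto intro: homotopic_with_trans homotopic_with_symD)
  ultimately show "c \<in> hclass ` based" by blast
qed (auto simp: hclass_def homotopy_classes_def quotient_def based_def)

lemma image_gclass:
  assumes n: "CARD('n) \<ge> 3"
  shows "gclass ` based = path_components_of (gauge_group E)"
proof (intro equalityI subsetI)
  fix c assume "c \<in> path_components_of (gauge_group E)"
  then obtain f where f: "f \<in> topspace (gauge_group E)" "c = path_component_of_set (gauge_group E) f"
    unfolding path_components_of_def by blast
  \<comment> \<open>The constant path makes the description of paths apply to a single gauge
    transformation.\<close>
  have "pathin (gauge_group E) (\<lambda>_. f)" using f(1) by (simp add: pathin_def)
  then obtain d where d: "twisted_family d" "\<And>s. s \<in> {0..1} \<Longrightarrow> f = gauge_of (d s)" using pathin_gauge_group by metis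
  have d01: "d 0 b = d 1 b" if "b \<in> susp_points X" for b
    using gauge_of_inj[OF _ that, of "d 0" "d 1"] d(2)[of 0] d(2)[of 1] by simp
  have "rotation_matrix (transpose (d 0 North))" using twisted_family_rot[OF d(1), of 0 North] by (simp add: susp_pointsI)
  then obtain C where C: "continuous_on {0..1::real} C" "\<And>t. t \<in> {0..1} \<Longrightarrow> rotation_matrix (C t)"
    "C 0 = mat 1" "C 1 = transpose (d 0 North)" using rotation_path_from_one[OF n] by metis
  define d' where "d' = (\<lambda>s b. d s b ** pinch (\<lambda>(s, t). C (s * t)) s b)"
  have td': "twisted_family d'" unfolding d'_def by (intro twisted_family_mult d(1) twisted_family_pinch_shrink C)
  have "d' 1 North = mat 1"
    using d01[of North] C(4) \<open>rotation_matrix (transpose (d 0 North))\<close>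
    by (simp add: d'_def susp_pointsI rotation_transpose_mult)
  then have b: "d' 1 \<in> based" using based_twisted_family[OF td', of 1] by simp
  have "gauge_of (d' 0) = f"
  proof -
    have "gauge_of (d' 0) = gauge_of (d 0)" by (rule gauge_of_cong) (simp add: d'_def pinch_shrink_0[of C, OF C(3)])
    then show ?thesis using d(2)[of 0] by simp
  qed
  then have "gclass (d' 1) = gclass (d 0)"
    using gclass_eqI[OF td', of "d 0" "d' 1"] d(2)[of 0] by simp
  also have "\<dots> = c" using d(2)[of 0] f(2) by (simp add: gclass_def)
  finally show "c \<in> gclass ` based" using b by blast
next
  fix c assume "c \<in> gclass ` based"
  then obtain u where u: "u \<in> based" "c = gclass u" by blast
  have "gauge_of u \<in> topspace (gauge_group E)" using gauge_of_in_gauge_group[OF twisted_family_based[OF u(1)], of 0] by simp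
  then show "c \<in> path_components_of (gauge_group E)" unfolding u(2) gclass_def path_components_of_def by blast
qed

lemma hclass_imp_gclass:
  assumes "u \<in> based" "v \<in> based" "hclass u = hclass v"
  shows "gclass u = gclass v"
proof -
  have "homotopic_susp u v" using assms hclass_eq_iff by blast
  then obtain d where "twisted_family d" "d 0 = u" "d 1 = v" using homotopic_susp_imp_twisted_family[OF assms(1,2)] by metis
  then show ?thesis using gclass_eqI[of d u v] by simp
qed

text \<open>The values over the north pole along a gauge path form a loop \<open>\<gamma>\<close>.
  Multiplying by the transposed pinch makes the path based and replaces its end \<open>v\<close> by
  the turn of \<open>v\<close> along the inverse loop \<open>\<delta>\<close>, which is either null
  or homotopic to \<open>\<beta>\<close>.\<close>

lemma gclass_imp_hclass:
  assumes \<beta>: "rotation_loop \<beta>" "\<beta> 0 = mat 1" "\<forall>\<gamma>. rotation_loop \<gamma> \<longrightarrow> \<not> null_loop \<gamma> \<longrightarrow> null_loop (\<lambda>t. transpose (\<beta> t) ** \<gamma> t)"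
    and uv: "u \<in> based" "v \<in> based" "gclass u = gclass v"
  shows "hclass u = hclass v \<or> hclass u = hclass (turn \<beta> v)"
proof -
  obtain d where d: "twisted_family d" "\<And>b. b \<in> susp_points X \<Longrightarrow> d 0 b = u b" "\<And>b. b \<in> susp_points X \<Longrightarrow> d 1 b = v b"
    using gclass_eqD[OF uv] by blast
  define \<gamma> where "\<gamma> = (\<lambda>s. d s North)"
  define \<delta> where "\<delta> = (\<lambda>s. transpose (\<gamma> s))"
  have g01: "\<gamma> 0 = mat 1" "\<gamma> 1 = mat 1" using d(2,3)[of North] uv(1,2) by (simp_all add: \<gamma>_def based_def susp_pointsI)
  have \<gamma>: "rotation_loop \<gamma>"
    using d(1) g01 by (auto simp: \<gamma>_def rotation_loop_def twisted_family_def continuous_map_special_orthogonal)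
  then have \<delta>: "rotation_loop \<delta>" "\<delta> 0 = mat 1" using rotation_loop_transpose g01 by (simp_all add: \<delta>_def transpose_mat)
  have "homotopic_susp u (turn \<delta> v)"
  proof (rule homotopic_susp_twisted_family[OF twisted_family_mult[OF d(1) twisted_family_transpose[OF twisted_family_pinch_shrink[OF rotation_loopD(1,2)[OF \<gamma>] g01(1)]]]])
    show "d s North ** transpose (pinch (\<lambda>(s, t). \<gamma> (s * t)) s North) = mat 1" if "s \<in> {0..1}" for s
      using rotation_transpose_mult(2)[OF rotation_loopD(2)[OF \<gamma> that]] by (simp add: \<gamma>_def)
    show "d 0 b ** transpose (pinch (\<lambda>(s, t). \<gamma> (s * t)) 0 b) = u b" if "b \<in> susp_points X" for b
      using pinch_shrink_0[of \<gamma>, OF g01(1) that] d(2)[OF that] by (simp add: transpose_mat)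
    show "d 1 b ** transpose (pinch (\<lambda>(s, t). \<gamma> (s * t)) 1 b) = turn \<delta> v b" if "b \<in> susp_points X" for b
      using pinch_shrink_1[OF that, of \<gamma>] d(3)[OF that] by (simp add: turn_def \<delta>_def pinch_transpose)
  qed
  moreover have "homotopic_susp v (turn \<delta> v)" if "null_loop \<delta>" by (rule turn_null_homotopic_susp[OF \<delta> that uv(2)])
  moreover have "homotopic_susp (turn \<beta> v) (turn \<delta> v)" if "\<not> null_loop \<delta>"
    by (rule turn_homotopic_susp[OF \<beta>(1,2) \<delta> \<beta>(3)[rule_format, OF \<delta>(1) that] uv(2)])
  ultimately show ?thesis
    using hclass_eq_iff uv(1,2) turn_based[OF \<delta> uv(2)] turn_based[OF \<beta>(1,2) uv(2)] by metis
qed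

text \<open>Let \<open>\<gamma>\<close> be the essential trace over the north pole of a loop of
  gauge transformations. The inverse of that loop and the pinch along \<open>\<gamma>\<close>
  combine to a based homotopy from \<open>v\<close> to its turn. The fibre that witnesses
  turnability may lie elsewhere; sliding along a segment of the suspension carries its loop to the
  pole up to conjugation.\<close>

lemma turnable_imp_hclass:
  assumes \<beta>: "rotation_loop \<beta>" "\<beta> 0 = mat 1" "\<forall>\<gamma>. rotation_loop \<gamma> \<longrightarrow> \<not> null_loop \<gamma> \<longrightarrow> null_loop (\<lambda>t. transpose (\<beta> t) ** \<gamma> t)"
    and t: "turnable E" and v: "v \<in> based"
  shows "hclass (turn \<beta> v) = hclass v"
proof (cases "topspace X = {}")
  case True
  \<comment> \<open>Without points in \<open>X\<close> no segment joins the poles, so nothing can be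
    carried to the north pole; but a pinch along a loop is then trivial at both points.\<close>
  have "homotopic_with (\<lambda>_. True) (suspension X) special_orthogonal (turn \<beta> v) v"
  proof (rule homotopic_with_equal)
    show "turn \<beta> v b = v b" if "b \<in> topspace (suspension X)" for b
    proof -
      have "b = South \<or> b = North" using that True by (auto simp: topspace_suspension susp_points_def)
      moreover have "\<beta> 1 = mat 1" using rotation_loopD(3)[OF \<beta>(1)] \<beta>(2) by simp
      ultimately show ?thesis by (auto simp: turn_def pinch_def)
    qed
  qed (use turn_based[OF \<beta>(1,2) v] in \<open>auto simp: based_def\<close>)
  then show ?thesis using hclass_eq_iff turn_based[OF \<beta>(1,2) v] v by (simp add: homotopic_susp_def)
next
  case False
  obtain \<psi> b where \<psi>: "pathin (gauge_group E) \<psi>" "\<psi> 0 = gauge_one E" "\<psi> 1 = gauge_one E"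
    and b: "b \<in> susp_points X" and ess: "essential_loop (fibre_SO E b) (\<lambda>s. restrict (\<psi> s) (fibre E b))"
    using t unfolding turnable_def points by blast
  obtain d where d: "twisted_family d" "\<And>s. s \<in> {0..1} \<Longrightarrow> \<psi> s = gauge_of (d s)" using pathin_gauge_group[OF \<psi>(1)] by blast
  have d01: "d 0 c = mat 1" "d 1 c = mat 1" if "c \<in> susp_points X" for c
    using gauge_of_inj[OF _ that, of "d 0" "\<lambda>_. mat 1"] gauge_of_inj[OF _ that, of "d 1" "\<lambda>_. mat 1"] d(2)[of 0] d(2)[of 1] \<psi>(2,3)
    by (simp_all add: gauge_of_one)
  have loop: "rotation_loop (\<lambda>s. d s c)" if c: "c \<in> susp_points X" for c
  proof -
    have "continuous_map unit_interval special_orthogonal (\<lambda>s. d s c)"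
      using c
    proof (cases rule: susp_points_cases)
      case (3 x t)
      show ?thesis
      proof (cases "t = 1")
        case True
        then show ?thesis using d(1) 3 by (simp add: twisted_family_def)
      next
        case False
        have "continuous_map unit_interval (prod_topology unit_interval XI) (\<lambda>s. (s, (x, t)))"
          using 3 by (intro continuous_map_pairedI) auto
        from continuous_map_compose[OF this, of special_orthogonal "\<lambda>(s, z). tw (d s) z"] d(1)
        show ?thesis using False 3 by (simp add: twisted_family_def o_def tw_def)
      qed
    qed (use d(1) in \<open>simp_all add: twisted_family_def\<close>)
    then show ?thesis using d01[OF c] by (auto simp: rotation_loop_def continuous_map_special_orthogonal)
  qed
  have nb: "\<not> null_loop (\<lambda>s. d s b)"
    using essential_loop_fibre[OF b loop[OF b], of "\<lambda>s. restrict (\<psi> s) (fibre E b)"] ess d(2) restrict_gauge_of[OF b] by simp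
  define \<gamma> where "\<gamma> = (\<lambda>s. d s North)"
  have \<gamma>: "rotation_loop \<gamma>" "\<gamma> 0 = mat 1" unfolding \<gamma>_def using loop d01 susp_pointsI(3)[of X] by auto
  have nn: "\<not> null_loop \<gamma>"
  proof
    assume null: "null_loop \<gamma>"
    have line: "null_loop (\<lambda>s. d s (susp_map (x, t)))" if x: "x \<in> topspace X" and t: "t \<in> {0..1}" "t \<noteq> 1" for x t
    proof -
      \<comment> \<open>For \<open>r = 0\<close> this is the loop at height \<open>t\<close>, for
        \<open>r = 1\<close> the conjugate of \<open>\<gamma>\<close> at height 1; each loop in
        between starts and ends at the identity.\<close>
      define h where "h = (\<lambda>(r, s). tw (d s) (x, t + (1 - t) * r))"
      have mem: "t + (1 - t) * r \<in> {0..1}" if "r \<in> {0..1}" for r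
      proof -
        have "(1 - t) * r \<le> (1 - t) * 1" "0 \<le> (1 - t) * r" using that t by (auto intro!: mult_left_mono)
        then show ?thesis using t by auto
      qed
      have "continuous_map (prod_topology unit_interval unit_interval) unit_interval (\<lambda>p. t + (1 - t) * fst p)"
        using mem by (auto simp: continuous_map_in_subtopology intro!: continuous_intros)
      then have "continuous_map (prod_topology unit_interval unit_interval) (prod_topology unit_interval XI) (\<lambda>p. (snd p, (x, t + (1 - t) * fst p)))"
        by (intro continuous_map_pairedI continuous_map_snd) (use x in auto)
      from continuous_map_compose[OF this, of special_orthogonal "\<lambda>(s, z). tw (d s) z"] d(1)
      have "continuous_map (prod_topology unit_interval unit_interval) special_orthogonal h"
        by (simp add: twisted_family_def o_def h_def case_prod_unfold)
      then have h: "continuous_on ({0..1} \<times> {0..1}) h" "\<And>p. p \<in> {0..1} \<times> {0..1} \<Longrightarrow> rotation_matrix (h p)"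
        unfolding continuous_map_matrix_family by blast+
      have tw1: "tw (d s) z = mat 1" if "z \<in> topspace XI" "s = 0 \<or> s = 1" for z s
      proof -
        have "d s North = mat 1" "d s (susp_map z) = mat 1"
          using that(2) d01 susp_map_points[OF that(1)] susp_pointsI(3)[of X] by auto
        then show ?thesis using tw_north_one[OF that(1)] by simp
      qed
      have "h (r, 0) = h (r, 1)" if "r \<in> {0..1}" for r
        using tw1[of "(x, t + (1 - t) * r)"] mem[OF that] x by (simp add: h_def)
      from null_loop_homotopy[OF h this]
      have "null_loop (\<lambda>s. h (0, s)) \<longleftrightarrow> null_loop (\<lambda>s. h (1, s))" by blast
      moreover have "(\<lambda>s. h (0, s)) = (\<lambda>s. d s (susp_map (x, t)))" using t(2) by (simp add: h_def tw_def fun_eq_iff)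
      moreover have "(\<lambda>s. h (1, s)) = (\<lambda>s. transpose (g x) ** \<gamma> s ** g x)" by (simp add: h_def tw_def fun_eq_iff \<gamma>_def)
      ultimately show ?thesis using null_loop_conjugate[OF null g_rot[OF x]] by simp
    qed
    obtain x0 where x0: "x0 \<in> topspace X" using False by blast
    show False
      using b
    proof (cases rule: susp_points_cases)
      case 1
      then show ?thesis using nb line[OF x0, of 0] by simp
    next
      case 2
      then show ?thesis using nb null by (simp add: \<gamma>_def)
    next
      case (3 x t)
      then show ?thesis using nb null line[of x t] by (cases "t = 1") (auto simp: \<gamma>_def)
    qed
  qed
  have 1: "homotopic_susp (turn \<beta> v) (turn \<gamma> v)"
    by (rule turn_homotopic_susp[OF \<beta>(1,2) \<gamma> \<beta>(3)[rule_format, OF \<gamma>(1) nn] v])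
  have "homotopic_susp v (turn \<gamma> v)"
  proof (rule homotopic_susp_twisted_family[OF twisted_family_mult[OF twisted_family_mult[OF twisted_family_based[OF v] twisted_family_transpose[OF d(1)]] twisted_family_pinch_shrink[OF rotation_loopD(1,2)[OF \<gamma>(1)] \<gamma>(2)]]])
    show "v North ** transpose (d s North) ** pinch (\<lambda>(s, t). \<gamma> (s * t)) s North = mat 1" if "s \<in> {0..1}" for s
      using v rotation_transpose_mult(1)[OF rotation_loopD(2)[OF \<gamma>(1) that]] by (simp add: based_def \<gamma>_def)
    show "v b ** transpose (d 0 b) ** pinch (\<lambda>(s, t). \<gamma> (s * t)) 0 b = v b" if "b \<in> susp_points X" for b
      using pinch_shrink_0[of \<gamma>, OF \<gamma>(2) that] d01(1)[OF that] by (simp add: transpose_mat)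
    show "v b ** transpose (d 1 b) ** pinch (\<lambda>(s, t). \<gamma> (s * t)) 1 b = turn \<gamma> v b" if "b \<in> susp_points X" for b
      using pinch_shrink_1[OF that, of \<gamma>] d01(2)[OF that] by (simp add: transpose_mat turn_def)
  qed
  with 1 show ?thesis
    using hclass_eq_iff turn_based[OF \<beta>(1,2) v] turn_based[OF \<gamma> v] v by metis
qed

text \<open>Cancelling \<open>v\<close> on the left of the based homotopy \<open>k\<close> and the
  growing pinch on its right closes it to a loop at the identity. Over the north pole only the
  inverse of \<open>\<beta>\<close> remains, which is essential.\<close>

lemma hclass_imp_turnable:
  assumes \<beta>: "rotation_loop \<beta>" "\<beta> 0 = mat 1" "\<not> null_loop \<beta>" and v: "v \<in> based" and eq: "hclass (turn \<beta> v) = hclass v"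
  shows "turnable E"
proof -
  have "homotopic_susp v (turn \<beta> v)" using hclass_eq_iff[OF v turn_based[OF \<beta>(1,2) v]] eq by simp
  then obtain k where k: "twisted_family k" "\<And>s. s \<in> {0..1} \<Longrightarrow> k s North = mat 1" "k 0 = v" "k 1 = turn \<beta> v"
    using homotopic_susp_imp_twisted_family[OF v turn_based[OF \<beta>(1,2) v]] by metis
  define d where "d = (\<lambda>s b. transpose (v b) ** k s b ** transpose (pinch (\<lambda>(s, t). \<beta> (s * t)) s b))"
  have td: "twisted_family d"
    unfolding d_def
    by (intro twisted_family_mult twisted_family_transpose k(1) twisted_family_based v twisted_family_pinch_shrink rotation_loopD \<beta>)
  have vr: "rotation_matrix (v b)" if "b \<in> susp_points X" for b
    using twisted_family_rot[OF twisted_family_based[OF v], of 0 b] that by simp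
  have d0: "d 0 b = mat 1" if "b \<in> susp_points X" for b
    using pinch_shrink_0[of \<beta>, OF \<beta>(2) that] rotation_transpose_mult(1)[OF vr[OF that]] by (simp add: d_def k(3) transpose_mat)
  have d1: "d 1 b = mat 1" if "b \<in> susp_points X" for b
  proof -
    have r: "rotation_matrix (pinch (\<lambda>(s, t). \<beta> (s * t)) 1 b)"
      using twisted_family_rot[OF twisted_family_pinch_shrink[OF rotation_loopD(1,2)[OF \<beta>(1)] \<beta>(2)], of 1 b] that by simp
    have "d 1 b = (transpose (v b) ** v b) ** (pinch (\<lambda>(s, t). \<beta> (s * t)) 1 b ** transpose (pinch (\<lambda>(s, t). \<beta> (s * t)) 1 b))"
      unfolding d_def k(4) turn_def pinch_shrink_1[OF that, of \<beta>] by (simp only: matrix_mul_assoc)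
    then show ?thesis using rotation_transpose_mult(1)[OF vr[OF that]] rotation_transpose_mult(2)[OF r] by simp
  qed
  have dN: "d s North = transpose (\<beta> s)" if "s \<in> {0..1}" for s
    using v k(2)[OF that] by (simp add: d_def based_def transpose_mat)
  have \<beta>t: "rotation_loop (\<lambda>s. transpose (\<beta> s))" by (rule rotation_loop_transpose[OF \<beta>(1)])
  have "\<not> null_loop (\<lambda>s. transpose (\<beta> s))"
    using null_loop_transpose[OF \<beta>t] \<beta>(3) by auto
  moreover have "restrict (gauge_of (d s)) (fibre E North) = fibre_act North (transpose (\<beta> s))" if "s \<in> {0..1}" for s
    using restrict_gauge_of[OF susp_pointsI(3)] dN[OF that] by simp
  ultimately have "essential_loop (fibre_SO E North) (\<lambda>s. restrict (gauge_of (d s)) (fibre E North))"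
    using essential_loop_fibre[OF susp_pointsI(3) \<beta>t, of "\<lambda>s. restrict (gauge_of (d s)) (fibre E North)"] by blast
  moreover have "gauge_of (d 0) = gauge_one E" "gauge_of (d 1) = gauge_one E"
    unfolding gauge_of_one[symmetric] using d0 d1 by (auto intro: gauge_of_cong)
  ultimately show ?thesis
    unfolding turnable_def points using pathin_gauge_of[OF td] susp_pointsI(3) by (intro exI[of _ "\<lambda>s. gauge_of (d s)"]) blast
qed

text \<open>\<open>gclass\<close> is coarser than \<open>hclass\<close>, and by the two lemmas on
  turnability \<open>turn \<beta>\<close> fixes all homotopy classes or none.\<close>

theorem card_path_components:
  assumes n: "CARD('n) \<ge> 3"
    and fin: "finite (homotopy_classes (suspension X) (special_orthogonal :: (real^'n^'n) topology))"
  shows "finite (path_components_of (gauge_group E))"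
    and "turnable E \<Longrightarrow> card (path_components_of (gauge_group E)) =
      card (homotopy_classes (suspension X) (special_orthogonal :: (real^'n^'n) topology))"
    and "\<not> turnable E \<Longrightarrow> card (homotopy_classes (suspension X) (special_orthogonal :: (real^'n^'n) topology)) =
      2 * card (path_components_of (gauge_group E))"
proof -
  obtain \<beta> :: "real \<Rightarrow> real^'n^'n" where \<beta>: "rotation_loop \<beta>" "\<beta> 0 = mat 1" "\<not> null_loop \<beta>"
    "\<forall>\<gamma>. rotation_loop \<gamma> \<longrightarrow> \<not> null_loop \<gamma> \<longrightarrow> null_loop (\<lambda>t. transpose (\<beta> t) ** \<gamma> t)"
    using exists_essential_rotation_loop[OF n] by blast
  note count = two_to_one_count[of hclass based gclass "turn \<beta>", unfolded image_hclass[OF n] image_gclass[OF n],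
      OF fin hclass_imp_gclass gclass_imp_hclass[OF \<beta>(1,2,4)] turn_based[OF \<beta>(1,2)] turn_gclass[OF \<beta>(1,2)]]
  show "finite (path_components_of (gauge_group E))" by (rule count(1))
  show "card (path_components_of (gauge_group E)) = card (homotopy_classes (suspension X) (special_orthogonal :: (real^'n^'n) topology))"
    if "turnable E" by (rule count(2)) (use turnable_imp_hclass[OF \<beta>(1,2,4) that] in blast)+
  show "card (homotopy_classes (suspension X) (special_orthogonal :: (real^'n^'n) topology)) = 2 * card (path_components_of (gauge_group E))"
    if "\<not> turnable E" by (rule count(3)) (use hclass_imp_turnable[OF \<beta>(1-3)] that in blast)+
qed

end

theorem theorem1p9:
  fixes k :: nat
    and X :: "'a topology"
    and E :: "('a susp, 'e, 'n::finite) bundle_data"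
  assumes "k > 1"
    and "CARD('n) = 2 * k"
    and "CW_complex X"
    and "finite (homotopy_classes (suspension X) (special_orthogonal :: (real^'n^'n) topology))"
    and "oriented_euclidean_vector_bundle E"
    and "base E = suspension X"
  shows "let n_SX = card (homotopy_classes (suspension X) (special_orthogonal :: (real^'n^'n) topology))
         in finite (path_components_of (gauge_group E)) \<and>
            real (card (path_components_of (gauge_group E))) =
              (if turnable E then real n_SX else real n_SX / 2)"
proof -
  obtain frm :: "'a susp \<Rightarrow> real^'n \<Rightarrow> 'e" and g :: "'a \<Rightarrow> real^'n^'n" where frm:
    "\<And>b. b \<in> susp_points X \<Longrightarrow> frm b \<in> orient E b"
    "\<And>b x y. b \<in> susp_points X \<Longrightarrow> vinner E (frm b x) (frm b y) = x \<bullet> y"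
    "continuous_map X special_orthogonal g"
    "\<And>v. continuous_map (prod_topology X unit_interval) (total E)
       (\<lambda>(x, t). if t = 1 then frm North (g x *v v) else frm (susp_map (x, t)) v)"
    using suspension_trivialization[OF assms(5,6,3)] by blast
  interpret trivialized_bundle E X frm g
  proof
    show "Hausdorff_space X" using assms(3) by (simp add: CW_complex_def)
  qed (use assms CW_complex_k_space frm in auto)
  \<comment> \<open>The rank is at least four, which lies in the range where the rotation group has
    a fundamental group of order two.\<close>
  have n: "CARD('n) \<ge> 3" using assms(1,2) by simp
  note count = card_path_components[OF n assms(4)]
  show ?thesis
    unfolding Let_def
  proof (intro conjI)
    show "finite (path_components_of (gauge_group E))" by (rule count(1))
    show "real (card (path_components_of (gauge_group E))) =
        (if turnable E then real (card (homotopy_classes (suspension X) (special_orthogonal :: (real^'n^'n) topology)))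
         else real (card (homotopy_classes (suspension X) (special_orthogonal :: (real^'n^'n) topology))) / 2)"
      using count(2,3) by auto
  qed
qed

end
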